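(* Let $\mathfrak q\in\mathbb C^\times$, $m=\mathfrak q+\mathfrak q^{-1}$, let $N_1,N_2\ge1$ and let $M_i$ be a finite-dimensional module over the affine Temperley–Lieb algebra $\mathsf T^a_{N_i}(m)$, $i=1,2$. Then the map $$\widehat c_{M_1,M_2}:\ M_1\,\widehat\times_f\,M_2\longrightarrow M_2\,\widehat\times^{-}_f\,M_1,\qquad a\otimes m_1\otimes m_2\mapsto g_{N_1,N_2}\,a\,g_{N_1,N_2}^{-1}\otimes m_2\otimes m_1$$ ($a\in\mathsf T^a_{N_1+N_2}$, $m_i\in M_i$) is well defined and is an isomorphism of $\mathsf T^a_{N_1+N_2}$-modules, where $\widehat\times_f$ and $\widehat\times_f^-$ are the two affine Temperley–Lieb fusion products defined in the context and the module structure on the target is the one specified there.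
   Context: **Affine Temperley–Lieb algebras.** For $N\ge1$, $\mathsf T^a_N=\mathsf T^a_N(m)$ is the $\mathbb C$-algebra spanned by affine diagrams: isotopy classes (boundary points fixed) of non-crossing pairings, drawn in an annulus, of $N$ points on the inner and $N$ on the outer boundary, possibly with non-contractible loops when there are no through-lines. The product $ab$ joins the inner boundary of $a$ to the outer boundary of $b$; contractible loops are replaced by $m$. Generators: $e_j$, $j\in\mathbb Z/N\mathbb Z$ (joining neighbours $j,j+1$ on each boundary, other points going straight; $e_0=e_N$), and the translation $u^{\pm1}$ ($u$ joins outer point $i+1$ to inner point $i$ for all $i$ mod $N$). For $N=1$, $\mathsf T^a_1=\mathbb C[u,u^{-1}]$. **Two fusions.** Fix $\mathfrak q^{1/2}$; $g_i^{\pm1}=\pm\mathrm i(\mathfrak q^{\pm1/2}\mathbf 1-\mathfrak q^{\mp1/2}e_i)$. With $N=N_1+N_2$, $\varepsilon_{N_1,N_2}:\mathsf T^a_{N_1}\otimes\mathsf T^a_{N_2}\to\mathsf T^a_N$ is the algebra map sending $e^{(1)}_j\mapsto e_j$ ($1\le j\le N_1-1$), $e^{(2)}_k\mapsto e_{N_1+k}$ ($1\le k\le N_2-1$), $u^{(1)}\mapsto u\,g_{N-1}^{-1}\cdots g_{N_1}^{-1}$, $u^{(2)}\mapsto g_{N_1}\cdots g_1u$, $e_0^{(1)}\mapsto g_{N_1}\cdots g_{N-1}e_0g_{N-1}^{-1}\cdots g_{N_1}^{-1}$, $e_0^{(2)}\mapsto g_0^{-1}\cdots g_{N_1-1}^{-1}e_{N_1}g_{N_1-1}\cdots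 g_0$ (superscripts label the tensor factor). $\varepsilon^-_{N_1,N_2}$ is the algebra map obtained from these formulas by replacing every $g_i$ by $g_i^{-1}$ and vice versa; e.g. $u^{(1)}\mapsto u\,g_{N-1}\cdots g_{N_1}$, $u^{(2)}\mapsto g_{N_1}^{-1}\cdots g_1^{-1}u$. For modules $M_i$ over $\mathsf T^a_{N_i}$, $M_1\,\widehat\times_f\,M_2=\mathsf T^a_N\otimes_{\mathsf T^a_{N_1}\otimes\mathsf T^a_{N_2}}(M_1\otimes M_2)$ with the balanced tensor product taken via $\varepsilon_{N_1,N_2}$, and $M_1\,\widehat\times^-_f\,M_2$ is the same with $\varepsilon^-_{N_1,N_2}$. **The element $g_{N_1,N_2}$.** $g_{N_1,N_2}=(g_{N_2}^{-1}\cdots g_1^{-1})(g_{N_2+1}^{-1}\cdots g_2^{-1})\cdots(g_{N_1+N_2-1}^{-1}\cdots g_{N_1}^{-1})\in\mathsf T^a_{N_1+N_2}$. **Module structures (the paper's convention).** In the map $\widehat c_{M_1,M_2}$, an element $a'\in\mathsf T^a_{N_1+N_2}$ acts on the source by left multiplication by $a'$, and on the target by left multiplication by $g_{N_1,N_2}\,a'\,g_{N_1,N_2}^{-1}$. *)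

theory Defs
  imports Complex_Main "HOL-Algebra.Module" "HOL-Algebra.Free_Abelian_Groups"
begin

section \<open>Affine diagrams\<close>

text \<open>
  An affine diagram on \<open>N\<close> + \<open>N\<close> points is encoded by its lift to the universal cover of the
  annulus, an infinite strip: the point \<open>(s, i)\<close> lies over the boundary point \<open>i mod N\<close> of the
  boundary circle \<open>s\<close>. The lifted pairing commutes with translation by \<open>N\<close>; two diagrams are
  isotopic relative to the boundary iff they have the same lifted pairing and the same number of
  non-contractible loops.
\<close>

datatype side = Outer | Inner

fun opp :: "side \<Rightarrow> side" where
  "opp Outer = Inner"
| "opp Inner = Outer"

type_synonym point = "side \<times> int"

datatype adiagram = ADiagram (pairing: "point \<Rightarrow> point") (loops: nat)

text \<open>
  The order in which the boundary of the strip is traversed: the outer line from left to right,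
  then the inner line from right to left. Two arcs of the strip cross iff their end points
  interleave in this order.
\<close>

fun before :: "point \<Rightarrow> point \<Rightarrow> bool" where
  "before (Outer, i) (Outer, j) \<longleftrightarrow> i < j"
| "before (Outer, i) (Inner, j) \<longleftrightarrow> True"
| "before (Inner, i) (Outer, j) \<longleftrightarrow> False"
| "before (Inner, i) (Inner, j) \<longleftrightarrow> j < i"

definition adiagrams :: "nat \<Rightarrow> adiagram set" where
  "adiagrams N = {d.
     (\<forall>x. pairing d (pairing d x) = x \<and> pairing d x \<noteq> x) \<and>
     (\<forall>s i. pairing d (s, i + int N) = map_prod id (\<lambda>j. j + int N) (pairing d (s, i))) \<and>
     \<not> (\<exists>x y. before x y \<and> before y (pairing d x) \<and> before (pairing d x) (pairing d y)) \<and>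
     (loops d > 0 \<longrightarrow> (\<forall>x. fst (pairing d x) = fst x))}"

definition id_diagram :: adiagram where
  "id_diagram = ADiagram (\<lambda>(s, i). (opp s, i)) 0"

definition u_diagram :: adiagram where
  "u_diagram = ADiagram
     (\<lambda>(s, i). case s of Outer \<Rightarrow> (Inner, i - 1) | Inner \<Rightarrow> (Outer, i + 1)) 0"

text \<open>For \<open>N \<ge> 2\<close> only; the index \<open>j\<close> is read modulo \<open>N\<close>.\<close>

definition e_diagram :: "nat \<Rightarrow> nat \<Rightarrow> adiagram" where
  "e_diagram N j = ADiagram
     (\<lambda>(s, i). if (i - int j) mod int N = 0 then (s, i + 1)
               else if (i - int j - 1) mod int N = 0 then (s, i - 1)
               else (opp s, i)) 0"

text \<open>
  Composition \<open>d d'\<close>: the inner boundary of \<open>d\<close> is glued to the outer boundary of \<open>d'\<close>. The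
  vertices of the resulting (lifted) picture are the outer points of \<open>d\<close> (\<open>Top\<close>), the
  glued points (\<open>Mid\<close>) and the inner points of \<open>d'\<close> (\<open>Bot\<close>).
\<close>

datatype level = Top | Mid | Bot

fun upper_vertex :: "point \<Rightarrow> level \<times> int" where
  "upper_vertex (Outer, i) = (Top, i)"
| "upper_vertex (Inner, i) = (Mid, i)"

fun lower_vertex :: "point \<Rightarrow> level \<times> int" where
  "lower_vertex (Outer, i) = (Mid, i)"
| "lower_vertex (Inner, i) = (Bot, i)"

fun end_vertex :: "point \<Rightarrow> level \<times> int" where
  "end_vertex (Outer, i) = (Top, i)"
| "end_vertex (Inner, i) = (Bot, i)"

definition glued :: "adiagram \<Rightarrow> adiagram \<Rightarrow> ((level \<times> int) \<times> (level \<times> int)) set" where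
  "glued d d' =
     (range (\<lambda>x. (upper_vertex x, upper_vertex (pairing d x))) \<union>
      range (\<lambda>x. (lower_vertex x, lower_vertex (pairing d' x))))\<^sup>*"

text \<open>
  Closed loops of the glued annular picture are the orbits, under translation by \<open>N\<close>, of the
  connected components of the lifted picture that avoid both boundaries. The loop is
  contractible iff its lifts are closed curves, that is, iff the components are finite.
\<close>

definition inner_components :: "adiagram \<Rightarrow> adiagram \<Rightarrow> (level \<times> int) set set" where
  "inner_components d d' = {C \<in> UNIV // glued d d'. C \<subseteq> {Mid} \<times> UNIV}"

definition loop_orbit :: "nat \<Rightarrow> (level \<times> int) set \<Rightarrow> (level \<times> int) set" where
  "loop_orbit N C = {(l, i + t * int N) | l i t. (l, i) \<in> C}"

definition contractible_loops :: "nat \<Rightarrow> adiagram \<Rightarrow> adiagram \<Rightarrow> nat" where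
  "contractible_loops N d d' = card (loop_orbit N ` {C \<in> inner_components d d'. finite C})"

definition noncontractible_loops :: "nat \<Rightarrow> adiagram \<Rightarrow> adiagram \<Rightarrow> nat" where
  "noncontractible_loops N d d' = card (loop_orbit N ` {C \<in> inner_components d d'. infinite C})"

definition diagram_comp :: "nat \<Rightarrow> adiagram \<Rightarrow> adiagram \<Rightarrow> adiagram" where
  "diagram_comp N d d' = ADiagram
     (\<lambda>x. THE y. y \<noteq> x \<and> (end_vertex x, end_vertex y) \<in> glued d d')
     (loops d + loops d' + noncontractible_loops N d d')"

section \<open>The affine Temperley--Lieb algebra\<close>

definition pm_scale :: "complex \<Rightarrow> ('b \<Rightarrow>\<^sub>0 complex) \<Rightarrow> ('b \<Rightarrow>\<^sub>0 complex)" where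
  "pm_scale c a = Poly_Mapping.map ((*) c) a"

text \<open>
  The complex algebra with basis \<open>B\<close>, unit \<open>\<iota> \<in> B\<close>, and product of the basis elements \<open>d\<close>, \<open>d'\<close>
  equal to the multiple \<open>w d d'\<close> of the basis element \<open>p d d'\<close>.
\<close>

definition basis_algebra ::
  "'b set \<Rightarrow> ('b \<Rightarrow> 'b \<Rightarrow> 'b) \<Rightarrow> ('b \<Rightarrow> 'b \<Rightarrow> complex) \<Rightarrow> 'b \<Rightarrow> ('b \<Rightarrow>\<^sub>0 complex) ring" where
  "basis_algebra B p w \<iota> =
     \<lparr>carrier = {a. Poly_Mapping.keys a \<subseteq> B},
      monoid.mult = (\<lambda>a b. \<Sum>d \<in> Poly_Mapping.keys a. \<Sum>d' \<in> Poly_Mapping.keys b.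
        Poly_Mapping.single (p d d')
          (Poly_Mapping.lookup a d * Poly_Mapping.lookup b d' * w d d')),
      monoid.one = Poly_Mapping.single \<iota> 1, ring.zero = 0, ring.add = (+)\<rparr>"

type_synonym tl = "adiagram \<Rightarrow>\<^sub>0 complex"
type_synonym tl_tensor = "(adiagram \<times> adiagram) \<Rightarrow>\<^sub>0 complex"

definition TLa :: "complex \<Rightarrow> nat \<Rightarrow> tl ring" where
  "TLa m N = basis_algebra (adiagrams N) (diagram_comp N)
     (\<lambda>d d'. m ^ contractible_loops N d d') id_diagram"

definition e_gen :: "nat \<Rightarrow> nat \<Rightarrow> tl" where
  "e_gen N j = Poly_Mapping.single (e_diagram N j) 1"

definition u_gen :: tl where
  "u_gen = Poly_Mapping.single u_diagram 1"

definition tl_one :: tl where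
  "tl_one = Poly_Mapping.single id_diagram 1"

text \<open>\<open>T\<^sub>N\<^sub>1 \<otimes> T\<^sub>N\<^sub>2\<close>, on its basis of pairs \<open>(d\<^sub>1, d\<^sub>2)\<close> standing for \<open>d\<^sub>1 \<otimes> d\<^sub>2\<close>.\<close>

definition TLa_tensor :: "complex \<Rightarrow> nat \<Rightarrow> nat \<Rightarrow> tl_tensor ring" where
  "TLa_tensor m N1 N2 = basis_algebra (adiagrams N1 \<times> adiagrams N2)
     (\<lambda>(d1, d2) (d1', d2'). (diagram_comp N1 d1 d1', diagram_comp N2 d2 d2'))
     (\<lambda>(d1, d2) (d1', d2').
        m ^ contractible_loops N1 d1 d1' * m ^ contractible_loops N2 d2 d2')
     (id_diagram, id_diagram)"

definition elem_tensor :: "tl \<Rightarrow> tl \<Rightarrow> tl_tensor" where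
  "elem_tensor a b = (\<Sum>d \<in> Poly_Mapping.keys a. \<Sum>d' \<in> Poly_Mapping.keys b.
     Poly_Mapping.single (d, d') (Poly_Mapping.lookup a d * Poly_Mapping.lookup b d'))"

section \<open>The fusion maps and the element \<open>g\<^sub>N\<^sub>1\<^sub>,\<^sub>N\<^sub>2\<close>\<close>

text \<open>Here and below \<open>s\<close> is the chosen square root of the parameter \<open>q\<close>.\<close>

definition g_pos :: "complex \<Rightarrow> nat \<Rightarrow> nat \<Rightarrow> tl" where
  "g_pos s N i = pm_scale \<i> (pm_scale s tl_one - pm_scale (inverse s) (e_gen N i))"

definition g_inv :: "complex \<Rightarrow> nat \<Rightarrow> nat \<Rightarrow> tl" where
  "g_inv s N i = pm_scale (- \<i>) (pm_scale (inverse s) tl_one - pm_scale s (e_gen N i))"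

definition list_prod :: "('a, 'k) monoid_scheme \<Rightarrow> 'a list \<Rightarrow> 'a" where
  "list_prod R xs = foldr (monoid.mult R) xs \<one>\<^bsub>R\<^esub>"

definition algebra_hom ::
  "('b \<Rightarrow>\<^sub>0 complex) ring \<Rightarrow> ('c \<Rightarrow>\<^sub>0 complex) ring \<Rightarrow> (('b \<Rightarrow>\<^sub>0 complex) \<Rightarrow> ('c \<Rightarrow>\<^sub>0 complex)) \<Rightarrow> bool"
  where
  "algebra_hom A B f \<longleftrightarrow>
     f \<in> ring_hom A B \<and> (\<forall>c. \<forall>a \<in> carrier A. f (pm_scale c a) = pm_scale c (f a))"

text \<open>
  The formulas defining \<open>\<epsilon>\<close>, with \<open>\<gamma> i\<close> in place of \<open>g\<^sub>i\<close> and \<open>\<delta> i\<close> in place of its inverse.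
\<close>

definition fusion_formulas ::
  "complex \<Rightarrow> nat \<Rightarrow> nat \<Rightarrow> (nat \<Rightarrow> tl) \<Rightarrow> (nat \<Rightarrow> tl) \<Rightarrow> (tl_tensor \<Rightarrow> tl) \<Rightarrow> bool" where
  "fusion_formulas m N1 N2 \<gamma> \<delta> \<epsilon> \<longleftrightarrow>
    (let N = N1 + N2; T = TLa m N;
         first = (\<lambda>a. elem_tensor a tl_one); second = (\<lambda>a. elem_tensor tl_one a)
     in
       (\<forall>j. 1 \<le> j \<and> j \<le> N1 - 1 \<longrightarrow> \<epsilon> (first (e_gen N1 j)) = e_gen N j) \<and>
       (\<forall>k. 1 \<le> k \<and> k \<le> N2 - 1 \<longrightarrow> \<epsilon> (second (e_gen N2 k)) = e_gen N (N1 + k)) \<and>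
       \<epsilon> (first u_gen) = list_prod T ([u_gen] @ map \<delta> (rev [N1..<N])) \<and>
       \<epsilon> (second u_gen) = list_prod T (map \<gamma> (rev [1..<Suc N1]) @ [u_gen]) \<and>
       (N1 \<ge> 2 \<longrightarrow> \<epsilon> (first (e_gen N1 0)) =
          list_prod T (map \<gamma> [N1..<N] @ [e_gen N 0] @ map \<delta> (rev [N1..<N]))) \<and>
       (N2 \<ge> 2 \<longrightarrow> \<epsilon> (second (e_gen N2 0)) =
          list_prod T (map \<delta> [0..<N1] @ [e_gen N N1] @ map \<gamma> (rev [0..<N1]))))"

definition is_fusion_map ::
  "complex \<Rightarrow> complex \<Rightarrow> nat \<Rightarrow> nat \<Rightarrow> (tl_tensor \<Rightarrow> tl) \<Rightarrow> bool" where
  "is_fusion_map m s N1 N2 \<epsilon> \<longleftrightarrow>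
     algebra_hom (TLa_tensor m N1 N2) (TLa m (N1 + N2)) \<epsilon> \<and>
     fusion_formulas m N1 N2 (g_pos s (N1 + N2)) (g_inv s (N1 + N2)) \<epsilon>"

definition is_fusion_map_minus ::
  "complex \<Rightarrow> complex \<Rightarrow> nat \<Rightarrow> nat \<Rightarrow> (tl_tensor \<Rightarrow> tl) \<Rightarrow> bool" where
  "is_fusion_map_minus m s N1 N2 \<epsilon> \<longleftrightarrow>
     algebra_hom (TLa_tensor m N1 N2) (TLa m (N1 + N2)) \<epsilon> \<and>
     fusion_formulas m N1 N2 (g_inv s (N1 + N2)) (g_pos s (N1 + N2)) \<epsilon>"

definition g_elem :: "complex \<Rightarrow> complex \<Rightarrow> nat \<Rightarrow> nat \<Rightarrow> tl" where
  "g_elem m s N1 N2 = (let T = TLa m (N1 + N2) in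
     list_prod T (map (\<lambda>k. list_prod T (map (g_inv s (N1 + N2)) (rev [k..<N2 + k])))
       [1..<Suc N1]))"

section \<open>Modules and tensor products\<close>

text \<open>
  Left modules over a not necessarily commutative ring (the library's locale for modules
  requires a commutative one). As in the library, the fields \<open>mult\<close> and \<open>one\<close> of a module are
  irrelevant.
\<close>

definition left_module :: "('r, 'k) ring_scheme \<Rightarrow> ('r, 'm) module \<Rightarrow> bool" where
  "left_module R M \<longleftrightarrow> abelian_group M \<and>
     (\<forall>a \<in> carrier R. \<forall>x \<in> carrier M. a \<odot>\<^bsub>M\<^esub> x \<in> carrier M) \<and>
     (\<forall>a \<in> carrier R. \<forall>b \<in> carrier R. \<forall>x \<in> carrier M.
        (a \<oplus>\<^bsub>R\<^esub> b) \<odot>\<^bsub>M\<^esub> x = a \<odot>\<^bsub>M\<^esub> x \<oplus>\<^bsub>M\<^esub> b \<odot>\<^bsub>M\<^esub> x) \<and>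
     (\<forall>a \<in> carrier R. \<forall>x \<in> carrier M. \<forall>y \<in> carrier M.
        a \<odot>\<^bsub>M\<^esub> (x \<oplus>\<^bsub>M\<^esub> y) = a \<odot>\<^bsub>M\<^esub> x \<oplus>\<^bsub>M\<^esub> a \<odot>\<^bsub>M\<^esub> y) \<and>
     (\<forall>a \<in> carrier R. \<forall>b \<in> carrier R. \<forall>x \<in> carrier M.
        (a \<otimes>\<^bsub>R\<^esub> b) \<odot>\<^bsub>M\<^esub> x = a \<odot>\<^bsub>M\<^esub> (b \<odot>\<^bsub>M\<^esub> x)) \<and>
     (\<forall>x \<in> carrier M. \<one>\<^bsub>R\<^esub> \<odot>\<^bsub>M\<^esub> x = x)"

definition module_iso ::
  "('r, 'k) ring_scheme \<Rightarrow> ('r, 'm) module \<Rightarrow> ('r, 'n) module \<Rightarrow> ('m \<Rightarrow> 'n) \<Rightarrow> bool" where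
  "module_iso R M M' f \<longleftrightarrow> left_module R M \<and> left_module R M' \<and>
     f \<in> iso (add_monoid M) (add_monoid M') \<and>
     (\<forall>a \<in> carrier R. \<forall>x \<in> carrier M. f (a \<odot>\<^bsub>M\<^esub> x) = a \<odot>\<^bsub>M'\<^esub> f x)"

definition restrict_scalars :: "('s \<Rightarrow> 'r) \<Rightarrow> ('r, 'm) module \<Rightarrow> ('s, 'm) module" where
  "restrict_scalars f M =
     \<lparr>carrier = carrier M, monoid.mult = monoid.mult M, monoid.one = monoid.one M, ring.zero = ring.zero M, ring.add = ring.add M,
      smult = (\<lambda>a x. f a \<odot>\<^bsub>M\<^esub> x)\<rparr>"

text \<open>The underlying complex vector space of a module over an affine Temperley--Lieb algebra.\<close>

definition vspace :: "(tl, 'm) module \<Rightarrow> (complex, 'm) module" where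
  "vspace M = restrict_scalars (\<lambda>c. pm_scale c tl_one) M"

definition finite_dim :: "(tl, 'm) module \<Rightarrow> bool" where
  "finite_dim M \<longleftrightarrow> (\<exists>B. finite B \<and> B \<subseteq> carrier M \<and>
     (\<forall>x \<in> carrier M. \<exists>c. x = (\<Oplus>\<^bsub>M\<^esub> b \<in> B. c b \<odot>\<^bsub>vspace M\<^esub> b)))"

text \<open>
  The balanced tensor product of a right module \<open>A\<close> and a left module \<open>M\<close> over a ring with
  carrier \<open>R\<close>: the free abelian group on \<open>carrier A \<times> carrier M\<close> modulo the subgroup generated by
  the usual relations. The right action \<open>a r\<close> is stored in \<open>A\<close> as \<open>r \<odot>\<^bsub>A\<^esub> a\<close>.
\<close>

definition tensor_free :: "('r, 'a) module \<Rightarrow> ('r, 'm) module \<Rightarrow> ('a \<times> 'm \<Rightarrow>\<^sub>0 int) monoid" where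
  "tensor_free A M = free_Abelian_group (carrier A \<times> carrier M)"

definition tensor_relations ::
  "'r set \<Rightarrow> ('r, 'a) module \<Rightarrow> ('r, 'm) module \<Rightarrow> ('a \<times> 'm \<Rightarrow>\<^sub>0 int) set" where
  "tensor_relations R A M =
     {frag_of (a \<oplus>\<^bsub>A\<^esub> a', x) - frag_of (a, x) - frag_of (a', x) | a a' x.
        a \<in> carrier A \<and> a' \<in> carrier A \<and> x \<in> carrier M} \<union>
     {frag_of (a, x \<oplus>\<^bsub>M\<^esub> x') - frag_of (a, x) - frag_of (a, x') | a x x'.
        a \<in> carrier A \<and> x \<in> carrier M \<and> x' \<in> carrier M} \<union>
     {frag_of (r \<odot>\<^bsub>A\<^esub> a, x) - frag_of (a, r \<odot>\<^bsub>M\<^esub> x) | a r x.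
        a \<in> carrier A \<and> r \<in> R \<and> x \<in> carrier M}"

definition tensor_kernel ::
  "'r set \<Rightarrow> ('r, 'a) module \<Rightarrow> ('r, 'm) module \<Rightarrow> ('a \<times> 'm \<Rightarrow>\<^sub>0 int) set" where
  "tensor_kernel R A M = generate (tensor_free A M) (tensor_relations R A M)"

definition tensor_class ::
  "'r set \<Rightarrow> ('r, 'a) module \<Rightarrow> ('r, 'm) module \<Rightarrow> ('a \<times> 'm \<Rightarrow>\<^sub>0 int) \<Rightarrow> ('a \<times> 'm \<Rightarrow>\<^sub>0 int) set" where
  "tensor_class R A M v = tensor_kernel R A M #>\<^bsub>tensor_free A M\<^esub> v"

definition pure_tensor ::
  "'r set \<Rightarrow> ('r, 'a) module \<Rightarrow> ('r, 'm) module \<Rightarrow> 'a \<Rightarrow> 'm \<Rightarrow> ('a \<times> 'm \<Rightarrow>\<^sub>0 int) set" where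
  "pure_tensor R A M a x = tensor_class R A M (frag_of (a, x))"

text \<open>
  The balanced tensor product as a module; \<open>act b (a, x)\<close> is a representative of the result of
  letting the scalar \<open>b\<close> act on \<open>a \<otimes> x\<close>.
\<close>

definition tensor_module ::
  "'r set \<Rightarrow> ('r, 'a) module \<Rightarrow> ('r, 'm) module \<Rightarrow> ('b \<Rightarrow> 'a \<times> 'm \<Rightarrow> ('a \<times> 'm \<Rightarrow>\<^sub>0 int)) \<Rightarrow>
     ('b, ('a \<times> 'm \<Rightarrow>\<^sub>0 int) set) module" where
  "tensor_module R A M act = (let Q = tensor_free A M Mod tensor_kernel R A M in
     \<lparr>carrier = carrier Q, monoid.mult = undefined, monoid.one = undefined,
      ring.zero = monoid.one Q, ring.add = monoid.mult Q,
      smult = (\<lambda>b Z. \<Union>v \<in> Z. tensor_class R A M (frag_extend (act b) v))\<rparr>)"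

text \<open>\<open>M\<^sub>1 \<otimes> M\<^sub>2\<close> over the complex numbers, as a module over \<open>T\<^sub>N\<^sub>1 \<otimes> T\<^sub>N\<^sub>2\<close>.\<close>

definition outer_tensor ::
  "(tl, 'm1) module \<Rightarrow> (tl, 'm2) module \<Rightarrow> (tl_tensor, ('m1 \<times> 'm2 \<Rightarrow>\<^sub>0 int) set) module" where
  "outer_tensor M1 M2 = tensor_module UNIV (vspace M1) (vspace M2)
     (\<lambda>t (x, y). \<Sum>(d1, d2) \<in> Poly_Mapping.keys t.
        frag_of (Poly_Mapping.single d1 (Poly_Mapping.lookup t (d1, d2)) \<odot>\<^bsub>M1\<^esub> x,
                 Poly_Mapping.single d2 1 \<odot>\<^bsub>M2\<^esub> y))"

definition outer_pure :: "(tl, 'm1) module \<Rightarrow> (tl, 'm2) module \<Rightarrow> 'm1 \<Rightarrow> 'm2 \<Rightarrow> ('m1 \<times> 'm2 \<Rightarrow>\<^sub>0 int) set"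
  where
  "outer_pure M1 M2 = pure_tensor UNIV (vspace M1) (vspace M2)"

text \<open>\<open>T\<^sub>N\<close> as a right module over \<open>T\<^sub>N\<^sub>1 \<otimes> T\<^sub>N\<^sub>2\<close> via \<open>\<epsilon>\<close>.\<close>

definition right_regular :: "tl ring \<Rightarrow> (tl_tensor \<Rightarrow> tl) \<Rightarrow> (tl_tensor, tl) module" where
  "right_regular T \<epsilon> =
     \<lparr>carrier = carrier T, monoid.mult = monoid.mult T, monoid.one = monoid.one T, ring.zero = ring.zero T, ring.add = ring.add T,
      smult = (\<lambda>t a. a \<otimes>\<^bsub>T\<^esub> \<epsilon> t)\<rparr>"

type_synonym ('m1, 'm2) fused = "(tl \<times> ('m1 \<times> 'm2 \<Rightarrow>\<^sub>0 int) set \<Rightarrow>\<^sub>0 int) set"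

text \<open>The fusion product, with \<open>\<epsilon>\<close> one of the two fusion maps.\<close>

definition fusion ::
  "complex \<Rightarrow> nat \<Rightarrow> nat \<Rightarrow> (tl_tensor \<Rightarrow> tl) \<Rightarrow> (tl, 'm1) module \<Rightarrow> (tl, 'm2) module \<Rightarrow>
     (tl, ('m1, 'm2) fused) module" where
  "fusion m N1 N2 \<epsilon> M1 M2 = (let T = TLa m (N1 + N2) in
     tensor_module (carrier (TLa_tensor m N1 N2)) (right_regular T \<epsilon>) (outer_tensor M1 M2)
       (\<lambda>b (a, z). frag_of (b \<otimes>\<^bsub>T\<^esub> a, z)))"

definition fusion_pure ::
  "complex \<Rightarrow> nat \<Rightarrow> nat \<Rightarrow> (tl_tensor \<Rightarrow> tl) \<Rightarrow> (tl, 'm1) module \<Rightarrow> (tl, 'm2) module \<Rightarrow>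
     tl \<Rightarrow> 'm1 \<Rightarrow> 'm2 \<Rightarrow> ('m1, 'm2) fused" where
  "fusion_pure m N1 N2 \<epsilon> M1 M2 a x y =
     pure_tensor (carrier (TLa_tensor m N1 N2)) (right_regular (TLa m (N1 + N2)) \<epsilon>)
       (outer_tensor M1 M2) a (outer_pure M1 M2 x y)"

section \<open>The braiding\<close>

definition g_conj :: "complex \<Rightarrow> complex \<Rightarrow> nat \<Rightarrow> nat \<Rightarrow> tl \<Rightarrow> tl" where
  "g_conj m s N1 N2 a = (let T = TLa m (N1 + N2); h = g_elem m s N1 N2 in
     h \<otimes>\<^bsub>T\<^esub> a \<otimes>\<^bsub>T\<^esub> inv\<^bsub>T\<^esub> h)"

text \<open>
  The additive maps given on pure tensors by the formula for the braiding; \<open>\<epsilon>\<close> and \<open>\<epsilon>'\<close> are the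
  fusion maps of the source and of the target.
\<close>

definition is_braiding ::
  "complex \<Rightarrow> complex \<Rightarrow> nat \<Rightarrow> nat \<Rightarrow> (tl_tensor \<Rightarrow> tl) \<Rightarrow> (tl_tensor \<Rightarrow> tl) \<Rightarrow>
     (tl, 'm1) module \<Rightarrow> (tl, 'm2) module \<Rightarrow>
     (('m1, 'm2) fused \<Rightarrow> ('m2, 'm1) fused) \<Rightarrow> bool" where
  "is_braiding m s N1 N2 \<epsilon> \<epsilon>' M1 M2 c \<longleftrightarrow>
     c \<in> extensional (carrier (fusion m N1 N2 \<epsilon> M1 M2)) \<and>
     c \<in> hom (add_monoid (fusion m N1 N2 \<epsilon> M1 M2)) (add_monoid (fusion m N2 N1 \<epsilon>' M2 M1)) \<and>
     (\<forall>a \<in> carrier (TLa m (N1 + N2)). \<forall>x \<in> carrier M1. \<forall>y \<in> carrier M2.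
        c (fusion_pure m N1 N2 \<epsilon> M1 M2 a x y) =
          fusion_pure m N2 N1 \<epsilon>' M2 M1 (g_conj m s N1 N2 a) y x)"

end

(*
  The element h = g_{N1,N2} intertwines the two fusion maps: h eps(t) = eps'(t') h, where t' is t
  with its two tensor factors exchanged. Hence conjugation by h, combined with the exchange of M1
  and M2, respects the relations of the balanced tensor products, and so does conjugation by the
  inverse of h in the other direction; uniqueness holds because pure tensors generate.

  The intertwining relation is multiplicative in t, so it suffices to have it for the generators
  u, u^{-1}, e_1 of either factor, where it follows by moving a generator through the braid h
  one crossing at a time. This needs the fact that every affine diagram is a product of these
  generators in which no contractible loop arises. By induction on the total displacement of the
  arcs: an arc nested around a short one is undone by a factor e_{i+1}; if all arcs are short,
  the diagram is, after a rotation, a product of commuting e_j, or its through lines can be moved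
  towards the vertical in the same way, or there are no through lines and it is explicit.

  Associativity of the diagrammatic product and the cocycle property of the loop numbers come
  from gluing three diagrams and contracting one of the two middle levels. The only topological
  input there is that the component of a boundary point of a glued picture is a finite path: it
  is an orbit of two involutions commuting with a translation, hence periodic by the pigeonhole
  principle, and a finite orbit of two involutions has either no or exactly two fixed points.
*)
theory Submission
  imports Defs
begin

text \<open>A fusion map is known only as an algebra map with prescribed values on generators. The
  intertwining relation can therefore be carried from the generators to a diagram only if the
  diagram itself, with coefficient one, is a product of them. For \<open>q = i\<close> one has
  \<open>m = 0\<close>, and a product in which a contractible loop closes vanishes; this is why
  generation is proved with such loops excluded. The second obstacle is planarity. That the
  composite of two arbitrary non-crossing diagrams is non-crossing would call for the topology of
  the annulus. Planarity is therefore kept apart from periodicity: associativity and loop counts are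
  established for arbitrary periodic matchings, non-crossing is checked only for left multiplication
  by \<open>U c\<close> and \<open>E N j\<close>, where the product is an explicit formula, and
  closure of \<open>adiagrams\<close> under composition is then a consequence of generation.
  Whatever concerns the inner boundary is obtained by reflecting the annulus.\<close>

section \<open>Orbits of two involutions\<close>

text \<open>Let \<open>n\<close> be the least period of the rotation. On indices modulo
  \<open>n\<close>, \<beta> acts as \<open>k -> -k\<close> and \<alpha> as
  \<open>k -> -1 - k\<close>, so a fixed index satisfies \<open>k = 0\<close>, \<open>2k = n\<close>
  or \<open>2k + 1 = n\<close>. According to the parity of \<open>n\<close>, exactly one of the last
  two has a solution, namely \<open>n div 2\<close>; it is not 0, because \<open>n = 1\<close> would
  make \<alpha> fix \<open>v\<close>.\<close>

lemma dihedral_orbit: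
  fixes \<alpha> \<beta> :: "'a \<Rightarrow> 'a"
  assumes \<alpha>\<alpha>: "\<And>x. \<alpha> (\<alpha> x) = x" and \<beta>\<beta>: "\<And>x. \<beta> (\<beta> x) = x"
    and v: "\<beta> v = v" "\<alpha> v \<noteq> v"
    and per: "m > 0" "((\<beta> \<circ> \<alpha>) ^^ m) v = v"
    and r: "r = {(x, y). y = \<alpha> x \<or> y = \<beta> x}"
  shows "finite (r\<^sup>* `` {v})"
    and "\<exists>w. w \<noteq> v \<and> (v, w) \<in> r\<^sup>* \<and> (\<alpha> w = w \<or> \<beta> w = w) \<and>
          (\<forall>w'. (v, w') \<in> r\<^sup>* \<and> (\<alpha> w' = w' \<or> \<beta> w' = w') \<longrightarrow> w' = v \<or> w' = w)"
proof -
  define p where "p k = ((\<beta> \<circ> \<alpha>) ^^ k) v" for k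
  have p0: "p 0 = v" and pS: "p (Suc k) = \<beta> (\<alpha> (p k))" for k
    by (simp_all add: p_def)
  define n where "n = (LEAST n. n > 0 \<and> p n = v)"
  have n: "n > 0 \<and> p n = v"
    unfolding n_def by (rule LeastI[of _ m]) (use per in \<open>auto simp: p_def\<close>)
  have nmin: "\<not> (k > 0 \<and> p k = v)" if "k < n" for k
    using not_less_Least that unfolding n_def by blast
  have \<beta>p: "\<beta> (p k) = p (n - k)" if "k \<le> n" for k
    using that
  proof (induction k)
    case 0 then show ?case using n v by (simp add: p0)
  next
    case (Suc k)
    have "p (n - k) = \<beta> (\<alpha> (p (n - Suc k)))"
      using Suc.prems pS[of "n - Suc k"] by (simp add: Suc_diff_Suc)
    then have "\<alpha> (\<beta> (p (n - k))) = p (n - Suc k)" by (simp add: \<alpha>\<alpha> \<beta>\<beta>)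
    moreover have "\<beta> (p k) = p (n - k)" using Suc by simp
    ultimately show ?case by (metis pS \<beta>\<beta>)
  qed
  have \<alpha>p: "\<alpha> (p k) = p (n - Suc k)" if "k < n" for k
    using \<beta>p[of "Suc k"] that pS[of k] \<beta>\<beta> by (metis Suc_leI)
  have inj: "k = l" if "p k = p l" "k < n" "l < n" for k l
  proof (rule ccontr)
    have *: False if "p k = p l" "k < l" "l < n" for k l
    proof -
      have "p (k - i) = p (l - i)" if "i \<le> k" for i
        using that
      proof (induction i)
        case 0 then show ?case using \<open>p k = p l\<close> by simp
      next
        case (Suc i)
        have "\<beta> (\<alpha> (p (k - Suc i))) = \<beta> (\<alpha> (p (l - Suc i)))"
          using Suc pS[of "k - Suc i"] pS[of "l - Suc i"] \<open>k < l\<close>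
          by (simp add: Suc_diff_Suc)
        then show ?case by (metis \<alpha>\<alpha> \<beta>\<beta>)
      qed
      from this[of k] have "p (l - k) = v" using p0 by simp
      moreover have "l - k < n" using that by simp
      ultimately show False using nmin[of "l - k"] that by simp
    qed
    assume "k \<noteq> l"
    then show False using *[of k l] *[of l k] that by (cases "k < l") auto
  qed
  have orb: "r\<^sup>* `` {v} = p ` {..<n}"
  proof
    show "r\<^sup>* `` {v} \<subseteq> p ` {..<n}"
    proof
      fix w assume "w \<in> r\<^sup>* `` {v}"
      then have "(v, w) \<in> r\<^sup>*" by simp
      then show "w \<in> p ` {..<n}"
      proof induction
        case base then show ?case using n p0 by (metis image_eqI lessThan_iff)
      next
        case (step y z)
        then obtain k where k: "k < n" "y = p k" by auto
        show ?case
        proof (cases "z = \<alpha> y")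
          case True
          then show ?thesis using \<alpha>p[OF k(1)] k by auto
        next
          case False
          then have "z = \<beta> y" using step r by auto
          then have z: "z = p (n - k)" using \<beta>p[of k] k by simp
          show ?thesis
          proof (cases "k = 0")
            case True then show ?thesis using z n p0 by (metis diff_zero image_eqI lessThan_iff)
          next
            case False then show ?thesis using z k by auto
          qed
        qed
      qed
    qed
    have "(v, p k) \<in> r\<^sup>*" for k
    proof (induction k)
      case 0 then show ?case by (simp add: p0)
    next
      case (Suc k)
      have "(p k, \<alpha> (p k)) \<in> r" "(\<alpha> (p k), p (Suc k)) \<in> r" by (auto simp: r pS)
      then show ?case using Suc by (meson rtrancl.rtrancl_into_rtrancl)
    qed
    then show "p ` {..<n} \<subseteq> r\<^sup>* `` {v}" by auto
  qed
  then show "finite (r\<^sup>* `` {v})" by simp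
  have fixed: "k = 0 \<or> 2 * k = n \<or> 2 * k + 1 = n"
    if "k < n" "\<alpha> (p k) = p k \<or> \<beta> (p k) = p k" for k
    using that(2)
  proof
    assume "\<alpha> (p k) = p k"
    then have "n - Suc k = k" using \<alpha>p[OF that(1)] inj[of "n - Suc k" k] that(1) by simp
    then show ?thesis using that by auto
  next
    assume "\<beta> (p k) = p k"
    then have "p (n - k) = p k" using \<beta>p[of k] that(1) by simp
    then have "k = 0 \<or> n - k = k" using inj[of "n - k" k] that(1) by linarith
    then show ?thesis using that by auto
  qed
  define h where "h = n div 2"
  have h: "0 < h" "h < n"
  proof -
    have "n \<noteq> 1"
    proof
      assume "n = 1"
      then have "\<alpha> (p 0) = p 0" using \<alpha>p[of 0] by simp
      then show False using v p0 by simp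
    qed
    then show "0 < h" "h < n" using n by (auto simp: h_def)
  qed
  have hfix: "\<alpha> (p h) = p h \<or> \<beta> (p h) = p h"
  proof (cases "even n")
    case True
    then have "n - h = h" by (auto simp: h_def)
    then show ?thesis using \<beta>p[of h] h by simp
  next
    case False
    then have "n - Suc h = h" unfolding h_def by presburger
    then show ?thesis using \<alpha>p[of h] h by simp
  qed
  show "\<exists>w. w \<noteq> v \<and> (v, w) \<in> r\<^sup>* \<and> (\<alpha> w = w \<or> \<beta> w = w) \<and>
          (\<forall>w'. (v, w') \<in> r\<^sup>* \<and> (\<alpha> w' = w' \<or> \<beta> w' = w') \<longrightarrow> w' = v \<or> w' = w)"
  proof (intro exI[of _ "p h"] conjI allI impI)
    show "p h \<noteq> v" using nmin h by blast
    show "(v, p h) \<in> r\<^sup>*" using orb h by (metis Image_singleton_iff image_eqI lessThan_iff)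
    show "\<alpha> (p h) = p h \<or> \<beta> (p h) = p h" by (rule hfix)
    fix w' assume w': "(v, w') \<in> r\<^sup>* \<and> (\<alpha> w' = w' \<or> \<beta> w' = w')"
    then have "w' \<in> p ` {..<n}" using orb by blast
    then obtain k where k: "k < n" "w' = p k" by auto
    then have "k = 0 \<or> 2 * k = n \<or> 2 * k + 1 = n" using fixed w' by blast
    then have "k = 0 \<or> k = h" by (auto simp: h_def)
    then show "w' = v \<or> w' = p h" using k p0 by auto
  qed
qed

text \<open>Conjugation by \<beta> inverts the rotation. Hence a power of the rotation that carries
  one \<beta>-fixed point to another also carries it back. This turns a return up to translation
  into a genuine return.\<close>

lemma dihedral_return:
  fixes \<alpha> \<beta> \<tau> :: "'a \<Rightarrow> 'a"
  assumes \<alpha>\<alpha>: "\<And>x. \<alpha> (\<alpha> x) = x" and \<beta>\<beta>: "\<And>x. \<beta> (\<beta> x) = x"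
    and v: "\<beta> v = v" "\<beta> (\<tau> v) = \<tau> v"
    and \<tau>: "((\<beta> \<circ> \<alpha>) ^^ n) v = \<tau> v"
  shows "((\<beta> \<circ> \<alpha>) ^^ (n + n)) v = v"
proof -
  have "((\<beta> \<circ> \<alpha>) ^^ k) (\<beta> (((\<beta> \<circ> \<alpha>) ^^ k) v)) = v" for k
  proof (induction k)
    case (Suc k)
    have "((\<beta> \<circ> \<alpha>) ^^ Suc k) (\<beta> (((\<beta> \<circ> \<alpha>) ^^ Suc k) v)) =
      ((\<beta> \<circ> \<alpha>) ^^ k) (\<beta> (\<alpha> (\<beta> (\<beta> (\<alpha> (((\<beta> \<circ> \<alpha>) ^^ k) v))))))"
      by (subst funpow_Suc_right) simp
    then show ?case using Suc \<alpha>\<alpha> \<beta>\<beta> by metis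
  qed (simp add: v)
  from this[of n] show ?thesis using \<tau> v by (simp add: funpow_add)
qed

section \<open>Graphs glued from periodic matchings\<close>

definition tr :: "int \<Rightarrow> 'l \<times> int \<Rightarrow> 'l \<times> int" where
  "tr t x = (fst x, snd x + t)"

lemma tr_simps [simp]: "tr t (l, i) = (l, i + t)" "fst (tr t x) = fst x" "snd (tr t x) = snd x + t"
  by (simp_all add: tr_def)

lemma tr_tr [simp]: "tr s (tr t x) = tr (t + s) x" and tr_0 [simp]: "tr 0 x = x"
  by (simp_all add: tr_def)

lemma tr_inject [simp]: "tr t x = tr t y \<longleftrightarrow> x = y"
  by (cases x; cases y) simp

text \<open>The periodic part of the definition of a diagram, without planarity and without the
  condition on loops; it is all that composition and associativity use.\<close>

definition pmatch :: "nat \<Rightarrow> adiagram \<Rightarrow> bool" where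
  "pmatch N d \<longleftrightarrow> (\<forall>x. pairing d (pairing d x) = x \<and> pairing d x \<noteq> x) \<and>
     (\<forall>x. pairing d (tr (int N) x) = tr (int N) (pairing d x))"

lemma pmatch_invol [simp]: "pmatch N d \<Longrightarrow> pairing d (pairing d x) = x"
  and pmatch_nofix [simp]: "pmatch N d \<Longrightarrow> pairing d x \<noteq> x"
  unfolding pmatch_def by blast+

lemma pmatch_inject [simp]: "pmatch N d \<Longrightarrow> pairing d x = pairing d y \<longleftrightarrow> x = y"
  by (metis pmatch_invol)

lemma pmatch_tr:
  assumes "pmatch N d"
  shows "pairing d (tr (t * int N) x) = tr (t * int N) (pairing d x)"
proof -
  have step: "pairing d (tr (int N) x) = tr (int N) (pairing d x)" for x
    using assms unfolding pmatch_def by blast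
  have up: "pairing d (tr (int k * int N) x) = tr (int k * int N) (pairing d x)" for k x
  proof (induction k)
    case (Suc k)
    have *: "tr (int (Suc k) * int N) x = tr (int N) (tr (int k * int N) x)" for x :: point
      by (simp add: algebra_simps)
    show ?case unfolding * step Suc ..
  qed simp
  show ?thesis
  proof (cases "t \<ge> 0")
    case True
    then show ?thesis using up[of "nat t" x] by simp
  next
    case False
    have "pairing d (tr (int (nat (-t)) * int N) (tr (t * int N) x)) =
      tr (int (nat (-t)) * int N) (pairing d (tr (t * int N) x))" by (rule up)
    then have "pairing d x = tr (- t * int N) (pairing d (tr (t * int N) x))" using False by simp
    then have "tr (t * int N) (pairing d x) = tr (t * int N) (tr (- t * int N) (pairing d (tr (t * int N) x)))"
      by simp
    then show ?thesis by simp
  qed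
qed

lemma adiagrams_iff:
  "d \<in> adiagrams N \<longleftrightarrow> pmatch N d \<and>
     \<not> (\<exists>x y. before x y \<and> before y (pairing d x) \<and> before (pairing d x) (pairing d y)) \<and>
     (loops d > 0 \<longrightarrow> (\<forall>x. fst (pairing d x) = fst x))"
proof -
  have tr: "tr t x = map_prod id (\<lambda>j. j + t) x" for t and x :: point by (cases x) simp
  have "(\<forall>s i. pairing d (s, i + int N) = map_prod id (\<lambda>j. j + int N) (pairing d (s, i))) \<longleftrightarrow>
    (\<forall>x. pairing d (tr (int N) x) = tr (int N) (pairing d x))"
    by (simp add: tr split_paired_all)
  then show ?thesis unfolding adiagrams_def pmatch_def mem_Collect_eq by blast
qed

lemma adiagrams_pmatch: "d \<in> adiagrams N \<Longrightarrow> pmatch N d"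
  unfolding adiagrams_iff by blast

text \<open>The labels of the levels are arbitrary, so that the four levels arising from three glued
  diagrams are covered by the same lemmas as the levels \<open>Top\<close>, \<open>Mid\<close>,
  \<open>Bot\<close>.\<close>

definition lv :: "'l \<Rightarrow> 'l \<Rightarrow> point \<Rightarrow> 'l \<times> int" where
  "lv i j x = ((case fst x of Outer \<Rightarrow> i | Inner \<Rightarrow> j), snd x)"

lemma lv_simps [simp]: "lv i j (Outer, k) = (i, k)" "lv i j (Inner, k) = (j, k)"
  by (simp_all add: lv_def)

lemma lv_inj: "i \<noteq> j \<Longrightarrow> lv i j x = lv i j y \<longleftrightarrow> x = y"
  by (cases x; cases y) (auto simp: lv_def split: side.splits)

lemma lv_tr: "lv i j (tr t x) = tr t (lv i j x)"
  by (simp add: lv_def tr_def)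

lemma vertex_lv: "upper_vertex = lv Top Mid" "lower_vertex = lv Mid Bot" "end_vertex = lv Top Bot"
proof -
  show "upper_vertex = lv Top Mid"
  proof fix x show "upper_vertex x = lv Top Mid x" by (cases x rule: upper_vertex.cases) auto qed
  show "lower_vertex = lv Mid Bot"
  proof fix x show "lower_vertex x = lv Mid Bot x" by (cases x rule: lower_vertex.cases) auto qed
  show "end_vertex = lv Top Bot"
  proof fix x show "end_vertex x = lv Top Bot x" by (cases x rule: end_vertex.cases) auto qed
qed

definition arcs :: "'l \<Rightarrow> 'l \<Rightarrow> adiagram \<Rightarrow> (('l \<times> int) \<times> ('l \<times> int)) set" where
  "arcs i j d = range (\<lambda>x. (lv i j x, lv i j (pairing d x)))"

lemma arcsI: "(lv i j x, lv i j (pairing d x)) \<in> arcs i j d"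
  by (simp add: arcs_def)

lemma glued_arcs: "glued d d' = (arcs Top Mid d \<union> arcs Mid Bot d')\<^sup>*"
  by (simp add: glued_def arcs_def vertex_lv)

lemma arcsE:
  assumes "(v, w) \<in> arcs i j d"
  obtains x where "v = lv i j x" "w = lv i j (pairing d x)"
  using assms unfolding arcs_def by blast

lemma sym_arcs:
  assumes "pmatch N d" shows "sym (arcs i j d)"
proof (rule symI)
  fix v w assume "(v, w) \<in> arcs i j d"
  then obtain x where "v = lv i j x" "w = lv i j (pairing d x)" by (rule arcsE)
  then show "(w, v) \<in> arcs i j d" using arcsI[of i j "pairing d x" d] assms by simp
qed

definition shift_inv :: "nat \<Rightarrow> (('l \<times> int) \<times> ('l \<times> int)) set \<Rightarrow> bool" where
  "shift_inv N r \<longleftrightarrow> (\<forall>x y t. (x, y) \<in> r \<longrightarrow> (tr (t * int N) x, tr (t * int N) y) \<in> r)"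

lemma shift_inv_arcs:
  assumes "pmatch N d" shows "shift_inv N (arcs i j d)"
  unfolding shift_inv_def
proof (intro allI impI)
  fix v w t assume "(v, w) \<in> arcs i j d"
  then obtain x where "v = lv i j x" "w = lv i j (pairing d x)" by (rule arcsE)
  then show "(tr (t * int N) v, tr (t * int N) w) \<in> arcs i j d"
    using arcsI[of i j "tr (t * int N) x" d] pmatch_tr[OF assms] by (simp add: lv_tr)
qed

lemma shift_inv_Un: "shift_inv N r \<Longrightarrow> shift_inv N s \<Longrightarrow> shift_inv N (r \<union> s)"
  by (auto simp: shift_inv_def)

lemma shift_inv_rtrancl: assumes "shift_inv N r" shows "shift_inv N (r\<^sup>*)"
  unfolding shift_inv_def
proof (intro allI impI)
  fix x y t assume "(x, y) \<in> r\<^sup>*"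
  then show "(tr (t * int N) x, tr (t * int N) y) \<in> r\<^sup>*"
  proof induction
    case (step y z)
    then show ?case using assms unfolding shift_inv_def by (meson rtrancl.rtrancl_into_rtrancl)
  qed simp
qed

text \<open>Extends the pairing to an involution of all vertices by fixing those on other levels. A
  boundary vertex of the glued picture is thereby a fixed point of one of the two involutions, which
  is how ends of paths are recognised.\<close>

definition arc_inv :: "'l \<Rightarrow> 'l \<Rightarrow> adiagram \<Rightarrow> 'l \<times> int \<Rightarrow> 'l \<times> int" where
  "arc_inv i j d v = (if fst v = i then lv i j (pairing d (Outer, snd v))
     else if fst v = j then lv i j (pairing d (Inner, snd v)) else v)"

lemma arc_inv_lv: "i \<noteq> j \<Longrightarrow> arc_inv i j d (lv i j x) = lv i j (pairing d x)"
  by (cases x; cases "fst x") (auto simp: arc_inv_def)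

lemma lv_cases: assumes "l = i \<or> l = j" obtains x where "(l, n) = lv i j x"
  using assms lv_simps by metis

lemma arc_inv_invol: assumes "pmatch N d" "i \<noteq> j" shows "arc_inv i j d (arc_inv i j d v) = v"
proof (cases "fst v = i \<or> fst v = j")
  case True
  then obtain x where "v = lv i j x" using lv_cases[of "fst v" i j "snd v"] by (metis prod.collapse)
  then show ?thesis using assms by (simp add: arc_inv_lv)
qed (auto simp: arc_inv_def)

lemma arc_inv_fix: assumes "pmatch N d" "i \<noteq> j"
  shows "arc_inv i j d v = v \<longleftrightarrow> fst v \<noteq> i \<and> fst v \<noteq> j"
proof (cases "fst v = i \<or> fst v = j")
  case True
  then obtain x where "v = lv i j x" using lv_cases[of "fst v" i j "snd v"] by (metis prod.collapse)
  then show ?thesis using assms True by (simp add: arc_inv_lv lv_inj)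
qed (auto simp: arc_inv_def)

lemma arc_inv_tr: assumes "pmatch N d"
  shows "arc_inv i j d (tr (t * int N) v) = tr (t * int N) (arc_inv i j d v)"
  using pmatch_tr[OF assms, of t "(Outer, snd v)"] pmatch_tr[OF assms, of t "(Inner, snd v)"]
  by (simp add: arc_inv_def lv_tr)

lemma arcs_arc_inv: "i \<noteq> j \<Longrightarrow> (v, w) \<in> arcs i j d \<Longrightarrow> w = arc_inv i j d v"
  by (auto simp: arcs_def arc_inv_lv)

lemma arc_inv_arcs: assumes "i \<noteq> j" shows "w = arc_inv i j d v \<Longrightarrow> (v, w) \<in> (arcs i j d)\<^sup>="
proof (cases "fst v = i \<or> fst v = j")
  case True
  then obtain x where "v = lv i j x" using lv_cases[of "fst v" i j "snd v"] by (metis prod.collapse)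
  then show "w = arc_inv i j d v \<Longrightarrow> (v, w) \<in> (arcs i j d)\<^sup>=" using assms by (auto simp: arc_inv_lv arcsI)
qed (auto simp: arc_inv_def)

lemma rtrancl_arc_inv:
  assumes "i \<noteq> j" "j \<noteq> k"
  shows "(arcs i j d \<union> arcs j k d')\<^sup>* = {(x, y). y = arc_inv i j d x \<or> y = arc_inv j k d' x}\<^sup>*" (is "_ = ?r\<^sup>*")
proof
  show "(arcs i j d \<union> arcs j k d')\<^sup>* \<subseteq> ?r\<^sup>*"
    by (rule rtrancl_mono) (use arcs_arc_inv[OF assms(1)] arcs_arc_inv[OF assms(2)] in auto)
  have "?r \<subseteq> (arcs i j d \<union> arcs j k d')\<^sup>="
    using arc_inv_arcs[OF assms(1)] arc_inv_arcs[OF assms(2)] by blast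
  then have "?r \<subseteq> (arcs i j d \<union> arcs j k d')\<^sup>*" by auto
  then show "?r\<^sup>* \<subseteq> (arcs i j d \<union> arcs j k d')\<^sup>*" by (rule rtrancl_subset_rtrancl)
qed

lemma arcs_level: "(v, w) \<in> arcs i j d \<Longrightarrow> fst v \<in> {i, j} \<and> fst w \<in> {i, j}"
  by (auto simp: arcs_def lv_def split: side.splits)

lemma glued_level:
  assumes "(v, w) \<in> (arcs i j d \<union> arcs j k d')\<^sup>*" "fst v \<in> {i, j, k}"
  shows "fst w \<in> {i, j, k}"
  using assms by (induction rule: rtrancl_induct) (auto dest!: arcs_level)

text \<open>The pigeonhole principle gives a coincidence only up to translation, which an endless
  drift round the annulus would produce as well. The drift is excluded because the second involution
  fixes \<open>v\<close> together with all its translates, so that \<open>dihedral_return\<close>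
  applies.\<close>

lemma path_end_aux:
  assumes N: "N > 0" and d: "pmatch N d" "pmatch N d'" and ijk: "i \<noteq> j" "j \<noteq> k" "i \<noteq> k"
    and r: "r = arcs i j d \<union> arcs j k d'" and v: "fst v = i"
  shows "finite (r\<^sup>* `` {v})"
    and "\<exists>w. w \<noteq> v \<and> (v, w) \<in> r\<^sup>* \<and> fst w \<in> {i, k} \<and>
          (\<forall>w'. (v, w') \<in> r\<^sup>* \<and> fst w' \<in> {i, k} \<longrightarrow> w' = v \<or> w' = w)"
proof -
  let ?a = "arc_inv i j d" and ?b = "arc_inv j k d'"
  let ?r = "{(x, y). y = ?a x \<or> y = ?b x}"
  define p where "p = ?b \<circ> ?a"
  have papp: "p x = ?b (?a x)" for x by (simp add: p_def)
  have aa: "?a (?a x) = x" and bb: "?b (?b x) = x" for x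
    using d ijk by (auto intro: arc_inv_invol)
  have r': "r\<^sup>* = ?r\<^sup>*" unfolding r by (rule rtrancl_arc_inv) (use ijk in auto)
  have bv: "?b v = v" "?a v \<noteq> v" using v ijk d by (auto simp: arc_inv_fix)
  have trp: "(p ^^ n) (tr (t * int N) x) = tr (t * int N) ((p ^^ n) x)" for n t x
  proof (induction n)
    case (Suc n)
    then show ?case by (metis papp funpow.simps(2) comp_apply arc_inv_tr[OF d(1)] arc_inv_tr[OF d(2)])
  qed simp
  have lev: "fst ((p ^^ n) v) \<in> {i, j, k}" for n
  proof -
    have "(v, (p ^^ n) v) \<in> ?r\<^sup>*"
    proof (induction n)
      case (Suc n)
      have "((p ^^ n) v, ?a ((p ^^ n) v)) \<in> ?r" "(?a ((p ^^ n) v), p ((p ^^ n) v)) \<in> ?r"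
        by (simp_all add: p_def)
      then have "(v, p ((p ^^ n) v)) \<in> ?r\<^sup>*" using Suc by (meson rtrancl.rtrancl_into_rtrancl)
      then show ?case by simp
    qed simp
    then show ?thesis using glued_level[of v _ i j d k d'] r r' v by auto
  qed
  have injp: "(p ^^ n) x = (p ^^ n) y \<Longrightarrow> x = y" for n x y
  proof (induction n)
    case (Suc n)
    then have "?b (?a ((p ^^ n) x)) = ?b (?a ((p ^^ n) y))" by (metis papp funpow.simps(2) comp_apply)
    then have "(p ^^ n) x = (p ^^ n) y" using aa bb by metis
    then show ?case by (rule Suc.IH)
  qed simp
  \<comment> \<open>The vertex reached after \<open>n\<close> rounds, modulo translation; at most
    \<open>3 * N\<close> values are possible.\<close>
  define f where "f n = (fst ((p ^^ n) v), snd ((p ^^ n) v) mod int N)" for n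
  have "range f \<subseteq> {i, j, k} \<times> {0..<int N}" using lev N by (auto simp: f_def)
  then have "finite (range f)" by (rule finite_subset) auto
  then have "\<not> inj f" using finite_imageD infinite_UNIV_nat by blast
  then obtain a b where "f a = f b" "a \<noteq> b" by (auto simp: inj_def)
  then obtain a b where ab: "f a = f b" "a < b" by (metis linorder_neqE_nat)
  have "int N dvd snd ((p ^^ b) v) - snd ((p ^^ a) v)"
    using ab by (simp add: f_def mod_eq_dvd_iff dvd_diff_commute)
  then obtain t where "snd ((p ^^ b) v) - snd ((p ^^ a) v) = int N * t" by auto
  then have "(p ^^ b) v = tr (t * int N) ((p ^^ a) v)"
    using ab by (simp add: f_def tr_def prod_eq_iff mult.commute diff_eq_eq add.commute)
  moreover have "(p ^^ b) v = (p ^^ a) ((p ^^ (b - a)) v)"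
    using ab(2) by (metis comp_apply funpow_add le_add_diff_inverse less_imp_le)
  ultimately have "(p ^^ a) ((p ^^ (b - a)) v) = (p ^^ a) (tr (t * int N) v)"
    by (simp add: trp)
  \<comment> \<open>\<open>p\<close> is injective and commutes with translations, so the coincidence
    can be moved back to the start of the path.\<close>
  then have "(p ^^ (b - a)) v = tr (t * int N) v" by (rule injp)
  moreover have "?b (tr (t * int N) v) = tr (t * int N) v" using bv(1) arc_inv_tr[OF d(2), of j k t v] by simp
  ultimately have "(p ^^ ((b - a) + (b - a))) v = v"
    unfolding p_def by (intro dihedral_return[where \<tau> = "tr (t * int N)"] aa bb bv)
  then have per: "((?b \<circ> ?a) ^^ ((b - a) + (b - a))) v = v" by (simp only: p_def)
  have pos: "(b - a) + (b - a) > 0" using ab by simp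
  note fin = dihedral_orbit(1)[OF aa bb bv pos per refl]
  note ex = dihedral_orbit(2)[OF aa bb bv pos per refl]
  show "finite (r\<^sup>* `` {v})" using fin r' by simp
  have "?a w = w \<or> ?b w = w \<longleftrightarrow> fst w \<in> {i, k}" if "(v, w) \<in> ?r\<^sup>*" for w
    using glued_level[of v w i j d k d'] r r' v that ijk
    by (auto simp: arc_inv_fix[OF d(1) ijk(1)] arc_inv_fix[OF d(2) ijk(2)])
  with ex show "\<exists>w. w \<noteq> v \<and> (v, w) \<in> r\<^sup>* \<and> fst w \<in> {i, k} \<and>
          (\<forall>w'. (v, w') \<in> r\<^sup>* \<and> fst w' \<in> {i, k} \<longrightarrow> w' = v \<or> w' = w)"
    unfolding r' by blast
qed

section \<open>Reflection of the annulus exchanging its two boundaries\<close>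

definition mirror :: "adiagram \<Rightarrow> adiagram" where
  "mirror d = ADiagram (\<lambda>x. map_prod opp id (pairing d (map_prod opp id x))) (loops d)"

lemma opp_opp [simp]: "opp (opp s) = s" by (cases s) auto

lemma mirror_mirror [simp]: "mirror (mirror d) = d"
  by (cases d) (simp add: mirror_def prod.map_comp comp_def map_prod_def case_prod_beta)

lemma mirror_simps [simp]: "loops (mirror d) = loops d"
  "pairing (mirror d) (Outer, i) = map_prod opp id (pairing d (Inner, i))"
  "pairing (mirror d) (Inner, i) = map_prod opp id (pairing d (Outer, i))"
  by (simp_all add: mirror_def)

lemma lv_opp: "lv i j (map_prod opp id x) = lv j i x"
  by (cases x; cases "fst x") auto

lemma arcs_mirror: "arcs i j (mirror d) = arcs j i d"
proof -
  have *: "arcs i j (mirror d) \<subseteq> arcs j i d" for i j :: 'a and d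
  proof (rule subrelI)
    fix v w assume "(v, w) \<in> arcs i j (mirror d)"
    then obtain x where "v = lv i j x" "w = lv i j (pairing (mirror d) x)" by (rule arcsE)
    then have "v = lv j i (map_prod opp id x)" "w = lv j i (pairing d (map_prod opp id x))"
      by (simp_all add: lv_opp mirror_def)
    then show "(v, w) \<in> arcs j i d" by (simp add: arcsI)
  qed
  from *[of i j d] *[of j i "mirror d"] show ?thesis by simp
qed

lemma pmatch_mirror: assumes "pmatch N d" shows "pmatch N (mirror d)"
  unfolding pmatch_def
proof (intro conjI allI)
  fix x :: point
  have *: "map_prod opp id (map_prod opp id y) = y" for y :: point by (cases y) simp
  show "pairing (mirror d) (pairing (mirror d) x) = x"
    using assms by (simp add: mirror_def *)
  show "pairing (mirror d) x \<noteq> x" using assms * by (metis adiagram.sel(1) mirror_def pmatch_nofix)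
  have "map_prod opp id (tr t x) = tr t (map_prod opp id x)" for t and x :: point by (cases x) simp
  then show "pairing (mirror d) (tr (int N) x) = tr (int N) (pairing (mirror d) x)"
    using pmatch_tr[OF assms, of 1] by (simp add: mirror_def)
qed

text \<open>\<open>path_end_aux\<close> starts on level \<open>i\<close> only. In the mirrored
  picture level \<open>k\<close> takes this role, which gives the other half.\<close>

lemma path_end:
  assumes N: "N > 0" and d: "pmatch N d" "pmatch N d'" and ijk: "i \<noteq> j" "j \<noteq> k" "i \<noteq> k"
    and r: "r = arcs i j d \<union> arcs j k d'"
  shows "finite (r\<^sup>* `` {lv i k x})" and "\<exists>!y. y \<noteq> x \<and> (lv i k x, lv i k y) \<in> r\<^sup>*"
proof -
  have "finite (r\<^sup>* `` {lv i k x}) \<and> (\<exists>w. w \<noteq> lv i k x \<and> (lv i k x, w) \<in> r\<^sup>* \<and> fst w \<in> {i, k} \<and>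
          (\<forall>w'. (lv i k x, w') \<in> r\<^sup>* \<and> fst w' \<in> {i, k} \<longrightarrow> w' = lv i k x \<or> w' = w))"
  proof (cases "fst x")
    case Outer
    then have "fst (lv i k x) = i" by (simp add: lv_def)
    note aux = path_end_aux[OF N d ijk r this]
    show ?thesis by (intro conjI aux)
  next
    case Inner
    then have k: "fst (lv i k x) = k" by (simp add: lv_def)
    have r': "r = arcs k j (mirror d') \<union> arcs j i (mirror d)" using r by (auto simp: arcs_mirror)
    have ki: "{k, i} = {i, k}" by auto
    have ne: "k \<noteq> j" "j \<noteq> i" "k \<noteq> i" using ijk by auto
    note aux = path_end_aux[OF N pmatch_mirror[OF d(2)] pmatch_mirror[OF d(1)] ne r' k, unfolded ki]
    show ?thesis by (intro conjI aux)
  qed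
  then obtain w where fin: "finite (r\<^sup>* `` {lv i k x})" and
    w: "w \<noteq> lv i k x" "(lv i k x, w) \<in> r\<^sup>*" "fst w \<in> {i, k}" and
    uniq: "\<And>w'. (lv i k x, w') \<in> r\<^sup>* \<Longrightarrow> fst w' \<in> {i, k} \<Longrightarrow> w' = lv i k x \<or> w' = w"
    by blast
  show "finite (r\<^sup>* `` {lv i k x})" by (rule fin)
  obtain y where y: "w = lv i k y" using w(3) lv_cases[of "fst w" i k "snd w"] by auto
  show "\<exists>!y. y \<noteq> x \<and> (lv i k x, lv i k y) \<in> r\<^sup>*"
  proof (rule ex1I[of _ y])
    show "y \<noteq> x \<and> (lv i k x, lv i k y) \<in> r\<^sup>*" using w y by auto
    fix z assume z: "z \<noteq> x \<and> (lv i k x, lv i k z) \<in> r\<^sup>*"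
    have "fst (lv i k z) \<in> {i, k}" by (simp add: lv_def split: side.splits)
    then have "lv i k z = lv i k x \<or> lv i k z = w" using uniq z by blast
    then show "z = y" using z y lv_inj[OF ijk(3)] by metis
  qed
qed

section \<open>Composition of periodic matchings\<close>

lemma rtrancl_image_inj:
  assumes "inj h"
  shows "(map_prod h h ` r)\<^sup>* `` {h v} = h ` (r\<^sup>* `` {v})"
proof
  show "(map_prod h h ` r)\<^sup>* `` {h v} \<subseteq> h ` (r\<^sup>* `` {v})"
  proof
    fix w assume "w \<in> (map_prod h h ` r)\<^sup>* `` {h v}"
    then have "(h v, w) \<in> (map_prod h h ` r)\<^sup>*" by simp
    then show "w \<in> h ` (r\<^sup>* `` {v})"
    proof induction
      case (step y z)
      then obtain y' where "y = h y'" "(v, y') \<in> r\<^sup>*" by auto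
      moreover obtain a b where "(a, b) \<in> r" "y = h a" "z = h b" using step(2) by auto
      ultimately have "(v, b) \<in> r\<^sup>*" "z = h b"
        using assms by (auto simp: inj_eq intro: rtrancl.rtrancl_into_rtrancl)
      then show ?case by simp
    qed auto
  qed
  have "(h v, h w) \<in> (map_prod h h ` r)\<^sup>*" if "(v, w) \<in> r\<^sup>*" for w
    using that
  proof induction
    case (step y z)
    then have "(h y, h z) \<in> map_prod h h ` r" by force
    then show ?case using step by (meson rtrancl.rtrancl_into_rtrancl)
  qed simp
  then show "h ` (r\<^sup>* `` {v}) \<subseteq> (map_prod h h ` r)\<^sup>* `` {h v}" by auto
qed

definition relabel :: "'l \<Rightarrow> 'l \<Rightarrow> 'l \<Rightarrow> level \<times> int \<Rightarrow> 'l \<times> int" where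
  "relabel i j k = map_prod (\<lambda>l. case l of Top \<Rightarrow> i | Mid \<Rightarrow> j | Bot \<Rightarrow> k) id"

lemma relabel_lv: "relabel i j k (lv Top Mid x) = lv i j x" "relabel i j k (lv Mid Bot x) = lv j k x"
  "relabel i j k (lv Top Bot x) = lv i k x"
  by (cases x; cases "fst x"; simp add: relabel_def lv_def)+

lemma inj_relabel: "i \<noteq> j \<Longrightarrow> j \<noteq> k \<Longrightarrow> i \<noteq> k \<Longrightarrow> inj (relabel i j k)"
  by (rule injI) (auto simp: relabel_def map_prod_def split: prod.splits level.splits)

lemma relabel_arcs:
  "map_prod (relabel i j k) (relabel i j k) ` (arcs Top Mid d \<union> arcs Mid Bot d') = arcs i j d \<union> arcs j k d'"
  by (simp add: arcs_def image_Un image_image relabel_lv)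

lemma glued_relabel:
  assumes "i \<noteq> j" "j \<noteq> k" "i \<noteq> k"
  shows "(lv i k x, lv i k y) \<in> (arcs i j d \<union> arcs j k d')\<^sup>* \<longleftrightarrow>
    (lv Top Bot x, lv Top Bot y) \<in> (arcs Top Mid d \<union> arcs Mid Bot d')\<^sup>*"
proof -
  note inj = inj_relabel[OF assms]
  have "(lv i k x, lv i k y) \<in> (arcs i j d \<union> arcs j k d')\<^sup>* \<longleftrightarrow>
    relabel i j k (lv Top Bot y) \<in> (arcs i j d \<union> arcs j k d')\<^sup>* `` {relabel i j k (lv Top Bot x)}"
    by (simp add: relabel_lv)
  also have "\<dots> \<longleftrightarrow>
    relabel i j k (lv Top Bot y) \<in> relabel i j k ` ((arcs Top Mid d \<union> arcs Mid Bot d')\<^sup>* `` {lv Top Bot x})"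
    by (simp only: rtrancl_image_inj[OF inj] relabel_arcs[of i j k d d', symmetric])
  also have "\<dots> \<longleftrightarrow> (lv Top Bot x, lv Top Bot y) \<in> (arcs Top Mid d \<union> arcs Mid Bot d')\<^sup>*"
    by (simp only: inj_image_mem_iff[OF inj] Image_singleton_iff)
  finally show ?thesis .
qed

text \<open>Existence and uniqueness of the other end of a path give the definite description in
  \<open>diagram_comp\<close> a meaning; from here on it is used through this criterion only. The
  free choice of the three labels lets several products be read off from one larger graph.\<close>

lemma pairing_comp_iff:
  assumes "N > 0" "pmatch N d" "pmatch N d'" "i \<noteq> j" "j \<noteq> k" "i \<noteq> k"
  shows "pairing (diagram_comp N d d') x = y \<longleftrightarrow>
    y \<noteq> x \<and> (lv i k x, lv i k y) \<in> (arcs i j d \<union> arcs j k d')\<^sup>*"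
proof -
  let ?P = "\<lambda>y. y \<noteq> x \<and> (lv Top Bot x, lv Top Bot y) \<in> (arcs Top Mid d \<union> arcs Mid Bot d')\<^sup>*"
  have ex: "\<exists>!y. ?P y"
    by (rule path_end(2)[OF assms(1-3) _ _ _ refl]) auto
  have "pairing (diagram_comp N d d') x = (THE y. ?P y)"
    by (simp add: diagram_comp_def glued_arcs vertex_lv)
  moreover have "(THE y. ?P y) = y \<longleftrightarrow> ?P y"
    by (rule iffI, erule subst, rule theI'[OF ex], rule the1_equality[OF ex])
  ultimately show ?thesis by (simp only: glued_relabel[OF assms(4-6)])
qed

lemma sym_Un_arcs: "pmatch N d \<Longrightarrow> pmatch N d' \<Longrightarrow> sym (arcs i j d \<union> arcs k l d')"
  by (simp add: sym_Un sym_arcs)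

lemma pmatch_comp:
  assumes "N > 0" "pmatch N d" "pmatch N d'"
  shows "pmatch N (diagram_comp N d d')"
proof -
  note iff = pairing_comp_iff[OF assms, of Top Mid Bot, simplified]
  let ?r = "arcs Top Mid d \<union> arcs Mid Bot d'"
  have sym: "sym (?r\<^sup>*)" by (intro sym_rtrancl sym_Un_arcs) (use assms in auto)
  have shift: "shift_inv N (?r\<^sup>*)"
    by (intro shift_inv_rtrancl shift_inv_Un shift_inv_arcs assms)
  have P: "pairing (diagram_comp N d d') x \<noteq> x \<and>
      (lv Top Bot x, lv Top Bot (pairing (diagram_comp N d d') x)) \<in> ?r\<^sup>*" for x
    using iff[of x "pairing (diagram_comp N d d') x"] by blast
  show ?thesis
    unfolding pmatch_def
  proof (intro conjI allI)
    fix x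
    show "pairing (diagram_comp N d d') x \<noteq> x" using P by blast
    show "pairing (diagram_comp N d d') (pairing (diagram_comp N d d') x) = x"
      unfolding iff using P[of x] sym by (metis symD)
    show "pairing (diagram_comp N d d') (tr (int N) x) = tr (int N) (pairing (diagram_comp N d d') x)"
      unfolding iff
    proof (intro conjI)
      show "tr (int N) (pairing (diagram_comp N d d') x) \<noteq> tr (int N) x" using P[of x] by simp
      have "(tr (1 * int N) (lv Top Bot x), tr (1 * int N) (lv Top Bot (pairing (diagram_comp N d d') x))) \<in> ?r\<^sup>*"
        using P[of x] shift unfolding shift_inv_def by blast
      then show "(lv Top Bot (tr (int N) x), lv Top Bot (tr (int N) (pairing (diagram_comp N d d') x))) \<in> ?r\<^sup>*"
        by (simp add: lv_tr)
    qed
  qed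
qed

text \<open>The graph glued from the mirrored diagrams is the original one with \<open>Top\<close>
  and \<open>Bot\<close> exchanged, so it suffices to read the criterion with reversed
  labels.\<close>

lemma comp_mirror_pairing:
  assumes "N > 0" "pmatch N d" "pmatch N d'"
  shows "pairing (diagram_comp N (mirror d') (mirror d)) x = pairing (mirror (diagram_comp N d d')) x"
proof -
  let ?o = "map_prod opp id :: point \<Rightarrow> point"
  have oo: "?o (?o x) = x" for x by (cases x) simp
  have "pairing (diagram_comp N d d') (?o x) = y \<longleftrightarrow>
     pairing (diagram_comp N (mirror d') (mirror d)) x = ?o y" for y
  proof -
    have "pairing (diagram_comp N d d') (?o x) = y \<longleftrightarrow>
      y \<noteq> ?o x \<and> (lv Bot Top (?o x), lv Bot Top y) \<in> (arcs Bot Mid d \<union> arcs Mid Top d')\<^sup>*"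
      by (rule pairing_comp_iff) (use assms in auto)
    also have "\<dots> \<longleftrightarrow> ?o y \<noteq> x \<and> (lv Top Bot x, lv Top Bot (?o y)) \<in>
        (arcs Top Mid (mirror d') \<union> arcs Mid Bot (mirror d))\<^sup>*"
      by (simp only: lv_opp arcs_mirror Un_commute) (metis oo)
    also have "\<dots> \<longleftrightarrow> pairing (diagram_comp N (mirror d') (mirror d)) x = ?o y"
      by (rule pairing_comp_iff[symmetric]) (use assms in \<open>auto intro: pmatch_mirror\<close>)
    finally show ?thesis .
  qed
  then have "pairing (diagram_comp N (mirror d') (mirror d)) x = ?o (pairing (diagram_comp N d d') (?o x))"
    by blast
  then show ?thesis by (simp only: mirror_def[of "diagram_comp N d d'"] adiagram.sel)
qed

section \<open>Counting closed components\<close>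

definition orb :: "nat \<Rightarrow> ('l \<times> int) set \<Rightarrow> ('l \<times> int) set" where
  "orb N C = (\<Union>t. tr (t * int N) ` C)"

text \<open>One form for both loop numbers: \<open>b\<close> selects finite components (contractible
  loops) or infinite ones, and \<open>L\<close> may contain two middle levels at once, as needed
  when three diagrams are glued.\<close>

definition closed_orbits ::
  "bool \<Rightarrow> nat \<Rightarrow> 'l set \<Rightarrow> (('l \<times> int) \<times> ('l \<times> int)) set \<Rightarrow> ('l \<times> int) set set" where
  "closed_orbits b N L r =
     {orb N (r\<^sup>* `` {v}) | v. r\<^sup>* `` {v} \<subseteq> L \<times> UNIV \<and> (finite (r\<^sup>* `` {v}) \<longleftrightarrow> b)}"

lemma closed_orbitsI:
  "\<omega> = orb N (r\<^sup>* `` {v}) \<Longrightarrow> r\<^sup>* `` {v} \<subseteq> L \<times> UNIV \<Longrightarrow> (finite (r\<^sup>* `` {v}) \<longleftrightarrow> b) \<Longrightarrow>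
    \<omega> \<in> closed_orbits b N L r"
  unfolding closed_orbits_def by blast

lemma orb_iff: "x \<in> orb N C \<longleftrightarrow> (\<exists>t. tr (t * int N) x \<in> C)"
proof
  assume "x \<in> orb N C"
  then obtain t y where "y \<in> C" "x = tr (t * int N) y" by (auto simp: orb_def)
  then have "tr (- t * int N) x \<in> C" by simp
  then show "\<exists>t. tr (t * int N) x \<in> C" ..
next
  assume "\<exists>t. tr (t * int N) x \<in> C"
  then obtain t where "tr (t * int N) x \<in> C" ..
  moreover have "x = tr (- t * int N) (tr (t * int N) x)" by simp
  ultimately show "x \<in> orb N C" unfolding orb_def by blast
qed

lemma orb_self: "x \<in> C \<Longrightarrow> x \<in> orb N C"
  unfolding orb_iff by (rule exI[of _ 0]) simp

lemma loop_orbit_orb: "loop_orbit N = orb N"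
proof (rule ext, rule Set.set_eqI, rule iffI)
  fix C :: "(level \<times> int) set" and x :: "level \<times> int"
  assume "x \<in> loop_orbit N C"
  then obtain l i t where "x = tr (t * int N) (l, i)" "(l, i) \<in> C" by (auto simp: loop_orbit_def)
  then show "x \<in> orb N C" unfolding orb_def by blast
next
  fix C :: "(level \<times> int) set" and x :: "level \<times> int"
  assume "x \<in> orb N C"
  then obtain t y where "x = tr (t * int N) y" "y \<in> C" by (auto simp: orb_def)
  then show "x \<in> loop_orbit N C" by (cases y) (auto simp: loop_orbit_def)
qed

lemma loops_closed_orbits:
  "contractible_loops N d d' = card (closed_orbits True N {Mid} (arcs Top Mid d \<union> arcs Mid Bot d'))"
  "noncontractible_loops N d d' = card (closed_orbits False N {Mid} (arcs Top Mid d \<union> arcs Mid Bot d'))"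
  unfolding contractible_loops_def noncontractible_loops_def inner_components_def closed_orbits_def
    glued_arcs loop_orbit_orb quotient_def
  by (rule arg_cong[of _ _ card]; auto)+

lemma card_closed_orbits_relabel:
  assumes ijk: "i \<noteq> j" "j \<noteq> k" "i \<noteq> k"
  shows "card (closed_orbits b N {j} (arcs i j d \<union> arcs j k d')) =
    card (closed_orbits b N {Mid} (arcs Top Mid d \<union> arcs Mid Bot d'))"
proof -
  let ?h = "relabel i j k"
  let ?r = "arcs Top Mid d \<union> arcs Mid Bot d'" and ?s = "arcs i j d \<union> arcs j k d'"
  note inj = inj_relabel[OF ijk]
  have htr: "?h (tr t v) = tr t (?h v)" for t v by (cases v) (simp add: relabel_def)
  have cl: "?s\<^sup>* `` {?h v} = ?h ` (?r\<^sup>* `` {v})" for v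
    using rtrancl_image_inj[OF inj, of ?r v] by (simp only: relabel_arcs)
  have orb: "orb N (?h ` C) = ?h ` orb N C" for C
    by (simp add: orb_def image_UN image_image htr)
  have sub: "?h ` C \<subseteq> {j} \<times> UNIV \<longleftrightarrow> C \<subseteq> {Mid} \<times> UNIV" for C
  proof -
    have "?h v \<in> {j} \<times> UNIV \<longleftrightarrow> v \<in> {Mid} \<times> UNIV" for v
      using ijk by (cases v) (auto simp: relabel_def split: level.splits)
    then show ?thesis by blast
  qed
  have fin: "finite (?h ` C) \<longleftrightarrow> finite C" for C
    using inj by (meson finite_image_iff inj_on_subset subset_UNIV)
  have "closed_orbits b N {j} ?s = (\<lambda>C. ?h ` C) ` closed_orbits b N {Mid} ?r" (is "?A = ?B")
  proof
    show "?A \<subseteq> ?B"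
    proof
      fix X assume "X \<in> ?A"
      then obtain v where v: "X = orb N (?s\<^sup>* `` {v})" "?s\<^sup>* `` {v} \<subseteq> {j} \<times> UNIV"
        "finite (?s\<^sup>* `` {v}) \<longleftrightarrow> b" by (auto simp: closed_orbits_def)
      have "v \<in> ?s\<^sup>* `` {v}" by simp
      then have "fst v = j" using v(2) by (metis mem_Times_iff singletonD subsetD)
      then have "v = ?h (Mid, snd v)" by (simp add: relabel_def prod_eq_iff)
      then obtain w where w: "v = ?h w" ..
      have "X = ?h ` orb N (?r\<^sup>* `` {w})" using v(1) by (simp only: w cl orb)
      moreover have "?r\<^sup>* `` {w} \<subseteq> {Mid} \<times> UNIV" using v(2) by (simp only: w cl sub)
      moreover have "finite (?r\<^sup>* `` {w}) \<longleftrightarrow> b" using v(3) by (simp only: w cl fin)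
      ultimately show "X \<in> ?B" unfolding closed_orbits_def by blast
    qed
    show "?B \<subseteq> ?A"
    proof
      fix X assume "X \<in> ?B"
      then obtain v where v: "X = ?h ` orb N (?r\<^sup>* `` {v})" "?r\<^sup>* `` {v} \<subseteq> {Mid} \<times> UNIV"
        "finite (?r\<^sup>* `` {v}) \<longleftrightarrow> b" by (auto simp: closed_orbits_def)
      have "X = orb N (?s\<^sup>* `` {?h v})" by (simp only: v(1) cl orb)
      moreover have "?s\<^sup>* `` {?h v} \<subseteq> {j} \<times> UNIV" by (simp only: cl sub v(2))
      moreover have "finite (?s\<^sup>* `` {?h v}) \<longleftrightarrow> b" by (simp only: cl fin v(3))
      ultimately show "X \<in> ?A" unfolding closed_orbits_def by blast
    qed
  qed
  moreover have "inj_on (\<lambda>C. ?h ` C) A" for A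
    by (rule inj_onI) (simp add: inj inj_image_eq_iff)
  ultimately show ?thesis by (simp add: card_image)
qed

lemma orb_class_eq:
  assumes "sym r" "shift_inv N r" "p \<in> orb N (r\<^sup>* `` {v})"
  shows "orb N (r\<^sup>* `` {v}) = orb N (r\<^sup>* `` {p})"
proof -
  obtain t where t: "(v, tr (t * int N) p) \<in> r\<^sup>*" using assms(3) by (auto simp: orb_iff)
  have shift: "(tr (s * int N) x, tr (s * int N) y) \<in> r\<^sup>*" if "(x, y) \<in> r\<^sup>*" for x y s
    using shift_inv_rtrancl[OF assms(2)] that unfolding shift_inv_def by blast
  have sym: "sym (r\<^sup>*)" using assms(1) by (rule sym_rtrancl)
  have "(\<exists>s. (v, tr (s * int N) x) \<in> r\<^sup>*) \<longleftrightarrow> (\<exists>s. (p, tr (s * int N) x) \<in> r\<^sup>*)" for x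
  proof
    assume "\<exists>s. (v, tr (s * int N) x) \<in> r\<^sup>*"
    then obtain s where "(v, tr (s * int N) x) \<in> r\<^sup>*" ..
    then have "(tr (t * int N) p, tr (s * int N) x) \<in> r\<^sup>*"
      using t sym by (meson rtrancl_trans symD)
    from shift[OF this, of "- t"] have "(p, tr ((s - t) * int N) x) \<in> r\<^sup>*" by (simp add: algebra_simps)
    then show "\<exists>s. (p, tr (s * int N) x) \<in> r\<^sup>*" ..
  next
    assume "\<exists>s. (p, tr (s * int N) x) \<in> r\<^sup>*"
    then obtain s where "(p, tr (s * int N) x) \<in> r\<^sup>*" ..
    from shift[OF this, of t] t have "(v, tr ((s + t) * int N) x) \<in> r\<^sup>*"
      by (simp add: algebra_simps)
    then show "\<exists>s. (v, tr (s * int N) x) \<in> r\<^sup>*" ..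
  qed
  then show ?thesis unfolding set_eq_iff orb_iff Image_singleton_iff by blast
qed

text \<open>
  Vertices on the levels in \<open>M\<close> are eliminated: the relation \<open>e\<close> on \<open>K\<close> records which
  vertices are joined by paths of \<open>r\<close> through \<open>M\<close>.
\<close>

locale contraction =
  fixes r c e :: "('l \<times> int) rel" and K M :: "('l \<times> int) set"
  assumes r: "r \<subseteq> (K \<union> M) \<times> (K \<union> M)" and e_sub: "e \<subseteq> K \<times> K" and disj: "K \<inter> M = {}"
    and e: "\<And>x y. x \<in> K \<Longrightarrow> y \<in> K \<Longrightarrow> (x, y) \<in> r\<^sup>* \<longleftrightarrow> x = y \<or> (x, y) \<in> e"
    and c: "\<And>x y. (x, y) \<in> c \<Longrightarrow> x \<notin> M \<and> y \<notin> M"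
begin

text \<open>The vertex \<open>z\<close> splits the path into a part already rewritten with
  \<open>e\<close> and a tail of \<open>r\<close> edges. An edge of \<open>c\<close> never starts
  inside \<open>M\<close>; so when one occurs, the tail ends outside \<open>M\<close> and can be
  rewritten too.\<close>

lemma last_exit:
  assumes "(v, w) \<in> (r \<union> c)\<^sup>*" "v \<notin> M"
  shows "\<exists>z. z \<notin> M \<and> (v, z) \<in> (e \<union> c)\<^sup>* \<and> (z, w) \<in> r\<^sup>* \<and> (z = w \<or> z \<in> K)"
proof -
  have reach: "(v, y) \<in> (e \<union> c)\<^sup>*"
    if "z \<notin> M" "(v, z) \<in> (e \<union> c)\<^sup>*" "(z, y) \<in> r\<^sup>*" "z = y \<or> z \<in> K" "y \<notin> M" for y z
  proof (cases "z = y")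
    case False
    then have "z \<in> K" using that by simp
    have "y \<in> K \<union> M"
      using that(3) False r by (metis (no_types, lifting) SigmaD2 rtranclE subsetD)
    then have "y \<in> K" using that by simp
    then have "(z, y) \<in> e" using e[OF \<open>z \<in> K\<close>] that False by blast
    then show ?thesis using that(2) by (meson UnI1 rtrancl.rtrancl_into_rtrancl)
  qed (use that in simp)
  from assms show ?thesis
  proof (induction rule: rtrancl_induct)
    case base then show ?case by blast
  next
    case (step y w)
    then obtain z where z: "z \<notin> M" "(v, z) \<in> (e \<union> c)\<^sup>*" "(z, y) \<in> r\<^sup>*" "z = y \<or> z \<in> K" by blast
    from step(2) show ?case
    proof
      assume "(y, w) \<in> r"
      then have "z \<in> K" using z r by blast
      then show ?thesis using z \<open>(y, w) \<in> r\<close> by (meson rtrancl.rtrancl_into_rtrancl)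
    next
      assume yw: "(y, w) \<in> c"
      then have "(v, y) \<in> (e \<union> c)\<^sup>*" using reach z c by blast
      then have "(v, w) \<in> (e \<union> c)\<^sup>*" using yw by (meson UnI2 rtrancl.rtrancl_into_rtrancl)
      then show ?thesis using yw c by blast
    qed
  qed
qed

lemma path_iff:
  assumes "v \<notin> M" "w \<notin> M"
  shows "(v, w) \<in> (r \<union> c)\<^sup>* \<longleftrightarrow> (v, w) \<in> (e \<union> c)\<^sup>*"
proof
  assume "(v, w) \<in> (r \<union> c)\<^sup>*"
  then obtain z where z: "z \<notin> M" "(v, z) \<in> (e \<union> c)\<^sup>*" "(z, w) \<in> r\<^sup>*" "z = w \<or> z \<in> K"
    using last_exit assms by blast
  show "(v, w) \<in> (e \<union> c)\<^sup>*"
  proof (cases "z = w")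
    case False
    have "w \<in> K \<union> M"
      using z(3) False r by (metis (no_types, lifting) SigmaD2 rtranclE subsetD)
    then have "(z, w) \<in> e" using e[of z w] z assms False by blast
    then show ?thesis using z(2) by (meson UnI1 rtrancl.rtrancl_into_rtrancl)
  qed (use z in simp)
next
  have "e \<subseteq> r\<^sup>*" using e e_sub by auto
  moreover have "r\<^sup>* \<subseteq> (r \<union> c)\<^sup>*" by (rule rtrancl_mono) simp
  ultimately have "e \<union> c \<subseteq> (r \<union> c)\<^sup>*" by auto
  then show "(v, w) \<in> (e \<union> c)\<^sup>* \<Longrightarrow> (v, w) \<in> (r \<union> c)\<^sup>*"
    using rtrancl_subset_rtrancl by blast
qed

lemma avoid: "(v, w) \<in> (e \<union> c)\<^sup>* \<Longrightarrow> v \<notin> M \<Longrightarrow> w \<notin> M"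
  by (induction rule: rtrancl_induct) (use c e_sub disj in auto)

lemma class_eq:
  assumes "v \<notin> M" shows "(e \<union> c)\<^sup>* `` {v} = (r \<union> c)\<^sup>* `` {v} - M"
  using path_iff[OF assms] avoid[OF _ assms] by blast

lemma class_inside:
  assumes "r\<^sup>* `` {v} \<subseteq> M" shows "(r \<union> c)\<^sup>* `` {v} = r\<^sup>* `` {v}"
proof
  show "(r \<union> c)\<^sup>* `` {v} \<subseteq> r\<^sup>* `` {v}"
  proof
    fix w assume "w \<in> (r \<union> c)\<^sup>* `` {v}"
    then have "(v, w) \<in> (r \<union> c)\<^sup>*" by simp
    then show "w \<in> r\<^sup>* `` {v}"
    proof induction
      case (step y z)
      then have "y \<in> M" using assms by blast
      then have "(y, z) \<in> r" using step c by blast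
      then show ?case using step by (simp add: rtrancl.rtrancl_into_rtrancl)
    qed simp
  qed
  show "r\<^sup>* `` {v} \<subseteq> (r \<union> c)\<^sup>* `` {v}"
    using rtrancl_mono[of r "r \<union> c"] by blast
qed

text \<open>Contraction could hide an infinite component only in an infinite piece of
  \<open>M\<close>; each piece hangs on a vertex of \<open>K\<close> and lies in the finite
  \<open>r\<close>-component of that vertex.\<close>

lemma class_finite:
  assumes "v \<notin> M" and fin: "\<And>x. x \<in> K \<Longrightarrow> finite (r\<^sup>* `` {x})"
  shows "finite ((r \<union> c)\<^sup>* `` {v}) \<longleftrightarrow> finite ((e \<union> c)\<^sup>* `` {v})"
proof
  assume "finite ((r \<union> c)\<^sup>* `` {v})"
  then show "finite ((e \<union> c)\<^sup>* `` {v})" unfolding class_eq[OF assms(1)] by simp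
next
  assume *: "finite ((e \<union> c)\<^sup>* `` {v})"
  have "(r \<union> c)\<^sup>* `` {v} \<subseteq> (\<Union>z \<in> (e \<union> c)\<^sup>* `` {v}. if z \<in> K then r\<^sup>* `` {z} else {z})"
  proof
    fix w assume "w \<in> (r \<union> c)\<^sup>* `` {v}"
    then obtain z where "(v, z) \<in> (e \<union> c)\<^sup>*" "(z, w) \<in> r\<^sup>*" "z = w \<or> z \<in> K"
      using last_exit assms by blast
    then show "w \<in> (\<Union>z \<in> (e \<union> c)\<^sup>* `` {v}. if z \<in> K then r\<^sup>* `` {z} else {z})"
      by (intro UN_I[of z]) auto
  qed
  moreover have "finite (\<Union>z \<in> (e \<union> c)\<^sup>* `` {v}. if z \<in> K then r\<^sup>* `` {z} else {z})"
    using * fin by auto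
  ultimately show "finite ((r \<union> c)\<^sup>* `` {v})" by (rule finite_subset)
qed

text \<open>A closed orbit of the full graph either stays on the eliminated level \<open>a\<close>,
  and is then a closed orbit of \<open>r\<close> alone, or it meets level \<open>b\<close>, and its
  trace there is a closed orbit of the contracted graph. This is the geometric content of the
  cocycle property.\<close>

lemma card_closed_orbits:
  assumes N: "N > 0" and M: "M = {a} \<times> UNIV" and b: "{b} \<times> UNIV \<subseteq> K"
    and sym: "sym r" "sym c" "sym e" and shift: "shift_inv N r" "shift_inv N c" "shift_inv N e"
    and fin: "\<And>x. x \<in> K \<Longrightarrow> finite (r\<^sup>* `` {x})"
  shows "card (closed_orbits \<beta> N {a, b} (r \<union> c)) =
    card (closed_orbits \<beta> N {a} r) + card (closed_orbits \<beta> N {b} (e \<union> c))"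
proof -
  let ?X = "(r \<union> c)\<^sup>*" and ?Y = "(e \<union> c)\<^sup>*" and ?W = "closed_orbits \<beta> N {a, b} (r \<union> c)"
  let ?B = "{b} \<times> (UNIV :: int set)"
  have ab: "a \<noteq> b" using b disj M by auto
  have symX: "sym ?X" by (intro sym_rtrancl sym_Un sym)
  have oX: "orb N (?X `` {v}) = orb N (?X `` {p})" if "p \<in> orb N (?X `` {v})" for v p
    by (rule orb_class_eq[OF _ _ that]) (intro sym_Un sym shift_inv_Un shift)+
  have subX: "(?X `` {v} \<subseteq> {a, b} \<times> UNIV) = (?Y `` {v} \<subseteq> ?B)"
    and capX: "?X `` {v} \<subseteq> {a, b} \<times> UNIV \<Longrightarrow> ?X `` {v} \<inter> ?B = ?Y `` {v}" if "v \<notin> M" for v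
    unfolding class_eq[OF that] using M ab by auto
  have orbcap: "orb N C \<inter> ?B = orb N (C \<inter> ?B)" for C
    by (auto simp: orb_iff)
  have W: "?W = {\<omega> \<in> ?W. \<omega> \<subseteq> M} \<union> {\<omega> \<in> ?W. \<not> \<omega> \<subseteq> M}" by blast
  \<comment> \<open>Cardinalities add up only for finite sets; every orbit has a representative at a
    position in \<open>0..<N\<close>.\<close>
  have finW: "finite ?W"
  proof -
    have "?W \<subseteq> (\<lambda>p. orb N (?X `` {p})) ` ({a, b} \<times> {0..<int N})"
    proof
      fix \<omega> assume "\<omega> \<in> ?W"
      then obtain v where v: "\<omega> = orb N (?X `` {v})" "?X `` {v} \<subseteq> {a, b} \<times> UNIV"
        by (auto simp: closed_orbits_def)
      let ?p = "(fst v, snd v mod int N)"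
      have "tr ((snd v div int N) * int N) ?p = v" by (simp add: prod_eq_iff)
      then have "?p \<in> orb N (?X `` {v})" unfolding orb_iff by (metis Image_singleton_iff rtrancl.rtrancl_refl)
      then have "\<omega> = orb N (?X `` {?p})" using oX v(1) by blast
      moreover have "?p \<in> {a, b} \<times> {0..<int N}"
      proof -
        have "v \<in> {a, b} \<times> UNIV" using v(2) by blast
        then show ?thesis using N by (cases v) auto
      qed
      ultimately show "\<omega> \<in> (\<lambda>p. orb N (?X `` {p})) ` ({a, b} \<times> {0..<int N})" by blast
    qed
    then show ?thesis by (rule finite_subset) auto
  qed
  have 1: "{\<omega> \<in> ?W. \<omega> \<subseteq> M} = closed_orbits \<beta> N {a} r"
  proof (intro Set.set_eqI iffI)
    fix \<omega> assume "\<omega> \<in> {\<omega> \<in> ?W. \<omega> \<subseteq> M}"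
    then obtain v where v: "\<omega> = orb N (?X `` {v})" "finite (?X `` {v}) \<longleftrightarrow> \<beta>" "\<omega> \<subseteq> M"
      by (auto simp: closed_orbits_def)
    then have "?X `` {v} \<subseteq> M" using orb_self by blast
    moreover have "r\<^sup>* `` {v} \<subseteq> ?X `` {v}" using rtrancl_mono[of r "r \<union> c"] by blast
    ultimately have sub: "r\<^sup>* `` {v} \<subseteq> M" by blast
    then have "?X `` {v} = r\<^sup>* `` {v}" by (rule class_inside)
    then show "\<omega> \<in> closed_orbits \<beta> N {a} r" using v sub M by (intro closed_orbitsI[of _ _ _ v]) simp_all
  next
    fix \<omega> assume "\<omega> \<in> closed_orbits \<beta> N {a} r"
    then obtain v where v: "\<omega> = orb N (r\<^sup>* `` {v})" "finite (r\<^sup>* `` {v}) \<longleftrightarrow> \<beta>" "r\<^sup>* `` {v} \<subseteq> M"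
      by (auto simp: closed_orbits_def M)
    then have eq: "?X `` {v} = r\<^sup>* `` {v}" by (intro class_inside)
    have "\<omega> \<subseteq> M" using v(1,3) by (auto simp: M orb_iff)
    moreover have "M \<subseteq> {a, b} \<times> UNIV" using M by auto
    ultimately have "r\<^sup>* `` {v} \<subseteq> {a, b} \<times> UNIV" using v(3) by (meson subset_trans)
    then have "\<omega> \<in> ?W" using v(1,2) by (intro closed_orbitsI[of _ _ _ v]) (simp_all only: eq)
    then show "\<omega> \<in> {\<omega> \<in> ?W. \<omega> \<subseteq> M}" using \<open>\<omega> \<subseteq> M\<close> by simp
  qed
  let ?W2 = "{\<omega> \<in> ?W. \<not> \<omega> \<subseteq> M}"
  have rep: "\<exists>v. v \<in> ?B \<and> v \<notin> M \<and> \<omega> = orb N (?X `` {v}) \<and> ?X `` {v} \<subseteq> {a, b} \<times> UNIV \<and> (finite (?X `` {v}) \<longleftrightarrow> \<beta>)"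
    if w: "\<omega> \<in> ?W2" for \<omega>
  proof -
    obtain u where u: "\<omega> = orb N (?X `` {u})" "?X `` {u} \<subseteq> {a, b} \<times> UNIV"
      "finite (?X `` {u}) \<longleftrightarrow> \<beta>" using w by (auto simp: closed_orbits_def)
    obtain p where "p \<in> \<omega>" "p \<notin> M" using w by blast
    then obtain t where t: "tr (t * int N) p \<in> ?X `` {u}" using u by (auto simp: orb_iff)
    define v where "v = tr (t * int N) p"
    have uv: "(u, v) \<in> ?X" using t v_def by simp
    have vM: "v \<notin> M" using \<open>p \<notin> M\<close> M unfolding v_def by (cases p) auto
    have vB: "v \<in> ?B" using u(2) uv vM M by auto
    have vu: "(v, u) \<in> ?X" using symX uv by (rule symD)
    have "?X `` {u} = ?X `` {v}"
    proof (rule Set.set_eqI)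
      fix x
      show "x \<in> ?X `` {u} \<longleftrightarrow> x \<in> ?X `` {v}"
        using rtrancl_trans[OF vu, of x] rtrancl_trans[OF uv, of x] by blast
    qed
    then show ?thesis using u vM vB by auto
  qed
  have img: "(\<lambda>\<omega>. \<omega> \<inter> ?B) ` ?W2 = closed_orbits \<beta> N {b} (e \<union> c)"
  proof (intro Set.set_eqI iffI)
    fix \<psi> assume "\<psi> \<in> (\<lambda>\<omega>. \<omega> \<inter> ?B) ` ?W2"
    then obtain \<omega> where "\<omega> \<in> ?W2" "\<psi> = \<omega> \<inter> ?B" by auto
    then obtain v where v: "v \<notin> M" "\<psi> = orb N (?X `` {v}) \<inter> ?B" "?X `` {v} \<subseteq> {a, b} \<times> UNIV"
      "finite (?X `` {v}) \<longleftrightarrow> \<beta>" using rep by blast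
    have "\<psi> = orb N (?Y `` {v})" using v(2) capX[OF v(1) v(3)] orbcap by simp
    moreover have "?Y `` {v} \<subseteq> ?B" using v(3) subX[OF v(1)] by simp
    moreover have "finite (?Y `` {v}) \<longleftrightarrow> \<beta>" using v(4) class_finite[OF v(1) fin] by blast
    ultimately show "\<psi> \<in> closed_orbits \<beta> N {b} (e \<union> c)" unfolding closed_orbits_def by blast
  next
    fix \<psi> assume "\<psi> \<in> closed_orbits \<beta> N {b} (e \<union> c)"
    then obtain v where v: "\<psi> = orb N (?Y `` {v})" "?Y `` {v} \<subseteq> ?B" "finite (?Y `` {v}) \<longleftrightarrow> \<beta>"
      by (auto simp: closed_orbits_def)
    have "v \<in> ?B" using v(2) by blast
    then have vM: "v \<notin> M" using M ab by auto
    have sub: "?X `` {v} \<subseteq> {a, b} \<times> UNIV" using subX[OF vM] v by simp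
    have "orb N (?X `` {v}) \<in> ?W"
      unfolding closed_orbits_def using sub v(3) class_finite[OF vM fin] by blast
    moreover have "v \<in> orb N (?X `` {v})" by (simp add: orb_self)
    ultimately have "orb N (?X `` {v}) \<in> ?W2" using vM by blast
    moreover have "\<psi> = orb N (?X `` {v}) \<inter> ?B" using v(1) capX[OF vM sub] orbcap by simp
    ultimately show "\<psi> \<in> (\<lambda>\<omega>. \<omega> \<inter> ?B) ` ?W2" by blast
  qed
  \<comment> \<open>An orbit is determined by any one of its points, in particular by one on level
    \<open>b\<close>.\<close>
  have "inj_on (\<lambda>\<omega>. \<omega> \<inter> ?B) ?W2"
  proof (rule inj_onI)
    fix \<omega> \<omega>' assume w: "\<omega> \<in> ?W2" "\<omega>' \<in> ?W2" and eq: "\<omega> \<inter> ?B = \<omega>' \<inter> ?B"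
    obtain v where v: "v \<in> ?B" "\<omega> = orb N (?X `` {v})" using rep[OF w(1)] by blast
    obtain v' where v': "\<omega>' = orb N (?X `` {v'})" using rep[OF w(2)] by blast
    have "v \<in> \<omega>" using v by (simp add: orb_self)
    then have "v \<in> \<omega>'" using eq v by blast
    then show "\<omega> = \<omega>'" using oX[of v v'] v v' by simp
  qed
  from card_image[OF this] have 2: "card ?W2 = card (closed_orbits \<beta> N {b} (e \<union> c))"
    unfolding img by (rule HOL.sym)
  have "card ?W = card {\<omega> \<in> ?W. \<omega> \<subseteq> M} + card ?W2"
  proof -
    have "card ({\<omega> \<in> ?W. \<omega> \<subseteq> M} \<union> ?W2) = card {\<omega> \<in> ?W. \<omega> \<subseteq> M} + card ?W2"
      by (rule card_Un_disjoint) (use finW in auto)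
    then show ?thesis unfolding W[symmetric] .
  qed
  then show ?thesis unfolding 1 2 .
qed

end

lemma lv_range: "x \<in> {i, k} \<times> UNIV \<Longrightarrow> \<exists>p. x = lv i k p"
  by (rule exI[of _ "(if fst x = i then Outer else Inner, snd x)"]) (auto simp: lv_def prod_eq_iff)

section \<open>Associativity\<close>

text \<open>By \<open>pairing_comp_iff\<close>, the arcs of the product are precisely the edges that
  replace the paths through level \<open>j\<close>.\<close>

lemma contraction_arcs:
  fixes i j k :: 'l
  assumes "N > 0" and d: "pmatch N d" "pmatch N d'" and ijk: "i \<noteq> j" "j \<noteq> k" "i \<noteq> k"
    and c: "\<And>x y. (x, y) \<in> c \<Longrightarrow> fst x \<noteq> j \<and> fst y \<noteq> j"
  shows "contraction (arcs i j d \<union> arcs j k d') c (arcs i k (diagram_comp N d d'))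
    ({i, k} \<times> UNIV) ({j} \<times> UNIV)"
proof
  note sub = arcs_level
  show "arcs i j d \<union> arcs j k d' \<subseteq> ({i, k} \<times> UNIV \<union> {j} \<times> UNIV) \<times> ({i, k} \<times> UNIV \<union> {j} \<times> UNIV)"
    by (auto dest!: sub)
  show "arcs i k (diagram_comp N d d') \<subseteq> ({i, k} \<times> UNIV) \<times> {i, k} \<times> UNIV"
    by (auto dest!: sub)
  show "({i, k} \<times> UNIV) \<inter> ({j} \<times> UNIV) = {}" using ijk by auto
  show "x \<notin> {j} \<times> UNIV \<and> y \<notin> {j} \<times> UNIV" if "(x, y) \<in> c" for x y
    using c[OF that] by (auto simp: mem_Times_iff)
  fix x y :: "'l \<times> int" assume "x \<in> {i, k} \<times> UNIV" "y \<in> {i, k} \<times> UNIV"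
  then obtain p q where p: "x = lv i k p" "y = lv i k q"
    using lv_range[of x i k] lv_range[of y i k] by blast
  have "(lv i k p, lv i k q) \<in> arcs i k (diagram_comp N d d') \<longleftrightarrow> pairing (diagram_comp N d d') p = q"
    using ijk by (auto simp: arcs_def lv_inj)
  also have "\<dots> \<longleftrightarrow> q \<noteq> p \<and> (lv i k p, lv i k q) \<in> (arcs i j d \<union> arcs j k d')\<^sup>*"
    by (rule pairing_comp_iff[OF assms(1) d ijk])
  finally show "(x, y) \<in> (arcs i j d \<union> arcs j k d')\<^sup>* \<longleftrightarrow> x = y \<or> (x, y) \<in> arcs i k (diagram_comp N d d')"
    unfolding p lv_inj[OF ijk(3)] by auto
qed

text \<open>The first summand counts the loops closed when \<open>d\<close> meets \<open>d'\<close>,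
  the second those closed when their product meets the remaining layer \<open>c\<close>;
  \<open>l\<close> is the level on which this second gluing takes place.\<close>

lemma card_closed_orbits_comp:
  assumes N: "N > 0" and d: "pmatch N d" "pmatch N d'" and ijk: "i \<noteq> j" "j \<noteq> k" "i \<noteq> k"
    and cc: "\<And>x y. (x, y) \<in> c \<Longrightarrow> fst x \<noteq> j \<and> fst y \<noteq> j" "sym c" "shift_inv N c"
    and l: "l = i \<or> l = k"
  shows "card (closed_orbits b N {j, l} (arcs i j d \<union> arcs j k d' \<union> c)) =
    card (closed_orbits b N {Mid} (arcs Top Mid d \<union> arcs Mid Bot d')) +
    card (closed_orbits b N {l} (arcs i k (diagram_comp N d d') \<union> c))"
proof -
  interpret contraction "arcs i j d \<union> arcs j k d'" c "arcs i k (diagram_comp N d d')"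
    "{i, k} \<times> UNIV" "{j} \<times> UNIV"
    by (rule contraction_arcs[OF N d ijk cc(1)])
  note dd = pmatch_comp[OF N d]
  have fin: "finite ((arcs i j d \<union> arcs j k d')\<^sup>* `` {x})" if "x \<in> {i, k} \<times> UNIV" for x
  proof -
    obtain p where "x = lv i k p" using lv_range[OF \<open>x \<in> {i, k} \<times> UNIV\<close>] ..
    then show ?thesis using path_end(1)[OF N d ijk refl] by simp
  qed
  show ?thesis
    unfolding card_closed_orbits_relabel[OF ijk, symmetric]
    by (rule card_closed_orbits[OF N refl _ sym_Un_arcs[OF d] cc(2) sym_arcs[OF dd] _ cc(3) shift_inv_arcs[OF dd] fin])
      (use l d in \<open>auto intro: shift_inv_Un shift_inv_arcs\<close>)
qed

context
  fixes N d1 d2 d3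
  assumes N: "N > 0" and d: "pmatch N d1" "pmatch N d2" "pmatch N d3"
begin

lemma comp_assoc_pairing:
  "pairing (diagram_comp N (diagram_comp N d1 d2) d3) x = pairing (diagram_comp N d1 (diagram_comp N d2 d3)) x"
proof -
  \<comment> \<open>The three layers occupy levels 0 to 3. Eliminating level 1 yields the left
    bracketing, eliminating level 2 the right one.\<close>
  let ?l = "lv (0 :: nat) 3"
  let ?G = "arcs 0 1 d1 \<union> arcs 1 2 d2 \<union> arcs 2 3 d3"
  note dd = pmatch_comp[OF N d(1,2)] pmatch_comp[OF N d(2,3)]
  have lev: "?l x \<notin> {1} \<times> UNIV" "?l x \<notin> {2} \<times> UNIV" for x
    by (cases x; cases "fst x"; simp add: lv_def)+
  have c1: "fst x \<noteq> 1 \<and> fst y \<noteq> 1" if "(x, y) \<in> arcs 2 (3 :: nat) d3" for x y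
    using arcs_level[OF that] by auto
  have c2: "fst x \<noteq> 2 \<and> fst y \<noteq> 2" if "(x, y) \<in> arcs 0 (1 :: nat) d1" for x y
    using arcs_level[OF that] by auto
  interpret L: contraction "arcs 0 1 d1 \<union> arcs 1 2 d2" "arcs 2 (3 :: nat) d3"
    "arcs 0 2 (diagram_comp N d1 d2)" "{0, 2} \<times> UNIV" "{1} \<times> UNIV"
    by (rule contraction_arcs[OF N d(1,2) _ _ _ c1]) auto
  interpret R: contraction "arcs 1 2 d2 \<union> arcs 2 3 d3" "arcs 0 (1 :: nat) d1"
    "arcs 1 3 (diagram_comp N d2 d3)" "{1, 3} \<times> UNIV" "{2} \<times> UNIV"
    by (rule contraction_arcs[OF N d(2,3) _ _ _ c2]) auto
  have "pairing (diagram_comp N (diagram_comp N d1 d2) d3) x = y \<longleftrightarrow>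
     pairing (diagram_comp N d1 (diagram_comp N d2 d3)) x = y" for y
  proof -
    have "pairing (diagram_comp N (diagram_comp N d1 d2) d3) x = y \<longleftrightarrow>
      y \<noteq> x \<and> (?l x, ?l y) \<in> (arcs 0 2 (diagram_comp N d1 d2) \<union> arcs 2 3 d3)\<^sup>*"
      by (rule pairing_comp_iff[OF N dd(1) d(3)]) auto
    also have "\<dots> \<longleftrightarrow> y \<noteq> x \<and> (?l x, ?l y) \<in> ?G\<^sup>*"
      using L.path_iff[OF lev(1) lev(1)] by simp
    also have "?G = arcs 1 2 d2 \<union> arcs 2 3 d3 \<union> arcs 0 1 d1" by blast
    also have "y \<noteq> x \<and> (?l x, ?l y) \<in> \<dots>\<^sup>* \<longleftrightarrow>
      y \<noteq> x \<and> (?l x, ?l y) \<in> (arcs 0 1 d1 \<union> arcs 1 3 (diagram_comp N d2 d3))\<^sup>*"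
      using R.path_iff[OF lev(2) lev(2)] by (simp add: Un_commute)
    also have "\<dots> \<longleftrightarrow> pairing (diagram_comp N d1 (diagram_comp N d2 d3)) x = y"
      by (rule pairing_comp_iff[OF N d(1) dd(2), symmetric]) auto
    finally show ?thesis .
  qed
  then show ?thesis by simp
qed

text \<open>Each side counts the closed orbits of the same four-level graph that are confined to
  levels 1 and 2: the finite ones in the first claim, the infinite ones in the second.\<close>

lemma comp_assoc_loops:
  shows "contractible_loops N d1 d2 + contractible_loops N (diagram_comp N d1 d2) d3 =
      contractible_loops N d2 d3 + contractible_loops N d1 (diagram_comp N d2 d3)"
    and "noncontractible_loops N d1 d2 + noncontractible_loops N (diagram_comp N d1 d2) d3 =
      noncontractible_loops N d2 d3 + noncontractible_loops N d1 (diagram_comp N d2 d3)"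
proof -
  note dd = pmatch_comp[OF N d(1,2)] pmatch_comp[OF N d(2,3)]
  have c1: "fst x \<noteq> 1 \<and> fst y \<noteq> 1" if "(x, y) \<in> arcs 2 (3 :: nat) d3" for x y
    using arcs_level[OF that] by auto
  have c2: "fst x \<noteq> 2 \<and> fst y \<noteq> 2" if "(x, y) \<in> arcs 0 (1 :: nat) d1" for x y
    using arcs_level[OF that] by auto
  have L: "card (closed_orbits b N {1, 2} (arcs 0 1 d1 \<union> arcs 1 2 d2 \<union> arcs 2 (3 :: nat) d3)) =
    card (closed_orbits b N {Mid} (arcs Top Mid d1 \<union> arcs Mid Bot d2)) +
    card (closed_orbits b N {2} (arcs 0 2 (diagram_comp N d1 d2) \<union> arcs 2 (3 :: nat) d3))" for b
    by (rule card_closed_orbits_comp[OF N d(1,2) _ _ _ c1 sym_arcs[OF d(3)] shift_inv_arcs[OF d(3)]]) auto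
  have R: "card (closed_orbits b N {2, 1} (arcs 1 2 d2 \<union> arcs 2 3 d3 \<union> arcs 0 (1 :: nat) d1)) =
    card (closed_orbits b N {Mid} (arcs Top Mid d2 \<union> arcs Mid Bot d3)) +
    card (closed_orbits b N {1} (arcs 1 3 (diagram_comp N d2 d3) \<union> arcs 0 (1 :: nat) d1))" for b
    by (rule card_closed_orbits_comp[OF N d(2,3) _ _ _ c2 sym_arcs[OF d(1)] shift_inv_arcs[OF d(1)]]) auto
  have "arcs 1 2 d2 \<union> arcs 2 3 d3 \<union> arcs 0 1 d1 = arcs 0 1 d1 \<union> arcs 1 2 d2 \<union> arcs 2 (3 :: nat) d3"
    "{2, 1} = {1, 2 :: nat}" by blast+
  note R' = R[unfolded this Un_commute[of "arcs 1 3 (diagram_comp N d2 d3)"]]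
  have rel: "card (closed_orbits b N {2} (arcs 0 2 (diagram_comp N d1 d2) \<union> arcs 2 (3 :: nat) d3)) =
      card (closed_orbits b N {Mid} (arcs Top Mid (diagram_comp N d1 d2) \<union> arcs Mid Bot d3))"
    "card (closed_orbits b N {1} (arcs 0 (1 :: nat) d1 \<union> arcs 1 3 (diagram_comp N d2 d3))) =
      card (closed_orbits b N {Mid} (arcs Top Mid d1 \<union> arcs Mid Bot (diagram_comp N d2 d3)))" for b
    by (rule card_closed_orbits_relabel; simp)+
  show "contractible_loops N d1 d2 + contractible_loops N (diagram_comp N d1 d2) d3 =
      contractible_loops N d2 d3 + contractible_loops N d1 (diagram_comp N d2 d3)"
    "noncontractible_loops N d1 d2 + noncontractible_loops N (diagram_comp N d1 d2) d3 =
      noncontractible_loops N d2 d3 + noncontractible_loops N d1 (diagram_comp N d2 d3)"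
    unfolding loops_closed_orbits
    using L[of True] R'[of True] rel[of True] L[of False] R'[of False] rel[of False] by linarith+
qed

lemma comp_assoc:
  "diagram_comp N (diagram_comp N d1 d2) d3 = diagram_comp N d1 (diagram_comp N d2 d3)"
proof (rule adiagram.expand)
  show "pairing (diagram_comp N (diagram_comp N d1 d2) d3) = pairing (diagram_comp N d1 (diagram_comp N d2 d3)) \<and>
    loops (diagram_comp N (diagram_comp N d1 d2) d3) = loops (diagram_comp N d1 (diagram_comp N d2 d3))"
    using comp_assoc_pairing comp_assoc_loops(2) by (auto simp: diagram_comp_def[of _ _ d3] diagram_comp_def[of _ d1])
qed

end

lemma mirror_loops:
  "contractible_loops N (mirror d') (mirror d) = contractible_loops N d d'"
  "noncontractible_loops N (mirror d') (mirror d) = noncontractible_loops N d d'"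
proof -
  have "card (closed_orbits b N {Mid} (arcs Top Mid (mirror d') \<union> arcs Mid Bot (mirror d))) =
    card (closed_orbits b N {Mid} (arcs Top Mid d \<union> arcs Mid Bot d'))" for b
    unfolding arcs_mirror
    by (subst Un_commute, rule card_closed_orbits_relabel) auto
  then show "contractible_loops N (mirror d') (mirror d) = contractible_loops N d d'"
    "noncontractible_loops N (mirror d') (mirror d) = noncontractible_loops N d d'"
    by (simp_all add: loops_closed_orbits)
qed

lemma comp_mirror:
  assumes "N > 0" "pmatch N d" "pmatch N d'"
  shows "diagram_comp N (mirror d') (mirror d) = mirror (diagram_comp N d d')"
proof (rule adiagram.expand)
  show "pairing (diagram_comp N (mirror d') (mirror d)) = pairing (mirror (diagram_comp N d d')) \<and>
    loops (diagram_comp N (mirror d') (mirror d)) = loops (mirror (diagram_comp N d d'))"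
    using comp_mirror_pairing[OF assms] mirror_loops(2)[of N d' d] by (auto simp: diagram_comp_def)
qed

section \<open>Left multiplication by the generators\<close>

text \<open>All powers of the translation: \<open>U 0\<close> is the identity, \<open>U 1\<close>
  the generator and \<open>U (- 1)\<close> its inverse.\<close>

definition U :: "int \<Rightarrow> adiagram" where
  "U c = ADiagram (\<lambda>(s, i). case s of Outer \<Rightarrow> (Inner, i - c) | Inner \<Rightarrow> (Outer, i + c)) 0"

text \<open>The index is an integer, so that conjugation by \<open>U c\<close> simply adds
  \<open>c\<close> to it, without reduction modulo \<open>N\<close>.\<close>

definition E :: "nat \<Rightarrow> int \<Rightarrow> adiagram" where
  "E N j = ADiagram (\<lambda>(s, i). if int N dvd i - j then (s, i + 1)
     else if int N dvd i - j - 1 then (s, i - 1) else (opp s, i)) 0"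

lemma id_diagram_U: "id_diagram = U 0"
  unfolding id_diagram_def U_def by (auto intro!: ext split: side.splits)

lemma u_diagram_U: "u_diagram = U 1"
  unfolding u_diagram_def U_def by (auto intro!: ext split: side.splits)

lemma e_diagram_E: "e_diagram N j = E N (int j)"
  unfolding e_diagram_def E_def dvd_eq_mod_eq_0 ..

lemma dvd_diffE:
  assumes "int N dvd i - j" obtains s where "i = j + s * int N"
proof -
  obtain k where "i - j = int N * k" using assms by (rule dvdE)
  then have "i = j + k * int N" by (simp add: algebra_simps)
  then show thesis by (rule that)
qed

lemma pairing_U [simp]: "pairing (U c) (Outer, i) = (Inner, i - c)" "pairing (U c) (Inner, i) = (Outer, i + c)"
  and loops_U [simp]: "loops (U c) = 0"
  by (simp_all add: U_def)

lemma loops_E [simp]: "loops (E N j) = 0"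
  by (simp add: E_def)

lemma pmatch_U: "pmatch N (U c)"
  unfolding pmatch_def tr_def by (auto simp: U_def split: side.splits)

lemma not_dvd_succ: "N \<ge> 2 \<Longrightarrow> int N dvd a \<Longrightarrow> \<not> int N dvd a + 1" "N \<ge> 2 \<Longrightarrow> int N dvd a \<Longrightarrow> \<not> int N dvd a - 1"
  by (auto simp: dvd_add_right_iff dvd_diff_right_iff)

text \<open>The involution (for \<open>N\<close> at least 2) that moves along the outer arcs of
  \<open>E N j\<close> and fixes all other points. Products with \<open>E N j\<close>, and the
  relations among them, become identities between this map and \<open>pairing d\<close>.\<close>

definition cupswap :: "nat \<Rightarrow> int \<Rightarrow> point \<Rightarrow> point" where
  "cupswap N j x = (if fst x = Inner then x
     else if int N dvd snd x - j then tr 1 x else if int N dvd snd x - j - 1 then tr (-1) x else x)"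

lemma cupswap_Inner [simp]: "cupswap N j (Inner, i) = (Inner, i)"
  by (simp add: cupswap_def)

lemma cupswap_ne: "cupswap N j x \<noteq> x \<longleftrightarrow> fst x = Outer \<and> (int N dvd snd x - j \<or> int N dvd snd x - j - 1)"
  by (cases x; cases "fst x") (auto simp: cupswap_def)

lemma cupswap_invol: assumes "N \<ge> 2" shows "cupswap N j (cupswap N j x) = x"
  using not_dvd_succ[OF assms, of "snd x - j"] not_dvd_succ[OF assms, of "snd x - j - 1"]
  by (cases x; cases "fst x") (auto simp: cupswap_def algebra_simps)

lemma cupswap_tr: "cupswap N j (tr (t * int N) x) = tr (t * int N) (cupswap N j x)"
proof -
  have "int N dvd snd x + t * int N - j \<longleftrightarrow> int N dvd snd x - j"
    "int N dvd snd x + t * int N - j - 1 \<longleftrightarrow> int N dvd snd x - j - 1"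
    by (metis add_diff_eq diff_add_eq dvd_add_times_triv_right_iff)+
  then show ?thesis by (cases x) (auto simp: cupswap_def algebra_simps)
qed

text \<open>The moved points form a single orbit under translations and \<open>cupswap\<close>. The
  arguments that a path does not meet an arc of \<open>E N j\<close> twice rest on this.\<close>

lemma cupswap_types:
  assumes "N \<ge> 2" "cupswap N j y \<noteq> y" "cupswap N j z \<noteq> z"
  shows "\<exists>t. z = tr (t * int N) y \<or> z = tr (t * int N) (cupswap N j y)"
proof -
  have main: "\<exists>t. z = tr (t * int N) w" if w: "fst z = fst w" "int N dvd snd z - snd w" for w :: point
  proof -
    obtain t where "snd z = snd w + t * int N" using w(2) by (rule dvd_diffE)
    then have "z = tr (t * int N) w" using w(1) by (simp add: tr_def prod_eq_iff)
    then show ?thesis ..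
  qed
  have y: "fst y = Outer" "int N dvd snd y - j \<or> int N dvd snd y - j - 1"
    and z: "fst z = Outer" "int N dvd snd z - j \<or> int N dvd snd z - j - 1"
    using assms(2,3) by (auto simp: cupswap_ne)
  have "int N dvd snd z - snd y \<or> int N dvd snd z - snd (cupswap N j y)"
  proof (cases "int N dvd snd y - j")
    case True
    then have c: "snd (cupswap N j y) = snd y + 1" using y by (simp add: cupswap_def)
    from z(2) show ?thesis
    proof
      assume "int N dvd snd z - j"
      from dvd_diff[OF this True] show ?thesis by simp
    next
      assume "int N dvd snd z - j - 1"
      from dvd_diff[OF this True] show ?thesis unfolding c by (simp add: algebra_simps)
    qed
  next
    case False
    then have y': "int N dvd snd y - j - 1" using y by simp
    have c: "snd (cupswap N j y) = snd y - 1" using y False by (simp add: cupswap_def)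
    from z(2) show ?thesis
    proof
      assume "int N dvd snd z - j"
      from dvd_diff[OF this y'] show ?thesis unfolding c by (simp add: algebra_simps)
    next
      assume "int N dvd snd z - j - 1"
      from dvd_diff[OF this y'] show ?thesis by simp
    qed
  qed
  moreover have "fst z = fst y" "fst z = fst (cupswap N j y)" using y z by (auto simp: cupswap_def)
  ultimately show ?thesis using main by blast
qed

lemma pairing_E_cup:
  assumes "cupswap N j (Outer, i) = (Outer, k)" "k \<noteq> i"
  shows "pairing (E N j) (s, i) = (s, k)"
  using assms by (auto simp: cupswap_def E_def split: if_splits)

lemma pairing_E_through:
  assumes "cupswap N j (Outer, i) = (Outer, i)"
  shows "pairing (E N j) (s, i) = (opp s, i)"
  using assms by (auto simp: cupswap_def E_def split: if_splits)

lemma cupswap_Outer: obtains k where "cupswap N j (Outer, i) = (Outer, k)"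
proof (rule that)
  show "cupswap N j (Outer, i) = (Outer, snd (cupswap N j (Outer, i)))" by (simp add: cupswap_def)
qed

lemma pmatch_E: assumes "N \<ge> 2" shows "pmatch N (E N j)"
proof -
  have P: "pairing (E N j) (s, i) =
    (if cupswap N j (Outer, i) = (Outer, i) then (opp s, i) else (s, snd (cupswap N j (Outer, i))))" for s i
    using pairing_E_cup[of N j i _ s] pairing_E_through[of N j i s] cupswap_Outer[of N j i] by (metis snd_conv)
  show ?thesis
    unfolding pmatch_def
  proof (intro conjI allI)
    fix x :: point
    obtain s i where x: "x = (s, i)" by (cases x)
    obtain k where k: "cupswap N j (Outer, i) = (Outer, k)" by (rule cupswap_Outer)
    then have "cupswap N j (Outer, k) = (Outer, i)" by (metis cupswap_invol assms)
    then show "pairing (E N j) (pairing (E N j) x) = x" by (auto simp: x P k)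
    show "pairing (E N j) x \<noteq> x" using k by (cases s) (auto simp: x P)
    show "pairing (E N j) (tr (int N) x) = tr (int N) (pairing (E N j) x)"
      using cupswap_tr[of N j 1 "(Outer, i)"] k by (auto simp: x P)
  qed
qed

section \<open>Left multiplication by rotations\<close>

lemma pairing_compI:
  assumes "N > 0" "pmatch N d" "pmatch N d'" "y \<noteq> x"
    "(lv Top Bot x, lv Top Bot y) \<in> (arcs Top Mid d \<union> arcs Mid Bot d')\<^sup>*"
  shows "pairing (diagram_comp N d d') x = y"
  using pairing_comp_iff[OF assms(1-3), of Top Mid Bot x y] assms(4,5) by simp

text \<open>Rotates the outer boundary and leaves the inner one alone; left multiplication by
  \<open>U c\<close> conjugates the pairing with this map.\<close>

definition sh :: "int \<Rightarrow> point \<Rightarrow> point" where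
  "sh c x = (if fst x = Outer then tr c x else x)"

lemma sh_simps [simp]: "sh c (Outer, i) = (Outer, i + c)" "sh c (Inner, i) = (Inner, i)" "fst (sh c x) = fst x"
  by (simp_all add: sh_def)

lemma sh_sh [simp]: "sh c (sh c' x) = sh (c' + c) x" and sh_0 [simp]: "sh 0 x = x"
  by (simp_all add: sh_def)

lemma sh_inject [simp]: "sh c x = sh c y \<longleftrightarrow> x = y"
  by (metis sh_sh sh_0 add.right_inverse)

lemma U_comp:
  assumes N: "N > 0" and d: "pmatch N d"
  shows "diagram_comp N (U c) d = ADiagram (\<lambda>x. sh c (pairing d (sh (- c) x))) (loops d)"
    and "contractible_loops N (U c) d = 0"
proof -
  let ?G = "arcs Top Mid (U c) \<union> arcs Mid Bot d"
  have edge: "(lv Top Bot (sh c z), lv Mid Bot z) \<in> ?G\<^sup>*" for z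
  proof (cases "fst z")
    case Outer
    then obtain i where z: "z = (Outer, i)" by (cases z) auto
    have "(lv Top Mid (Outer, i + c), lv Top Mid (pairing (U c) (Outer, i + c))) \<in> ?G"
      by (rule UnI1, rule arcsI)
    then show ?thesis by (simp add: z r_into_rtrancl)
  next
    case Inner
    then show ?thesis by (cases z) auto
  qed
  have sym: "sym (?G\<^sup>*)" by (rule sym_rtrancl[OF sym_Un_arcs[OF pmatch_U d]])
  have "pairing (diagram_comp N (U c) d) x = sh c (pairing d (sh (- c) x))" for x
  proof (rule pairing_compI[OF N pmatch_U d])
    have "sh (- c) x \<noteq> pairing d (sh (- c) x)" using d by (metis pmatch_nofix)
    then show "sh c (pairing d (sh (- c) x)) \<noteq> x" by (metis sh_sh sh_0 add.left_inverse sh_inject)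
    have "(lv Top Bot x, lv Mid Bot (sh (- c) x)) \<in> ?G\<^sup>*" using edge[of "sh (- c) x"] by simp
    moreover have "(lv Mid Bot (sh (- c) x), lv Mid Bot (pairing d (sh (- c) x))) \<in> ?G\<^sup>*"
      by (rule r_into_rtrancl, rule UnI2, rule arcsI)
    moreover have "(lv Mid Bot (pairing d (sh (- c) x)), lv Top Bot (sh c (pairing d (sh (- c) x)))) \<in> ?G\<^sup>*"
      using sym edge by (rule symD)
    ultimately show "(lv Top Bot x, lv Top Bot (sh c (pairing d (sh (- c) x)))) \<in> ?G\<^sup>*"
      by (meson rtrancl_trans)
  qed
  \<comment> \<open>Every middle vertex is joined to level \<open>Top\<close> by a line of
    \<open>U c\<close>, hence no component stays in the middle.\<close>
  moreover have none: "closed_orbits b N {Mid} ?G = {}" for b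
  proof -
    have "\<not> ?G\<^sup>* `` {v} \<subseteq> {Mid} \<times> UNIV" for v
    proof
      assume sub: "?G\<^sup>* `` {v} \<subseteq> {Mid} \<times> UNIV"
      then have "v \<in> {Mid} \<times> UNIV" by blast
      then obtain i where v: "v = (Mid, i)" by auto
      have "(lv Mid Bot (Outer, i), lv Top Bot (sh c (Outer, i))) \<in> ?G\<^sup>*" using sym edge by (rule symD)
      then have "(Top, i + c) \<in> {Mid} \<times> UNIV" using sub v by auto
      then show False by simp
    qed
    then show ?thesis unfolding closed_orbits_def by blast
  qed
  ultimately show "diagram_comp N (U c) d = ADiagram (\<lambda>x. sh c (pairing d (sh (- c) x))) (loops d)"
    by (intro adiagram.expand) (auto simp: diagram_comp_def[of N "U c" d] loops_closed_orbits intro!: ext)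
  show "contractible_loops N (U c) d = 0" by (simp add: loops_closed_orbits none)
qed

text \<open>A path entering from the lower diagram is turned back by at most one arc of
  \<open>E N j\<close>. A second arc would be a translate of the first: either \<open>x\<close>
  would be a translate of a moved point, or the pairing would have a fixed point.\<close>

lemma cupswap_path:
  assumes N: "N \<ge> 2" and d: "pmatch N d" and x: "cupswap N j x = x"
    and dx: "cupswap N j (pairing d x) \<noteq> pairing d x"
  shows "cupswap N j (pairing d (cupswap N j (pairing d x))) = pairing d (cupswap N j (pairing d x))"
    and "pairing d (cupswap N j (pairing d x)) \<noteq> x"
proof -
  let ?y = "pairing d x"
  show "pairing d (cupswap N j ?y) \<noteq> x" using dx d by (metis pmatch_invol)
  show "cupswap N j (pairing d (cupswap N j ?y)) = pairing d (cupswap N j ?y)" (is "cupswap N j ?z = ?z")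
  proof (rule ccontr)
    assume z: "cupswap N j ?z \<noteq> ?z"
    then obtain t where "?z = tr (t * int N) ?y \<or> ?z = tr (t * int N) (cupswap N j ?y)"
      using cupswap_types[OF N dx] by blast
    then show False
    proof
      assume "?z = tr (t * int N) ?y"
      then have "cupswap N j ?y = tr (t * int N) x" using d by (metis pmatch_invol pmatch_tr)
      then have "cupswap N j (cupswap N j ?y) = cupswap N j ?y" using x by (simp add: cupswap_tr)
      then show False using dx cupswap_invol[OF N] by metis
    next
      assume z: "?z = tr (t * int N) (cupswap N j ?y)"
      then have "cupswap N j ?y = tr (t * int N) ?z" using d by (metis pmatch_invol pmatch_tr)
      then have "tr (t * int N + t * int N) ?z = ?z" using z by (metis tr_tr)
      then have "t * int N = 0" by (metis tr_simps(3) add_cancel_left_right add_eq_0_iff add.left_neutral eq_neg_iff_add_eq_0 mult_eq_0_iff double_zero)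
      then have "t = 0" using N by simp
      then have "?z = cupswap N j ?y" using z by simp
      then show False using d by (metis pmatch_nofix)
    qed
  qed
qed

section \<open>Left multiplication by a generator \<open>E N j\<close>: the pairing and the loops
  that close\<close>

context
  fixes N :: nat and d :: adiagram and j :: int
  assumes N: "N \<ge> 2" and d: "pmatch N d"
begin

private abbreviation "G \<equiv> arcs Top Mid (E N j) \<union> arcs Mid Bot d"
private abbreviation "\<kappa> \<equiv> cupswap N j"

private lemma symG: "sym (G\<^sup>*)"
  by (rule sym_rtrancl[OF sym_Un_arcs[OF pmatch_E[OF N] d]])

private lemma low: "(lv Mid Bot x, lv Mid Bot (pairing d x)) \<in> G\<^sup>*"
  by (rule r_into_rtrancl, rule UnI2, rule arcsI)

private lemma up: "(lv Top Mid x, lv Top Mid (pairing (E N j) x)) \<in> G\<^sup>*"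
  by (rule r_into_rtrancl, rule UnI1, rule arcsI)

private lemma cup_top: assumes "\<kappa> x \<noteq> x" shows "(lv Top Bot x, lv Top Bot (\<kappa> x)) \<in> G\<^sup>*"
proof -
  obtain i where x: "x = (Outer, i)" using assms by (cases x; cases "fst x") auto
  obtain k where k: "\<kappa> x = (Outer, k)" using cupswap_Outer x by metis
  then have "pairing (E N j) (Outer, i) = (Outer, k)" using assms x by (intro pairing_E_cup) auto
  then show ?thesis using up[of x] x k by simp
qed

private lemma cup_mid: assumes "\<kappa> x \<noteq> x" shows "(lv Mid Bot x, lv Mid Bot (\<kappa> x)) \<in> G\<^sup>*"
proof -
  obtain i where x: "x = (Outer, i)" using assms by (cases x; cases "fst x") auto
  obtain k where k: "\<kappa> x = (Outer, k)" using cupswap_Outer x by metis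
  then have "pairing (E N j) (Inner, i) = (Inner, k)" using assms x by (intro pairing_E_cup) auto
  then show ?thesis using up[of "(Inner, i)"] x k by simp
qed

private lemma straight: assumes "\<kappa> x = x" shows "(lv Top Bot x, lv Mid Bot x) \<in> G\<^sup>*"
proof (cases "fst x")
  case Outer
  then obtain i where x: "x = (Outer, i)" by (cases x) auto
  then have "pairing (E N j) (Outer, i) = (Inner, i)" using pairing_E_through assms by fastforce
  then show ?thesis using up[of x] x by simp
next
  case Inner
  then show ?thesis by (cases x) auto
qed

text \<open>The cases are: a foot of an upper arc of \<open>E N j\<close>; a path passing straight
  through it at both ends; a path turned back once by a lower arc. \<open>cupswap_path\<close> shows
  that the last one then leaves through a straight line.\<close>

lemma pairing_E_comp:
  "pairing (diagram_comp N (E N j) d) x =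
    (if \<kappa> x \<noteq> x then \<kappa> x else if \<kappa> (pairing d x) = pairing d x then pairing d x
     else pairing d (\<kappa> (pairing d x)))"
proof -
  note I = pairing_compI[OF _ pmatch_E[OF N] d]
  consider "\<kappa> x \<noteq> x" | "\<kappa> x = x" "\<kappa> (pairing d x) = pairing d x" | "\<kappa> x = x" "\<kappa> (pairing d x) \<noteq> pairing d x"
    by blast
  then show ?thesis
  proof cases
    case 1
    have "pairing (diagram_comp N (E N j) d) x = \<kappa> x"
      by (rule I) (use N cup_top 1 in auto)
    then show ?thesis using 1 by simp
  next
    case 2
    have "(lv Top Bot x, lv Top Bot (pairing d x)) \<in> G\<^sup>*"
      using straight[OF 2(1)] low[of x] symD[OF symG straight[OF 2(2)]] by (meson rtrancl_trans)
    then have "pairing (diagram_comp N (E N j) d) x = pairing d x"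
      using N pmatch_nofix[OF d] by (intro I) auto
    then show ?thesis using 2 by simp
  next
    case 3
    let ?z = "pairing d (\<kappa> (pairing d x))"
    note z = cupswap_path[OF N d 3]
    have "(lv Mid Bot x, lv Mid Bot ?z) \<in> G\<^sup>*"
      using low[of x] cup_mid[OF 3(2)] low[of "\<kappa> (pairing d x)"] by (meson rtrancl_trans)
    then have "(lv Top Bot x, lv Top Bot ?z) \<in> G\<^sup>*"
      using straight[OF 3(1)] symD[OF symG straight[OF z(1)]] by (meson rtrancl_trans)
    then have "pairing (diagram_comp N (E N j) d) x = ?z"
      using N z(2) by (intro I) auto
    then show ?thesis using 3 by simp
  qed
qed

private lemma closed_mid:
  assumes "G\<^sup>* `` {v} \<subseteq> {Mid} \<times> UNIV" "(v, lv Mid Bot x) \<in> G\<^sup>*"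
  shows "\<kappa> x \<noteq> x"
proof
  assume "\<kappa> x = x"
  then have "(v, lv Top Bot x) \<in> G\<^sup>*" using assms(2) symD[OF symG straight] by (meson rtrancl_trans)
  then have "lv Top Bot x \<in> {Mid} \<times> UNIV" using assms(1) by blast
  then show False by (cases x; cases "fst x") auto
qed

private lemma closed_base:
  assumes "G\<^sup>* `` {v} \<subseteq> {Mid} \<times> UNIV"
  shows "\<exists>i. int N dvd i - j \<and> (v, (Mid, i)) \<in> G\<^sup>*"
proof -
  have "v \<in> {Mid} \<times> UNIV" using assms by blast
  then obtain i where v: "v = lv Mid Bot (Outer, i)" by auto
  then have ne: "\<kappa> (Outer, i) \<noteq> (Outer, i)" using closed_mid[OF assms] by blast
  show ?thesis
  proof (cases "int N dvd i - j")
    case True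
    then show ?thesis using v by auto
  next
    case False
    then have "int N dvd i - 1 - j" "\<kappa> (Outer, i) = (Outer, i - 1)"
      using ne by (auto simp: cupswap_def algebra_simps split: if_splits)
    then show ?thesis using cup_mid[OF ne] v by auto
  qed
qed

text \<open>Inside a closed component the partner of a foot \<open>i\<close> must again be a foot,
  hence a translate of \<open>i\<close> or of \<open>i + 1\<close>; the first alternative would
  force a fixed point of the pairing.\<close>

private lemma closed_cup:
  assumes "G\<^sup>* `` {v} \<subseteq> {Mid} \<times> UNIV"
  shows "\<exists>t. pairing d (Outer, j) = (Outer, j + 1 + t * int N)"
proof -
  obtain i where i: "int N dvd i - j" "(v, (Mid, i)) \<in> G\<^sup>*" using closed_base[OF assms] by blast
  then obtain s where s: "i = j + s * int N" by (auto elim: dvd_diffE)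
  let ?y = "pairing d (Outer, i)"
  have "(v, lv Mid Bot ?y) \<in> G\<^sup>*" using i low[of "(Outer, i)"] by (simp add: rtrancl_trans)
  then have y: "\<kappa> ?y \<noteq> ?y" by (rule closed_mid[OF assms])
  moreover have x: "\<kappa> (Outer, i) = (Outer, i + 1)" using i(1) by (simp add: cupswap_def)
  ultimately obtain t where "?y = tr (t * int N) (Outer, i) \<or> ?y = tr (t * int N) (Outer, i + 1)"
    using cupswap_types[OF N, of j "(Outer, i)" ?y] by auto
  then have "?y = (Outer, i + 1 + t * int N)"
  proof
    assume *: "?y = tr (t * int N) (Outer, i)"
    then have "(Outer, i) = tr (t * int N) ?y" using d by (metis pmatch_invol pmatch_tr)
    then have "t * int N = 0" using * by auto
    then show ?thesis using * d by (metis pmatch_nofix tr_0)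
  qed simp
  moreover have "?y = tr (s * int N) (pairing d (Outer, j))"
    using pmatch_tr[OF d, of s "(Outer, j)"] s by simp
  ultimately have "pairing d (Outer, j) = (Outer, j + 1 + t * int N)"
    using s by (cases "pairing d (Outer, j)") auto
  then show ?thesis ..
qed

text \<open>The component alternates between an arc of \<open>d\<close> and an arc of
  \<open>E N j\<close> and advances by \<open>t * int N\<close> in each round. So \<open>t\<close>
  is a winding number: for \<open>t = 0\<close> the loop has two points and is contractible,
  otherwise it runs off to infinity in the cover.\<close>

private lemma closed_class:
  assumes t: "pairing d (Outer, j) = (Outer, j + 1 + t * int N)" and i: "int N dvd i - j"
  shows "G\<^sup>* `` {(Mid, i)} = {Mid} \<times> (\<Union>k. {i + k * (t * int N), i + 1 + k * (t * int N)})" (is "_ = ?Z")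
proof -
  obtain s where s: "i = j + s * int N" using i by (auto elim: dvd_diffE)
  have d0: "pairing d (Outer, i + k * (t * int N)) = (Outer, i + 1 + (k + 1) * (t * int N))" for k
    using pmatch_tr[OF d, of "s + k * t" "(Outer, j)"] t s by (simp add: algebra_simps)
  have d1: "pairing d (Outer, i + 1 + k * (t * int N)) = (Outer, i + (k - 1) * (t * int N))" for k
    using d0[of "k - 1"] pmatch_invol[OF d, of "(Outer, i + (k - 1) * (t * int N))"] by simp
  have dv: "int N dvd i + k * (t * int N) - j" for k
    unfolding s by simp
  have e0: "\<kappa> (Outer, i + k * (t * int N)) = (Outer, i + 1 + k * (t * int N))" for k
    using dv[of k] by (simp add: cupswap_def algebra_simps)
  have e1: "\<kappa> (Outer, i + 1 + k * (t * int N)) = (Outer, i + k * (t * int N))" for k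
    using e0[of k] cupswap_invol[OF N] by metis
  show ?thesis
  proof
    show "G\<^sup>* `` {(Mid, i)} \<subseteq> ?Z"
    proof
      fix w assume "w \<in> G\<^sup>* `` {(Mid, i)}"
      then have "((Mid, i), w) \<in> G\<^sup>*" by simp
      then show "w \<in> ?Z"
      proof induction
        case base
        show ?case by (auto intro: exI[of _ 0])
      next
        case (step y w)
        then obtain a k where y: "y = (Mid, a)" "a = i + k * (t * int N) \<or> a = i + 1 + k * (t * int N)" by auto
        from step(2) show ?case
        proof
          assume "(y, w) \<in> arcs Top Mid (E N j)"
          then have w: "w = lv Top Mid (pairing (E N j) (Inner, a))"
            by (auto simp: y arc_inv_def dest: arcs_arc_inv[rotated])
          from y(2) show ?thesis
          proof
            assume a: "a = i + k * (t * int N)"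
            have "pairing (E N j) (Inner, a) = (Inner, i + 1 + k * (t * int N))"
              by (rule pairing_E_cup) (use e0[of k] a in auto)
            then show ?thesis using w by auto
          next
            assume a: "a = i + 1 + k * (t * int N)"
            have "pairing (E N j) (Inner, a) = (Inner, i + k * (t * int N))"
              by (rule pairing_E_cup) (use e1[of k] a in auto)
            then show ?thesis using w by auto
          qed
        next
          assume "(y, w) \<in> arcs Mid Bot d"
          then have "w = lv Mid Bot (pairing d (Outer, a))"
            by (auto simp: y arc_inv_def dest: arcs_arc_inv[rotated])
          then show ?thesis using y(2) d0[of k] d1[of k] by auto
        qed
      qed
    qed
    have m0: "((Mid, i + k * (t * int N)), (Mid, i + 1 + k * (t * int N))) \<in> G\<^sup>*" for k
      using cup_mid[of "(Outer, i + k * (t * int N))"] e0[of k] by simp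
    have m1: "((Mid, i + k * (t * int N)), (Mid, i + (k + 1) * (t * int N))) \<in> G\<^sup>*" for k
    proof -
      have "((Mid, i + k * (t * int N)), (Mid, i + 1 + (k + 1) * (t * int N))) \<in> G\<^sup>*"
        using low[of "(Outer, i + k * (t * int N))"] d0[of k] by simp
      moreover have "((Mid, i + 1 + (k + 1) * (t * int N)), (Mid, i + (k + 1) * (t * int N))) \<in> G\<^sup>*"
        by (rule symD[OF symG m0])
      ultimately show ?thesis by (rule rtrancl_trans)
    qed
    have m2: "((Mid, i), (Mid, i + k * (t * int N))) \<in> G\<^sup>*" for k
    proof (induction k rule: int_induct[of _ 0])
      case (step1 k)
      then show ?case using m1[of k] by (meson rtrancl_trans)
    next
      case (step2 k)
      then show ?case using symD[OF symG m1[of "k - 1"]] by (metis diff_add_cancel rtrancl_trans)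
    qed simp
    show "?Z \<subseteq> G\<^sup>* `` {(Mid, i)}" using m2 rtrancl_trans[OF m2 m0] by auto
  qed
qed

text \<open>All closed components are translates of the one through \<open>(Mid, j)\<close>, so at
  most one loop arises, and \<open>t\<close> decides its kind.\<close>

private lemma closed_orbits_E:
  "closed_orbits b N {Mid} G =
    (if \<exists>t. pairing d (Outer, j) = (Outer, j + 1 + t * int N) \<and> (t = 0 \<longleftrightarrow> b)
     then {orb N (G\<^sup>* `` {(Mid, j)})} else {})"
proof (cases "\<exists>t. pairing d (Outer, j) = (Outer, j + 1 + t * int N)")
  case False
  then have "\<not> G\<^sup>* `` {v} \<subseteq> {Mid} \<times> UNIV" for v using closed_cup by blast
  then show ?thesis using False unfolding closed_orbits_def by auto
next
  case True
  then obtain t where t: "pairing d (Outer, j) = (Outer, j + 1 + t * int N)" ..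
  have fin: "finite (G\<^sup>* `` {(Mid, i)}) \<longleftrightarrow> t = 0" if "int N dvd i - j" for i
  proof -
    have "finite ({Mid} \<times> (\<Union>k. {i + k * (t * int N), i + 1 + k * (t * int N)})) \<longleftrightarrow> t = 0" (is "?L \<longleftrightarrow> _")
    proof
      assume ?L
      then have "finite (\<Union>k. {i + k * (t * int N), i + 1 + k * (t * int N)})"
        by (auto dest: finite_cartesian_productD2)
      moreover have "range (\<lambda>k. i + k * (t * int N)) \<subseteq> (\<Union>k. {i + k * (t * int N), i + 1 + k * (t * int N)})"
        by auto
      ultimately have "finite (range (\<lambda>k. i + k * (t * int N)))" by (rule rev_finite_subset)
      then have "\<not> inj (\<lambda>k :: int. i + k * (t * int N))" using finite_imageD infinite_UNIV_int by blast
      then show "t = 0" using N by (auto simp: inj_def)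
    qed simp
    then show ?thesis using closed_class[OF t that] by simp
  qed
  have jj: "int N dvd j - j" by simp
  have orbv: "orb N (G\<^sup>* `` {v}) = orb N (G\<^sup>* `` {(Mid, j)}) \<and> (finite (G\<^sup>* `` {v}) \<longleftrightarrow> t = 0)"
    if v: "G\<^sup>* `` {v} \<subseteq> {Mid} \<times> UNIV" for v
  proof -
    obtain i where i: "int N dvd i - j" "(v, (Mid, i)) \<in> G\<^sup>*" using closed_base[OF v] by blast
    then obtain s where s: "i = j + s * int N" by (auto elim: dvd_diffE)
    have iv: "((Mid, i), v) \<in> G\<^sup>*" using symG i(2) by (rule symD)
    have "G\<^sup>* `` {v} = G\<^sup>* `` {(Mid, i)}"
    proof (rule Set.set_eqI)
      fix x
      show "x \<in> G\<^sup>* `` {v} \<longleftrightarrow> x \<in> G\<^sup>* `` {(Mid, i)}"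
        using rtrancl_trans[OF iv, of x] rtrancl_trans[OF i(2), of x] by blast
    qed
    moreover have "(Mid, j) \<in> orb N (G\<^sup>* `` {v})"
      unfolding orb_iff using i(2) s by (auto intro!: exI[of _ s])
    then have "orb N (G\<^sup>* `` {v}) = orb N (G\<^sup>* `` {(Mid, j)})"
      by (rule orb_class_eq[OF sym_Un_arcs[OF pmatch_E[OF N] d] shift_inv_Un[OF shift_inv_arcs[OF pmatch_E[OF N]] shift_inv_arcs[OF d]]])
    ultimately show ?thesis using fin[OF i(1)] by simp
  qed
  have base: "G\<^sup>* `` {(Mid, j)} \<subseteq> {Mid} \<times> UNIV" using closed_class[OF t jj] by auto
  have "(\<exists>t'. pairing d (Outer, j) = (Outer, j + 1 + t' * int N) \<and> (t' = 0 \<longleftrightarrow> b)) \<longleftrightarrow> (t = 0 \<longleftrightarrow> b)"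
    using t N by auto
  moreover have "closed_orbits b N {Mid} G = (if t = 0 \<longleftrightarrow> b then {orb N (G\<^sup>* `` {(Mid, j)})} else {})"
  proof (rule Set.set_eqI)
    fix \<omega>
    show "\<omega> \<in> closed_orbits b N {Mid} G \<longleftrightarrow> \<omega> \<in> (if t = 0 \<longleftrightarrow> b then {orb N (G\<^sup>* `` {(Mid, j)})} else {})"
    proof
      assume "\<omega> \<in> closed_orbits b N {Mid} G"
      then obtain v where "\<omega> = orb N (G\<^sup>* `` {v})" "G\<^sup>* `` {v} \<subseteq> {Mid} \<times> UNIV" "finite (G\<^sup>* `` {v}) \<longleftrightarrow> b"
        unfolding closed_orbits_def by blast
      then show "\<omega> \<in> (if t = 0 \<longleftrightarrow> b then {orb N (G\<^sup>* `` {(Mid, j)})} else {})"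
        using orbv[of v] by simp
    next
      assume "\<omega> \<in> (if t = 0 \<longleftrightarrow> b then {orb N (G\<^sup>* `` {(Mid, j)})} else {})"
      then have "\<omega> = orb N (G\<^sup>* `` {(Mid, j)})" "t = 0 \<longleftrightarrow> b" by (auto split: if_splits)
      then show "\<omega> \<in> closed_orbits b N {Mid} G"
        using base fin[OF jj] by (intro closed_orbitsI[of _ _ _ "(Mid, j)"]) simp_all
    qed
  qed
  ultimately show ?thesis by simp
qed

lemma contractible_loops_E:
  "contractible_loops N (E N j) d = (if pairing d (Outer, j) = (Outer, j + 1) then 1 else 0)"
  unfolding loops_closed_orbits closed_orbits_E by auto

lemma noncontractible_loops_E:
  "noncontractible_loops N (E N j) d =
    (if \<exists>t. t \<noteq> 0 \<and> pairing d (Outer, j) = (Outer, j + 1 + t * int N) then 1 else 0)"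
  unfolding loops_closed_orbits closed_orbits_E by auto

lemma loops_E_comp:
  "loops (diagram_comp N (E N j) d) =
    loops d + (if \<exists>t. t \<noteq> 0 \<and> pairing d (Outer, j) = (Outer, j + 1 + t * int N) then 1 else 0)"
  by (simp add: diagram_comp_def[of N "E N j" d] noncontractible_loops_E)

end

section \<open>Non-crossing matchings\<close>

text \<open>Embedding the order \<open>before\<close> into the reals turns crossing conditions into linear arithmetic.\<close>

definition pos :: "point \<Rightarrow> real" where
  "pos x = (case fst x of Outer \<Rightarrow> arctan (real_of_int (snd x)) - 10 | Inner \<Rightarrow> 10 - arctan (real_of_int (snd x)))"

lemma arctan_small: "\<bar>arctan x\<bar> < 10"
  using arctan_lbound[of x] arctan_ubound[of x] pi_less_4 by linarith

lemma before_pos: "before x y \<longleftrightarrow> pos x < pos y"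
  using arctan_small[of "real_of_int (snd x)"] arctan_small[of "real_of_int (snd y)"]
  by (cases x; cases y; cases "fst x"; cases "fst y") (auto simp: pos_def arctan_less_iff)

lemma pos_eq [simp]: "pos x = pos y \<longleftrightarrow> x = y"
  using arctan_small[of "real_of_int (snd x)"] arctan_small[of "real_of_int (snd y)"]
  by (cases x; cases y; cases "fst x"; cases "fst y") (auto simp: pos_def arctan_eq_iff)

lemma pos_Outer: "pos (Outer, i) < pos (Outer, k) \<longleftrightarrow> i < k"
  and pos_Outer_Inner: "pos (Outer, i) < pos (Inner, k)"
  and pos_Inner: "pos (Inner, i) < pos (Inner, k) \<longleftrightarrow> k < i"
  using before_pos[of "(Outer, i)" "(Outer, k)"] before_pos[of "(Outer, i)" "(Inner, k)"]
    before_pos[of "(Inner, i)" "(Inner, k)"] by auto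

lemma pos_Inner_Outer: "\<not> pos (Inner, i) < pos (Outer, k)"
  using pos_Outer_Inner[of k i] by linarith

definition btw :: "point \<Rightarrow> point \<Rightarrow> point \<Rightarrow> bool" where
  "btw p q a \<longleftrightarrow> pos p < pos a \<and> pos a < pos q \<or> pos q < pos a \<and> pos a < pos p"

text \<open>Interleaving is symmetric in the two chords. This allows the roles of the fixed and the
  traversed arc to be exchanged in \<open>E_comp_noncrossing\<close>.\<close>

lemma separation_sym:
  assumes "p \<noteq> a" "p \<noteq> b" "q \<noteq> a" "q \<noteq> b" "p \<noteq> q" "a \<noteq> b"
  shows "(btw p q a \<longleftrightarrow> btw p q b) \<longleftrightarrow> (btw a b p \<longleftrightarrow> btw a b q)"
proof -
  have "pos p \<noteq> pos a" "pos p \<noteq> pos b" "pos q \<noteq> pos a" "pos q \<noteq> pos b" "pos p \<noteq> pos q" "pos a \<noteq> pos b"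
    using assms by simp_all
  then show ?thesis unfolding btw_def by linarith
qed

text \<open>Phrased as invariance of betweenness instead of an ordering of four points: in this form
  the condition can be transported along a path, one arc at a time.\<close>

definition noncrossing :: "(point \<Rightarrow> point) \<Rightarrow> bool" where
  "noncrossing f \<longleftrightarrow> (\<forall>p a. a \<noteq> p \<longrightarrow> a \<noteq> f p \<longrightarrow> (btw p (f p) a \<longleftrightarrow> btw p (f p) (f a)))"

lemma noncrossing_iff:
  assumes f: "\<And>x. f (f x) = x" "\<And>x. f x \<noteq> x"
  shows "noncrossing f \<longleftrightarrow> \<not> (\<exists>x y. before x y \<and> before y (f x) \<and> before (f x) (f y))"
proof
  assume nc: "noncrossing f"
  show "\<not> (\<exists>x y. before x y \<and> before y (f x) \<and> before (f x) (f y))"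
  proof
    assume "\<exists>x y. before x y \<and> before y (f x) \<and> before (f x) (f y)"
    then obtain x y where xy: "pos x < pos y" "pos y < pos (f x)" "pos (f x) < pos (f y)"
      by (auto simp: before_pos)
    then have "y \<noteq> x" "y \<noteq> f x" by auto
    then have "btw x (f x) y \<longleftrightarrow> btw x (f x) (f y)" using nc unfolding noncrossing_def by blast
    then show False using xy by (auto simp: btw_def)
  qed
next
  assume nc: "\<not> (\<exists>x y. before x y \<and> before y (f x) \<and> before (f x) (f y))"
  have *: "btw p (f p) (f a)" if "btw p (f p) a" "a \<noteq> p" "a \<noteq> f p" for p a
  proof (rule ccontr)
    assume "\<not> btw p (f p) (f a)"
    moreover have "f a \<noteq> p" "f a \<noteq> f p" using that f(1) by metis+
    ultimately have out: "\<not> btw p (f p) (f a)" "pos (f a) \<noteq> pos p" "pos (f a) \<noteq> pos (f p)" by auto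
    define x where "x = (if pos p < pos (f p) then p else f p)"
    have x: "pos x < pos a" "pos a < pos (f x)" "pos (f a) < pos x \<or> pos (f x) < pos (f a)"
    proof -
      note * = that(1)[unfolded btw_def] out(1)[unfolded btw_def] out(2,3)
      show "pos x < pos a" "pos a < pos (f x)" "pos (f a) < pos x \<or> pos (f x) < pos (f a)"
        using * unfolding x_def by (cases "pos p < pos (f p)"; simp add: f; linarith)+
    qed
    from x(3) show False
    proof
      assume "pos (f a) < pos x"
      then have "before (f a) x \<and> before x (f (f a)) \<and> before (f (f a)) (f x)"
        using x f(1) by (simp add: before_pos)
      then show False using nc by blast
    next
      assume "pos (f x) < pos (f a)"
      then show False using nc x unfolding before_pos by blast
    qed
  qed
  show "noncrossing f"
    unfolding noncrossing_def
  proof (intro allI impI iffI)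
    fix p a assume a: "a \<noteq> p" "a \<noteq> f p"
    show "btw p (f p) a \<Longrightarrow> btw p (f p) (f a)" using * a by blast
    assume "btw p (f p) (f a)"
    then have "btw p (f p) (f (f a))" by (rule *) (use a f in metis)+
    then show "btw p (f p) a" by (simp add: f)
  qed
qed

lemma adiagrams_noncrossing:
  "d \<in> adiagrams N \<longleftrightarrow> pmatch N d \<and> noncrossing (pairing d) \<and>
     (loops d > 0 \<longrightarrow> (\<forall>x. fst (pairing d x) = fst x))"
  unfolding adiagrams_iff using noncrossing_iff[of "pairing d"] pmatch_invol pmatch_nofix by blast

lemma noncrossingD:
  "d \<in> adiagrams N \<Longrightarrow> a \<noteq> p \<Longrightarrow> a \<noteq> pairing d p \<Longrightarrow>
    btw p (pairing d p) a \<longleftrightarrow> btw p (pairing d p) (pairing d a)"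
  unfolding adiagrams_noncrossing noncrossing_def by blast

lemma mirror_adiagrams: assumes "d \<in> adiagrams N" shows "mirror d \<in> adiagrams N"
proof -
  let ?o = "map_prod opp id :: point \<Rightarrow> point"
  have oo: "?o (?o x) = x" for x by (cases x) simp
  have "pos (?o x) = - pos x" for x by (cases x; cases "fst x") (auto simp: pos_def)
  then have btw: "btw (?o p) (?o q) (?o a) \<longleftrightarrow> btw p q a" for p q a by (auto simp: btw_def)
  note d = assms[unfolded adiagrams_noncrossing]
  have "noncrossing (pairing (mirror d))"
    unfolding noncrossing_def
  proof (intro allI impI)
    fix p a assume "a \<noteq> p" "a \<noteq> pairing (mirror d) p"
    then have "?o a \<noteq> ?o p" "?o a \<noteq> pairing d (?o p)" unfolding mirror_def by (metis oo adiagram.sel(1))+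
    then have "btw (?o p) (pairing d (?o p)) (?o a) \<longleftrightarrow> btw (?o p) (pairing d (?o p)) (pairing d (?o a))"
      using d unfolding noncrossing_def by blast
    then show "btw p (pairing (mirror d) p) a \<longleftrightarrow> btw p (pairing (mirror d) p) (pairing (mirror d) a)"
      unfolding mirror_def adiagram.sel
      using btw[of "?o p" "pairing d (?o p)" "?o a"] btw[of "?o p" "pairing d (?o p)" "pairing d (?o a)"]
      by (simp only: oo)
  qed
  moreover have "fst (pairing (mirror d) x) = fst x" if "\<forall>x. fst (pairing d x) = fst x" for x
    using that by (cases x; cases "fst x") auto
  ultimately show ?thesis using d by (auto simp: adiagrams_noncrossing intro: pmatch_mirror)
qed

text \<open>An arc spanning more than a period would cross its own translate by \<open>N\<close>; an
  arc spanning exactly a period would have an end in common with it.\<close>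

lemma outer_arc_short:
  assumes d: "d \<in> adiagrams N" and N: "N > 0" and ab: "pairing d (Outer, a) = (Outer, b)" "a < b"
  shows "b < a + int N"
proof (rule ccontr)
  assume *: "\<not> b < a + int N"
  note m = adiagrams_pmatch[OF d]
  have aN: "pairing d (Outer, a + int N) = (Outer, b + int N)"
    using pmatch_tr[OF m, of 1 "(Outer, a)"] ab by simp
  have "b \<noteq> a + int N"
  proof
    assume "b = a + int N"
    then have "pairing d (Outer, b) = (Outer, b + int N)" using aN by simp
    moreover have "pairing d (Outer, b) = (Outer, a)" using ab pmatch_invol[OF m] by metis
    ultimately show False using ab by simp
  qed
  then have "btw (Outer, a) (Outer, b) (Outer, a + int N)" using * N by (simp add: btw_def pos_Outer)
  then have "btw (Outer, a) (Outer, b) (Outer, b + int N)"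
    using noncrossingD[OF d, of "(Outer, a + int N)" "(Outer, a)"] \<open>b \<noteq> a + int N\<close> N ab aN by simp
  then show False using ab N by (simp add: btw_def pos_Outer)
qed

text \<open>Geometrically, \<open>E N j\<close> closes a non-contractible loop on \<open>d\<close>.
  The bound on the length of arcs leaves only \<open>t = - 1\<close>, that is, an arc from
  \<open>j + 1 - int N\<close> to \<open>j\<close>. The points from one end to the other represent
  all residues modulo \<open>N\<close>, so every outer point lies under a translate of this arc and
  no line can leave the outer boundary.\<close>

lemma no_through_lines:
  assumes d: "d \<in> adiagrams N" and N: "N \<ge> 2"
    and t: "pairing d (Outer, j) = (Outer, j + 1 + t * int N)" "t \<noteq> 0"
  shows "fst (pairing d x) = fst x"
proof -
  note m = adiagrams_pmatch[OF d]
  have "t = - 1"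
  proof (cases "t \<ge> 0")
    case True
    then have "t * int N \<ge> 1 * int N" using t by (intro mult_right_mono) auto
    then have "j < j + 1 + t * int N" by linarith
    from outer_arc_short[OF d _ t(1) this] \<open>t * int N \<ge> 1 * int N\<close> show ?thesis using N by simp
  next
    case False
    show ?thesis
    proof (rule ccontr)
      assume "t \<noteq> - 1"
      then have "t * int N \<le> - 2 * int N" using False by (intro mult_right_mono) auto
      moreover have "pairing d (Outer, j + 1 + t * int N) = (Outer, j)" using t pmatch_invol[OF m] by metis
      moreover have "j + 1 + t * int N < j" using calculation N by linarith
      ultimately show False using outer_arc_short[OF d, of "j + 1 + t * int N" j] N by linarith
    qed
  qed
  define a where "a = j + 1 - int N"
  have a: "pairing d (Outer, a) = (Outer, j)" using t pmatch_invol[OF m, of "(Outer, j)"] \<open>t = - 1\<close> by (simp add: a_def)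
  have outer: "fst (pairing d (Outer, i)) = Outer" for i
  proof (rule ccontr)
    assume *: "fst (pairing d (Outer, i)) \<noteq> Outer"
    \<comment> \<open>The representative of \<open>i\<close> modulo \<open>N\<close> that lies under
      the arc from \<open>a\<close> to \<open>j\<close> or at one of its ends.\<close>
    define i' where "i' = a + (i - a) mod int N"
    have "i' = i + (- ((i - a) div int N)) * int N"
      unfolding i'_def by (simp add: minus_div_mult_eq_mod[symmetric])
    then have "pairing d (Outer, i') = tr (- ((i - a) div int N) * int N) (pairing d (Outer, i))"
      using pmatch_tr[OF m, of "- ((i - a) div int N)" "(Outer, i)"] by simp
    then obtain k where k: "pairing d (Outer, i') = (Inner, k)"
      using * by (cases "pairing d (Outer, i)"; cases "fst (pairing d (Outer, i))") auto
    have "0 \<le> (i - a) mod int N" "(i - a) mod int N < int N" using N by simp_all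
    then have "a \<le> i'" "i' \<le> j" unfolding i'_def a_def by linarith+
    moreover have "i' \<noteq> a" using k a by auto
    moreover have "i' \<noteq> j" using k a pmatch_invol[OF m, of "(Outer, a)"] by auto
    ultimately have "btw (Outer, a) (Outer, j) (Outer, i')" "(Outer, i') \<noteq> (Outer, a)" "(Outer, i') \<noteq> (Outer, j)"
      by (auto simp: btw_def pos_Outer)
    then have "btw (Outer, a) (Outer, j) (Inner, k)"
      using noncrossingD[OF d, of "(Outer, i')" "(Outer, a)"] a k by simp
    then show False using pos_Outer_Inner[of a k] pos_Outer_Inner[of j k] by (auto simp: btw_def)
  qed
  have "fst (pairing d (Inner, i)) = Inner" for i
  proof (rule ccontr)
    assume "fst (pairing d (Inner, i)) \<noteq> Inner"
    then obtain k where "pairing d (Inner, i) = (Outer, k)"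
      by (cases "pairing d (Inner, i)"; cases "fst (pairing d (Inner, i))") auto
    then have "pairing d (Outer, k) = (Inner, i)" using pmatch_invol[OF m] by metis
    then show False using outer[of k] by simp
  qed
  then show ?thesis using outer by (cases x; cases "fst x") auto
qed

text \<open>No boundary point lies strictly between two neighbours, so both compare alike with any
  third point.\<close>

lemma cupswap_adjacent:
  assumes "N \<ge> 2" "cupswap N j a \<noteq> a" "p \<noteq> a" "p \<noteq> cupswap N j a"
  shows "pos p < pos a \<longleftrightarrow> pos p < pos (cupswap N j a)" "pos a < pos p \<longleftrightarrow> pos (cupswap N j a) < pos p"
proof -
  have *: "pos p < pos (Outer, i) \<longleftrightarrow> pos p < pos (Outer, i + 1)" "pos (Outer, i) < pos p \<longleftrightarrow> pos (Outer, i + 1) < pos p"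
    if "p \<noteq> (Outer, i)" "p \<noteq> (Outer, i + 1)" for i
    using that pos_Outer_Inner[of i "snd p"] pos_Outer_Inner[of "i + 1" "snd p"]
    by (cases p; cases "fst p"; auto simp: pos_Outer)+
  obtain i where a: "a = (Outer, i)" using assms by (cases a; cases "fst a") auto
  have "cupswap N j a = (Outer, i + 1) \<or> cupswap N j a = (Outer, i - 1)"
    using assms by (auto simp: a cupswap_def split: if_splits)
  then show "pos p < pos a \<longleftrightarrow> pos p < pos (cupswap N j a)" "pos a < pos p \<longleftrightarrow> pos (cupswap N j a) < pos p"
    using *[of i] *[of "i - 1"] assms a by auto
qed

lemma btw_adjacent:
  assumes "N \<ge> 2" "cupswap N j a \<noteq> a" "p \<noteq> a" "p \<noteq> cupswap N j a" "q \<noteq> a" "q \<noteq> cupswap N j a"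
  shows "btw p q a \<longleftrightarrow> btw p q (cupswap N j a)"
  using cupswap_adjacent[OF assms(1-4)] cupswap_adjacent[OF assms(1,2,5,6)] by (simp add: btw_def)

lemma not_btw_adjacent:
  assumes "N \<ge> 2" "cupswap N j p \<noteq> p" shows "\<not> btw p (cupswap N j p) a"
proof (cases "a = p \<or> a = cupswap N j p")
  case True then show ?thesis by (auto simp: btw_def)
next
  case False
  then show ?thesis using cupswap_adjacent[OF assms, of a] by (auto simp: btw_def)
qed

text \<open>The side of an arc on which a point lies is followed along the pieces of the composite
  path: across an arc of \<open>d\<close> it is kept because \<open>d\<close> is non-crossing,
  across an arc of \<open>E N j\<close> because the two feet are neighbours. If the arc taken as
  reference is itself composite, the roles are exchanged and its own pieces are traversed.\<close>

lemma E_comp_noncrossing: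
  assumes N: "N \<ge> 2" and d: "d \<in> adiagrams N"
  shows "noncrossing (pairing (diagram_comp N (E N j) d))"
proof -
  note m = adiagrams_pmatch[OF d]
  let ?k = "cupswap N j" and ?d = "pairing d" and ?f = "pairing (diagram_comp N (E N j) d)"
  have mf: "pmatch N (diagram_comp N (E N j) d)" using N by (intro pmatch_comp pmatch_E m) auto
  note kk = cupswap_invol[OF N]
  have f1: "?k x \<noteq> x \<Longrightarrow> ?f x = ?k x"
    and f2: "?k x = x \<Longrightarrow> ?k (?d x) = ?d x \<Longrightarrow> ?f x = ?d x"
    and f3: "?k x = x \<Longrightarrow> ?k (?d x) \<noteq> ?d x \<Longrightarrow> ?f x = ?d (?k (?d x))" for x
    by (simp_all add: pairing_E_comp[OF N m])
  have fk: "?k (?f x) = ?f x" if "?k x = x" for x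
    using cupswap_path(1)[OF N m that] f2[OF that] f3[OF that] by metis
  \<comment> \<open>\<open>u\<close> and \<open>?d u\<close> are the ends of an arc of
    \<open>d\<close>, while \<open>a\<close> starts a possibly composite arc of the product; the
    condition on \<open>?d a\<close> says that the two paths do not share a piece.\<close>
  have step: "btw u (?d u) a \<longleftrightarrow> btw u (?d u) (?f a)"
    if a: "?k a = a" "a \<noteq> u" "a \<noteq> ?d u"
      and y: "?k (?d a) \<noteq> ?d a \<Longrightarrow> u \<noteq> ?d a \<and> u \<noteq> ?k (?d a) \<and> ?d u \<noteq> ?d a \<and> ?d u \<noteq> ?k (?d a)" for u a
  proof (cases "?k (?d a) = ?d a")
    case True
    then show ?thesis using noncrossingD[OF d a(2,3)] f2[OF a(1)] by simp
  next
    case False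
    note y = y[OF False]
    have "btw u (?d u) a \<longleftrightarrow> btw u (?d u) (?d a)" by (rule noncrossingD[OF d a(2,3)])
    also have "\<dots> \<longleftrightarrow> btw u (?d u) (?k (?d a))" by (rule btw_adjacent[OF N False]) (use y in auto)
    also have "\<dots> \<longleftrightarrow> btw u (?d u) (?d (?k (?d a)))"
      by (rule noncrossingD[OF d]) (use y in auto)
    finally show ?thesis using f3[OF a(1) False] by simp
  qed
  show ?thesis
    unfolding noncrossing_def
  proof (intro allI impI)
    fix p a assume a: "a \<noteq> p" "a \<noteq> ?f p"
    have b: "?f a \<noteq> p" "?f a \<noteq> ?f p" using a pmatch_invol[OF mf] by metis+
    show "btw p (?f p) a \<longleftrightarrow> btw p (?f p) (?f a)"
    proof (cases "?k p = p")
      case False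
      then show ?thesis using not_btw_adjacent[OF N False] f1[OF False] by simp
    next
      case p: True
      note fp = fk[OF p]
      show ?thesis
      proof (cases "?k a = a")
        case False
        have "p \<noteq> a" "p \<noteq> ?k a" "?f p \<noteq> a" "?f p \<noteq> ?k a" using p fp False kk by metis+
        then show ?thesis using btw_adjacent[OF N False] f1[OF False] by simp
      next
        case ka: True
        note fa = fk[OF ka]
        show ?thesis
        proof (cases "?k (?d p) = ?d p")
          case True
          have "btw p (?d p) a \<longleftrightarrow> btw p (?d p) (?f a)"
          proof (rule step[OF ka a(1)])
            show "a \<noteq> ?d p" using a f2[OF p True] by simp
            assume "?k (?d a) \<noteq> ?d a"
            then show "p \<noteq> ?d a \<and> p \<noteq> ?k (?d a) \<and> ?d p \<noteq> ?d a \<and> ?d p \<noteq> ?k (?d a)"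
              using p True kk by metis
          qed
          then show ?thesis using f2[OF p True] by simp
        next
          case False
          let ?y = "?d p"
          have fpd: "?f p = ?d (?k ?y)" by (rule f3[OF p False])
          have dy: "?d ?y = p" using m by simp
          have ky: "?k (?k ?y) \<noteq> ?k ?y" using False kk by metis
          have ay: "a \<noteq> ?y" "?f a \<noteq> ?y" "a \<noteq> ?k ?y" "?f a \<noteq> ?k ?y" using ka fa False kk by metis+
          have ne: "?f a \<noteq> a" using mf by simp
          have n1: "p \<noteq> ?y" using p False by auto
          have n2: "?f p \<noteq> ?k ?y" using fp ky by auto
          have s1: "btw p ?y a \<longleftrightarrow> btw p ?y (?f a)"
          proof (rule step[OF ka a(1) ay(1)])
            assume da: "?k (?d a) \<noteq> ?d a"
            have "?y \<noteq> ?k (?d a)"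
            proof
              assume "?y = ?k (?d a)"
              then have "?f a = p" using f3[OF ka da] dy by simp
              then show False using b by simp
            qed
            moreover have "?y \<noteq> ?d a" using a m by simp
            ultimately show "p \<noteq> ?d a \<and> p \<noteq> ?k (?d a) \<and> ?y \<noteq> ?d a \<and> ?y \<noteq> ?k (?d a)"
              using p da kk by metis
          qed
          have s3: "btw (?k ?y) (?d (?k ?y)) a \<longleftrightarrow> btw (?k ?y) (?d (?k ?y)) (?f a)"
          proof (rule step[OF ka ay(3)])
            show "a \<noteq> ?d (?k ?y)" using a fpd by simp
            assume da: "?k (?d a) \<noteq> ?d a"
            have 1: "?k ?y \<noteq> ?d a" using a fpd m by (metis pmatch_invol)
            have 2: "?k ?y \<noteq> ?k (?d a)" using a m kk by (metis pmatch_invol)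
            have "?k (?f p) = ?f p" by (rule fp)
            then show "?k ?y \<noteq> ?d a \<and> ?k ?y \<noteq> ?k (?d a) \<and> ?d (?k ?y) \<noteq> ?d a \<and> ?d (?k ?y) \<noteq> ?k (?d a)"
              using 1 2 da kk fpd by metis
          qed
          \<comment> \<open>Now the arc from \<open>a\<close> to \<open>?f a\<close> is the
            reference, and the path of \<open>p\<close> is traversed: an arc of \<open>d\<close>, an
            arc of \<open>E N j\<close>, another arc of \<open>d\<close>. The outer two pieces are
            \<open>s1\<close> and \<open>s3\<close> read through
            \<open>separation_sym\<close>.\<close>
          have "btw a (?f a) p \<longleftrightarrow> btw a (?f a) ?y"
            using separation_sym[of p a "?f a" ?y] s1 a b ay ne n1 by auto
          also have "\<dots> \<longleftrightarrow> btw a (?f a) (?k ?y)"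
            by (rule btw_adjacent[OF N False ay(1,3,2,4)])
          also have "\<dots> \<longleftrightarrow> btw a (?f a) (?f p)"
            using separation_sym[of "?k ?y" a "?f a" "?f p"] s3 a b ay ne n2 by (auto simp: fpd)
          finally show ?thesis
            using separation_sym[of p a "?f a" "?f p"] a b ne mf by (metis pmatch_nofix)
        qed
      qed
    qed
  qed
qed

text \<open>A non-contractible loop, whether present in \<open>d\<close> or created by the product,
  goes with the absence of through lines; in the second case this is
  \<open>no_through_lines\<close>.\<close>

lemma E_comp_adiagrams:
  assumes N: "N \<ge> 2" and d: "d \<in> adiagrams N"
  shows "diagram_comp N (E N j) d \<in> adiagrams N"
  unfolding adiagrams_noncrossing
proof (intro conjI impI allI)
  note m = adiagrams_pmatch[OF d]
  show "pmatch N (diagram_comp N (E N j) d)" using N by (intro pmatch_comp pmatch_E m) auto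
  show "noncrossing (pairing (diagram_comp N (E N j) d))" by (rule E_comp_noncrossing[OF N d])
  fix x assume "0 < loops (diagram_comp N (E N j) d)"
  then have "loops d > 0 \<or> (\<exists>t. t \<noteq> 0 \<and> pairing d (Outer, j) = (Outer, j + 1 + t * int N))"
    by (auto simp: loops_E_comp[OF N m] split: if_splits)
  then have side: "fst (pairing d y) = fst y" for y
  proof
    assume "loops d > 0"
    then show ?thesis using d unfolding adiagrams_noncrossing by blast
  next
    assume "\<exists>t. t \<noteq> 0 \<and> pairing d (Outer, j) = (Outer, j + 1 + t * int N)"
    then show ?thesis using no_through_lines[OF d N] by blast
  qed
  have "fst (cupswap N j y) = fst y" for y by (simp add: cupswap_def)
  then show "fst (pairing (diagram_comp N (E N j) d) x) = fst x"
    using side by (simp add: pairing_E_comp[OF N m])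
qed

lemma pos_sh: "pos (sh c x) < pos (sh c y) \<longleftrightarrow> pos x < pos y"
  by (cases x; cases y; cases "fst x"; cases "fst y")
    (auto simp: pos_Outer pos_Inner pos_Outer_Inner pos_Inner_Outer)

lemma U_comp_adiagrams:
  assumes N: "N > 0" and d: "d \<in> adiagrams N"
  shows "diagram_comp N (U c) d \<in> adiagrams N"
proof -
  note m = adiagrams_pmatch[OF d]
  have btw: "btw (sh c p) (sh c q) (sh c a) \<longleftrightarrow> btw p q a" for p q a
    by (simp add: btw_def pos_sh)
  have "noncrossing (\<lambda>x. sh c (pairing d (sh (- c) x)))"
    unfolding noncrossing_def
  proof (intro allI impI)
    fix p a assume a: "a \<noteq> p" "a \<noteq> sh c (pairing d (sh (- c) p))"
    have s: "x = sh c (sh (- c) x)" for x by simp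
    have 1: "sh (- c) a \<noteq> sh (- c) p" using a(1) by simp
    have 2: "sh (- c) a \<noteq> pairing d (sh (- c) p)"
    proof
      assume "sh (- c) a = pairing d (sh (- c) p)"
      then have "sh c (sh (- c) a) = sh c (pairing d (sh (- c) p))" by (rule arg_cong)
      then show False using a(2) by simp
    qed
    from noncrossingD[OF d 1 2]
    show "btw p (sh c (pairing d (sh (- c) p))) a \<longleftrightarrow>
      btw p (sh c (pairing d (sh (- c) p))) (sh c (pairing d (sh (- c) a)))"
      by (subst (1 3) s[of p], subst (1) s[of a]) (simp only: btw)
  qed
  moreover have "fst (sh c (pairing d (sh (- c) x))) = fst x" if "loops d > 0" for x
  proof -
    have "fst (pairing d (sh (- c) x)) = fst (sh (- c) x)"
      using d that unfolding adiagrams_noncrossing by blast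
    then show ?thesis by simp
  qed
  moreover note pmatch_comp[OF N pmatch_U m, of c]
  ultimately show ?thesis
    unfolding adiagrams_noncrossing U_comp(1)[OF N m] adiagram.sel by blast
qed

lemma U_adiagrams: "U c \<in> adiagrams N"
proof -
  have False if "before x y" "before y (pairing (U c) x)" "before (pairing (U c) x) (pairing (U c) y)" for x y
    using that by (cases x; cases y; cases "fst x"; cases "fst y") auto
  then show ?thesis using pmatch_U by (auto simp: adiagrams_iff)
qed

lemma U_id [simp]: assumes "N > 0" "pmatch N d"
  shows "diagram_comp N (U 0) d = d" "contractible_loops N (U 0) d = 0"
  using U_comp[OF assms, of 0] by (cases d; simp)+

lemma mirror_U: "mirror (U c) = U (- c)"
  by (rule adiagram.expand) (auto simp: mirror_def U_def intro!: ext split: side.splits)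

lemma id_U [simp]: assumes "N > 0" "pmatch N d"
  shows "diagram_comp N d (U 0) = d" "contractible_loops N d (U 0) = 0"
proof -
  have "diagram_comp N (mirror (mirror d)) (mirror (U 0)) = mirror (diagram_comp N (U 0) (mirror d))"
    by (rule comp_mirror) (use assms in \<open>auto intro: pmatch_U pmatch_mirror\<close>)
  then show "diagram_comp N d (U 0) = d"
    using U_id(1)[OF assms(1) pmatch_mirror[OF assms(2)]] mirror_U[of 0] by simp
  show "contractible_loops N d (U 0) = 0"
    using mirror_loops(1)[of N "mirror d" "mirror (U 0)"] mirror_U[of 0]
      U_id(2)[OF assms(1) pmatch_mirror[OF assms(2)]] by simp
qed

lemma U_U: assumes "N > 0" shows "diagram_comp N (U a) (U b) = U (a + b)"
  unfolding U_comp(1)[OF assms pmatch_U]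
  by (rule adiagram.expand) (auto simp: sh_def U_def intro!: ext split: side.splits)

lemma E_adiagrams: assumes "N \<ge> 2" shows "E N j \<in> adiagrams N"
  using E_comp_adiagrams[OF assms U_adiagrams, of j 0] id_U(1)[OF _ pmatch_E[OF assms]] assms by simp

section \<open>Temperley--Lieb relations for diagrams\<close>

lemma pairing_E: "pairing (E N j) (s, i) =
    (if cupswap N j (Outer, i) = (Outer, i) then (opp s, i) else (s, snd (cupswap N j (Outer, i))))"
  using pairing_E_cup[of N j i _ s] pairing_E_through[of N j i s] cupswap_Outer[of N j i] by (metis snd_conv)

lemma mirror_E: "mirror (E N j) = E N j"
proof (rule adiagram.expand, intro conjI ext)
  fix x show "pairing (mirror (E N j)) x = pairing (E N j) x"
    by (cases x; cases "fst x") (auto simp: mirror_def pairing_E)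
qed simp

lemma cup_pairing:
  assumes "N \<ge> 2" "pmatch N d" "pairing d (Outer, j) = (Outer, j + 1)" "cupswap N j x \<noteq> x"
  shows "pairing d x = cupswap N j x"
proof -
  obtain i where x: "x = (Outer, i)" using assms(4) by (cases x; cases "fst x") auto
  have P1: "pairing d (Outer, j + t * int N) = (Outer, j + 1 + t * int N)" for t
    using pmatch_tr[OF assms(2), of t "(Outer, j)"] assms(3) by simp
  have P: "pairing d (Outer, j + t * int N) = (Outer, j + 1 + t * int N)"
    "pairing d (Outer, j + 1 + t * int N) = (Outer, j + t * int N)" for t
    using P1[of t] pmatch_invol[OF assms(2), of "(Outer, j + t * int N)"] by simp_all
  show ?thesis
  proof (cases "int N dvd i - j")
    case True
    then show ?thesis by (auto simp: x cupswap_def P elim: dvd_diffE)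
  next
    case False
    then have *: "int N dvd i - (j + 1)" using assms(4) by (simp add: x cupswap_ne diff_diff_eq)
    then obtain t where "i = j + 1 + t * int N" by (rule dvd_diffE)
    then show ?thesis using False * P[of t] by (simp add: x cupswap_def diff_diff_eq)
  qed
qed

lemma cup_complement:
  assumes "N \<ge> 2" "pmatch N d" "pairing d (Outer, j) = (Outer, j + 1)" "cupswap N j x = x"
  shows "cupswap N j (pairing d x) = pairing d x"
  using cup_pairing[OF assms(1-3), of "pairing d x"] cupswap_invol[OF assms(1)] assms(2,4)
  by (metis pmatch_invol)

text \<open>The diagrammatic half of \<open>e_j^2 = m e_j\<close>; the factor \<open>m\<close> is
  recorded by \<open>contractible_loops_E\<close>.\<close>

lemma E_absorb:
  assumes N: "N \<ge> 2" and d: "pmatch N d" and cup: "pairing d (Outer, j) = (Outer, j + 1)"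
  shows "diagram_comp N (E N j) d = d"
proof (rule adiagram.expand, intro conjI ext)
  fix x show "pairing (diagram_comp N (E N j) d) x = pairing d x"
    using cup_pairing[OF N d cup, of x] cup_complement[OF N d cup, of x] by (auto simp: pairing_E_comp[OF N d])
next
  show "loops (diagram_comp N (E N j) d) = loops d"
    using N by (simp add: loops_E_comp[OF N d] cup)
qed

text \<open>The arcs at \<open>j\<close> and at a neighbouring index \<open>k\<close> involve three
  consecutive positions, distinct modulo \<open>N\<close> because \<open>N\<close> is at least 3. A
  point moved by \<open>k\<close> but not by \<open>j\<close> is an extreme one; the two moves carry
  it to the opposite extreme, which \<open>k\<close> fixes.\<close>

lemma cupswap_neighbours:
  assumes N: "N \<ge> 3" and k: "k = j + 1 \<or> k = j - 1" and x: "cupswap N j x = x" "cupswap N k x \<noteq> x"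
  shows "cupswap N j (cupswap N k x) \<noteq> cupswap N k x"
    and "cupswap N k (cupswap N j (cupswap N k x)) = cupswap N j (cupswap N k x)"
proof -
  obtain i where xi: "x = (Outer, i)" using x(2) by (cases x; cases "fst x") auto
  have nd: "\<not> int N dvd 1" "\<not> int N dvd 2" "\<not> int N dvd - 1" "\<not> int N dvd - 2"
    using N zdvd_imp_le[of "int N" 1] zdvd_imp_le[of "int N" 2] by auto
  have sh: "(int N dvd a + c \<longleftrightarrow> int N dvd c) \<and> (int N dvd a - c \<longleftrightarrow> int N dvd c)" if "int N dvd a" for a c
    using that by (simp add: dvd_add_right_iff dvd_diff_right_iff)
  have "cupswap N j (cupswap N k x) \<noteq> cupswap N k x \<and>
    cupswap N k (cupswap N j (cupswap N k x)) = cupswap N j (cupswap N k x)"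
    using k
  proof
    assume k: "k = j + 1"
    then have i: "int N dvd i - (j + 2)" using x by (auto simp: xi cupswap_def algebra_simps split: if_splits)
    then obtain t where t: "i = j + 2 + t * int N" by (rule dvd_diffE)
    have c1: "cupswap N k (Outer, i) = (Outer, j + 1 + t * int N)"
      using nd by (simp add: cupswap_def k t dvd_add_left_iff)
    have c2: "cupswap N j (Outer, j + 1 + t * int N) = (Outer, j + t * int N)"
      using nd by (simp add: cupswap_def dvd_add_left_iff)
    have c3: "cupswap N k (Outer, j + t * int N) = (Outer, j + t * int N)"
      using nd sh[of "t * int N" 1] sh[of "t * int N" 2] by (simp add: cupswap_def k)
    show ?thesis by (simp add: xi c1 c2 c3)
  next
    assume k: "k = j - 1"
    then have i: "int N dvd i - (j - 1)" using x by (auto simp: xi cupswap_def algebra_simps split: if_splits)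
    then obtain t where t: "i = j - 1 + t * int N" by (rule dvd_diffE)
    have c1: "cupswap N k (Outer, i) = (Outer, j + t * int N)"
      using nd by (simp add: cupswap_def k t dvd_add_left_iff)
    have c2: "cupswap N j (Outer, j + t * int N) = (Outer, j + 1 + t * int N)"
      using nd by (simp add: cupswap_def dvd_add_left_iff)
    have c3: "cupswap N k (Outer, j + 1 + t * int N) = (Outer, j + 1 + t * int N)"
      using nd sh[of "t * int N" 1] sh[of "t * int N" 2] by (simp add: cupswap_def k add.commute)
    show ?thesis by (simp add: xi c1 c2 c3)
  qed
  then show "cupswap N j (cupswap N k x) \<noteq> cupswap N k x"
    "cupswap N k (cupswap N j (cupswap N k x)) = cupswap N j (cupswap N k x)" by blast+
qed

text \<open>Besides the relation \<open>e_j e_k e_j = e_j\<close>, which is the case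
  \<open>d = E N j\<close>, this shows that multiplying by a neighbouring generator is undone
  without any loop whenever \<open>d\<close> has a cup at \<open>j\<close>. The reduction of
  diagrams in \<open>slide\<close> relies on the general form.\<close>

lemma E_slide:
  assumes N: "N \<ge> 3" and k: "k = j + 1 \<or> k = j - 1" and d: "pmatch N d"
    and cup: "pairing d (Outer, j) = (Outer, j + 1)"
  shows "diagram_comp N (E N j) (diagram_comp N (E N k) d) = d"
    and "contractible_loops N (E N k) d = 0"
    and "contractible_loops N (E N j) (diagram_comp N (E N k) d) = 0"
proof -
  have N2: "N \<ge> 2" and N0: "N > 0" using N by auto
  let ?d = "pairing d" and ?D = "pairing (diagram_comp N (E N k) d)"
  note mD = pmatch_comp[OF N0 pmatch_E[OF N2] d, of k]
  note P = pairing_E_comp[OF N2 d, of k]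
  note cp = cup_pairing[OF N2 d cup] and cc = cup_complement[OF N2 d cup]
  note kk = cupswap_invol[OF N2]
  note nb = cupswap_neighbours[OF N k]
  have "\<not> int N dvd 2" using N zdvd_imp_le[of "int N" 2] by auto
  then have nd: "t * int N \<noteq> 2" "t * int N \<noteq> - 2" for t
    using dvd_triv_right[of "int N" t] by (metis, metis dvd_minus_iff)
  have cup': "?d (Outer, j + 1 + t * int N) = (Outer, j + t * int N)" for t
    using pmatch_tr[OF d, of t "(Outer, j)"] pmatch_invol[OF d, of "(Outer, j + t * int N)"] cup by simp
  have kO: "cupswap N k (Outer, k) = (Outer, k + 1)" "cupswap N k (Outer, k + 1) = (Outer, k)"
    using not_dvd_succ[OF N2, of 0] by (auto simp: cupswap_def)
  have free: "cupswap N (j + 1) (Outer, j) = (Outer, j)"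
    using nd[of 1] N zdvd_imp_le[of "int N" 2] by (auto simp: cupswap_def algebra_simps)
  have Dj: "(k = j + 1 \<and> ?D (Outer, j) = ?d (Outer, j + 2)) \<or> (k = j - 1 \<and> ?D (Outer, j) = (Outer, j - 1))"
    using k kO P[of "(Outer, j)"] cup free by (auto simp: add.commute)
  have no_k: "?d (Outer, k) \<noteq> (Outer, k + 1 + t * int N)" for t
    using k
  proof
    assume "k = j + 1"
    then show ?thesis using cup'[of 0] nd[of t] by auto
  next
    assume kj: "k = j - 1"
    show ?thesis
    proof
      assume "?d (Outer, k) = (Outer, k + 1 + t * int N)"
      then have "?d (Outer, j + t * int N) = (Outer, j - 1)" using pmatch_invol[OF d] kj by (metis diff_add_cancel)
      then show False using pmatch_tr[OF d, of t "(Outer, j)"] cup nd[of t] by auto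
    qed
  qed
  have no_j: "?D (Outer, j) \<noteq> (Outer, j + 1 + t * int N)" for t
    using Dj
  proof
    assume "k = j + 1 \<and> ?D (Outer, j) = ?d (Outer, j + 2)"
    then show ?thesis using cup'[of t] pmatch_invol[OF d, of "(Outer, j + 2)"] nd[of t] by auto
  next
    assume "k = j - 1 \<and> ?D (Outer, j) = (Outer, j - 1)"
    then show ?thesis using nd[of t] by auto
  qed
  show "contractible_loops N (E N k) d = 0"
    using no_k[of 0] by (simp add: contractible_loops_E[OF N2 d])
  show "contractible_loops N (E N j) (diagram_comp N (E N k) d) = 0"
    using no_j[of 0] by (simp add: contractible_loops_E[OF N2 mD])
  show "diagram_comp N (E N j) (diagram_comp N (E N k) d) = d"
  proof (rule adiagram.expand, intro conjI ext)
    show "loops (diagram_comp N (E N j) (diagram_comp N (E N k) d)) = loops d"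
      using no_j no_k by (simp add: loops_E_comp[OF N2 mD] loops_E_comp[OF N2 d])
    fix x
    show "pairing (diagram_comp N (E N j) (diagram_comp N (E N k) d)) x = ?d x"
    proof (cases "cupswap N j x = x")
      case False
      then show ?thesis using cp by (simp add: pairing_E_comp[OF N2 mD])
    next
      case x: True
      show ?thesis
      proof (cases "cupswap N k x = x")
        case False
        let ?w = "cupswap N k x"
        note w = nb[OF x False]
        have "?d (cupswap N j ?w) = ?w" using cp[OF w(1)] pmatch_invol[OF d] by metis
        moreover have "cupswap N k ?w \<noteq> ?w" using False kk by metis
        ultimately have "?D (cupswap N j ?w) = ?d x" using P[of "cupswap N j ?w"] w(2) kk by simp
        moreover have "?D x = ?w" using P[of x] False by simp
        ultimately show ?thesis using x w(1) by (simp add: pairing_E_comp[OF N2 mD])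
      next
        case kx: True
        have y: "cupswap N j (?d x) = ?d x" by (rule cc[OF x])
        show ?thesis
        proof (cases "cupswap N k (?d x) = ?d x")
          case True
          then have "?D x = ?d x" using P[of x] kx by simp
          then show ?thesis using x y by (simp add: pairing_E_comp[OF N2 mD])
        next
          case False
          let ?w = "cupswap N k (?d x)"
          note w = nb[OF y False]
          have "?D x = cupswap N j ?w" using P[of x] kx False cp[OF w(1)] by simp
          moreover have "cupswap N j (cupswap N j ?w) \<noteq> cupswap N j ?w" using w(1) kk by metis
          moreover have "?D ?w = ?d x" using P[of ?w] False kk by metis
          ultimately show ?thesis using x cupswap_invol[OF N2] by (simp add: pairing_E_comp[OF N2 mD])
        qed
      qed
    qed
  qed
qed

lemma E_commute:
  assumes N: "N \<ge> 2" and far: "\<not> int N dvd i - j" "\<not> int N dvd i - j - 1" "\<not> int N dvd i - j + 1"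
  shows "diagram_comp N (E N i) (E N j) = diagram_comp N (E N j) (E N i)"
    and "contractible_loops N (E N i) (E N j) = 0"
proof -
  have sep: "cupswap N j x = x" if "cupswap N i x \<noteq> x" "\<not> int N dvd i - j" "\<not> int N dvd i - j - 1" "\<not> int N dvd i - j + 1" for i j x
  proof (rule ccontr)
    assume j: "cupswap N j x \<noteq> x"
    have "int N dvd (snd x - j) - (snd x - i) \<or> int N dvd (snd x - j - 1) - (snd x - i) \<or>
       int N dvd (snd x - j) - (snd x - i - 1) \<or> int N dvd (snd x - j - 1) - (snd x - i - 1)"
      using j that(1) unfolding cupswap_ne by (meson dvd_diff)
    then show False using that(2-4) by (simp add: algebra_simps)
  qed
  have P: "pairing (diagram_comp N (E N i) (E N j)) (s, a) =
      (if cupswap N i (Outer, a) \<noteq> (Outer, a) then (s, snd (cupswap N i (Outer, a)))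
       else if cupswap N j (Outer, a) \<noteq> (Outer, a) then (s, snd (cupswap N j (Outer, a)))
       else (opp s, a))"
    and L: "loops (diagram_comp N (E N i) (E N j)) = 0" and C: "contractible_loops N (E N i) (E N j) = 0"
    if f: "\<not> int N dvd i - j" "\<not> int N dvd i - j - 1" "\<not> int N dvd i - j + 1" for i j s a
  proof -
    have f': "\<not> int N dvd j - i" "\<not> int N dvd j - i - 1" "\<not> int N dvd j - i + 1"
    proof -
      have "j - i = - (i - j)" "j - i - 1 = - (i - j + 1)" "j - i + 1 = - (i - j - 1)" by simp_all
      then show "\<not> int N dvd j - i" "\<not> int N dvd j - i - 1" "\<not> int N dvd j - i + 1"
        using f by (metis dvd_minus_iff)+
    qed
    obtain b where b: "cupswap N i (Outer, a) = (Outer, b)" by (rule cupswap_Outer)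
    obtain c where c: "cupswap N j (Outer, a) = (Outer, c)" by (rule cupswap_Outer)
    have ib: "cupswap N i (Outer, b) = (Outer, a)" using b cupswap_invol[OF N] by metis
    have jc: "cupswap N j (Outer, c) = (Outer, a)" using c cupswap_invol[OF N] by metis
    have bj: "cupswap N j (Outer, b) = (Outer, b)" if "b \<noteq> a"
      using sep[of i "(Outer, b)" j] that ib f by simp
    have aj: "c = a" if "b \<noteq> a" using sep[of i "(Outer, a)" j] that b c f by simp
    have ci: "cupswap N i (Outer, c) = (Outer, c)" if "c \<noteq> a"
      using sep[of j "(Outer, c)" i] that jc f' by simp
    show "pairing (diagram_comp N (E N i) (E N j)) (s, a) =
      (if cupswap N i (Outer, a) \<noteq> (Outer, a) then (s, snd (cupswap N i (Outer, a)))
       else if cupswap N j (Outer, a) \<noteq> (Outer, a) then (s, snd (cupswap N j (Outer, a)))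
       else (opp s, a))"
      using b c ib jc bj aj ci
      by (cases s; cases "b = a"; cases "c = a") (simp_all add: pairing_E_comp[OF N pmatch_E[OF N]] pairing_E)
    have "cupswap N i (Outer, i) \<noteq> (Outer, i)" by (simp add: cupswap_ne)
    then have "pairing (E N j) (Outer, i) = (Inner, i)" using sep f by (simp add: pairing_E)
    then show "loops (diagram_comp N (E N i) (E N j)) = 0" "contractible_loops N (E N i) (E N j) = 0"
      by (simp_all add: loops_E_comp[OF N pmatch_E[OF N]] contractible_loops_E[OF N pmatch_E[OF N]])
  qed
  have far': "\<not> int N dvd j - i" "\<not> int N dvd j - i - 1" "\<not> int N dvd j - i + 1"
  proof -
    have "j - i = - (i - j)" "j - i - 1 = - (i - j + 1)" "j - i + 1 = - (i - j - 1)" by simp_all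
    then show "\<not> int N dvd j - i" "\<not> int N dvd j - i - 1" "\<not> int N dvd j - i + 1"
      using far by (metis dvd_minus_iff)+
  qed
  show "diagram_comp N (E N i) (E N j) = diagram_comp N (E N j) (E N i)"
  proof (rule adiagram.expand, intro conjI ext)
    fix x :: point
    obtain s a where x: "x = (s, a)" by (cases x)
    show "pairing (diagram_comp N (E N i) (E N j)) x = pairing (diagram_comp N (E N j) (E N i)) x"
      unfolding x P[OF far] P[OF far'] using sep[of i "(Outer, a)" j] far by auto
  qed (simp add: L[OF far] L[OF far'])
  show "contractible_loops N (E N i) (E N j) = 0" by (rule C[OF far])
qed

lemma cupswap_shift: "cupswap N (j + c) (Outer, i + c) = tr c (cupswap N j (Outer, i))"
  by (auto simp: cupswap_def algebra_simps)

lemma U_E: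
  assumes N: "N \<ge> 2"
  shows "diagram_comp N (U c) (E N j) = diagram_comp N (E N (j + c)) (U c)"
    and "contractible_loops N (E N (j + c)) (U c) = 0"
proof -
  have N0: "N > 0" using N by simp
  note uc = U_comp(1)[OF N0 pmatch_E[OF N], of c j]
  show "contractible_loops N (E N (j + c)) (U c) = 0"
    by (simp add: contractible_loops_E[OF N pmatch_U])
  show "diagram_comp N (U c) (E N j) = diagram_comp N (E N (j + c)) (U c)"
  proof (rule adiagram.expand, intro conjI ext)
    show "loops (diagram_comp N (U c) (E N j)) = loops (diagram_comp N (E N (j + c)) (U c))"
      by (simp add: uc loops_E_comp[OF N pmatch_U])
    fix x :: point
    obtain s a where x: "x = (s, a)" by (cases x)
    obtain b where b: "cupswap N j (Outer, a) = (Outer, b)" by (rule cupswap_Outer)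
    obtain b' where b': "cupswap N j (Outer, a - c) = (Outer, b')" by (rule cupswap_Outer)
    have 1: "cupswap N (j + c) (Outer, a + c) = (Outer, b + c)" using cupswap_shift[of N j c a] b by simp
    have 2: "cupswap N (j + c) (Outer, a) = (Outer, b' + c)" using cupswap_shift[of N j c "a - c"] b' by simp
    show "pairing (diagram_comp N (U c) (E N j)) x = pairing (diagram_comp N (E N (j + c)) (U c)) x"
      by (cases s) (auto simp: uc x pairing_E pairing_E_comp[OF N pmatch_U] b b' 1 2)
  qed
qed

section \<open>Generation of the diagrams\<close>

text \<open>Loop-free products: such a diagram equals the corresponding product of generators in the
  algebra with coefficient one, whatever the value of \<open>m\<close>.\<close>

inductive gen :: "nat \<Rightarrow> adiagram \<Rightarrow> bool" for N where
  gen_u: "gen N (U 1)"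
| gen_u_inv: "gen N (U (- 1))"
| gen_e: "N \<ge> 2 \<Longrightarrow> gen N (E N 1)"
| gen_comp: "gen N d \<Longrightarrow> gen N d' \<Longrightarrow> contractible_loops N d d' = 0 \<Longrightarrow> gen N (diagram_comp N d d')"

lemma gen_pmatch: assumes "N > 0" "gen N d" shows "pmatch N d"
  using assms(2) by induction (auto intro: pmatch_U pmatch_E pmatch_comp assms(1))

lemma gen_U: assumes "N > 0" shows "gen N (U c)"
proof (induction c rule: int_induct[of _ 0])
  case base
  show ?case using gen_comp[OF gen_u[of N] gen_u_inv[of N]] U_comp(2)[OF assms pmatch_U] U_U[OF assms, of 1 "- 1"] by simp
next
  case (step1 i)
  then show ?case using gen_comp[OF step1(2) gen_u] U_comp(2)[OF assms pmatch_U] U_U[OF assms, of i 1] by simp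
next
  case (step2 i)
  then show ?case using gen_comp[OF step2(2) gen_u_inv] U_comp(2)[OF assms pmatch_U] U_U[OF assms, of i "- 1"] by simp
qed

text \<open>\<open>E N j\<close> is the conjugate of \<open>E N 1\<close> by the rotation
  \<open>U (j - 1)\<close>.\<close>

lemma gen_E: assumes "N \<ge> 2" shows "gen N (E N j)"
proof -
  have N: "N > 0" using assms by simp
  define c where "c = j - 1"
  have j: "1 + c = j" by (simp add: c_def)
  have UE: "diagram_comp N (U c) (E N 1) = diagram_comp N (E N j) (U c)" "contractible_loops N (E N j) (U c) = 0"
    using U_E(1)[OF assms, of c 1] U_E(2)[OF assms, of 1 c] unfolding j by simp_all
  have 1: "gen N (diagram_comp N (U c) (E N 1))"
    by (intro gen_comp gen_U gen_e assms N U_comp(2) pmatch_E)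
  note p = pmatch_E[OF assms, of j] pmatch_U[of N c] pmatch_U[of N "- c"]
  have UU: "diagram_comp N (U c) (U (- c)) = U 0" using U_U[OF N, of c "- c"] by simp
  have 2: "diagram_comp N (diagram_comp N (U c) (E N 1)) (U (- c)) = E N j"
    unfolding UE comp_assoc[OF N p] UU using p N by simp
  \<comment> \<open>The loops are counted in the other bracketing, where in each product one factor
    is a rotation.\<close>
  have "contractible_loops N (diagram_comp N (U c) (E N 1)) (U (- c)) = 0"
    using comp_assoc_loops(1)[OF N p] unfolding UE UU
    using p N U_comp(2)[OF N pmatch_U] by simp
  from gen_comp[OF 1 gen_U[OF N] this] show ?thesis unfolding 2 .
qed

text \<open>Planarity is handed on one generator at a time, so only left multiplication by
  \<open>U c\<close> and \<open>E N j\<close> has to be known to preserve it.\<close>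

lemma gen_comp_adiagrams:
  assumes "N > 0" "gen N d" "x \<in> adiagrams N"
  shows "diagram_comp N d x \<in> adiagrams N"
  using assms(2,3)
proof (induction arbitrary: x)
  case (gen_comp d d')
  note p = gen_pmatch[OF assms(1) gen_comp(1)] gen_pmatch[OF assms(1) gen_comp(2)] adiagrams_pmatch[OF gen_comp.prems]
  show ?case unfolding comp_assoc[OF assms(1) p] by (intro gen_comp)
qed (auto intro: U_comp_adiagrams E_comp_adiagrams assms(1))

lemma gen_mirror: assumes "N > 0" "gen N d" shows "gen N (mirror d)"
  using assms(2)
proof induction
  case (gen_comp d d')
  then have "gen N (diagram_comp N (mirror d') (mirror d))"
    by (intro gen.gen_comp) (simp_all add: mirror_loops)
  then show ?case using comp_mirror[OF assms(1)] gen_pmatch[OF assms(1)] gen_comp by simp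
qed (auto simp: mirror_U mirror_E intro: gen.intros)

text \<open>Applying the pairing twice would translate \<open>x\<close> by twice the amount and yet
  return it to its place.\<close>

lemma pmatch_ne_tr: assumes "pmatch N d" shows "pairing d x \<noteq> tr (t * int N) x"
proof
  assume *: "pairing d x = tr (t * int N) x"
  then have "x = tr (t * int N) (pairing d x)" using assms by (metis pmatch_invol pmatch_tr)
  then have "x = tr (t * int N) (tr (t * int N) x)" using * by simp
  then have "t * int N = 0" by (cases x) simp
  then show False using * assms by (metis pmatch_nofix tr_0)
qed

lemma through_monotone:
  assumes d: "d \<in> adiagrams N" and i: "pairing d (Outer, i) = (Inner, k)" "pairing d (Outer, j) = (Inner, l)" "i < j"
  shows "k < l"
proof -
  have "btw (Outer, i) (Inner, k) (Outer, j)" using i by (simp add: btw_def pos_Outer pos_Outer_Inner)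
  then have "btw (Outer, i) (Inner, k) (Inner, l)"
    using noncrossingD[OF d, of "(Outer, j)" "(Outer, i)"] i by simp
  then show ?thesis by (auto simp: btw_def pos_Inner pos_Inner_Outer)
qed

text \<open>The inner ends form a strictly increasing function that gains exactly \<open>N\<close>
  over \<open>N\<close> consecutive points, so each single step is 1.\<close>

lemma no_outer_arcs:
  assumes d: "d \<in> adiagrams N" and N: "N > 0" and out: "\<And>i. fst (pairing d (Outer, i)) = Inner"
  shows "\<exists>c. d = U c"
proof -
  note m = adiagrams_pmatch[OF d]
  define f where "f i = snd (pairing d (Outer, i))" for i
  have f: "pairing d (Outer, i) = (Inner, f i)" for i
    using out[of i] by (simp add: f_def prod_eq_iff)
  have mono: "f i < f j" if "i < j" for i j
    by (rule through_monotone[OF d f f that])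
  have per: "f (i + int N) = f i + int N" for i
    using pmatch_tr[OF m, of 1 "(Outer, i)"] f by simp
  have low: "f (i + int n) \<ge> f i + int n" for i n
  proof (induction n)
    case (Suc n)
    have "f (i + int n) < f (i + int (Suc n))" by (rule mono) simp
    then show ?case using Suc by simp
  qed simp
  have step: "f (i + 1) = f i + 1" for i
  proof -
    have "f (i + 1 + int (N - 1)) \<ge> f (i + 1) + int (N - 1)" by (rule low)
    then have "f (i + 1) \<le> f i + 1" using per[of i] N by (simp add: of_nat_diff)
    then show ?thesis using mono[of i "i + 1"] by simp
  qed
  have fc: "f i = i + f 0" for i
  proof (induction i rule: int_induct[of _ 0])
    case (step1 i) then show ?case using step[of i] by simp
  next
    case (step2 i) then show ?case using step[of "i - 1"] by simp
  qed simp
  have O: "pairing d (Outer, i) = (Inner, i + f 0)" for i unfolding f[of i] by (subst fc) (rule refl)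
  have I: "pairing d (Inner, i) = (Outer, i - f 0)" for i
    using pmatch_invol[OF m, of "(Outer, i - f 0)"] O[of "i - f 0"] by simp
  have "loops d = 0"
  proof (rule ccontr)
    assume "loops d \<noteq> 0"
    then have "fst (pairing d (Outer, 0)) = Outer" using d unfolding adiagrams_noncrossing by simp
    then show False using out by simp
  qed
  then have "d = U (- f 0)"
  proof (intro adiagram.expand conjI ext)
    fix x show "pairing d x = pairing (U (- f 0)) x" by (cases x; cases "fst x") (auto simp: O I)
  qed simp
  then show ?thesis ..
qed

subsection \<open>The total displacement\<close>

definition fund :: "nat \<Rightarrow> point set" where
  "fund N = {Outer, Inner} \<times> {0..<int N}"

definition disp :: "adiagram \<Rightarrow> point \<Rightarrow> int" where
  "disp d x = \<bar>snd (pairing d x) - snd x\<bar>"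

definition total :: "nat \<Rightarrow> adiagram \<Rightarrow> nat" where
  "total N d = nat (\<Sum>x \<in> fund N. disp d x)"

lemma finite_fund: "finite (fund N)"
  by (simp add: fund_def)

lemma total_mirror: "total N (mirror d) = total N d"
proof -
  let ?o = "map_prod opp id :: point \<Rightarrow> point"
  have oo: "?o (?o x) = x" for x by (cases x) simp
  have bij: "bij_betw ?o (fund N) (fund N)"
    by (rule bij_betwI[of _ _ _ ?o]) (auto simp: fund_def)
  have "disp (mirror d) x = disp d (?o x)" for x
    by (cases x; cases "fst x") (auto simp: disp_def)
  then have "(\<Sum>x \<in> fund N. disp (mirror d) x) = (\<Sum>x \<in> fund N. disp d (?o x))" by simp
  also have "\<dots> = (\<Sum>x \<in> fund N. disp d x)" by (rule sum.reindex_bij_betw[OF bij])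
  finally have "(\<Sum>x \<in> fund N. disp (mirror d) x) = (\<Sum>x \<in> fund N. disp d x)" .
  then show ?thesis by (simp add: total_def)
qed

text \<open>A periodic function supported on the translates of inequivalent points \<open>P\<close>
  may be summed over \<open>P\<close> instead of a fundamental domain. The change of total
  displacement is thereby computed at four points only, wherever they lie.\<close>

lemma sum_fund:
  fixes g :: "point \<Rightarrow> int"
  assumes N: "N > 0" and per: "\<And>t x. g (tr (t * int N) x) = g x" and P: "finite P"
    and ineq: "\<And>p p' t. p \<in> P \<Longrightarrow> p' \<in> P \<Longrightarrow> p' = tr (t * int N) p \<Longrightarrow> p' = p"
    and supp: "\<And>x. (\<And>p t. p \<in> P \<Longrightarrow> x \<noteq> tr (t * int N) p) \<Longrightarrow> g x = 0"
  shows "(\<Sum>x \<in> fund N. g x) = (\<Sum>p \<in> P. g p)"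
proof -
  define red where "red x = (fst x, snd x mod int N)" for x :: point
  have red: "red x = tr ((- (snd x div int N)) * int N) x" for x
    by (simp add: red_def tr_def minus_div_mult_eq_mod[symmetric])
  have inj: "inj_on red P"
  proof (rule inj_onI)
    fix p p' assume p: "p \<in> P" "p' \<in> P" "red p = red p'"
    then have "tr ((snd p' div int N) * int N) (red p) = p'" by (simp add: red)
    then have "p' = tr ((snd p' div int N - snd p div int N) * int N) p"
      unfolding red[of p] by (simp add: algebra_simps)
    then show "p = p'" using ineq[OF p(1,2)] by metis
  qed
  have fst_cases: "fst x \<in> {Outer, Inner}" for x :: point by (cases "fst x") auto
  have sub: "red ` P \<subseteq> fund N"
    using N fst_cases by (auto simp: red_def fund_def)
  have "(\<Sum>p \<in> P. g p) = (\<Sum>p \<in> P. g (red p))" by (simp only: red per)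
  also have "\<dots> = (\<Sum>x \<in> red ` P. g x)" by (simp add: sum.reindex[OF inj])
  also have "\<dots> = (\<Sum>x \<in> fund N. g x)"
  proof (rule sum.mono_neutral_left[OF finite_fund sub], rule ballI)
    fix x assume x: "x \<in> fund N - red ` P"
    show "g x = 0"
    proof (rule supp)
      fix p t assume p: "p \<in> P"
      show "x \<noteq> tr (t * int N) p"
      proof
        assume xp: "x = tr (t * int N) p"
        have "red x = x" using x by (cases x) (auto simp: red_def fund_def)
        moreover have "red x = red p" by (simp add: xp red_def)
        ultimately show False using x p by auto
      qed
    qed
  qed
  finally show ?thesis by simp
qed

text \<open>The point of this lemma is \<open>d = e\<^bsub>i+1\<^esub> D\<close>, with \<open>D\<close> of smaller total displacement.\<close>

lemma slide:
  assumes d: "d \<in> adiagrams N" and N: "N > 0"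
    and cup: "pairing d (Outer, i + 1) = (Outer, i + 2)"
    and arc: "pairing d (Outer, i) = (s, b)" and b: "b \<ge> i + 2"
  defines "D \<equiv> diagram_comp N (E N i) d"
  shows "D \<in> adiagrams N" and "total N D < total N d" and "gen N D \<Longrightarrow> gen N d"
    and "pairing D (Outer, i + t * int N) = (Outer, i + 1 + t * int N)"
    and "pairing D (Outer, i + 1 + t * int N) = (Outer, i + t * int N)"
    and "pairing D (Outer, i + 2 + t * int N) = (s, b + t * int N)"
    and "pairing D (s, b + t * int N) = (Outer, i + 2 + t * int N)"
    and "(\<And>t. x \<notin> {(Outer, i + t * int N), (Outer, i + 1 + t * int N), (Outer, i + 2 + t * int N), (s, b + t * int N)}) \<Longrightarrow>
      pairing D x = pairing d x"
proof -
  note m = adiagrams_pmatch[OF d]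
  note ne = pmatch_ne_tr[OF m]
  have cup': "pairing d (Outer, i + 2) = (Outer, i + 1)" using cup pmatch_invol[OF m] by metis
  \<comment> \<open>For \<open>N = 1\<close> the short arc would join a point to its translate; for
    \<open>N = 2\<close> the long arc would be a translate of the short one, against
    \<open>b >= i + 2\<close>.\<close>
  have N3: "N \<ge> 3"
  proof (rule ccontr)
    assume "\<not> N \<ge> 3"
    then consider "N = 1" | "N = 2" using N by linarith
    then show False
    proof cases
      case 1
      then show False using ne[of "(Outer, i + 1)" 1] cup by simp
    next
      case 2
      then have "pairing d (Outer, i + 2) = tr 2 (pairing d (Outer, i))"
        using pmatch_tr[OF m, of 1 "(Outer, i)"] by simp
      then show False using cup' arc b by simp
    qed
  qed
  then have N2: "N \<ge> 2" by simp
  note sl = E_slide[OF N3 _ m, of i "i + 1"]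
  have cup2: "pairing d (Outer, i + 1) = (Outer, i + 1 + 1)" using cup by simp
  show DN: "D \<in> adiagrams N" unfolding D_def by (rule E_comp_adiagrams[OF N2 d])
  note mD = adiagrams_pmatch[OF DN]
  show "gen N D \<Longrightarrow> gen N d"
    using gen_comp[OF gen_E[OF N2, of "i + 1"], of D] sl cup2 unfolding D_def by simp
  note P = pairing_E_comp[OF N2 m, of i, folded D_def]
  have ndv: "\<not> int N dvd 1" "\<not> int N dvd 2"
    using N3 zdvd_imp_le[of "int N" 1] zdvd_imp_le[of "int N" 2] by auto
  have tN: "t * int N \<noteq> 1" "t * int N \<noteq> 2" "t * int N \<noteq> - 1" "t * int N \<noteq> - 2" for t
  proof -
    show "t * int N \<noteq> 1" "t * int N \<noteq> 2" using ndv dvd_triv_right[of "int N" t] by metis+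
    show "t * int N \<noteq> - 1" "t * int N \<noteq> - 2" using ndv dvd_triv_right[of "int N" t] by (metis dvd_minus_iff)+
  qed
  have k0: "cupswap N i (Outer, i) = (Outer, i + 1)" "cupswap N i (Outer, i + 1) = (Outer, i)"
    using not_dvd_succ[OF N2, of 0] by (auto simp: cupswap_def)
  have ktype: "\<exists>t. x = (Outer, i + t * int N) \<or> x = (Outer, i + 1 + t * int N)" if "cupswap N i x \<noteq> x" for x
    using cupswap_types[OF N2 _ that, of "(Outer, i)"] k0 by auto
  have k2: "cupswap N i (Outer, i + 2) = (Outer, i + 2)"
  proof (rule ccontr)
    assume "cupswap N i (Outer, i + 2) \<noteq> (Outer, i + 2)"
    from ktype[OF this] obtain t where "t * int N = 2 \<or> t * int N = 1" by auto
    then show False using tN by blast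
  qed
  have arc': "pairing d (s, b) = (Outer, i)" using arc pmatch_invol[OF m] by metis
  \<comment> \<open>The far end of the long arc is no translate of \<open>i\<close>,
    \<open>i + 1\<close> or \<open>i + 2\<close>; hence the four points affected by the product are
    inequivalent modulo \<open>N\<close>.\<close>
  have n0: "(s, b) \<noteq> (Outer, i + t * int N)" for t using ne[of "(Outer, i)" t] arc by simp
  have n1: "(s, b) \<noteq> (Outer, i + 1 + t * int N)" for t
  proof
    assume *: "(s, b) = (Outer, i + 1 + t * int N)"
    then have "pairing d (s, b) = (Outer, i + 2 + t * int N)"
      using pmatch_tr[OF m, of t "(Outer, i + 1)"] cup by simp
    then show False using arc' tN(4)[of t] by auto
  qed
  have n2: "(s, b) \<noteq> (Outer, i + 2 + t * int N)" for t
  proof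
    assume *: "(s, b) = (Outer, i + 2 + t * int N)"
    then have "pairing d (s, b) = (Outer, i + 1 + t * int N)"
      using pmatch_tr[OF m, of t "(Outer, i + 2)"] cup' by simp
    then show False using arc' tN(3)[of t] by auto
  qed
  have kb: "cupswap N i (s, b) = (s, b)" using ktype[of "(s, b)"] n0 n1 by blast
  have D0: "pairing D (Outer, i) = (Outer, i + 1)" "pairing D (Outer, i + 1) = (Outer, i)"
    using P[of "(Outer, i)"] P[of "(Outer, i + 1)"] k0 by simp_all
  have D2: "pairing D (Outer, i + 2) = (s, b)"
    using P[of "(Outer, i + 2)"] k0 k2 cup' arc by simp
  have Db: "pairing D (s, b) = (Outer, i + 2)" using D2 pmatch_invol[OF mD] by metis
  show "pairing D (Outer, i + t * int N) = (Outer, i + 1 + t * int N)"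
    "pairing D (Outer, i + 1 + t * int N) = (Outer, i + t * int N)"
    "pairing D (Outer, i + 2 + t * int N) = (s, b + t * int N)"
    "pairing D (s, b + t * int N) = (Outer, i + 2 + t * int N)" for t
    using pmatch_tr[OF mD, of t "(Outer, i)"] pmatch_tr[OF mD, of t "(Outer, i + 1)"]
      pmatch_tr[OF mD, of t "(Outer, i + 2)"] pmatch_tr[OF mD, of t "(s, b)"] D0 D2 Db by simp_all
  show other: "pairing D x = pairing d x"
    if x: "\<And>t. x \<notin> {(Outer, i + t * int N), (Outer, i + 1 + t * int N), (Outer, i + 2 + t * int N), (s, b + t * int N)}" for x
  proof -
    have "cupswap N i x = x" using ktype[of x] x by blast
    moreover have "cupswap N i (pairing d x) = pairing d x"
    proof (rule ccontr)
      assume "cupswap N i (pairing d x) \<noteq> pairing d x"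
      from ktype[OF this] obtain t where "pairing d x = tr (t * int N) (Outer, i) \<or> pairing d x = tr (t * int N) (Outer, i + 1)" by auto
      then have "x = tr (t * int N) (pairing d (Outer, i)) \<or> x = tr (t * int N) (pairing d (Outer, i + 1))"
        using m by (metis pmatch_invol pmatch_tr)
      then show False using x[of t] arc cup by auto
    qed
    ultimately show ?thesis using P[of x] by simp
  qed
  define g where "g x = disp d x - disp D x" for x
  let ?P = "{(Outer, i), (Outer, i + 1), (Outer, i + 2), (s, b)}"
  have dist: "(Outer, i) \<noteq> (s, b)" "(Outer, i + 1) \<noteq> (s, b)" "(Outer, i + 2) \<noteq> (s, b)"
    using n0[of 0] n1[of 0] n2[of 0] by auto
  have "(\<Sum>x \<in> fund N. g x) = (\<Sum>p \<in> ?P. g p)"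
  proof (rule sum_fund[OF N])
    show "g (tr (t * int N) x) = g x" for t x
      by (simp add: g_def disp_def pmatch_tr[OF m] pmatch_tr[OF mD])
    show "finite ?P" by simp
    fix p p' t assume p: "p \<in> ?P" "p' \<in> ?P" "p' = tr (t * int N) p"
    have inv: "p = tr ((- t) * int N) p'" using p(3) by simp
    show "p' = p"
    proof (cases "p = (s, b) \<or> p' = (s, b)")
      case True
      then show ?thesis
      proof
        assume "p = (s, b)"
        then show ?thesis using p(2) inv n0[of "- t"] n1[of "- t"] n2[of "- t"] by auto
      next
        assume "p' = (s, b)"
        then show ?thesis using p(1,3) n0[of t] n1[of t] n2[of t] by auto
      qed
    next
      case False
      then show ?thesis using p tN[of t] by auto
    qed
  next
    fix x assume x: "\<And>p t. p \<in> ?P \<Longrightarrow> x \<noteq> tr (t * int N) p"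
    have "pairing D x = pairing d x"
    proof (rule other)
      fix t
      show "x \<notin> {(Outer, i + t * int N), (Outer, i + 1 + t * int N), (Outer, i + 2 + t * int N), (s, b + t * int N)}"
        using x[of "(Outer, i)" t] x[of "(Outer, i + 1)" t] x[of "(Outer, i + 2)" t] x[of "(s, b)" t] by auto
    qed
    then show "g x = 0" by (simp add: g_def disp_def)
  qed
  also have "\<dots> = g (Outer, i) + (g (Outer, i + 1) + (g (Outer, i + 2) + g (s, b)))"
    using dist by simp
  \<comment> \<open>The four differences are \<open>b - i - 1\<close>, \<open>0\<close>,
    \<open>1 - (b - i - 2)\<close> and \<open>2\<close>.\<close>
  also have "\<dots> = 4"
    using D0 D2 Db arc arc' cup cup' b by (simp add: g_def disp_def)
  finally have "(\<Sum>x \<in> fund N. disp d x) - (\<Sum>x \<in> fund N. disp D x) = 4"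
    by (simp add: g_def sum_subtractf)
  moreover have "(\<Sum>x \<in> fund N. disp D x) \<ge> 0" by (simp add: disp_def sum_nonneg)
  ultimately show "total N D < total N d" unfolding total_def by linarith
qed

section \<open>Arcs nested around a short arc\<close>

definition simple_outer :: "adiagram \<Rightarrow> bool" where
  "simple_outer d \<longleftrightarrow> (\<forall>i k. pairing d (Outer, i) = (Outer, k) \<longrightarrow> k = i + 1 \<or> k = i - 1)"

text \<open>Take a shortest arc among those that do not join neighbours. The point next to its left
  end is paired underneath it, hence by a shorter arc, which by minimality joins neighbours.\<close>

lemma nested_arc:
  assumes d: "d \<in> adiagrams N" and ns: "\<not> simple_outer d"
  shows "\<exists>a b. pairing d (Outer, a + 1) = (Outer, a + 2) \<and> pairing d (Outer, a) = (Outer, b) \<and> b \<ge> a + 2"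
proof -
  note m = adiagrams_pmatch[OF d]
  let ?Q = "\<lambda>n. n \<ge> 2 \<and> (\<exists>i. pairing d (Outer, i) = (Outer, i + int n))"
  obtain i k where ik: "pairing d (Outer, i) = (Outer, k)" "k \<noteq> i + 1" "k \<noteq> i - 1"
    using ns by (auto simp: simple_outer_def)
  have ki: "pairing d (Outer, k) = (Outer, i)" using ik pmatch_invol[OF m] by metis
  have "k \<noteq> i" using ik pmatch_nofix[OF m] by metis
  have "\<exists>n. ?Q n"
  proof (cases "i < k")
    case True
    then show ?thesis using ik by (intro exI[of _ "nat (k - i)"] conjI exI[of _ i]) auto
  next
    case False
    then show ?thesis using ik ki \<open>k \<noteq> i\<close> by (intro exI[of _ "nat (i - k)"] conjI exI[of _ k]) auto
  qed
  then have Q: "?Q (LEAST n. ?Q n)" by (rule LeastI_ex)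
  define n where "n = (LEAST n. ?Q n)"
  obtain a where a: "n \<ge> 2" "pairing d (Outer, a) = (Outer, a + int n)" using Q unfolding n_def by blast
  have min: "n \<le> n'" if "?Q n'" for n' unfolding n_def by (rule Least_le[of ?Q, OF that])
  have "btw (Outer, a) (Outer, a + int n) (Outer, a + 1)" using a by (simp add: btw_def pos_Outer)
  then have "btw (Outer, a) (Outer, a + int n) (pairing d (Outer, a + 1))"
    using noncrossingD[OF d, of "(Outer, a + 1)" "(Outer, a)"] a by auto
  then obtain c where c: "pairing d (Outer, a + 1) = (Outer, c)" "a < c" "c < a + int n"
    by (cases "pairing d (Outer, a + 1)"; cases "fst (pairing d (Outer, a + 1))")
      (auto simp: btw_def pos_Outer pos_Inner_Outer)
  have "c \<noteq> a + 1" using c pmatch_nofix[OF m] by metis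
  have "c = a + 2"
  proof (rule ccontr)
    assume "c \<noteq> a + 2"
    then have "?Q (nat (c - (a + 1)))" using c \<open>c \<noteq> a + 1\<close>
      by (intro conjI exI[of _ "a + 1"]) auto
    from min[OF this] show False using c \<open>c \<noteq> a + 1\<close> by linarith
  qed
  then show ?thesis using a c by (intro exI[of _ a] exI[of _ "a + int n"]) auto
qed

subsection \<open>Diagrams with parallel cups and caps\<close>

text \<open>The product of the commuting generators \<open>E N j\<close> for \<open>j\<close> in
  \<open>J\<close>, provided that \<open>J\<close> is periodic and contains no two
  neighbours.\<close>

definition cups :: "int set \<Rightarrow> adiagram" where
  "cups J = ADiagram (\<lambda>(s, i). if i \<in> J then (s, i + 1) else if i - 1 \<in> J then (s, i - 1) else (opp s, i)) 0"

lemma pairing_cups: "pairing (cups J) (s, i) =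
    (if i \<in> J then (s, i + 1) else if i - 1 \<in> J then (s, i - 1) else (opp s, i))"
  by (simp add: cups_def)

lemma loops_cups [simp]: "loops (cups J) = 0"
  by (simp add: cups_def)

lemma pmatch_cups:
  assumes per: "\<And>i. i + int N \<in> J \<longleftrightarrow> i \<in> J" and sep: "\<And>i. i \<in> J \<Longrightarrow> i + 1 \<notin> J"
  shows "pmatch N (cups J)"
  unfolding pmatch_def
proof (intro conjI allI)
  fix x :: point
  obtain s i where x: "x = (s, i)" by (cases x)
  show "pairing (cups J) (pairing (cups J) x) = x"
    using sep[of i] sep[of "i - 1"] sep[of "i - 2"] by (auto simp: x pairing_cups)
  show "pairing (cups J) x \<noteq> x" by (cases s) (auto simp: x pairing_cups)
  have eq: "i + int N - 1 = (i - 1) + int N" by simp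
  have "i + int N - 1 \<in> J \<longleftrightarrow> i - 1 \<in> J" unfolding eq by (rule per)
  then show "pairing (cups J) (tr (int N) x) = tr (int N) (pairing (cups J) x)"
    using per[of i] by (simp add: x pairing_cups)
qed

lemma gen_cups:
  assumes N: "N > 0" and "\<And>i. i + int N \<in> J \<longleftrightarrow> i \<in> J" "\<And>i. i \<in> J \<Longrightarrow> i + 1 \<notin> J"
  shows "gen N (cups J)"
  using assms(2,3)
proof (induction "card (J \<inter> {0..<int N})" arbitrary: J rule: less_induct)
  case less
  note per = less.prems(1) and sep = less.prems(2)
  have per': "i + t * int N \<in> J \<longleftrightarrow> i \<in> J" for i t
  proof (induction t rule: int_induct[of _ 0])
    case (step1 t) then show ?case using per[of "i + t * int N"] by (simp add: algebra_simps)
  next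
    case (step2 t) then show ?case using per[of "i + (t - 1) * int N"] by (simp add: algebra_simps)
  qed simp
  have mod: "i mod int N \<in> J \<longleftrightarrow> i \<in> J" for i
    using per'[of i "- (i div int N)"] by (simp add: minus_div_mult_eq_mod[symmetric])
  show ?case
  proof (cases "J = {}")
    case True
    have "cups {} = U 0" unfolding cups_def U_def by (auto intro!: ext split: side.splits)
    then show ?thesis using True gen_U[OF N] by simp
  next
    case False
    then obtain j where j: "j \<in> J" by blast
    have N2: "N \<ge> 2"
    proof (rule ccontr)
      assume "\<not> N \<ge> 2"
      then have "N = 1" using N by simp
      then show False using per[of j] sep[OF j] j by simp
    qed
    have jJ: "i \<in> J" if "int N dvd i - j" for i
      using that j per'[of j] by (auto elim: dvd_diffE)
    \<comment> \<open>Removing the whole residue class of \<open>j\<close> removes exactly one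
      generator.\<close>
    define J' where "J' = {i \<in> J. \<not> int N dvd i - j}"
    have J': "i \<in> J' \<longleftrightarrow> i \<in> J \<and> \<not> int N dvd i - j" for i by (simp add: J'_def)
    have sep': "i \<in> J' \<Longrightarrow> i + 1 \<notin> J'" for i using sep J' by blast
    have perJ': "i + int N \<in> J' \<longleftrightarrow> i \<in> J'" for i
    proof -
      have eq: "i + int N - j = (i - j) + int N" by simp
      have "int N dvd i + int N - j \<longleftrightarrow> int N dvd i - j" unfolding eq by (rule dvd_add_triv_right_iff)
      then show ?thesis using per[of i] by (simp add: J')
    qed
    have "card (J' \<inter> {0..<int N}) < card (J \<inter> {0..<int N})"
    proof (rule psubset_card_mono)
      have "j mod int N \<in> J \<inter> {0..<int N}" using mod[of j] j N by simp
      moreover have "j mod int N \<notin> J'" by (simp add: J' mod_eq_dvd_iff[symmetric])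
      ultimately show "J' \<inter> {0..<int N} \<subset> J \<inter> {0..<int N}" using J' by blast
    qed simp
    then have gJ': "gen N (cups J')" using less.hyps perJ' sep' by blast
    have m: "pmatch N (cups J')" by (rule pmatch_cups[OF perJ']) (rule sep')
    have base: "pairing (cups J') (Outer, j) = (Inner, j)"
      using sep[of "j - 1"] j by (auto simp: pairing_cups J')
    have "diagram_comp N (E N j) (cups J') = cups J"
    proof (rule adiagram.expand, intro conjI ext)
      show "loops (diagram_comp N (E N j) (cups J')) = loops (cups J)"
        by (simp add: loops_E_comp[OF N2 m] base)
      fix x :: point
      obtain s i where x: "x = (s, i)" by (cases x)
      have F: "int N dvd i - j \<Longrightarrow> i \<in> J" "int N dvd i - j - 1 \<Longrightarrow> i - 1 \<in> J"
        "int N dvd i + 1 - j \<Longrightarrow> i + 1 \<in> J" "int N dvd i - 1 - j \<Longrightarrow> i - 1 \<in> J" "int N dvd i - 1 - j - 1 \<Longrightarrow> i - 2 \<in> J"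
        using jJ[of i] jJ[of "i - 1"] jJ[of "i + 1"] jJ[of "i - 2"] by (simp_all add: algebra_simps)
      have S: "i \<in> J \<Longrightarrow> i + 1 \<notin> J" "i - 1 \<in> J \<Longrightarrow> i \<notin> J" "i - 2 \<in> J \<Longrightarrow> i - 1 \<notin> J"
        using sep[of i] sep[of "i - 1"] sep[of "i - 2"] by simp_all
      have e: "int N dvd i - 1 - j \<longleftrightarrow> int N dvd i - j - 1" "int N dvd i + 1 - j - 1 \<longleftrightarrow> int N dvd i - j"
        by (simp_all add: algebra_simps)
      show "pairing (diagram_comp N (E N j) (cups J')) x = pairing (cups J) x"
        unfolding x pairing_E_comp[OF N2 m]
        using F S e by (cases s) (auto simp: cupswap_def pairing_cups J')
    qed
    moreover have "contractible_loops N (E N j) (cups J') = 0"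
      by (simp add: contractible_loops_E[OF N2 m] base)
    ultimately show ?thesis using gen_comp[OF gen_E[OF N2, of j] gJ'] by simp
  qed
qed

text \<open>The diagrams without through lines all of whose arcs join neighbours; \<open>p\<close>, \<open>p'\<close> matter modulo 2 only.\<close>

definition parallel :: "int \<Rightarrow> int \<Rightarrow> nat \<Rightarrow> adiagram" where
  "parallel p p' l = ADiagram (\<lambda>(s, i). (s, if even (i - (case s of Outer \<Rightarrow> p | Inner \<Rightarrow> p')) then i + 1 else i - 1)) l"

lemma pairing_parallel:
  "pairing (parallel p p' l) (Outer, i) = (Outer, if even (i - p) then i + 1 else i - 1)"
  "pairing (parallel p p' l) (Inner, i) = (Inner, if even (i - p') then i + 1 else i - 1)"
  "loops (parallel p p' l) = l"
  by (simp_all add: parallel_def)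

lemma pmatch_parallel: assumes "even N" shows "pmatch N (parallel p p' l)"
  unfolding pmatch_def
proof (intro conjI allI)
  fix x :: point
  obtain s i where x: "x = (s, i)" by (cases x)
  show "pairing (parallel p p' l) (pairing (parallel p p' l) x) = x" "pairing (parallel p p' l) x \<noteq> x"
    "pairing (parallel p p' l) (tr (int N) x) = tr (int N) (pairing (parallel p p' l) x)"
    using assms by (cases s; auto simp: x pairing_parallel)+
qed

text \<open>The inner arcs of the first diagram and the outer arcs of the second are offset by one.
  Together they zigzag through all middle points, which form one infinite component: a single
  non-contractible loop.\<close>

lemma parallel_comp:
  assumes N: "N > 0" "even N"
  shows "diagram_comp N (parallel (p + 1) (p + 1) 0) (parallel p p' l) = parallel (p + 1) p' (Suc l)"
    and "contractible_loops N (parallel (p + 1) (p + 1) 0) (parallel p p' l) = 0"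
proof -
  let ?d = "parallel (p + 1) (p + 1) 0" and ?d' = "parallel p p' l"
  let ?G = "arcs Top Mid ?d \<union> arcs Mid Bot ?d'"
  note m = pmatch_parallel[OF N(2), of "p + 1" "p + 1" 0] pmatch_parallel[OF N(2), of p p' l]
  have up: "(lv Top Mid x, lv Top Mid (pairing ?d x)) \<in> ?G\<^sup>*" for x by (rule r_into_rtrancl, rule UnI1, rule arcsI)
  have low: "(lv Mid Bot x, lv Mid Bot (pairing ?d' x)) \<in> ?G\<^sup>*" for x by (rule r_into_rtrancl, rule UnI2, rule arcsI)
  have sym: "sym (?G\<^sup>*)" by (rule sym_rtrancl[OF sym_Un_arcs[OF m]])
  have P: "pairing (diagram_comp N ?d ?d') x = pairing (parallel (p + 1) p' (Suc l)) x" for x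
  proof (rule pairing_compI[OF N(1) m])
    show "pairing (parallel (p + 1) p' (Suc l)) x \<noteq> x" by (rule pmatch_nofix[OF pmatch_parallel[OF N(2)]])
    show "(lv Top Bot x, lv Top Bot (pairing (parallel (p + 1) p' (Suc l)) x)) \<in> ?G\<^sup>*"
      using up[of x] low[of x] by (cases x; cases "fst x") (auto simp: pairing_parallel)
  qed
  have next_mid: "((Mid, a), (Mid, a + 1)) \<in> ?G\<^sup>*" for a
    using up[of "(Inner, a)"] low[of "(Outer, a)"] by (cases "even (a - p)") (simp_all add: pairing_parallel)
  have mids: "((Mid, a), (Mid, c)) \<in> ?G\<^sup>*" for a c
  proof (induction c rule: int_induct[of _ a])
    case (step1 c) then show ?case using next_mid[of c] by (meson rtrancl_trans)
  next
    case (step2 c) then show ?case using symD[OF sym next_mid[of "c - 1"]] by (metis diff_add_cancel rtrancl_trans)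
  qed simp
  have stay: "fst w = Mid" if "(v, w) \<in> ?G\<^sup>*" "fst v = Mid" for v w
    using that
  proof induction
    case (step y z)
    then obtain a where y: "y = (Mid, a)" by (cases y) auto
    from step(2) have "z = lv Top Mid (pairing ?d (Inner, a)) \<or> z = lv Mid Bot (pairing ?d' (Outer, a))"
      by (auto simp: y arc_inv_def dest: arcs_arc_inv[rotated])
    then show ?case by (auto simp: pairing_parallel)
  qed
  have cls: "?G\<^sup>* `` {(Mid, a)} = {Mid} \<times> UNIV" for a
    using mids[of a] stay by (fastforce simp: mem_Times_iff)
  have inf: "infinite ({Mid} \<times> (UNIV :: int set))"
    using infinite_UNIV_int by (auto dest: finite_cartesian_productD2)
  have co: "closed_orbits b N {Mid} ?G = (if b then {} else {orb N ({Mid} \<times> UNIV)})" for b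
  proof -
    have "\<exists>a. v = (Mid, a)" if "?G\<^sup>* `` {v} \<subseteq> {Mid} \<times> UNIV" for v
    proof -
      have "v \<in> {Mid} \<times> UNIV" using that by blast
      then show ?thesis by auto
    qed
    then have "closed_orbits b N {Mid} ?G = {orb N (?G\<^sup>* `` {(Mid, a)}) | a. finite (?G\<^sup>* `` {(Mid, a)}) \<longleftrightarrow> b}"
      unfolding closed_orbits_def using cls by blast
    then show ?thesis using inf by (auto simp: cls)
  qed
  show "contractible_loops N ?d ?d' = 0" by (simp add: loops_closed_orbits co)
  have "noncontractible_loops N ?d ?d' = 1" by (simp add: loops_closed_orbits co)
  then show "diagram_comp N ?d ?d' = parallel (p + 1) p' (Suc l)"
    using P by (intro adiagram.expand) (auto simp: diagram_comp_def[of N ?d] pairing_parallel(3))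
qed

text \<open>\<open>parallel p p 0\<close> is a product of commuting cups. A rotation changes the
  parity of the outer arcs, and each further factor as in \<open>parallel_comp\<close> adds one
  loop.\<close>

lemma gen_parallel:
  assumes N: "N > 0" "even N"
  shows "gen N (parallel p p' l)"
proof -
  have cong: "parallel p p' l = parallel r r' l" if "even (p - r)" "even (p' - r')" for p p' r r' l
  proof -
    have "even (i - p) \<longleftrightarrow> even (i - r)" "even (i - p') \<longleftrightarrow> even (i - r')" for i
      using that by presburger+
    then show ?thesis by (auto simp: parallel_def intro!: ext split: side.splits)
  qed
  have rot: "gen N (parallel (p + 1) p' l)" if "gen N (parallel p p' l)" for p p' l
  proof -
    note m = pmatch_parallel[OF N(2), of p p' l]
    have "diagram_comp N (U 1) (parallel p p' l) = parallel (p + 1) p' l"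
    proof (rule adiagram.expand, intro conjI ext)
      fix x show "pairing (diagram_comp N (U 1) (parallel p p' l)) x = pairing (parallel (p + 1) p' l) x"
        by (cases x; cases "fst x") (auto simp: U_comp(1)[OF N(1) m] pairing_parallel)
    qed (simp add: U_comp(1)[OF N(1) m] pairing_parallel)
    then show ?thesis using gen_comp[OF gen_u that U_comp(2)[OF N(1) m]] by simp
  qed
  have diag: "gen N (parallel p p 0)" for p
  proof -
    have "parallel p p 0 = cups {i. even (i - p)}"
      by (auto simp: parallel_def cups_def intro!: ext split: side.splits)
    then show ?thesis using gen_cups[OF N(1), of "{i. even (i - p)}"] N(2) by simp
  qed
  have rp: "even (p - r) \<or> even (p - (r + 1))" for p r :: int by presburger
  show ?thesis
  proof (induction l arbitrary: p)
    case 0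
    show ?case
      using rp[of p p'] cong[of p p' p' p' 0] cong[of p "p' + 1" p' p' 0] diag[of p'] rot[OF diag[of p']] by auto
  next
    case (Suc l)
    have "gen N (diagram_comp N (parallel (p - 1 + 1) (p - 1 + 1) 0) (parallel (p - 1) p' l))"
      using Suc[of "p - 1"] diag[of p] parallel_comp(2)[OF N, of "p - 1" p' l] by (intro gen_comp) simp_all
    then show ?case using parallel_comp(1)[OF N, of "p - 1" p' l] by simp
  qed
qed

section \<open>Diagrams with through lines all of whose arcs join neighbours\<close>

lemma simple_outer_cases:
  assumes "simple_outer d" "fst (pairing d (Outer, i)) = Outer"
  shows "pairing d (Outer, i) = (Outer, i + 1) \<or> pairing d (Outer, i) = (Outer, i - 1)"
  using assms by (cases "pairing d (Outer, i)") (auto simp: simple_outer_def)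

text \<open>The points strictly between two consecutive through lines are paired off with neighbours
  from the left, so their number is even.\<close>

lemma run_odd:
  assumes m: "pmatch N d" and s: "simple_outer d"
    and i: "fst (pairing d (Outer, i)) = Inner" and j: "fst (pairing d (Outer, j)) = Inner" "i < j"
    and run: "\<And>c. i < c \<Longrightarrow> c < j \<Longrightarrow> fst (pairing d (Outer, c)) = Outer"
  shows "odd (j - i)"
proof -
  have pair: "pairing d (Outer, i + 1 + 2 * int n) = (Outer, i + 2 + 2 * int n)" if "i + 1 + 2 * int n < j" for n
    using that
  proof (induction n)
    case 0
    have "pairing d (Outer, i + 1) \<noteq> (Outer, i)"
    proof
      assume "pairing d (Outer, i + 1) = (Outer, i)"
      then have "pairing d (Outer, i) = (Outer, i + 1)" using pmatch_invol[OF m] by metis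
      then show False using i by simp
    qed
    then show ?case using simple_outer_cases[OF s run[of "i + 1"]] 0 by auto
  next
    case (Suc n)
    let ?q = "i + 1 + 2 * int (Suc n)"
    have IH: "pairing d (Outer, i + 1 + 2 * int n) = (Outer, i + 2 + 2 * int n)" using Suc by simp
    have "pairing d (Outer, ?q) \<noteq> (Outer, ?q - 1)"
    proof
      assume "pairing d (Outer, ?q) = (Outer, ?q - 1)"
      then have "pairing d (Outer, ?q) = pairing d (Outer, i + 1 + 2 * int n)" using IH by simp
      then show False using m by simp
    qed
    then show ?case using simple_outer_cases[OF s run[of ?q]] Suc.prems by (auto simp: algebra_simps)
  qed
  show ?thesis
  proof (rule ccontr)
    assume "\<not> odd (j - i)"
    then have "even (j - i)" by blast
    then obtain l where "j - i = 2 * l" by (rule evenE)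
    then have "j = i + 2 + 2 * (l - 1)" by simp
    then obtain k where k: "j = i + 2 + 2 * k" ..
    then have "k \<ge> 0" using j by simp
    then have "pairing d (Outer, i + 1 + 2 * k) = (Outer, j)" using pair[of "nat k"] k by simp
    then have "pairing d (Outer, j) = (Outer, i + 1 + 2 * k)" using pmatch_invol[OF m] by metis
    then show False using j by simp
  qed
qed

text \<open>Consecutive through lines are an odd distance apart on either boundary, so the
  displacements of all through lines have the same parity. One rotation then makes all of them
  even.\<close>

lemma displacement_parity:
  assumes d: "d \<in> adiagrams N" and s: "simple_outer d" "simple_outer (mirror d)"
    and i: "pairing d (Outer, i) = (Inner, k)" and j: "pairing d (Outer, j) = (Inner, l)" and ij: "i \<le> j"
  shows "even ((l - k) - (j - i))"
  using i ij
proof (induction "nat (j - i)" arbitrary: i k rule: less_induct)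
  case less
  note m = adiagrams_pmatch[OF d]
  show ?case
  proof (cases "i = j")
    case True then show ?thesis using less j by auto
  next
    case False
    define n where "n = (LEAST n. n > 0 \<and> fst (pairing d (Outer, i + int n)) = Inner)"
    have ex: "nat (j - i) > 0 \<and> fst (pairing d (Outer, i + int (nat (j - i)))) = Inner"
      using False less j by auto
    have n: "n > 0 \<and> fst (pairing d (Outer, i + int n)) = Inner"
      unfolding n_def using ex by (rule LeastI)
    have nj: "n \<le> nat (j - i)" unfolding n_def using ex by (rule Least_le)
    have run: "fst (pairing d (Outer, c)) = Outer" if "i < c" "c < i + int n" for c
    proof (rule ccontr)
      assume "fst (pairing d (Outer, c)) \<noteq> Outer"
      then have "fst (pairing d (Outer, c)) = Inner" by (cases "fst (pairing d (Outer, c))") auto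
      then have "nat (c - i) > 0 \<and> fst (pairing d (Outer, i + int (nat (c - i)))) = Inner" using that by simp
      then have "n \<le> nat (c - i)" unfolding n_def by (rule Least_le)
      then show False using that by linarith
    qed
    obtain r where r: "pairing d (Outer, i + int n) = (Inner, r)"
      using n by (cases "pairing d (Outer, i + int n)") auto
    have kr: "k < r" using through_monotone[OF d less(2) r] n by simp
    have o1: "odd (i + int n - i)"
      by (rule run_odd[OF m s(1)]) (use less n run in auto)
    \<comment> \<open>By monotonicity of the through lines the two inner ends are consecutive as
      well, so the same count applies to the mirror image.\<close>
    have o2: "odd (r - k)"
    proof (rule run_odd[OF pmatch_mirror[OF m] s(2)])
      have k: "pairing d (Inner, k) = (Outer, i)" "pairing d (Inner, r) = (Outer, i + int n)"
        using less(2) r pmatch_invol[OF m] by metis+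
      then show "fst (pairing (mirror d) (Outer, k)) = Inner" "fst (pairing (mirror d) (Outer, r)) = Inner" by auto
      show "k < r" by (rule kr)
      fix c assume c: "k < c" "c < r"
      show "fst (pairing (mirror d) (Outer, c)) = Outer"
      proof (rule ccontr)
        assume "fst (pairing (mirror d) (Outer, c)) \<noteq> Outer"
        then obtain a where "pairing d (Inner, c) = (Outer, a)"
          by (cases "pairing d (Inner, c)"; cases "fst (pairing d (Inner, c))") auto
        then have a: "pairing d (Outer, a) = (Inner, c)" using pmatch_invol[OF m] by metis
        have "i < a"
        proof (rule ccontr)
          assume "\<not> i < a"
          then have "a < i \<or> a = i" by auto
          then show False using through_monotone[OF d a less(2)] a less(2) c by auto
        qed
        moreover have "a < i + int n"
        proof (rule ccontr)
          assume "\<not> a < i + int n"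
          then have "i + int n < a \<or> a = i + int n" by auto
          then show False using through_monotone[OF d r a] a r c by auto
        qed
        ultimately show False using run[of a] a by simp
      qed
    qed
    have "even ((l - r) - (j - (i + int n)))"
      by (rule less(1)[OF _ r]) (use n nj False less(3) in auto)
    then show ?thesis using o1 o2 by presburger
  qed
qed

lemma tr_up: assumes "N > 0" obtains t where "t \<ge> 0" "(c :: int) \<le> a + t * int N"
proof
  show "0 \<le> \<bar>c - a\<bar>" by simp
  have "c \<le> a + \<bar>c - a\<bar> * 1" by simp
  also have "\<dots> \<le> a + \<bar>c - a\<bar> * int N" using assms by (intro add_left_mono mult_left_mono) auto
  finally show "c \<le> a + \<bar>c - a\<bar> * int N" .
qed

text \<open>Evenness is a normalisation reached by a rotation. It makes a through line that is not
  vertical lean by at least two, which is the distance that \<open>slide\<close> requires.\<close>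

definition reduced :: "nat \<Rightarrow> adiagram \<Rightarrow> bool" where
  "reduced N d \<longleftrightarrow> d \<in> adiagrams N \<and> simple_outer d \<and> simple_outer (mirror d) \<and>
     (\<exists>i k. pairing d (Outer, i) = (Inner, k)) \<and>
     (\<forall>i k. pairing d (Outer, i) = (Inner, k) \<longrightarrow> even (k - i))"

lemma reduced_mirror: assumes "reduced N d" shows "reduced N (mirror d)"
proof -
  have d: "d \<in> adiagrams N" using assms by (simp add: reduced_def)
  note m = adiagrams_pmatch[OF d]
  have flip: "pairing (mirror d) (Outer, k) = (Inner, i) \<longleftrightarrow> pairing d (Outer, i) = (Inner, k)" for i k
  proof -
    have "pairing (mirror d) (Outer, k) = (Inner, i) \<longleftrightarrow> pairing d (Inner, k) = (Outer, i)"
      by (cases "pairing d (Inner, k)"; cases "fst (pairing d (Inner, k))") auto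
    also have "\<dots> \<longleftrightarrow> pairing d (Outer, i) = (Inner, k)" using pmatch_invol[OF m] by metis
    finally show ?thesis .
  qed
  have "even (i - k) \<longleftrightarrow> even (k - i)" for i k :: int by presburger
  then show ?thesis using assms mirror_adiagrams[OF d] unfolding reduced_def flip mirror_mirror by blast
qed

text \<open>Go to the right from a through line leaning to the right. As long as no cup follows
  immediately, the next point carries another such line, since lines are increasing and lean by at
  least two. An outer arc exists and recurs periodically, so at some point a cup does follow, and
  \<open>slide\<close> moves the line across it. The displacement of that line changes by two, so
  the normalisation persists.\<close>

lemma reduce_step:
  assumes N: "N > 0" and red: "reduced N d" and arc: "pairing d (Outer, a) = (Outer, b)"
    and thr: "pairing d (Outer, i0) = (Inner, k0)" "k0 > i0"
  shows "\<exists>D. reduced N D \<and> total N D < total N d \<and> (gen N D \<longrightarrow> gen N d)"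
proof -
  have d: "d \<in> adiagrams N" and so: "simple_outer d" and si: "simple_outer (mirror d)"
    and ev: "\<And>i k. pairing d (Outer, i) = (Inner, k) \<Longrightarrow> even (k - i)"
    using red by (auto simp: reduced_def)
  note m = adiagrams_pmatch[OF d]
  have "\<exists>i k. pairing d (Outer, i) = (Inner, k) \<and> k > i \<and> pairing d (Outer, i + 1) = (Outer, i + 2)"
  proof (rule ccontr)
    assume no: "\<not> ?thesis"
    have all: "\<exists>k. pairing d (Outer, i0 + int n) = (Inner, k) \<and> k > i0 + int n" for n
    proof (induction n)
      case 0 then show ?case using thr by simp
    next
      case (Suc n)
      then obtain k where k: "pairing d (Outer, i0 + int n) = (Inner, k)" "k > i0 + int n" by blast
      let ?c = "i0 + int n"
      have "k \<ge> ?c + 2" using ev[OF k(1)] k(2) by presburger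
      have "pairing d (Outer, ?c + 1) \<noteq> (Outer, ?c + 2)" using no k by blast
      then have "pairing d (Outer, ?c + 1) \<noteq> (Outer, ?c + 1 + 1)" by (simp add: add.commute)
      moreover have "pairing d (Outer, ?c + 1) \<noteq> (Outer, ?c + 1 - 1)"
      proof
        assume "pairing d (Outer, ?c + 1) = (Outer, ?c + 1 - 1)"
        then have "pairing d (Outer, ?c) = (Outer, ?c + 1)" using pmatch_invol[OF m, of "(Outer, ?c + 1)"] by simp
        then show False using k by simp
      qed
      ultimately have "fst (pairing d (Outer, ?c + 1)) \<noteq> Outer" using simple_outer_cases[OF so] by blast
      then obtain k' where k': "pairing d (Outer, ?c + 1) = (Inner, k')"
        by (cases "pairing d (Outer, ?c + 1)"; cases "fst (pairing d (Outer, ?c + 1))") auto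
      then have "k < k'" using through_monotone[OF d k(1) k'] by simp
      then show ?case using k' \<open>k \<ge> ?c + 2\<close> by (auto simp: algebra_simps)
    qed
    \<comment> \<open>A translate of the given outer arc starts to the right of \<open>i0\<close>,
      where every point was found to carry a through line.\<close>
    obtain t where t: "i0 \<le> a + t * int N" using tr_up[OF N] by metis
    then obtain k where "pairing d (Outer, a + t * int N) = (Inner, k)"
      using all[of "nat (a + t * int N - i0)"] by auto
    then show False using pmatch_tr[OF m, of t "(Outer, a)"] arc by simp
  qed
  then obtain i k where ik: "pairing d (Outer, i) = (Inner, k)" "k > i" "pairing d (Outer, i + 1) = (Outer, i + 2)"
    by blast
  have k2: "k \<ge> i + 2" using ev[OF ik(1)] ik(2) by presburger
  let ?D = "diagram_comp N (E N i) d"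
  note sl = slide[OF d N ik(3) ik(1) k2]
  note mD = adiagrams_pmatch[OF sl(1)]
  have cases: "(\<exists>t. x = (Outer, i + t * int N) \<and> pairing ?D x = (Outer, i + 1 + t * int N)) \<or>
      (\<exists>t. x = (Outer, i + 1 + t * int N) \<and> pairing ?D x = (Outer, i + t * int N)) \<or>
      (\<exists>t. x = (Outer, i + 2 + t * int N) \<and> pairing ?D x = (Inner, k + t * int N)) \<or>
      (\<exists>t. x = (Inner, k + t * int N) \<and> pairing ?D x = (Outer, i + 2 + t * int N)) \<or> pairing d x = pairing ?D x" for x
    using sl(4-7) sl(8)[of x, symmetric] by blast
  have "simple_outer ?D"
    unfolding simple_outer_def
  proof (intro allI impI)
    fix x y assume "pairing ?D (Outer, x) = (Outer, y)"
    then show "y = x + 1 \<or> y = x - 1"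
      using cases[of "(Outer, x)"] so unfolding simple_outer_def by auto
  qed
  moreover have "simple_outer (mirror ?D)"
    unfolding simple_outer_def
  proof (intro allI impI)
    fix x y assume xy: "pairing (mirror ?D) (Outer, x) = (Outer, y)"
    then have "pairing ?D (Inner, x) = (Inner, y)"
      by (cases "pairing ?D (Inner, x)"; cases "fst (pairing ?D (Inner, x))") auto
    then have "pairing (mirror d) (Outer, x) = (Outer, y)" using cases[of "(Inner, x)"] by auto
    then show "y = x + 1 \<or> y = x - 1" using si unfolding simple_outer_def by blast
  qed
  moreover have "even (y - x)" if "pairing ?D (Outer, x) = (Inner, y)" for x y
    using cases[of "(Outer, x)"] that ev[OF ik(1)] ev[of x y] by auto
  moreover have "pairing ?D (Outer, i + 2 + 0 * int N) = (Inner, k + 0 * int N)" by (rule sl(6))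
  ultimately have "reduced N ?D" using sl(1) unfolding reduced_def by blast
  then show ?thesis using sl(2,3) by blast
qed

text \<open>Between vertical through lines the points of both boundaries are paired off with
  neighbours starting at the same place, so the inner arcs copy the outer ones. This is verified
  point by point to the right of one line and then spread by periodicity.\<close>

lemma vertical_cups:
  assumes N: "N > 0" and red: "reduced N d" and vert: "\<And>i k. pairing d (Outer, i) = (Inner, k) \<Longrightarrow> k = i"
  shows "d = cups {i. pairing d (Outer, i) = (Outer, i + 1)}"
proof -
  have d: "d \<in> adiagrams N" and so: "simple_outer d" and si: "simple_outer (mirror d)"
    using red by (auto simp: reduced_def)
  note m = adiagrams_pmatch[OF d]
  obtain i0 where i0: "pairing d (Outer, i0) = (Inner, i0)" using red vert unfolding reduced_def by blast
  let ?I = "\<lambda>c. pairing d (Inner, c) =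
     (if fst (pairing d (Outer, c)) = Inner then (Outer, c) else (Inner, snd (pairing d (Outer, c))))"
  have thr: "pairing d (Outer, c) = (Inner, c)" "pairing d (Inner, c) = (Outer, c)" if "fst (pairing d (Outer, c)) = Inner" for c
  proof -
    show "pairing d (Outer, c) = (Inner, c)" using that vert[of c] by (cases "pairing d (Outer, c)") auto
    then show "pairing d (Inner, c) = (Outer, c)" using pmatch_invol[OF m] by metis
  qed
  have thr': "fst (pairing d (Outer, c)) = Inner" if inner: "fst (pairing d (Inner, c)) = Outer" for c
  proof -
    obtain a where a: "pairing d (Inner, c) = (Outer, a)" using inner by (cases "pairing d (Inner, c)") auto
    then have "pairing d (Outer, a) = (Inner, c)" using pmatch_invol[OF m] by metis
    then have "a = c" using vert by blast
    then show ?thesis using \<open>pairing d (Outer, a) = (Inner, c)\<close> by simp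
  qed
  have up: "?I (i0 + int n)" for n
  proof (induction n)
    case 0 then show ?case using i0 pmatch_invol[OF m, of "(Outer, i0)"] by simp
  next
    case (Suc n)
    let ?c = "i0 + int n"
    show ?case
    proof (cases "fst (pairing d (Outer, ?c + 1)) = Inner")
      case True
      then show ?thesis using thr[of "?c + 1"] by (simp add: algebra_simps)
    next
      case False
      then have o: "fst (pairing d (Outer, ?c + 1)) = Outer" by (cases "fst (pairing d (Outer, ?c + 1))") auto
      have "fst (pairing d (Inner, ?c + 1)) = Inner" using thr'[of "?c + 1"] o by (cases "fst (pairing d (Inner, ?c + 1))") auto
      then have "fst (pairing (mirror d) (Outer, ?c + 1)) = Outer" by simp
      from simple_outer_cases[OF si this]
      have i: "pairing d (Inner, ?c + 1) = (Inner, ?c + 2) \<or> pairing d (Inner, ?c + 1) = (Inner, ?c)"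
        by (cases "pairing d (Inner, ?c + 1)"; cases "fst (pairing d (Inner, ?c + 1))") auto
      have o': "pairing d (Outer, ?c + 1) = (Outer, ?c + 2) \<or> pairing d (Outer, ?c + 1) = (Outer, ?c)"
        using simple_outer_cases[OF so o] by auto
      have "pairing d (Outer, ?c + 1) = (Outer, ?c) \<longleftrightarrow> pairing d (Outer, ?c) = (Outer, ?c + 1)"
        using pmatch_invol[OF m] by metis
      also have "\<dots> \<longleftrightarrow> pairing d (Inner, ?c) = (Inner, ?c + 1)"
        using Suc by (cases "pairing d (Outer, ?c)"; cases "fst (pairing d (Outer, ?c))") auto
      also have "\<dots> \<longleftrightarrow> pairing d (Inner, ?c + 1) = (Inner, ?c)"
        using pmatch_invol[OF m] by metis
      finally show ?thesis using i o' o by (auto simp: algebra_simps)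
    qed
  qed
  have I: "?I c" for c
  proof -
    obtain t where t: "i0 \<le> c + t * int N" using tr_up[OF N] by metis
    then have "?I (c + t * int N)" using up[of "nat (c + t * int N - i0)"] by simp
    then show ?thesis
      using pmatch_tr[OF m, of t "(Outer, c)"] pmatch_tr[OF m, of t "(Inner, c)"]
      by (cases "pairing d (Outer, c)"; cases "pairing d (Inner, c)") (auto split: if_splits)
  qed
  let ?J = "{i. pairing d (Outer, i) = (Outer, i + 1)}"
  have O: "pairing d (Outer, c) = (if c \<in> ?J then (Outer, c + 1) else if c - 1 \<in> ?J then (Outer, c - 1) else (Inner, c))" for c
  proof (cases "fst (pairing d (Outer, c)) = Inner")
    case True
    have "pairing d (Outer, c - 1) \<noteq> (Outer, c)"
    proof
      assume "pairing d (Outer, c - 1) = (Outer, c)"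
      then have "pairing d (Outer, c) = (Outer, c - 1)" using pmatch_invol[OF m] by metis
      then show False using True by simp
    qed
    then show ?thesis using thr[OF True] by auto
  next
    case False
    then have "fst (pairing d (Outer, c)) = Outer" by (cases "fst (pairing d (Outer, c))") auto
    moreover have "pairing d (Outer, c) = (Outer, c - 1) \<Longrightarrow> pairing d (Outer, c - 1) = (Outer, c)"
      using pmatch_invol[OF m] by metis
    ultimately show ?thesis using simple_outer_cases[OF so, of c] by auto
  qed
  have "loops d = 0"
  proof (rule ccontr)
    assume "loops d \<noteq> 0"
    then have "fst (pairing d (Outer, i0)) = Outer" using d unfolding adiagrams_noncrossing by simp
    then show False using i0 by simp
  qed
  then show ?thesis
  proof (intro adiagram.expand conjI ext)
    fix x show "pairing d x = pairing (cups ?J) x"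
    proof (cases x)
      case (Pair s c)
      show ?thesis
      proof (cases s)
        case Outer show ?thesis unfolding Pair Outer pairing_cups opp.simps by (rule O)
      next
        case Inner
        then show ?thesis using O[of c] I[of c] unfolding Pair pairing_cups by (auto split: if_splits)
      qed
    qed
  qed simp
qed

text \<open>\<open>reduce_step\<close> applies to a line leaning to the right when some outer arc
  exists; a line leaning to the left is treated in the mirror image. What remains is a rotation, if
  one boundary carries no arcs, or a product of commuting cups, if all lines are vertical.\<close>

lemma gen_reduced: assumes N: "N > 0" and "reduced N d" shows "gen N d"
  using assms(2)
proof (induction "total N d" arbitrary: d rule: less_induct)
  case less
  have d: "d \<in> adiagrams N" using less.prems by (simp add: reduced_def)
  note m = adiagrams_pmatch[OF d]
  have md: "mirror d \<in> adiagrams N" by (rule mirror_adiagrams[OF d])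
  show ?case
  proof (cases "(\<forall>i. fst (pairing d (Outer, i)) = Inner) \<or> (\<forall>i. fst (pairing (mirror d) (Outer, i)) = Inner)")
    case True
    then show ?thesis
    proof
      assume "\<forall>i. fst (pairing d (Outer, i)) = Inner"
      then obtain c where "d = U c" using no_outer_arcs[OF d N] by blast
      then show ?thesis using gen_U[OF N] by simp
    next
      assume "\<forall>i. fst (pairing (mirror d) (Outer, i)) = Inner"
      then obtain c where "mirror d = U c" using no_outer_arcs[OF md N] by blast
      then have "d = U (- c)" by (metis mirror_mirror mirror_U)
      then show ?thesis using gen_U[OF N] by simp
    qed
  next
    case False
    note through = False
    have arcs: "\<exists>a b. pairing e (Outer, a) = (Outer, b)" if arc: "\<not> (\<forall>i. fst (pairing e (Outer, i)) = Inner)" for e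
    proof -
      obtain i where "fst (pairing e (Outer, i)) \<noteq> Inner" using arc by blast
      then have "fst (pairing e (Outer, i)) = Outer" by (cases "fst (pairing e (Outer, i))") auto
      then show ?thesis by (metis prod.collapse)
    qed
    show ?thesis
    proof (cases "\<exists>i k. pairing d (Outer, i) = (Inner, k) \<and> k \<noteq> i")
      case False
      then have *: "d = cups {i. pairing d (Outer, i) = (Outer, i + 1)}" using vertical_cups[OF N less.prems] by blast
      have "gen N (cups {i. pairing d (Outer, i) = (Outer, i + 1)})"
      proof (rule gen_cups[OF N])
        fix i
        have "pairing d (Outer, i + int N) = tr (int N) (pairing d (Outer, i))"
          using pmatch_tr[OF m, of 1 "(Outer, i)"] by simp
        then show "i + int N \<in> {i. pairing d (Outer, i) = (Outer, i + 1)} \<longleftrightarrow> i \<in> {i. pairing d (Outer, i) = (Outer, i + 1)}"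
          by (cases "pairing d (Outer, i)") auto
        assume "i \<in> {i. pairing d (Outer, i) = (Outer, i + 1)}"
        then have "pairing d (Outer, i + 1) = (Outer, i)" using pmatch_invol[OF m, of "(Outer, i)"] by simp
        then show "i + 1 \<notin> {i. pairing d (Outer, i) = (Outer, i + 1)}" by simp
      qed
      then show ?thesis using * by simp
    next
      case True
      then obtain i k where ik: "pairing d (Outer, i) = (Inner, k)" "k \<noteq> i" by blast
      show ?thesis
      proof (cases "k > i")
        case True
        obtain a b where "pairing d (Outer, a) = (Outer, b)" using arcs through by blast
        from reduce_step[OF N less.prems this ik(1) True] show ?thesis using less.hyps by blast
      next
        case False
        have "pairing d (Inner, k) = (Outer, i)" using ik(1) pmatch_invol[OF m] by metis
        then have *: "pairing (mirror d) (Outer, k) = (Inner, i)" by simp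
        obtain a b where "pairing (mirror d) (Outer, a) = (Outer, b)"
          using arcs through by blast
        from reduce_step[OF N reduced_mirror[OF less.prems] this *]
        have "gen N (mirror d)" using less.hyps False ik total_mirror by force
        from gen_mirror[OF N this] show ?thesis by simp
      qed
    qed
  qed
qed

section \<open>Diagrams without through lines, and generation of all diagrams\<close>

lemma all_simple_parallel:
  assumes d: "d \<in> adiagrams N" and so: "simple_outer d" and out: "\<And>i. fst (pairing d (Outer, i)) = Outer"
  shows "\<exists>p. \<forall>i. pairing d (Outer, i) = (Outer, if even (i - p) then i + 1 else i - 1)"
proof -
  note m = adiagrams_pmatch[OF d]
  have inv: "pairing d (Outer, a) = (Outer, b) \<longleftrightarrow> pairing d (Outer, b) = (Outer, a)" for a b
    using pmatch_invol[OF m] by metis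
  note cs = simple_outer_cases[OF so out]
  have "pairing d (Outer, 0) = (Outer, 0 + 1) \<or> pairing d (Outer, - 1) = (Outer, - 1 + 1)"
    using cs[of 0] inv[of 0 "- 1"] by auto
  then obtain p where p: "pairing d (Outer, p) = (Outer, p + 1)" by blast
  have up: "pairing d (Outer, i + 2) = (Outer, i + 3)" if "pairing d (Outer, i) = (Outer, i + 1)" for i
  proof -
    have "pairing d (Outer, i + 2) \<noteq> (Outer, i + 1)" using inv[of "i + 2" "i + 1"] inv[of i "i + 1"] that by auto
    then show ?thesis using cs[of "i + 2"] by auto
  qed
  have down: "pairing d (Outer, i - 2) = (Outer, i - 1)" if "pairing d (Outer, i) = (Outer, i + 1)" for i
  proof -
    have "pairing d (Outer, i - 1) \<noteq> (Outer, i)" using inv[of "i - 1" i] that by auto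
    then show ?thesis using cs[of "i - 1"] inv[of "i - 1" "i - 2"] by auto
  qed
  have ev: "pairing d (Outer, p + 2 * k) = (Outer, p + 2 * k + 1)" for k
  proof (induction k rule: int_induct[of _ 0])
    case base then show ?case using p by simp
  next
    case (step1 k) then show ?case using up[of "p + 2 * k"] by (simp add: algebra_simps)
  next
    case (step2 k) then show ?case using down[of "p + 2 * k"] by (simp add: algebra_simps)
  qed
  have "pairing d (Outer, i) = (Outer, if even (i - p) then i + 1 else i - 1)" for i
  proof (cases "even (i - p)")
    case True
    then obtain k where "i - p = 2 * k" by (rule evenE)
    then have "i = p + 2 * k" by simp
    then show ?thesis using ev[of k] True by simp
  next
    case False
    then obtain k where "i - p = 2 * k + 1" by (rule oddE)
    then have "i = p + 2 * k + 1" by simp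
    then show ?thesis using ev[of k] inv[of "p + 2 * k" "p + 2 * k + 1"] False by simp
  qed
  then show ?thesis by blast
qed

text \<open>Without through lines the diagram is a \<open>parallel\<close>, its number of loops
  included. With through lines it is first rotated into a reduced one; the rotation is undone at the
  end, and it closes no loop.\<close>

lemma gen_simple:
  assumes N: "N > 0" and d: "d \<in> adiagrams N" and so: "simple_outer d" and si: "simple_outer (mirror d)"
  shows "gen N d"
proof (cases "\<exists>i k. pairing d (Outer, i) = (Inner, k)")
  case False
  note m = adiagrams_pmatch[OF d]
  have out: "fst (pairing d (Outer, i)) = Outer" for i
    using False by (cases "pairing d (Outer, i)"; cases "fst (pairing d (Outer, i))") auto
  have inn: "fst (pairing d (Inner, i)) = Inner" for i
  proof (rule ccontr)
    assume "fst (pairing d (Inner, i)) \<noteq> Inner"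
    then obtain a where "pairing d (Inner, i) = (Outer, a)"
      by (cases "pairing d (Inner, i)"; cases "fst (pairing d (Inner, i))") auto
    then have "pairing d (Outer, a) = (Inner, i)" using pmatch_invol[OF m] by metis
    then show False using False by blast
  qed
  obtain p where p: "\<And>i. pairing d (Outer, i) = (Outer, if even (i - p) then i + 1 else i - 1)"
    using all_simple_parallel[OF d so out] by blast
  have "fst (pairing (mirror d) (Outer, i)) = Outer" for i using inn by simp
  then obtain p' where p': "\<And>i. pairing (mirror d) (Outer, i) = (Outer, if even (i - p') then i + 1 else i - 1)"
    using all_simple_parallel[OF mirror_adiagrams[OF d] si] by blast
  have p'': "pairing d (Inner, i) = (Inner, if even (i - p') then i + 1 else i - 1)" for i
    using p'[of i] by (cases "pairing d (Inner, i)"; cases "fst (pairing d (Inner, i))") auto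
  have "even N"
  proof (rule ccontr)
    assume "odd N"
    have "pairing d (Outer, p + int N) = (Outer, p + 1 + int N)"
      using pmatch_tr[OF m, of 1 "(Outer, p)"] p[of p] by simp
    then show False using p[of "p + int N"] \<open>odd N\<close> by simp
  qed
  moreover have "d = parallel p p' (loops d)"
  proof (rule adiagram.expand, intro conjI ext)
    fix x show "pairing d x = pairing (parallel p p' (loops d)) x"
      using p p'' by (cases x; cases "fst x") (auto simp: pairing_parallel)
  qed (simp add: pairing_parallel)
  ultimately show ?thesis using gen_parallel[OF N] by metis
next
  case True
  note m = adiagrams_pmatch[OF d]
  obtain i0 k0 where ik: "pairing d (Outer, i0) = (Inner, k0)" using True by blast
  \<comment> \<open>The displacement of one through line: after rotating by it this line is
    vertical, and by parity all displacements become even.\<close>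
  define c where "c = k0 - i0"
  let ?D = "diagram_comp N (U c) d"
  have D: "?D \<in> adiagrams N" by (rule U_comp_adiagrams[OF N d])
  note uc = U_comp(1)[OF N m, of c]
  have O: "pairing ?D (Outer, i) = sh c (pairing d (Outer, i - c))" for i
    by (simp add: uc)
  have I: "pairing ?D (Inner, i) = sh c (pairing d (Inner, i))" for i
    by (simp add: uc)
  have so': "simple_outer ?D"
    unfolding simple_outer_def
  proof (intro allI impI)
    fix i k assume "pairing ?D (Outer, i) = (Outer, k)"
    then have "pairing d (Outer, i - c) = (Outer, k - c)"
      unfolding O by (cases "pairing d (Outer, i - c)"; cases "fst (pairing d (Outer, i - c))") auto
    then have "k - c = i - c + 1 \<or> k - c = i - c - 1" using so unfolding simple_outer_def by blast
    then show "k = i + 1 \<or> k = i - 1" by auto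
  qed
  have si': "simple_outer (mirror ?D)"
    unfolding simple_outer_def
  proof (intro allI impI)
    fix i k assume "pairing (mirror ?D) (Outer, i) = (Outer, k)"
    then have "pairing (mirror d) (Outer, i) = (Outer, k)"
      unfolding mirror_simps I by (cases "pairing d (Inner, i)"; cases "fst (pairing d (Inner, i))") auto
    then show "k = i + 1 \<or> k = i - 1" using si unfolding simple_outer_def by blast
  qed
  have base: "pairing ?D (Outer, k0) = (Inner, k0)" unfolding O using ik by (simp add: c_def)
  have "even (k - i)" if "pairing ?D (Outer, i) = (Inner, k)" for i k
  proof (cases "i \<le> k0")
    case True
    have "even ((k0 - k) - (k0 - i))" by (rule displacement_parity[OF D so' si' that base True])
    then show ?thesis by presburger
  next
    case False
    then have "even ((k - k0) - (i - k0))" by (intro displacement_parity[OF D so' si' base that]) simp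
    then show ?thesis by presburger
  qed
  then have "reduced N ?D" using D so' si' base unfolding reduced_def by blast
  then have "gen N ?D" by (rule gen_reduced[OF N])
  then have "gen N (diagram_comp N (U (- c)) ?D)"
    by (rule gen_comp[OF gen_U[OF N] _ U_comp(2)[OF N adiagrams_pmatch[OF D]]])
  moreover have "diagram_comp N (U (- c)) ?D = d"
    unfolding comp_assoc[OF N pmatch_U pmatch_U m, symmetric] U_U[OF N] using N m by simp
  ultimately show ?thesis by simp
qed

lemma adiagrams_gen: assumes N: "N > 0" and "d \<in> adiagrams N" shows "gen N d"
  using assms(2)
proof (induction "total N d" arbitrary: d rule: less_induct)
  case less
  have sl: "\<exists>D. D \<in> adiagrams N \<and> total N D < total N e \<and> (gen N D \<longrightarrow> gen N e)"
    if e: "e \<in> adiagrams N" "\<not> simple_outer e" for e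
  proof -
    obtain a b where ab: "pairing e (Outer, a + 1) = (Outer, a + 2)" "pairing e (Outer, a) = (Outer, b)" "b \<ge> a + 2"
      using nested_arc[OF e] by blast
    from slide(1-3)[OF e(1) N ab] show ?thesis by blast
  qed
  consider "\<not> simple_outer d" | "\<not> simple_outer (mirror d)" | "simple_outer d" "simple_outer (mirror d)" by blast
  then show ?case
  proof cases
    case 1
    from sl[OF less.prems 1] less.hyps show ?thesis by blast
  next
    case 2
    from sl[OF mirror_adiagrams[OF less.prems] 2] less.hyps have "gen N (mirror d)" by (auto simp: total_mirror)
    from gen_mirror[OF N this] show ?thesis by simp
  next
    case 3
    then show ?thesis by (rule gen_simple[OF N less.prems])
  qed
qed

text \<open>The left factor is written as a product of generators, each of which preserves
  planarity.\<close>

lemma comp_adiagrams: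
  "N > 0 \<Longrightarrow> d \<in> adiagrams N \<Longrightarrow> d' \<in> adiagrams N \<Longrightarrow> diagram_comp N d d' \<in> adiagrams N"
  by (intro gen_comp_adiagrams adiagrams_gen)

section \<open>Algebras with a multiplicative basis\<close>

lemma lookup_pm_scale [simp]: "Poly_Mapping.lookup (pm_scale c a) x = c * Poly_Mapping.lookup a x"
  by (simp add: pm_scale_def Poly_Mapping.map.rep_eq when_def)

lemma pm_scale_simps [simp]:
  "pm_scale c 0 = 0" "pm_scale c (a + b) = pm_scale c a + pm_scale c b"
  "pm_scale c (a - b) = pm_scale c a - pm_scale c b" "pm_scale c (- a) = - pm_scale c a"
  "pm_scale c (pm_scale c' a) = pm_scale (c * c') a" "pm_scale 1 a = a" "pm_scale 0 a = 0"
  "pm_scale c (Poly_Mapping.single x v) = Poly_Mapping.single x (c * v)"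
  by (rule poly_mapping_eqI; simp add: lookup_add lookup_minus lookup_single when_def algebra_simps)+

lemma pm_scale_sum: "pm_scale c (\<Sum>i \<in> I. f i) = (\<Sum>i \<in> I. pm_scale c (f i))"
  by (induction I rule: infinite_finite_induct) simp_all

lemma keys_pm_scale: "Poly_Mapping.keys (pm_scale c a) \<subseteq> Poly_Mapping.keys a"
  by (auto simp: in_keys_iff)

lemma pm_induct [consumes 1, case_names zero single add]:
  fixes a :: "'a \<Rightarrow>\<^sub>0 'b :: comm_monoid_add"
  assumes "Poly_Mapping.keys a \<subseteq> B" "P 0" "\<And>d c. d \<in> B \<Longrightarrow> P (Poly_Mapping.single d c)"
    "\<And>a b. Poly_Mapping.keys a \<subseteq> B \<Longrightarrow> Poly_Mapping.keys b \<subseteq> B \<Longrightarrow> P a \<Longrightarrow> P b \<Longrightarrow> P (a + b)"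
  shows "P a"
proof -
  have a: "a = (\<Sum>d \<in> Poly_Mapping.keys a. Poly_Mapping.single d (Poly_Mapping.lookup a d))"
    by (rule poly_mapping_eqI) (simp add: lookup_sum lookup_single when_def in_keys_iff sum.delta)
  have "Poly_Mapping.keys (\<Sum>d \<in> A. Poly_Mapping.single d (Poly_Mapping.lookup a d)) \<subseteq> B \<and>
      P (\<Sum>d \<in> A. Poly_Mapping.single d (Poly_Mapping.lookup a d))" if "finite A" "A \<subseteq> B" for A
    using that
  proof induction
    case (insert x A)
    then have "Poly_Mapping.keys (Poly_Mapping.single x (Poly_Mapping.lookup a x)) \<subseteq> B" by auto
    moreover have "Poly_Mapping.keys (Poly_Mapping.single x (Poly_Mapping.lookup a x) +
       (\<Sum>d \<in> A. Poly_Mapping.single d (Poly_Mapping.lookup a d))) \<subseteq> B"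
      using insert calculation by (meson Un_least insert_subset keys_add subset_trans)
    ultimately show ?case using insert assms(3,4) by simp
  qed (simp add: assms(2))
  from this[of "Poly_Mapping.keys a"] assms(1) a show ?thesis by simp
qed

definition bmult :: "('b \<Rightarrow> 'b \<Rightarrow> 'b) \<Rightarrow> ('b \<Rightarrow> 'b \<Rightarrow> complex) \<Rightarrow> ('b \<Rightarrow>\<^sub>0 complex) \<Rightarrow> ('b \<Rightarrow>\<^sub>0 complex) \<Rightarrow> ('b \<Rightarrow>\<^sub>0 complex)" where
  "bmult p w a b = (\<Sum>d \<in> Poly_Mapping.keys a. \<Sum>d' \<in> Poly_Mapping.keys b.
     Poly_Mapping.single (p d d') (Poly_Mapping.lookup a d * Poly_Mapping.lookup b d' * w d d'))"

lemma basis_algebra_simps [simp]: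
  "monoid.mult (basis_algebra B p w \<iota>) = bmult p w" "carrier (basis_algebra B p w \<iota>) = {a. Poly_Mapping.keys a \<subseteq> B}"
  "monoid.one (basis_algebra B p w \<iota>) = Poly_Mapping.single \<iota> 1"
  "ring.zero (basis_algebra B p w \<iota>) = 0" "ring.add (basis_algebra B p w \<iota>) = (+)"
  by (auto simp: basis_algebra_def bmult_def intro!: ext)

text \<open>The keys of a sum may be fewer than those of the summands; summation over fixed larger
  sets makes bilinearity a matter of distributivity.\<close>

lemma bmult_superset:
  assumes "finite A" "Poly_Mapping.keys a \<subseteq> A" "finite A'" "Poly_Mapping.keys b \<subseteq> A'"
  shows "bmult p w a b = (\<Sum>d \<in> A. \<Sum>d' \<in> A'.
     Poly_Mapping.single (p d d') (Poly_Mapping.lookup a d * Poly_Mapping.lookup b d' * w d d'))"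
proof -
  have "(\<Sum>d' \<in> Poly_Mapping.keys b. Poly_Mapping.single (p d d') (Poly_Mapping.lookup a d * Poly_Mapping.lookup b d' * w d d')) =
    (\<Sum>d' \<in> A'. Poly_Mapping.single (p d d') (Poly_Mapping.lookup a d * Poly_Mapping.lookup b d' * w d d'))" for d
    by (rule sum.mono_neutral_left) (use assms in \<open>auto simp: in_keys_iff\<close>)
  then show ?thesis
    unfolding bmult_def by (simp, intro sum.mono_neutral_left) (use assms in \<open>auto simp: in_keys_iff\<close>)
qed

lemma bmult_add_left: "bmult p w (a + a') b = bmult p w a b + bmult p w a' b"
proof -
  let ?A = "Poly_Mapping.keys a \<union> Poly_Mapping.keys a'"
  have "Poly_Mapping.keys (a + a') \<subseteq> ?A" by (rule keys_add)
  then show ?thesis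
    using bmult_superset[of ?A a "Poly_Mapping.keys b" b] bmult_superset[of ?A a' "Poly_Mapping.keys b" b]
      bmult_superset[of ?A "a + a'" "Poly_Mapping.keys b" b]
    by (simp add: lookup_add algebra_simps single_add sum.distrib)
qed

lemma bmult_add_right: "bmult p w a (b + b') = bmult p w a b + bmult p w a b'"
proof -
  let ?A = "Poly_Mapping.keys b \<union> Poly_Mapping.keys b'"
  have "Poly_Mapping.keys (b + b') \<subseteq> ?A" by (rule keys_add)
  then show ?thesis
    using bmult_superset[of "Poly_Mapping.keys a" a ?A b] bmult_superset[of "Poly_Mapping.keys a" a ?A b']
      bmult_superset[of "Poly_Mapping.keys a" a ?A "b + b'"]
    by (simp add: lookup_add algebra_simps single_add sum.distrib)
qed

lemma bmult_scale_left: "bmult p w (pm_scale c a) b = pm_scale c (bmult p w a b)"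
  using bmult_superset[of "Poly_Mapping.keys a" "pm_scale c a" "Poly_Mapping.keys b" b p w]
  by (simp add: keys_pm_scale bmult_def pm_scale_sum mult.assoc)

lemma bmult_scale_right: "bmult p w a (pm_scale c b) = pm_scale c (bmult p w a b)"
  using bmult_superset[of "Poly_Mapping.keys a" a "Poly_Mapping.keys b" "pm_scale c b" p w]
  by (simp add: keys_pm_scale bmult_def pm_scale_sum mult.assoc mult.left_commute)

lemma bmult_zero [simp]: "bmult p w 0 b = 0" "bmult p w a 0 = 0"
  by (simp_all add: bmult_def)

lemma bmult_single [simp]:
  "bmult p w (Poly_Mapping.single d c) (Poly_Mapping.single d' c') = Poly_Mapping.single (p d d') (c * c' * w d d')"
  using bmult_superset[of "{d}" "Poly_Mapping.single d c" "{d'}" "Poly_Mapping.single d' c'" p w] by simp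

text \<open>A twisted monoid algebra: \<open>assoc_w\<close> is the cocycle identity for the
  coefficients, and with \<open>assoc\<close> it makes the bilinear product associative.\<close>

locale multiplicative_basis =
  fixes B :: "'b set" and p :: "'b \<Rightarrow> 'b \<Rightarrow> 'b" and w :: "'b \<Rightarrow> 'b \<Rightarrow> complex" and \<iota> :: 'b
  assumes closed: "\<And>d d'. d \<in> B \<Longrightarrow> d' \<in> B \<Longrightarrow> p d d' \<in> B" and unit: "\<iota> \<in> B"
    and assoc: "\<And>d d' d''. d \<in> B \<Longrightarrow> d' \<in> B \<Longrightarrow> d'' \<in> B \<Longrightarrow> p (p d d') d'' = p d (p d' d'')"
    and assoc_w: "\<And>d d' d''. d \<in> B \<Longrightarrow> d' \<in> B \<Longrightarrow> d'' \<in> B \<Longrightarrow> w d d' * w (p d d') d'' = w d' d'' * w d (p d' d'')"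
    and unit_left: "\<And>d. d \<in> B \<Longrightarrow> p \<iota> d = d \<and> w \<iota> d = 1"
    and unit_right: "\<And>d. d \<in> B \<Longrightarrow> p d \<iota> = d \<and> w d \<iota> = 1"
begin

lemma bmult_closed:
  assumes "Poly_Mapping.keys a \<subseteq> B" "Poly_Mapping.keys b \<subseteq> B"
  shows "Poly_Mapping.keys (bmult p w a b) \<subseteq> B"
  using assms(1)
proof (induction a rule: pm_induct)
  case (single d c)
  show ?case
    using assms(2)
  proof (induction b rule: pm_induct)
    case (single d' c')
    then show ?case using closed \<open>d \<in> B\<close> by auto
  next
    case (add b b')
    then show ?case unfolding bmult_add_right by (meson Un_least keys_add subset_trans)
  qed simp
next
  case (add a a')
  then show ?case unfolding bmult_add_left by (meson Un_least keys_add subset_trans)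
qed simp

lemma bmult_assoc:
  assumes "Poly_Mapping.keys a \<subseteq> B" "Poly_Mapping.keys b \<subseteq> B" "Poly_Mapping.keys c \<subseteq> B"
  shows "bmult p w (bmult p w a b) c = bmult p w a (bmult p w b c)"
  using assms(1)
proof (induction a rule: pm_induct)
  case (single d x)
  show ?case
    using assms(2)
  proof (induction b rule: pm_induct)
    case (single d' y)
    show ?case
      using assms(3)
    proof (induction c rule: pm_induct)
      case (single d'' z)
      have "w d d' * w (p d d') d'' = w d' d'' * w d (p d' d'')"
        using assoc_w \<open>d \<in> B\<close> \<open>d' \<in> B\<close> \<open>d'' \<in> B\<close> by blast
      then have "x * y * w d d' * z * w (p d d') d'' = x * (y * z * w d' d'') * w d (p d' d'')"
        by (simp add: mult_ac)
      then show ?case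
        by (simp only: bmult_single assoc[OF \<open>d \<in> B\<close> \<open>d' \<in> B\<close> \<open>d'' \<in> B\<close>])
    qed (simp_all add: bmult_add_right)
  qed (simp_all add: bmult_add_right bmult_add_left)
qed (simp_all add: bmult_add_left)

lemma bmult_one_left: "Poly_Mapping.keys a \<subseteq> B \<Longrightarrow> bmult p w (Poly_Mapping.single \<iota> 1) a = a"
  by (induction a rule: pm_induct) (simp_all add: bmult_add_right unit_left)

lemma bmult_one_right: "Poly_Mapping.keys a \<subseteq> B \<Longrightarrow> bmult p w a (Poly_Mapping.single \<iota> 1) = a"
  by (induction a rule: pm_induct) (simp_all add: bmult_add_left unit_right)

lemma ring_basis_algebra: "ring (basis_algebra B p w \<iota>)"
proof (rule ringI)
  let ?R = "basis_algebra B p w \<iota>"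
  have k: "Poly_Mapping.keys (a + b) \<subseteq> B" if "Poly_Mapping.keys a \<subseteq> B" "Poly_Mapping.keys b \<subseteq> B" for a b :: "'b \<Rightarrow>\<^sub>0 complex"
    using that by (meson Un_least keys_add subset_trans)
  show "abelian_group ?R"
  proof (rule abelian_groupI)
    fix x assume "x \<in> carrier ?R"
    then show "\<exists>y \<in> carrier ?R. y \<oplus>\<^bsub>?R\<^esub> x = \<zero>\<^bsub>?R\<^esub>"
      by (intro bexI[of _ "- x"]) (auto simp: in_keys_iff)
  qed (auto simp: k add.assoc add.commute dest: k)
  show "monoid ?R"
    by (rule monoidI) (auto simp: unit bmult_assoc bmult_one_left bmult_one_right intro: subsetD[OF bmult_closed])
qed (simp_all add: bmult_add_left bmult_add_right)

end

lemma tl_basis: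
  assumes N: "N > 0"
  shows "multiplicative_basis (adiagrams N) (diagram_comp N) (\<lambda>d d'. m ^ contractible_loops N d d') id_diagram"
proof
  fix d d' d'' assume d: "d \<in> adiagrams N" "d' \<in> adiagrams N" "d'' \<in> adiagrams N"
  note p = d[THEN adiagrams_pmatch]
  show "diagram_comp N (diagram_comp N d d') d'' = diagram_comp N d (diagram_comp N d' d'')"
    by (rule comp_assoc[OF N p])
  show "m ^ contractible_loops N d d' * m ^ contractible_loops N (diagram_comp N d d') d'' =
    m ^ contractible_loops N d' d'' * m ^ contractible_loops N d (diagram_comp N d' d'')"
    using comp_assoc_loops(1)[OF N p] by (simp flip: power_add)
qed (auto simp: id_diagram_U N adiagrams_pmatch intro: comp_adiagrams[OF N] U_adiagrams)

lemma ring_TLa: "N > 0 \<Longrightarrow> ring (TLa m N)"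
  unfolding TLa_def by (rule multiplicative_basis.ring_basis_algebra[OF tl_basis])

section \<open>The braid relations\<close>

text \<open>
  The part of the affine Temperley--Lieb relations needed to move the generators through a
  braid: \<open>b\<close> are the braid generators, \<open>c\<close> their inverses.
\<close>

locale tl_braid = monoid G for G (structure) +
  fixes N :: nat and b c e :: "nat \<Rightarrow> 'a" and u :: 'a
  assumes carr [simp]: "b i \<in> carrier G" "c i \<in> carrier G" "e i \<in> carrier G" "u \<in> carrier G"
    and bc: "b i \<otimes> c i = \<one>" "c i \<otimes> b i = \<one>"
    and far_bb: "\<lbrakk>1 \<le> i; i + 2 \<le> j; j < N\<rbrakk> \<Longrightarrow> b j \<otimes> b i = b i \<otimes> b j"
    and far_be: "\<lbrakk>1 \<le> i; i + 2 \<le> j; j < N\<rbrakk> \<Longrightarrow> b j \<otimes> e i = e i \<otimes> b j"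
    and up: "\<lbrakk>1 \<le> i; i + 1 < N\<rbrakk> \<Longrightarrow> b i \<otimes> (b (i + 1) \<otimes> e i) = e (i + 1) \<otimes> (b i \<otimes> b (i + 1))"
    and down: "\<lbrakk>1 \<le> i; i + 1 < N\<rbrakk> \<Longrightarrow> b (i + 1) \<otimes> (b i \<otimes> e (i + 1)) = e i \<otimes> (b (i + 1) \<otimes> b i)"
    and rot: "\<lbrakk>1 \<le> i; i + 1 < N\<rbrakk> \<Longrightarrow> u \<otimes> b i = b (i + 1) \<otimes> u"
begin

text \<open>The word \<open>b (n+k-1) ... b k\<close>, in which one strand crosses \<open>n\<close>
  others; \<open>asc\<close> is the word in increasing order, and \<open>asc_inv\<close> is the
  inverse of \<open>asc\<close>.\<close>

fun desc :: "nat \<Rightarrow> nat \<Rightarrow> 'a" where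
  "desc 0 k = \<one>"
| "desc (Suc n) k = b (n + k) \<otimes> desc n k"

fun asc :: "nat \<Rightarrow> nat \<Rightarrow> 'a" where
  "asc 0 k = \<one>"
| "asc (Suc n) k = asc n k \<otimes> b (n + k)"

fun asc_inv :: "nat \<Rightarrow> nat \<Rightarrow> 'a" where
  "asc_inv 0 k = \<one>"
| "asc_inv (Suc n) k = c (n + k) \<otimes> asc_inv n k"

text \<open>The element \<open>g_elem\<close> is \<open>rows N2 1 N1\<close>. This function and
  \<open>cols\<close> read the same rectangle of crossings by rows and by columns.\<close>

fun rows :: "nat \<Rightarrow> nat \<Rightarrow> nat \<Rightarrow> 'a" where
  "rows n a 0 = \<one>"
| "rows n a (Suc l) = rows n a l \<otimes> desc n (a + l)"

fun cols :: "nat \<Rightarrow> nat \<Rightarrow> nat \<Rightarrow> 'a" where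
  "cols l a 0 = \<one>"
| "cols l a (Suc n) = asc l (a + n) \<otimes> cols l a n"

lemma desc_closed [simp]: "desc n k \<in> carrier G" by (induction n) simp_all
lemma asc_closed [simp]: "asc n k \<in> carrier G" by (induction n) simp_all
lemma asc_inv_closed [simp]: "asc_inv n k \<in> carrier G" by (induction n) simp_all
lemma rows_closed [simp]: "rows n a l \<in> carrier G" by (induction l) simp_all
lemma cols_closed [simp]: "cols l a n \<in> carrier G" by (induction n) simp_all

lemmas closed = desc_closed asc_closed asc_inv_closed rows_closed cols_closed

lemma commute_mult:
  assumes "x \<otimes> y = y \<otimes> x" "x \<otimes> z = z \<otimes> x" "x \<in> carrier G" "y \<in> carrier G" "z \<in> carrier G"
  shows "x \<otimes> (y \<otimes> z) = (y \<otimes> z) \<otimes> x"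
  using assms by (metis m_assoc)

lemma desc_commute:
  assumes x: "x \<in> carrier G" and "\<And>i. k \<le> i \<Longrightarrow> i < n + k \<Longrightarrow> x \<otimes> b i = b i \<otimes> x"
  shows "x \<otimes> desc n k = desc n k \<otimes> x"
  using assms(2) by (induction n) (simp_all add: x commute_mult)

lemma asc_commute:
  assumes x: "x \<in> carrier G" and "\<And>i. k \<le> i \<Longrightarrow> i < n + k \<Longrightarrow> x \<otimes> b i = b i \<otimes> x"
  shows "x \<otimes> asc n k = asc n k \<otimes> x"
  using assms(2) by (induction n) (simp_all add: x commute_mult)

lemma cols_commute:
  assumes x: "x \<in> carrier G" and "\<And>i. a \<le> i \<Longrightarrow> i + 1 < l + a + n \<Longrightarrow> x \<otimes> b i = b i \<otimes> x"
  shows "x \<otimes> cols l a n = cols l a n \<otimes> x"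
  using assms(2)
proof (induction n)
  case (Suc n)
  have "x \<otimes> asc l (a + n) = asc l (a + n) \<otimes> x" by (rule asc_commute[OF x]) (use Suc.prems in auto)
  moreover have "x \<otimes> cols l a n = cols l a n \<otimes> x" using Suc by simp
  ultimately show ?case using x by (simp add: commute_mult)
qed (simp add: x)

text \<open>The new crossing at the end of each column commutes with all earlier columns, because
  their indices are smaller by at least two; collected at the right, these crossings form the new
  row.\<close>

lemma cols_Suc:
  assumes "n + l < N"
  shows "cols (Suc l) 1 n = cols l 1 n \<otimes> desc n (Suc l)"
  using assms
proof (induction n)
  case (Suc n)
  have comm: "b (l + (1 + n)) \<otimes> cols l 1 n = cols l 1 n \<otimes> b (l + (1 + n))"
    by (rule cols_commute) (use Suc.prems in \<open>auto intro: far_bb\<close>)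
  have "cols (Suc l) 1 (Suc n) = asc l (1 + n) \<otimes> (b (l + (1 + n)) \<otimes> cols l 1 n) \<otimes> desc n (Suc l)"
    using Suc by (simp add: m_assoc)
  also have "\<dots> = asc l (1 + n) \<otimes> (cols l 1 n \<otimes> b (l + (1 + n))) \<otimes> desc n (Suc l)" by (simp only: comm)
  also have "\<dots> = cols l 1 (Suc n) \<otimes> desc (Suc n) (Suc l)"
    by (simp add: m_assoc add.commute add.left_commute)
  finally show ?case .
qed simp

text \<open>The braid of \<open>l\<close> strands crossing \<open>n\<close> strands, read strand by strand in either way.\<close>

lemma rows_eq_cols: assumes "n + l \<le> N" shows "rows n 1 l = cols l 1 n"
  using assms
proof (induction l)
  case 0
  have "asc 0 k = \<one>" for k by simp
  then have "cols 0 1 n = \<one>" by (induction n) simp_all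
  then show ?case by simp
next
  case (Suc l)
  then show ?case using cols_Suc[of n l] by simp
qed

lemma rows_shift: "rows n a (Suc l) = desc n a \<otimes> rows n (Suc a) l"
  by (induction l) (simp_all add: m_assoc)

lemma cols_shift: "cols l a (Suc n) = cols l (Suc a) n \<otimes> asc l a"
  by (induction n) (simp_all add: m_assoc)

lemma asc_asc_inv: "asc n k \<otimes> asc_inv n k = \<one>" "asc_inv n k \<otimes> asc n k = \<one>"
proof -
  show "asc n k \<otimes> asc_inv n k = \<one>"
  proof (induction n)
    case (Suc n)
    have "asc (Suc n) k \<otimes> asc_inv (Suc n) k = asc n k \<otimes> ((b (n + k) \<otimes> c (n + k)) \<otimes> asc_inv n k)"
      by (simp add: m_assoc)
    then show ?case using Suc by (simp add: bc)
  qed simp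
  show "asc_inv n k \<otimes> asc n k = \<one>"
  proof (induction n)
    case (Suc n)
    have "asc_inv (Suc n) k \<otimes> asc (Suc n) k = c (n + k) \<otimes> ((asc_inv n k \<otimes> asc n k) \<otimes> b (n + k))"
      by (simp add: m_assoc)
    then show ?case using Suc by (simp add: bc)
  qed simp
qed

section \<open>Moving the translation through the braid\<close>

lemma rot_desc: "1 \<le> k \<Longrightarrow> n + k < N \<Longrightarrow> u \<otimes> desc n k = desc n (Suc k) \<otimes> u"
proof (induction n)
  case (Suc n)
  have "u \<otimes> desc (Suc n) k = (u \<otimes> b (n + k)) \<otimes> desc n k" by (simp add: m_assoc)
  also have "\<dots> = b (Suc (n + k)) \<otimes> (u \<otimes> desc n k)" using Suc.prems by (simp add: rot m_assoc)
  also have "\<dots> = desc (Suc n) (Suc k) \<otimes> u" using Suc by (simp add: m_assoc)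
  finally show ?case .
qed simp

lemma rot_asc: "1 \<le> k \<Longrightarrow> n + k < N \<Longrightarrow> u \<otimes> asc n k = asc n (Suc k) \<otimes> u"
proof (induction n)
  case (Suc n)
  have "u \<otimes> asc (Suc n) k = (u \<otimes> asc n k) \<otimes> b (n + k)" by (simp add: m_assoc)
  also have "\<dots> = asc n (Suc k) \<otimes> (u \<otimes> b (n + k))" using Suc by (simp add: m_assoc)
  also have "\<dots> = asc (Suc n) (Suc k) \<otimes> u" using Suc.prems by (simp add: rot m_assoc)
  finally show ?case .
qed simp

lemma rot_rows: "1 \<le> a \<Longrightarrow> n + a + l \<le> N \<Longrightarrow> u \<otimes> rows n a l = rows n (Suc a) l \<otimes> u"
proof (induction l)
  case (Suc l)
  have "u \<otimes> rows n a (Suc l) = (u \<otimes> rows n a l) \<otimes> desc n (a + l)" by (simp add: m_assoc)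
  also have "\<dots> = rows n (Suc a) l \<otimes> (u \<otimes> desc n (a + l))" using Suc by (simp add: m_assoc)
  also have "\<dots> = rows n (Suc a) (Suc l) \<otimes> u" using Suc.prems by (simp add: rot_desc m_assoc)
  finally show ?case .
qed simp

lemma rot_cols: "1 \<le> a \<Longrightarrow> l + a + n \<le> N \<Longrightarrow> u \<otimes> cols l a n = cols l (Suc a) n \<otimes> u"
proof (induction n)
  case (Suc n)
  have "u \<otimes> cols l a (Suc n) = (u \<otimes> asc l (a + n)) \<otimes> cols l a n" by (simp add: m_assoc)
  also have "\<dots> = asc l (Suc (a + n)) \<otimes> (u \<otimes> cols l a n)" using Suc.prems by (simp add: rot_asc m_assoc)
  also have "\<dots> = cols l (Suc a) (Suc n) \<otimes> u" using Suc by (simp add: m_assoc)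
  finally show ?case .
qed simp

text \<open>Passing \<open>u\<close> through all rows but the last raises their indices by one. The
  free factor \<open>desc n 1\<close> then serves as the new first row, while
  \<open>desc n l\<close> is the old last row.\<close>

lemma braid_u_first:
  assumes "l \<ge> 1" "n + l = N"
  shows "rows n 1 l \<otimes> (u \<otimes> desc n l) = (desc n 1 \<otimes> u) \<otimes> rows n 1 l"
proof -
  obtain l' where l: "l = Suc l'" using assms by (cases l) auto
  have "(desc n 1 \<otimes> u) \<otimes> rows n 1 l = desc n 1 \<otimes> ((u \<otimes> rows n 1 l') \<otimes> desc n l)"
    by (simp add: l m_assoc)
  also have "\<dots> = desc n 1 \<otimes> ((rows n 2 l' \<otimes> u) \<otimes> desc n l)"
    using rot_rows[of 1 n l'] assms l by (simp add: numeral_2_eq_2)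
  also have "\<dots> = (desc n 1 \<otimes> rows n 2 l') \<otimes> (u \<otimes> desc n l)" by (simp add: m_assoc)
  also have "desc n 1 \<otimes> rows n 2 l' = rows n 1 l" unfolding l rows_shift by (simp add: numeral_2_eq_2)
  finally show ?thesis by simp
qed

text \<open>The column-wise counterpart of \<open>braid_u_first\<close>: \<open>asc_inv l 1\<close>
  cancels the rightmost column, \<open>u\<close> raises the remaining ones by one, and the missing
  leftmost column is inserted together with its inverse.\<close>

lemma braid_u_second:
  assumes "n \<ge> 1" "n + l = N"
  shows "rows n 1 l \<otimes> (asc_inv l 1 \<otimes> u) = (u \<otimes> asc_inv l n) \<otimes> rows n 1 l"
proof -
  obtain n' where n: "n = Suc n'" using assms by (cases n) auto
  have r: "rows n 1 l = cols l 1 n" using rows_eq_cols assms by simp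
  have "rows n 1 l \<otimes> (asc_inv l 1 \<otimes> u) = cols l 2 n' \<otimes> ((asc l 1 \<otimes> asc_inv l 1) \<otimes> u)"
    unfolding r unfolding n cols_shift by (simp add: m_assoc numeral_2_eq_2)
  also have "\<dots> = cols l 2 n' \<otimes> u" by (simp add: asc_asc_inv)
  also have "\<dots> = u \<otimes> cols l 1 n'" using rot_cols[of 1 l n'] assms n by (simp add: numeral_2_eq_2)
  also have "\<dots> = u \<otimes> ((asc_inv l n \<otimes> asc l n) \<otimes> cols l 1 n')" by (simp add: asc_asc_inv)
  also have "\<dots> = (u \<otimes> asc_inv l n) \<otimes> (asc l n \<otimes> cols l 1 n')" by (simp add: m_assoc)
  also have "asc l n \<otimes> cols l 1 n' = rows n 1 l" unfolding r by (simp add: n)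
  finally show ?thesis .
qed

text \<open>Two neighbouring strands crossed by the same \<open>n\<close> strands carry
  \<open>e\<close> with them: each pair of crossings moves it up by one index, which is the relation
  \<open>up\<close>.\<close>

lemma desc_desc_e:
  "n + 1 < N \<Longrightarrow> desc n 1 \<otimes> (desc n 2 \<otimes> e 1) = e (Suc n) \<otimes> (desc n 1 \<otimes> desc n 2)"
proof (induction n)
  case (Suc n)
  have comm: "b (n + 2) \<otimes> desc n 1 = desc n 1 \<otimes> b (n + 2)"
    by (rule desc_commute) (use Suc.prems in \<open>auto intro: far_bb\<close>)
  \<comment> \<open>Regroups the two rows into pairs of consecutive crossings; only a distant
    commutation is used.\<close>
  have dd: "desc (Suc n) 1 \<otimes> desc (Suc n) 2 = b (n + 1) \<otimes> (b (n + 2) \<otimes> (desc n 1 \<otimes> desc n 2))"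
  proof -
    have "desc (Suc n) 1 \<otimes> desc (Suc n) 2 = b (n + 1) \<otimes> ((desc n 1 \<otimes> b (n + 2)) \<otimes> desc n 2)"
      by (simp add: m_assoc)
    also have "\<dots> = b (n + 1) \<otimes> ((b (n + 2) \<otimes> desc n 1) \<otimes> desc n 2)" by (simp only: comm)
    finally show ?thesis by (simp add: m_assoc)
  qed
  have "desc (Suc n) 1 \<otimes> (desc (Suc n) 2 \<otimes> e 1) = (desc (Suc n) 1 \<otimes> desc (Suc n) 2) \<otimes> e 1"
    by (simp only: m_assoc closed carr)
  also have "\<dots> = b (n + 1) \<otimes> (b (n + 2) \<otimes> (desc n 1 \<otimes> (desc n 2 \<otimes> e 1)))"
    unfolding dd by (simp only: m_assoc closed carr m_closed)
  also have "\<dots> = (b (n + 1) \<otimes> (b (n + 1 + 1) \<otimes> e (n + 1))) \<otimes> (desc n 1 \<otimes> desc n 2)"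
    using Suc by (simp add: m_assoc)
  also have "b (n + 1) \<otimes> (b (n + 1 + 1) \<otimes> e (n + 1)) = e (n + 1 + 1) \<otimes> (b (n + 1) \<otimes> b (n + 1 + 1))"
    by (rule up) (use Suc.prems in auto)
  also have "(e (n + 1 + 1) \<otimes> (b (n + 1) \<otimes> b (n + 1 + 1))) \<otimes> (desc n 1 \<otimes> desc n 2) =
     e (Suc (Suc n)) \<otimes> (b (n + 1) \<otimes> (b (n + 2) \<otimes> (desc n 1 \<otimes> desc n 2)))"
    by (simp add: m_assoc)
  also have "\<dots> = e (Suc (Suc n)) \<otimes> (desc (Suc n) 1 \<otimes> desc (Suc n) 2)" by (simp only: dd)
  finally show ?case .
qed simp

text \<open>Only the first two rows interact with \<open>e 1\<close>; the indices in all later rows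
  are at least 3, so these rows commute with it.\<close>

lemma braid_e_first:
  assumes "2 \<le> l" "n + l \<le> N"
  shows "rows n 1 l \<otimes> e 1 = e (n + 1) \<otimes> rows n 1 l"
proof -
  have "rows n 1 (Suc (Suc l)) \<otimes> e 1 = e (Suc n) \<otimes> rows n 1 (Suc (Suc l))" if "n + Suc (Suc l) \<le> N" for l
    using that
  proof (induction l)
    case 0
    then show ?case using desc_desc_e[of n] by (simp add: m_assoc numeral_2_eq_2)
  next
    case (Suc l)
    let ?D = "desc n (1 + Suc (Suc l))"
    have comm: "e 1 \<otimes> ?D = ?D \<otimes> e 1"
      by (rule desc_commute) (use Suc.prems in \<open>auto intro!: far_be[symmetric]\<close>)
    have "rows n 1 (Suc (Suc (Suc l))) \<otimes> e 1 = rows n 1 (Suc (Suc l)) \<otimes> (?D \<otimes> e 1)"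
      unfolding rows.simps(2)[of n 1 "Suc (Suc l)"] by (simp only: m_assoc closed carr)
    also have "\<dots> = (rows n 1 (Suc (Suc l)) \<otimes> e 1) \<otimes> ?D" by (simp only: m_assoc closed carr comm)
    also have "\<dots> = e (Suc n) \<otimes> (rows n 1 (Suc (Suc l)) \<otimes> ?D)" using Suc by (simp only: m_assoc closed carr)
    finally show ?case by simp
  qed
  from this[of "l - 2"] assms show ?thesis by (simp add: numeral_2_eq_2 Suc_diff_Suc)
qed

text \<open>Only the last two crossings of the row interact with \<open>e (Suc k)\<close>, by the
  relation \<open>down\<close>; the crossings before them are distant from
  \<open>e k\<close>.\<close>

lemma desc_e:
  assumes "1 \<le> k" "2 \<le> n" "n + k \<le> N"
  shows "desc n k \<otimes> e (Suc k) = e k \<otimes> desc n k"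
proof -
  have "desc (Suc (Suc n)) k \<otimes> e (Suc k) = e k \<otimes> desc (Suc (Suc n)) k" if "Suc (Suc n) + k \<le> N" for n
    using that
  proof (induction n)
    case 0
    then show ?case using down[of k] assms by (simp add: m_assoc)
  next
    case (Suc n)
    have comm: "b (Suc (Suc n) + k) \<otimes> e k = e k \<otimes> b (Suc (Suc n) + k)"
      by (rule far_be) (use Suc.prems assms in auto)
    have "desc (Suc (Suc (Suc n))) k \<otimes> e (Suc k) = b (Suc (Suc n) + k) \<otimes> (desc (Suc (Suc n)) k \<otimes> e (Suc k))"
      unfolding desc.simps(2)[of "Suc (Suc n)"] by (simp only: m_assoc closed carr)
    also have "\<dots> = (b (Suc (Suc n) + k) \<otimes> e k) \<otimes> desc (Suc (Suc n)) k"
      using Suc by (simp only: m_assoc closed carr)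
    also have "\<dots> = e k \<otimes> desc (Suc (Suc (Suc n))) k" unfolding comm desc.simps(2)[of "Suc (Suc n)"]
      by (simp only: m_assoc closed carr)
    finally show ?case .
  qed
  from this[of "n - 2"] assms show ?thesis by (simp add: numeral_2_eq_2 Suc_diff_Suc)
qed

text \<open>Each row passed lowers the index by one, so \<open>l\<close> rows take
  \<open>l + 1\<close> to \<open>1\<close>.\<close>

lemma braid_e_second:
  assumes "2 \<le> n"
  shows "n + l \<le> N \<Longrightarrow> rows n 1 l \<otimes> e (l + 1) = e 1 \<otimes> rows n 1 l"
proof (induction l)
  case (Suc l)
  have d: "desc n (1 + l) \<otimes> e (Suc (1 + l)) = e (1 + l) \<otimes> desc n (1 + l)"
    by (rule desc_e) (use Suc.prems assms in auto)
  have "rows n 1 (Suc l) \<otimes> e (Suc l + 1) = rows n 1 l \<otimes> (desc n (1 + l) \<otimes> e (Suc (1 + l)))"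
    by (simp add: m_assoc)
  also have "\<dots> = (rows n 1 l \<otimes> e (l + 1)) \<otimes> desc n (1 + l)"
    unfolding d by (simp add: m_assoc)
  also have "\<dots> = (e 1 \<otimes> rows n 1 l) \<otimes> desc n (1 + l)" using Suc by simp
  finally show ?case by (simp add: m_assoc)
qed simp

end

section \<open>Braid words as products of lists\<close>

lemma (in monoid) list_prod_append:
  assumes "set xs \<subseteq> carrier G" "set ys \<subseteq> carrier G"
  shows "list_prod G (xs @ ys) = list_prod G xs \<otimes> list_prod G ys \<and> list_prod G (xs @ ys) \<in> carrier G"
proof -
  have ys: "list_prod G ys \<in> carrier G" using assms(2) by (induction ys) (auto simp: list_prod_def)
  have "list_prod G xs \<in> carrier G \<and> list_prod G (xs @ ys) = list_prod G xs \<otimes> list_prod G ys"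
    using assms(1) by (induction xs) (use ys in \<open>auto simp: list_prod_def m_assoc\<close>)
  then show ?thesis using ys by simp
qed

lemma list_prod_simps [simp]:
  "list_prod G [] = \<one>\<^bsub>G\<^esub>" "list_prod G (x # xs) = x \<otimes>\<^bsub>G\<^esub> list_prod G xs"
  by (simp_all add: list_prod_def)

context tl_braid
begin

lemma desc_list: "list_prod G (map b (rev [k..<n + k])) = desc n k"
  by (induction n) simp_all

lemma asc_inv_list: "list_prod G (map c (rev [k..<n + k])) = asc_inv n k"
  by (induction n) simp_all

lemma rows_list: "list_prod G (map (\<lambda>k. list_prod G (map b (rev [k..<n + k]))) [a..<a + l]) = rows n a l"
proof (induction l)
  case (Suc l)
  have "list_prod G (map (desc n) [a..<a + l] @ [desc n (a + l)]) =
    list_prod G (map (desc n) [a..<a + l]) \<otimes> list_prod G [desc n (a + l)]"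
    by (rule list_prod_append[THEN conjunct1]) auto
  then show ?case using Suc by (simp add: desc_list)
qed simp

lemma rows_Units: "rows n a l \<in> Units G"
proof -
  have "b i \<in> Units G" for i unfolding Units_def using bc[of i] by auto
  then have "desc n k \<in> Units G" for n k by (induction n) simp_all
  then show ?thesis by (induction l) simp_all
qed

end

section \<open>Relations in the affine Temperley--Lieb algebra\<close>

lemma TLa_simps [simp]:
  "monoid.mult (TLa m N) = bmult (diagram_comp N) (\<lambda>d d'. m ^ contractible_loops N d d')"
  "carrier (TLa m N) = {a. Poly_Mapping.keys a \<subseteq> adiagrams N}"
  "monoid.one (TLa m N) = tl_one" "ring.zero (TLa m N) = 0" "ring.add (TLa m N) = (+)"
  by (simp_all add: TLa_def tl_one_def)

lemma combination_closed:
  fixes a b :: "'b \<Rightarrow>\<^sub>0 complex"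
  shows "Poly_Mapping.keys a \<subseteq> B \<Longrightarrow> Poly_Mapping.keys b \<subseteq> B \<Longrightarrow>
    Poly_Mapping.keys (pm_scale x a + pm_scale y b) \<subseteq> B"
  by (meson Un_least keys_add keys_pm_scale subset_trans)

context
  fixes N :: nat and s m :: complex
  assumes N: "N \<ge> 2" and s: "s \<noteq> 0" and m: "m = s\<^sup>2 + inverse (s\<^sup>2)"
begin

private abbreviation mul (infixl "\<bullet>" 70) where
  "mul \<equiv> bmult (diagram_comp N) (\<lambda>d d'. m ^ contractible_loops N d d')"

private lemma N0: "N > 0" using N by simp

private lemma eN: "e_gen N i = Poly_Mapping.single (E N (int i)) 1"
  by (simp add: e_gen_def e_diagram_E)

private lemma uN: "u_gen = Poly_Mapping.single (U 1) 1" and oN: "tl_one = Poly_Mapping.single (U 0) 1"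
  by (simp_all add: u_gen_def tl_one_def u_diagram_U id_diagram_U)

private lemma keys_gen:
  "Poly_Mapping.keys (e_gen N i) \<subseteq> adiagrams N" "Poly_Mapping.keys u_gen \<subseteq> adiagrams N"
  "Poly_Mapping.keys tl_one \<subseteq> adiagrams N"
  by (simp_all add: eN uN oN E_adiagrams[OF N] U_adiagrams)

private lemma one:
  "Poly_Mapping.keys x \<subseteq> adiagrams N \<Longrightarrow> tl_one \<bullet> x = x"
  "Poly_Mapping.keys x \<subseteq> adiagrams N \<Longrightarrow> x \<bullet> tl_one = x"
  unfolding tl_one_def
  by (rule multiplicative_basis.bmult_one_left[OF tl_basis[OF N0]], assumption,
    rule multiplicative_basis.bmult_one_right[OF tl_basis[OF N0]], assumption)

private lemma keys_mul:
  "Poly_Mapping.keys x \<subseteq> adiagrams N \<Longrightarrow> Poly_Mapping.keys y \<subseteq> adiagrams N \<Longrightarrow>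
    Poly_Mapping.keys (x \<bullet> y) \<subseteq> adiagrams N"
  by (rule multiplicative_basis.bmult_closed[OF tl_basis[OF N0]])

private lemma cupE: "pairing (E N j) (Outer, j) = (Outer, j + 1)"
  by (rule pairing_E_cup) (auto simp: cupswap_def)

private lemma ee: "e_gen N i \<bullet> e_gen N i = pm_scale m (e_gen N i)"
  using E_absorb[OF N pmatch_E[OF N] cupE] by (simp add: eN contractible_loops_E[OF N pmatch_E[OF N]] cupE)

private lemma eee:
  assumes "N \<ge> 3" "int k = int j + 1 \<or> int k = int j - 1"
  shows "e_gen N j \<bullet> (e_gen N k \<bullet> e_gen N j) = e_gen N j"
  using E_slide[OF assms pmatch_E[OF N] cupE] by (simp add: eN)

private lemma far:
  assumes "1 \<le> i" "i + 2 \<le> j" "j < N"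
  shows "e_gen N j \<bullet> e_gen N i = e_gen N i \<bullet> e_gen N j"
proof -
  have f: "\<not> int N dvd a" if "0 < a" "a < int N" for a using that by (simp add: zdvd_not_zless)
  have 1: "\<not> int N dvd int j - int i" "\<not> int N dvd int j - int i - 1" "\<not> int N dvd int j - int i + 1"
    by (rule f; use assms in linarith)+
  have "\<not> int N dvd - (int j - int i)" "\<not> int N dvd - (int j - int i + 1)" "\<not> int N dvd - (int j - int i - 1)"
    using 1 by (simp_all only: dvd_minus_iff not_False_eq_True)
  then have 2: "\<not> int N dvd int i - int j" "\<not> int N dvd int i - int j - 1" "\<not> int N dvd int i - int j + 1"
    by (simp_all add: algebra_simps)
  show ?thesis using E_commute[OF N 1] E_commute(2)[OF N 2] by (simp add: eN)
qed

private lemma ue: "u_gen \<bullet> e_gen N i = e_gen N (i + 1) \<bullet> u_gen"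
  using U_E(1)[OF N, of 1 "int i"] U_E(2)[OF N, of "int i" 1] U_comp(2)[OF N0 pmatch_E[OF N]]
  by (simp add: eN uN add.commute)

private lemma binv: "g_inv s N i = pm_scale (- \<i> * inverse s) tl_one + pm_scale (\<i> * s) (e_gen N i)"
  by (rule poly_mapping_eqI) (simp add: g_inv_def lookup_add lookup_minus algebra_simps)

private lemma bpos: "g_pos s N i = pm_scale (\<i> * s) tl_one + pm_scale (- \<i> * inverse s) (e_gen N i)"
  by (rule poly_mapping_eqI) (simp add: g_pos_def lookup_add lookup_minus algebra_simps)

private lemmas linear = bmult_add_left bmult_add_right bmult_scale_left bmult_scale_right

text \<open>Write a braid generator as \<open>x + y e\<close> with \<open>x = -i/s\<close> and
  \<open>y = i s\<close>. Then \<open>x y = 1\<close>, and the choice of \<open>m\<close> amounts to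
  \<open>x^2 + m + y^2 = 0\<close>. These identities account for both the inverses and
  \<open>slide_braid\<close>.\<close>

private lemma coeff:
  "(- \<i> * inverse s) * (\<i> * s) = 1" "(\<i> * s) * (- \<i> * inverse s) = 1"
  "(- \<i> * inverse s) * (- \<i> * inverse s) + m + (\<i> * s) * (\<i> * s) = 0"
  using s by (simp_all add: m power2_eq_square field_simps)

private lemma scale_cancel:
  assumes "x + m + y = 0"
  shows "pm_scale x a + (pm_scale 1 c + (pm_scale m a + pm_scale y a)) = c"
    and "pm_scale x a + (pm_scale m a + (pm_scale 1 c + pm_scale y a)) = c"
proof -
  have "x * v + (w + (m * v + y * v)) = w" for v w :: complex
  proof -
    have "x * v + (w + (m * v + y * v)) = w + (x + m + y) * v" by (simp add: algebra_simps)
    then show ?thesis by (simp add: assms)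
  qed
  then show "pm_scale x a + (pm_scale 1 c + (pm_scale m a + pm_scale y a)) = c"
    "pm_scale x a + (pm_scale m a + (pm_scale 1 c + pm_scale y a)) = c"
    by (auto intro!: poly_mapping_eqI simp: lookup_add add.left_commute)
qed

text \<open>After expansion both sides reduce to \<open>e_k e_j\<close>: the remaining terms are
  multiples of a single generator with total coefficient \<open>x^2 + m + y^2 = 0\<close>.\<close>

private lemma slide_braid:
  assumes N3: "N \<ge> 3" and jk: "int k = int j + 1 \<or> int k = int j - 1"
  shows "g_inv s N j \<bullet> (g_inv s N k \<bullet> e_gen N j) = e_gen N k \<bullet> (g_inv s N j \<bullet> g_inv s N k)"
proof -
  let ?x = "- \<i> * inverse s" and ?y = "\<i> * s" and ?e = "e_gen N j" and ?f = "e_gen N k"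
  note k = keys_gen keys_mul
  have kj: "int j = int k + 1 \<or> int j = int k - 1" using jk by auto
  have c': "?x * ?x + m + ?y * ?y = 0" by (rule coeff)
  have "g_inv s N j \<bullet> (g_inv s N k \<bullet> ?e) =
    pm_scale (?x * ?x) ?e + (pm_scale (?x * ?y) (?f \<bullet> ?e) + (pm_scale (?y * ?x) (?e \<bullet> ?e) + pm_scale (?y * ?y) (?e \<bullet> (?f \<bullet> ?e))))"
    by (simp only: binv linear one k pm_scale_simps add_ac mult.commute)
  also have "\<dots> = ?f \<bullet> ?e"
    unfolding coeff(1,2) ee eee[OF N3 jk] pm_scale_simps(5) mult_1_left by (rule scale_cancel(1)[OF c'])
  finally have 1: "g_inv s N j \<bullet> (g_inv s N k \<bullet> ?e) = ?f \<bullet> ?e" .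
  have "?f \<bullet> (g_inv s N j \<bullet> g_inv s N k) =
    pm_scale (?x * ?x) ?f + (pm_scale (?x * ?y) (?f \<bullet> ?f) + (pm_scale (?y * ?x) (?f \<bullet> ?e) + pm_scale (?y * ?y) (?f \<bullet> (?e \<bullet> ?f))))"
    by (simp only: binv linear one k pm_scale_simps add_ac mult.commute)
  also have "\<dots> = ?f \<bullet> ?e"
    unfolding coeff(1,2) ee eee[OF N3 kj] pm_scale_simps(5) mult_1_left by (rule scale_cancel(2)[OF c'])
  finally show ?thesis using 1 by simp
qed

lemma tl_braid_TLa: "tl_braid (TLa m N) N (g_inv s N) (g_pos s N) (e_gen N) u_gen"
proof -
  interpret ring "TLa m N" by (rule ring_TLa[OF N0])
  note k = keys_gen keys_mul
  have inv: "pm_scale x a + (pm_scale y b + (pm_scale z b + pm_scale (t * m) b)) = a"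
    if "x = 1" "y + z + t * m = 0" for x y z t and a b :: tl
  proof -
    have "y * v + (z * v + t * m * v) = 0" for v
    proof -
      have "y * v + (z * v + t * m * v) = (y + z + t * m) * v" by (simp add: algebra_simps)
      then show ?thesis by (simp add: that)
    qed
    then show ?thesis using that(1) by (auto intro!: poly_mapping_eqI simp: lookup_add)
  qed
  show ?thesis
  proof (unfold_locales; (simp only: TLa_simps mem_Collect_eq)?)
    fix i
    show "Poly_Mapping.keys (g_inv s N i) \<subseteq> adiagrams N" "Poly_Mapping.keys (g_pos s N i) \<subseteq> adiagrams N"
      unfolding binv bpos by (intro combination_closed keys_gen)+
    show "Poly_Mapping.keys (e_gen N i) \<subseteq> adiagrams N" "Poly_Mapping.keys u_gen \<subseteq> adiagrams N"
      by (rule keys_gen)+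
    let ?x = "- \<i> * inverse s" and ?y = "\<i> * s"
    have "g_inv s N i \<bullet> g_pos s N i = pm_scale (?x * ?y) tl_one +
       (pm_scale (?x * ?x) (e_gen N i) + (pm_scale (?y * ?y) (e_gen N i) + pm_scale ((?x * ?y) * m) (e_gen N i)))"
      by (simp only: binv bpos linear one k ee pm_scale_simps add_ac mult_ac)
    also have "\<dots> = tl_one" by (rule inv) (use coeff in \<open>auto simp: algebra_simps\<close>)
    finally show "g_inv s N i \<bullet> g_pos s N i = tl_one" .
    have "g_pos s N i \<bullet> g_inv s N i = pm_scale (?x * ?y) tl_one +
       (pm_scale (?y * ?y) (e_gen N i) + (pm_scale (?x * ?x) (e_gen N i) + pm_scale ((?x * ?y) * m) (e_gen N i)))"
      by (simp only: binv bpos linear one k ee pm_scale_simps add_ac mult_ac)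
    also have "\<dots> = tl_one" by (rule inv) (use coeff in \<open>auto simp: algebra_simps\<close>)
    finally show "g_pos s N i \<bullet> g_inv s N i = tl_one" .
    show "u_gen \<bullet> g_inv s N i = g_inv s N (i + 1) \<bullet> u_gen"
      by (simp only: binv linear one k ue)
    {
      assume i: "1 \<le> i" "i + 1 < N"
      then have N3: "N \<ge> 3" by simp
      show "g_inv s N i \<bullet> (g_inv s N (i + 1) \<bullet> e_gen N i) = e_gen N (i + 1) \<bullet> (g_inv s N i \<bullet> g_inv s N (i + 1))"
        by (rule slide_braid[OF N3]) simp
      show "g_inv s N (i + 1) \<bullet> (g_inv s N i \<bullet> e_gen N (i + 1)) = e_gen N i \<bullet> (g_inv s N (i + 1) \<bullet> g_inv s N i)"
        by (rule slide_braid[OF N3]) simp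
    }
    fix j assume ij: "1 \<le> i" "i + 2 \<le> j" "j < N"
    show "g_inv s N j \<bullet> e_gen N i = e_gen N i \<bullet> g_inv s N j"
      by (simp only: binv linear one k far[OF ij])
    show "g_inv s N j \<bullet> g_inv s N i = g_inv s N i \<bullet> g_inv s N j"
      by (simp only: binv linear one k far[OF ij] pm_scale_simps add_ac mult_ac)
  qed
qed

end

section \<open>The braid intertwines the two fusion maps\<close>

definition swap_tensor :: "tl_tensor \<Rightarrow> tl_tensor" where
  "swap_tensor t = Poly_Mapping.map_key prod.swap t"

lemma lookup_swap_tensor [simp]: "Poly_Mapping.lookup (swap_tensor t) (d2, d1) = Poly_Mapping.lookup t (d1, d2)"
  by (simp add: swap_tensor_def map_key.rep_eq)

lemma swap_tensor_simps [simp]: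
  "swap_tensor (Poly_Mapping.single (d1, d2) c) = Poly_Mapping.single (d2, d1) c"
  "swap_tensor (t + t') = swap_tensor t + swap_tensor t'" "swap_tensor 0 = 0"
  "swap_tensor (swap_tensor t) = t"
proof -
  have eq: "x = y" if "\<And>d1 d2. Poly_Mapping.lookup x (d1, d2) = Poly_Mapping.lookup y (d1, d2)" for x y :: tl_tensor
    by (rule poly_mapping_eqI) (use that in \<open>metis prod.collapse\<close>)
  show "swap_tensor (Poly_Mapping.single (d1, d2) c) = Poly_Mapping.single (d2, d1) c"
    "swap_tensor (t + t') = swap_tensor t + swap_tensor t'" "swap_tensor 0 = 0"
    "swap_tensor (swap_tensor t) = t"
    by (rule eq; auto simp: lookup_single lookup_add when_def)+
qed

lemma keys_swap_tensor: "Poly_Mapping.keys (swap_tensor t) = prod.swap ` Poly_Mapping.keys t"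
proof -
  have "(d2, d1) \<in> Poly_Mapping.keys (swap_tensor t) \<longleftrightarrow> (d1, d2) \<in> Poly_Mapping.keys t" for d1 d2
    by (simp add: in_keys_iff)
  then show ?thesis by force
qed

lemma TLa_tensor_simps [simp]:
  "monoid.mult (TLa_tensor m N1 N2) = bmult (\<lambda>(d1, d2) (d1', d2'). (diagram_comp N1 d1 d1', diagram_comp N2 d2 d2'))
     (\<lambda>(d1, d2) (d1', d2'). m ^ contractible_loops N1 d1 d1' * m ^ contractible_loops N2 d2 d2')"
  "carrier (TLa_tensor m N1 N2) = {t. Poly_Mapping.keys t \<subseteq> adiagrams N1 \<times> adiagrams N2}"
  "monoid.one (TLa_tensor m N1 N2) = Poly_Mapping.single (U 0, U 0) 1"
  "ring.zero (TLa_tensor m N1 N2) = 0" "ring.add (TLa_tensor m N1 N2) = (+)"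
  by (simp_all add: TLa_tensor_def id_diagram_U)

lemma elem_tensor_single [simp]:
  "elem_tensor (Poly_Mapping.single d 1) (Poly_Mapping.single d' 1) = Poly_Mapping.single (d, d') 1"
  by (simp add: elem_tensor_def)

lemma swap_tensor_carrier:
  "t \<in> carrier (TLa_tensor m N1 N2) \<Longrightarrow> swap_tensor t \<in> carrier (TLa_tensor m N2 N1)"
  by (auto simp: keys_swap_tensor TLa_tensor_simps)

text \<open>Serves for the inverse translation: its image is not prescribed by a formula but is
  fixed by being an inverse.\<close>

lemma (in monoid) intertwine_inverse:
  assumes "h \<in> carrier G" "x \<in> carrier G" "x' \<in> carrier G" "y \<in> carrier G" "y' \<in> carrier G"
    "x \<otimes> x' = \<one>" "y' \<otimes> y = \<one>" "h \<otimes> x = y \<otimes> h"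
  shows "h \<otimes> x' = y' \<otimes> h"
proof -
  have "h \<otimes> x' = (y' \<otimes> y) \<otimes> (h \<otimes> x')" using assms by simp
  also have "\<dots> = y' \<otimes> ((y \<otimes> h) \<otimes> x')" using assms(1-5) by (simp add: m_assoc)
  also have "\<dots> = y' \<otimes> (h \<otimes> (x \<otimes> x'))" using assms(1-5) by (simp add: m_assoc flip: assms(8))
  finally show ?thesis using assms by simp
qed

declare TLa_simps [simp del] TLa_tensor_simps [simp del]

section \<open>Products of elementary tensors\<close>

lemma single_carrier:
  "d \<in> adiagrams N1 \<Longrightarrow> d' \<in> adiagrams N2 \<Longrightarrow> Poly_Mapping.single (d, d') c \<in> carrier (TLa_tensor m N1 N2)"
  by (simp add: TLa_tensor_simps)

lemma single_first_mult:
  assumes "N2 > 0" "contractible_loops N1 d d' = 0"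
  shows "Poly_Mapping.single (d, U 0) 1 \<otimes>\<^bsub>TLa_tensor m N1 N2\<^esub> Poly_Mapping.single (d', U 0) 1 =
    Poly_Mapping.single (diagram_comp N1 d d', U 0) 1"
  using assms U_id[OF assms(1) pmatch_U] by (simp add: TLa_tensor_simps)

lemma single_second_mult:
  assumes "N1 > 0" "contractible_loops N2 d d' = 0"
  shows "Poly_Mapping.single (U 0, d) 1 \<otimes>\<^bsub>TLa_tensor m N1 N2\<^esub> Poly_Mapping.single (U 0, d') 1 =
    Poly_Mapping.single (U 0, diagram_comp N2 d d') 1"
  using assms U_id[OF assms(1) pmatch_U] by (simp add: TLa_tensor_simps)

lemma single_mixed_mult:
  assumes "N1 > 0" "N2 > 0" "d1 \<in> adiagrams N1" "d2 \<in> adiagrams N2"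
  shows "Poly_Mapping.single (d1, U 0) 1 \<otimes>\<^bsub>TLa_tensor m N1 N2\<^esub> Poly_Mapping.single (U 0, d2) 1 = Poly_Mapping.single (d1, d2) 1"
    and "Poly_Mapping.single (U 0, d2) 1 \<otimes>\<^bsub>TLa_tensor m N1 N2\<^esub> Poly_Mapping.single (d1, U 0) 1 = Poly_Mapping.single (d1, d2) 1"
  using U_id[OF assms(1) adiagrams_pmatch[OF assms(3)]] U_id[OF assms(2) adiagrams_pmatch[OF assms(4)]]
    id_U[OF assms(1) adiagrams_pmatch[OF assms(3)]] id_U[OF assms(2) adiagrams_pmatch[OF assms(4)]]
  by (simp_all add: TLa_tensor_simps)

lemma gen_adiagrams: assumes "N > 0" "gen N d" shows "d \<in> adiagrams N"
  using gen_comp_adiagrams[OF assms U_adiagrams, of 0] id_U(1)[OF assms(1) gen_pmatch[OF assms]] by simp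

lemma (in monoid) intertwine_mult:
  assumes "h \<in> carrier G" "x \<in> carrier G" "x' \<in> carrier G" "y \<in> carrier G" "y' \<in> carrier G"
    "h \<otimes> x = y \<otimes> h" "h \<otimes> x' = y' \<otimes> h"
  shows "h \<otimes> (x \<otimes> x') = (y \<otimes> y') \<otimes> h"
proof -
  have "h \<otimes> (x \<otimes> x') = (h \<otimes> x) \<otimes> x'" using assms(1-5) by (simp add: m_assoc)
  also have "\<dots> = y \<otimes> (h \<otimes> x')" using assms(1-5) by (simp add: assms(6) m_assoc)
  also have "\<dots> = (y \<otimes> y') \<otimes> h" using assms(1-5) by (simp add: assms(7) m_assoc)
  finally show ?thesis .
qed

locale fusion_pair =
  fixes q s m :: complex and N1 N2 :: nat and \<epsilon> \<epsilon>' :: "tl_tensor \<Rightarrow> tl"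
  assumes q: "q \<noteq> 0" "s\<^sup>2 = q" "m = q + inverse q" and pos: "N1 \<ge> 1" "N2 \<ge> 1"
    and \<epsilon>: "is_fusion_map m s N1 N2 \<epsilon>" and \<epsilon>': "is_fusion_map_minus m s N2 N1 \<epsilon>'"
begin

abbreviation "T \<equiv> TLa m (N1 + N2)"
abbreviation "h \<equiv> g_elem m s N1 N2"

sublocale braid: tl_braid T "N1 + N2" "g_inv s (N1 + N2)" "g_pos s (N1 + N2)" "e_gen (N1 + N2)" u_gen
  by (rule tl_braid_TLa) (use q pos in auto)

sublocale T: ring T
  by (rule ring_TLa) (use pos in auto)

lemma h_rows: "h = braid.rows N2 1 N1"
  using braid.rows_list[of N2 1 N1] by (simp add: g_elem_def)

lemma h_Units: "h \<in> Units T"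
  unfolding h_rows by (rule braid.rows_Units)

lemma h_carrier: "h \<in> carrier T"
  using h_Units by (rule braid.Units_closed)

lemma hom_\<epsilon>: "\<epsilon> \<in> ring_hom (TLa_tensor m N1 N2) T" "\<epsilon>' \<in> ring_hom (TLa_tensor m N2 N1) T"
  "\<And>c a. a \<in> carrier (TLa_tensor m N1 N2) \<Longrightarrow> \<epsilon> (pm_scale c a) = pm_scale c (\<epsilon> a)"
  "\<And>c a. a \<in> carrier (TLa_tensor m N2 N1) \<Longrightarrow> \<epsilon>' (pm_scale c a) = pm_scale c (\<epsilon>' a)"
  using \<epsilon> \<epsilon>' unfolding is_fusion_map_def is_fusion_map_minus_def algebra_hom_def
  by (auto simp: add.commute)

lemmas \<epsilon>_closed = ring_hom_closed[OF hom_\<epsilon>(1)] and \<epsilon>'_closed = ring_hom_closed[OF hom_\<epsilon>(2)]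
lemmas \<epsilon>_mult = ring_hom_mult[OF hom_\<epsilon>(1)] and \<epsilon>'_mult = ring_hom_mult[OF hom_\<epsilon>(2)]
lemmas \<epsilon>_add = ring_hom_add[OF hom_\<epsilon>(1)] and \<epsilon>'_add = ring_hom_add[OF hom_\<epsilon>(2)]
lemmas \<epsilon>_one = ring_hom_one[OF hom_\<epsilon>(1)] and \<epsilon>'_one = ring_hom_one[OF hom_\<epsilon>(2)]

lemma \<epsilon>_zero: "\<epsilon> 0 = 0" "\<epsilon>' 0 = 0"
  using \<epsilon>_add[of 0 0] \<epsilon>'_add[of 0 0] by (simp_all add: TLa_simps TLa_tensor_simps)

text \<open>In both maps the words attached to the translations consist of one \<open>desc\<close>
  or one \<open>asc_inv\<close> and \<open>u_gen\<close>: exchanging \<open>N1\<close> with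
  \<open>N2\<close> and each crossing with its inverse turns one family into the other. These are
  the shapes expected by \<open>braid_u_first\<close> and \<open>braid_u_second\<close>.\<close>

lemma \<epsilon>_values:
  "\<epsilon> (Poly_Mapping.single (U 1, U 0) 1) = u_gen \<otimes>\<^bsub>T\<^esub> braid.desc N2 N1"
  "\<epsilon> (Poly_Mapping.single (U 0, U 1) 1) = braid.asc_inv N1 1 \<otimes>\<^bsub>T\<^esub> u_gen"
  "N1 \<ge> 2 \<Longrightarrow> \<epsilon> (Poly_Mapping.single (E N1 1, U 0) 1) = e_gen (N1 + N2) 1"
  "N2 \<ge> 2 \<Longrightarrow> \<epsilon> (Poly_Mapping.single (U 0, E N2 1) 1) = e_gen (N1 + N2) (N1 + 1)"
  "\<epsilon>' (Poly_Mapping.single (U 1, U 0) 1) = u_gen \<otimes>\<^bsub>T\<^esub> braid.asc_inv N1 N2"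
  "\<epsilon>' (Poly_Mapping.single (U 0, U 1) 1) = braid.desc N2 1 \<otimes>\<^bsub>T\<^esub> u_gen"
  "N2 \<ge> 2 \<Longrightarrow> \<epsilon>' (Poly_Mapping.single (E N2 1, U 0) 1) = e_gen (N1 + N2) 1"
  "N1 \<ge> 2 \<Longrightarrow> \<epsilon>' (Poly_Mapping.single (U 0, E N1 1) 1) = e_gen (N1 + N2) (N2 + 1)"
proof -
  note F = \<epsilon>[unfolded is_fusion_map_def fusion_formulas_def Let_def, THEN conjunct2]
  note F' = \<epsilon>'[unfolded is_fusion_map_minus_def fusion_formulas_def Let_def add.commute[of N2 N1], THEN conjunct2]
  have gens: "u_gen = Poly_Mapping.single (U 1) 1" "tl_one = Poly_Mapping.single (U 0) 1"
    "e_gen N 1 = Poly_Mapping.single (E N 1) 1" for N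
    by (simp_all add: u_gen_def tl_one_def e_gen_def u_diagram_U id_diagram_U e_diagram_E)
  have r1: "[N1..<N1 + N2] = [N1..<N2 + N1]" by (simp add: add.commute)
  have snoc: "list_prod T (xs @ [u_gen]) = list_prod T xs \<otimes>\<^bsub>T\<^esub> u_gen" if "set xs \<subseteq> carrier T" for xs
    using braid.list_prod_append[OF that, of "[u_gen]"] braid.carr(4) by (simp only: list_prod_simps braid.r_one) simp
  have sub: "set (map (g_pos s (N1 + N2)) l) \<subseteq> carrier T" "set (map (g_inv s (N1 + N2)) l) \<subseteq> carrier T" for l
    using braid.carr(1,2) by auto
  show "\<epsilon> (Poly_Mapping.single (U 1, U 0) 1) = u_gen \<otimes>\<^bsub>T\<^esub> braid.desc N2 N1"
    using F[THEN conjunct2, THEN conjunct2, THEN conjunct1] braid.desc_list[of N1 N2]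
    by (simp only: gens elem_tensor_single r1 list_prod_simps append.simps)
  show "\<epsilon> (Poly_Mapping.single (U 0, U 1) 1) = braid.asc_inv N1 1 \<otimes>\<^bsub>T\<^esub> u_gen"
    using F[THEN conjunct2, THEN conjunct2, THEN conjunct2, THEN conjunct1]
      braid.asc_inv_list[of 1 N1] snoc[OF sub(1)] by (simp add: gens(1,2) elem_tensor_single)
  show "N1 \<ge> 2 \<Longrightarrow> \<epsilon> (Poly_Mapping.single (E N1 1, U 0) 1) = e_gen (N1 + N2) 1"
    using F[THEN conjunct1, rule_format, of 1] gens(3)[of N1] by (simp add: gens(2) elem_tensor_single)
  show "N2 \<ge> 2 \<Longrightarrow> \<epsilon> (Poly_Mapping.single (U 0, E N2 1) 1) = e_gen (N1 + N2) (N1 + 1)"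
    using F[THEN conjunct2, THEN conjunct1, rule_format, of 1] gens(3)[of N2] by (simp add: gens(2) elem_tensor_single)
  show "\<epsilon>' (Poly_Mapping.single (U 1, U 0) 1) = u_gen \<otimes>\<^bsub>T\<^esub> braid.asc_inv N1 N2"
    using F'[THEN conjunct2, THEN conjunct2, THEN conjunct1] braid.asc_inv_list[of N2 N1]
    by (simp only: gens elem_tensor_single list_prod_simps append.simps)
  show "\<epsilon>' (Poly_Mapping.single (U 0, U 1) 1) = braid.desc N2 1 \<otimes>\<^bsub>T\<^esub> u_gen"
    using F'[THEN conjunct2, THEN conjunct2, THEN conjunct2, THEN conjunct1]
      braid.desc_list[of 1 N2] snoc[OF sub(2)] by (simp add: gens(1,2) elem_tensor_single)
  show "N2 \<ge> 2 \<Longrightarrow> \<epsilon>' (Poly_Mapping.single (E N2 1, U 0) 1) = e_gen (N1 + N2) 1"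
    using F'[THEN conjunct1, rule_format, of 1] gens(3)[of N2] by (simp add: gens(2) elem_tensor_single)
  show "N1 \<ge> 2 \<Longrightarrow> \<epsilon>' (Poly_Mapping.single (U 0, E N1 1) 1) = e_gen (N1 + N2) (N2 + 1)"
    using F'[THEN conjunct2, THEN conjunct1, rule_format, of 1] gens(3)[of N1] by (simp add: gens(2) elem_tensor_single)
qed

lemma intertwine_u_first:
  "h \<otimes>\<^bsub>T\<^esub> \<epsilon> (Poly_Mapping.single (U 1, U 0) 1) = \<epsilon>' (Poly_Mapping.single (U 0, U 1) 1) \<otimes>\<^bsub>T\<^esub> h"
  using braid.braid_u_first[of N1 N2] pos unfolding \<epsilon>_values h_rows by (simp add: add.commute)

lemma intertwine_u_second:
  "h \<otimes>\<^bsub>T\<^esub> \<epsilon> (Poly_Mapping.single (U 0, U 1) 1) = \<epsilon>' (Poly_Mapping.single (U 1, U 0) 1) \<otimes>\<^bsub>T\<^esub> h"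
  using braid.braid_u_second[of N2 N1] pos unfolding \<epsilon>_values h_rows by (simp add: add.commute)

lemma U_inverse:
  assumes "N > 0"
  shows "diagram_comp N (U 1) (U (- 1)) = U 0" "diagram_comp N (U (- 1)) (U 1) = U 0"
    "contractible_loops N (U c) (U c') = 0"
  using U_U[OF assms, of 1 "- 1"] U_U[OF assms, of "- 1" 1] U_comp(2)[OF assms pmatch_U] by simp_all

lemma N_pos: "N1 > 0" "N2 > 0"
  using pos by auto

text \<open>Since no contractible loop arises along \<open>gen\<close>, a composite diagram is
  literally the product of its factors in the tensor product algebra, and multiplicativity of the
  two maps applies.\<close>

lemma intertwine_first:
  assumes "gen N1 d"
  shows "h \<otimes>\<^bsub>T\<^esub> \<epsilon> (Poly_Mapping.single (d, U 0) 1) = \<epsilon>' (Poly_Mapping.single (U 0, d) 1) \<otimes>\<^bsub>T\<^esub> h"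
  using assms
proof induction
  case gen_u
  show ?case by (rule intertwine_u_first)
next
  case gen_u_inv
  note c = single_carrier[OF U_adiagrams U_adiagrams]
  show ?case
  proof (rule braid.intertwine_inverse[OF h_carrier \<epsilon>_closed[OF c] \<epsilon>_closed[OF c] \<epsilon>'_closed[OF c] \<epsilon>'_closed[OF c] _ _ intertwine_u_first])
    show "\<epsilon> (Poly_Mapping.single (U 1, U 0) 1) \<otimes>\<^bsub>T\<^esub> \<epsilon> (Poly_Mapping.single (U (- 1), U 0) 1) = \<one>\<^bsub>T\<^esub>"
      using \<epsilon>_mult[OF c c, of 1 0 1 "- 1" 0 1] \<epsilon>_one
        single_first_mult[OF N_pos(2) U_inverse(3)[OF N_pos(1)], of m 1 "- 1"] U_inverse[OF N_pos(1)]
      by (simp add: TLa_tensor_simps(3))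
    show "\<epsilon>' (Poly_Mapping.single (U 0, U (- 1)) 1) \<otimes>\<^bsub>T\<^esub> \<epsilon>' (Poly_Mapping.single (U 0, U 1) 1) = \<one>\<^bsub>T\<^esub>"
      using \<epsilon>'_mult[OF c c, of 0 "- 1" 1 0 1 1] \<epsilon>'_one
        single_second_mult[OF N_pos(2) U_inverse(3)[OF N_pos(1)], of m "- 1" 1] U_inverse[OF N_pos(1)]
      by (simp add: TLa_tensor_simps(3))
  qed
next
  case gen_e
  then show ?case using braid.braid_e_first[of N1 N2] unfolding h_rows by (simp add: \<epsilon>_values(3,8) add.commute)
next
  case (gen_comp d d')
  note d = gen_adiagrams[OF N_pos(1) gen_comp(1)] and d' = gen_adiagrams[OF N_pos(1) gen_comp(2)]
  note c = single_carrier[OF d U_adiagrams] and c' = single_carrier[OF d' U_adiagrams]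
  note e = single_carrier[OF U_adiagrams d] and e' = single_carrier[OF U_adiagrams d']
  show ?case
    unfolding single_first_mult[OF N_pos(2) gen_comp(3), symmetric, where m = m]
      single_second_mult[OF N_pos(2) gen_comp(3), symmetric, where m = m] \<epsilon>_mult[OF c c'] \<epsilon>'_mult[OF e e']
    by (rule braid.intertwine_mult[OF h_carrier \<epsilon>_closed[OF c] \<epsilon>_closed[OF c'] \<epsilon>'_closed[OF e] \<epsilon>'_closed[OF e'] gen_comp.IH])
qed

lemma intertwine_second:
  assumes "gen N2 d"
  shows "h \<otimes>\<^bsub>T\<^esub> \<epsilon> (Poly_Mapping.single (U 0, d) 1) = \<epsilon>' (Poly_Mapping.single (d, U 0) 1) \<otimes>\<^bsub>T\<^esub> h"
  using assms
proof induction
  case gen_u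
  show ?case by (rule intertwine_u_second)
next
  case gen_u_inv
  note c = single_carrier[OF U_adiagrams U_adiagrams]
  show ?case
  proof (rule braid.intertwine_inverse[OF h_carrier \<epsilon>_closed[OF c] \<epsilon>_closed[OF c] \<epsilon>'_closed[OF c] \<epsilon>'_closed[OF c] _ _ intertwine_u_second])
    show "\<epsilon> (Poly_Mapping.single (U 0, U 1) 1) \<otimes>\<^bsub>T\<^esub> \<epsilon> (Poly_Mapping.single (U 0, U (- 1)) 1) = \<one>\<^bsub>T\<^esub>"
      using \<epsilon>_mult[OF c c, of 0 1 1 0 "- 1" 1] \<epsilon>_one
        single_second_mult[OF N_pos(1) U_inverse(3)[OF N_pos(2)], of m 1 "- 1"] U_inverse[OF N_pos(2)]
      by (simp add: TLa_tensor_simps(3))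
    show "\<epsilon>' (Poly_Mapping.single (U (- 1), U 0) 1) \<otimes>\<^bsub>T\<^esub> \<epsilon>' (Poly_Mapping.single (U 1, U 0) 1) = \<one>\<^bsub>T\<^esub>"
      using \<epsilon>'_mult[OF c c, of "- 1" 0 1 1 0 1] \<epsilon>'_one
        single_first_mult[OF N_pos(1) U_inverse(3)[OF N_pos(2)], of m "- 1" 1] U_inverse[OF N_pos(2)]
      by (simp add: TLa_tensor_simps(3))
  qed
next
  case gen_e
  then show ?case using braid.braid_e_second[of N2 N1] unfolding h_rows by (simp add: \<epsilon>_values(4,7) add.commute)
next
  case (gen_comp d d')
  note d = gen_adiagrams[OF N_pos(2) gen_comp(1)] and d' = gen_adiagrams[OF N_pos(2) gen_comp(2)]
  note c = single_carrier[OF U_adiagrams d] and c' = single_carrier[OF U_adiagrams d']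
  note e = single_carrier[OF d U_adiagrams] and e' = single_carrier[OF d' U_adiagrams]
  show ?case
    unfolding single_first_mult[OF N_pos(1) gen_comp(3), symmetric, where m = m]
      single_second_mult[OF N_pos(1) gen_comp(3), symmetric, where m = m] \<epsilon>_mult[OF c c'] \<epsilon>'_mult[OF e e']
    by (rule braid.intertwine_mult[OF h_carrier \<epsilon>_closed[OF c] \<epsilon>_closed[OF c'] \<epsilon>'_closed[OF e] \<epsilon>'_closed[OF e'] gen_comp.IH])
qed

lemma intertwine:
  assumes "t \<in> carrier (TLa_tensor m N1 N2)"
  shows "h \<otimes>\<^bsub>T\<^esub> \<epsilon> t = \<epsilon>' (swap_tensor t) \<otimes>\<^bsub>T\<^esub> h"
proof -
  have "Poly_Mapping.keys t \<subseteq> adiagrams N1 \<times> adiagrams N2" using assms by (simp add: TLa_tensor_simps)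
  then show ?thesis
  proof (induction t rule: pm_induct)
    case zero
    show ?case using h_carrier by (simp add: \<epsilon>_zero TLa_simps)
  next
    case (single x c)
    obtain d1 d2 where x: "x = (d1, d2)" by (cases x)
    have d: "d1 \<in> adiagrams N1" "d2 \<in> adiagrams N2" using single x by auto
    note g = adiagrams_gen[OF N_pos(1) d(1)] adiagrams_gen[OF N_pos(2) d(2)]
    note cs = single_carrier[OF d(1) U_adiagrams] single_carrier[OF U_adiagrams d(2)]
      single_carrier[OF U_adiagrams d(1)] single_carrier[OF d(2) U_adiagrams]
    \<comment> \<open>The two factors commute, which permits opposite orders on the two sides: the
      exchange takes the first times the second to the second times the first, so that
      \<open>d1\<close> is moved through \<open>h\<close> as the left factor on both sides.\<close>
    have "h \<otimes>\<^bsub>T\<^esub> \<epsilon> (Poly_Mapping.single (d1, d2) 1) = \<epsilon>' (Poly_Mapping.single (d2, d1) 1) \<otimes>\<^bsub>T\<^esub> h"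
      unfolding single_mixed_mult(1)[OF N_pos d, symmetric, where m = m]
        single_mixed_mult(2)[OF N_pos(2,1) d(2,1), symmetric, where m = m] \<epsilon>_mult[OF cs(1,2)] \<epsilon>'_mult[OF cs(3,4)]
      by (rule braid.intertwine_mult[OF h_carrier \<epsilon>_closed[OF cs(1)] \<epsilon>_closed[OF cs(2)] \<epsilon>'_closed[OF cs(3)]
            \<epsilon>'_closed[OF cs(4)] intertwine_first[OF g(1)] intertwine_second[OF g(2)]])
    then have "h \<otimes>\<^bsub>T\<^esub> pm_scale c (\<epsilon> (Poly_Mapping.single (d1, d2) 1)) = pm_scale c (\<epsilon>' (Poly_Mapping.single (d2, d1) 1)) \<otimes>\<^bsub>T\<^esub> h"
      by (simp add: TLa_simps bmult_scale_left bmult_scale_right)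
    then have "h \<otimes>\<^bsub>T\<^esub> \<epsilon> (pm_scale c (Poly_Mapping.single (d1, d2) 1)) = \<epsilon>' (pm_scale c (Poly_Mapping.single (d2, d1) 1)) \<otimes>\<^bsub>T\<^esub> h"
      by (simp only: hom_\<epsilon>(3)[OF single_carrier[OF d]] hom_\<epsilon>(4)[OF single_carrier[OF d(2,1)]])
    then show ?case by (simp add: x)
  next
    case (add a b)
    have c: "a \<in> carrier (TLa_tensor m N1 N2)" "b \<in> carrier (TLa_tensor m N1 N2)"
      using add by (simp_all add: TLa_tensor_simps)
    have "\<epsilon> (a + b) = \<epsilon> a + \<epsilon> b" "\<epsilon>' (swap_tensor a + swap_tensor b) = \<epsilon>' (swap_tensor a) + \<epsilon>' (swap_tensor b)"
      using \<epsilon>_add[OF c] \<epsilon>'_add[OF swap_tensor_carrier[OF c(1)] swap_tensor_carrier[OF c(2)]]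
      by (simp_all add: TLa_simps TLa_tensor_simps)
    then show ?case using add by (simp add: TLa_simps bmult_add_left bmult_add_right)
  qed
qed

end

section \<open>Balanced tensor products\<close>

text \<open>Closure conditions that place the defining relations inside the free group. The
  construction is used at both stages: over the complex numbers, and over the tensor product of the
  two algebras.\<close>

locale tensor_data =
  fixes R :: "'r set" and A :: "('r, 'a) module" and M :: "('r, 'm) module"
  assumes A_add: "\<And>a a'. a \<in> carrier A \<Longrightarrow> a' \<in> carrier A \<Longrightarrow> a \<oplus>\<^bsub>A\<^esub> a' \<in> carrier A"
    and M_add: "\<And>x x'. x \<in> carrier M \<Longrightarrow> x' \<in> carrier M \<Longrightarrow> x \<oplus>\<^bsub>M\<^esub> x' \<in> carrier M"
    and A_smult: "\<And>r a. r \<in> R \<Longrightarrow> a \<in> carrier A \<Longrightarrow> r \<odot>\<^bsub>A\<^esub> a \<in> carrier A"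
    and M_smult: "\<And>r x. r \<in> R \<Longrightarrow> x \<in> carrier M \<Longrightarrow> r \<odot>\<^bsub>M\<^esub> x \<in> carrier M"
begin

abbreviation "S \<equiv> carrier A \<times> carrier M"
abbreviation "K \<equiv> tensor_kernel R A M"
abbreviation "cl \<equiv> tensor_class R A M"

lemma relations_keys: "\<rho> \<in> tensor_relations R A M \<Longrightarrow> Poly_Mapping.keys \<rho> \<subseteq> S"
proof -
  have d: "Poly_Mapping.keys (x - y) \<subseteq> S" if "Poly_Mapping.keys x \<subseteq> S" "Poly_Mapping.keys y \<subseteq> S" for x y :: "'a \<times> 'm \<Rightarrow>\<^sub>0 int"
    using that keys_diff[of x y] by blast
  assume "\<rho> \<in> tensor_relations R A M"
  then show ?thesis
    unfolding tensor_relations_def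
    by (elim UnE CollectE exE conjE; simp only:; intro d; simp add: keys_frag_of A_add M_add A_smult M_smult)
qed

lemma K_subgroup: "subgroup K (tensor_free A M)"
  unfolding tensor_kernel_def
  by (rule group.generate_is_subgroup) (use relations_keys in \<open>auto simp: tensor_free_def\<close>)

lemma K_keys: "k \<in> K \<Longrightarrow> Poly_Mapping.keys k \<subseteq> S"
  using subgroup.mem_carrier[OF K_subgroup] by (simp add: tensor_free_def)

lemma K_zero [simp]: "0 \<in> K"
  using subgroup.one_closed[OF K_subgroup] by (simp add: tensor_free_def)

lemma K_add: "k \<in> K \<Longrightarrow> k' \<in> K \<Longrightarrow> k + k' \<in> K"
  using subgroup.m_closed[OF K_subgroup] by (simp add: tensor_free_def)

lemma K_minus: "k \<in> K \<Longrightarrow> - k \<in> K"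
  using subgroup.m_inv_closed[OF K_subgroup] K_keys by (simp add: tensor_free_def)

lemma K_diff: "k \<in> K \<Longrightarrow> k' \<in> K \<Longrightarrow> k - k' \<in> K"
  using K_add[OF _ K_minus] by fastforce

lemma K_sum: "(\<And>i. i \<in> I \<Longrightarrow> f i \<in> K) \<Longrightarrow> sum f I \<in> K"
  by (induction I rule: infinite_finite_induct) (auto intro: K_add)

lemma K_relations:
  "a \<in> carrier A \<Longrightarrow> a' \<in> carrier A \<Longrightarrow> x \<in> carrier M \<Longrightarrow>
    frag_of (a \<oplus>\<^bsub>A\<^esub> a', x) - frag_of (a, x) - frag_of (a', x) \<in> K"
  "a \<in> carrier A \<Longrightarrow> x \<in> carrier M \<Longrightarrow> x' \<in> carrier M \<Longrightarrow>
    frag_of (a, x \<oplus>\<^bsub>M\<^esub> x') - frag_of (a, x) - frag_of (a, x') \<in> K"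
  "a \<in> carrier A \<Longrightarrow> r \<in> R \<Longrightarrow> x \<in> carrier M \<Longrightarrow>
    frag_of (r \<odot>\<^bsub>A\<^esub> a, x) - frag_of (a, r \<odot>\<^bsub>M\<^esub> x) \<in> K"
  unfolding tensor_kernel_def tensor_relations_def
  by (rule generate.incl, rule UnI1, rule UnI1, blast)
    (rule generate.incl, rule UnI1, rule UnI2, blast, rule generate.incl, rule UnI2, blast)

lemma class_iff: "x \<in> cl v \<longleftrightarrow> x - v \<in> K"
proof -
  have "cl v = (\<lambda>k. k + v) ` K" by (auto simp: tensor_class_def r_coset_def tensor_free_def)
  then show ?thesis by (metis (no_types, lifting) add_diff_cancel diff_add_cancel image_iff)
qed

lemma class_self [simp]: "v \<in> cl v"
  by (simp add: class_iff)

lemma class_eqI: assumes "v - w \<in> K" shows "cl v = cl w"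
proof (rule Set.set_eqI)
  fix x
  have "x - w = (x - v) + (v - w)" "x - v = (x - w) - (v - w)" by simp_all
  then show "x \<in> cl v \<longleftrightarrow> x \<in> cl w" unfolding class_iff using assms K_add K_diff by metis
qed

lemma class_eq_iff: "cl v = cl w \<longleftrightarrow> v - w \<in> K"
  using class_eqI class_self class_iff by metis

lemma carrier_tensor: "carrier (tensor_module R A M act) = cl ` {v. Poly_Mapping.keys v \<subseteq> S}"
  by (auto simp: tensor_module_def Let_def FactGroup_def RCOSETS_def tensor_class_def tensor_free_def)

lemma zero_tensor: "\<zero>\<^bsub>tensor_module R A M act\<^esub> = cl 0"
proof -
  have "\<zero>\<^bsub>tensor_module R A M act\<^esub> = K" by (simp add: tensor_module_def Let_def FactGroup_def)
  also have "K = cl 0" by (auto simp: class_iff)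
  finally show ?thesis .
qed

lemma add_tensor: "cl v \<oplus>\<^bsub>tensor_module R A M act\<^esub> cl w = cl (v + w)"
proof -
  have "cl v \<oplus>\<^bsub>tensor_module R A M act\<^esub> cl w = (\<Union>x \<in> cl v. \<Union>y \<in> cl w. {x + y})"
    by (simp add: tensor_module_def Let_def FactGroup_def set_mult_def tensor_free_def)
  also have "\<dots> = cl (v + w)"
  proof (intro Set.set_eqI iffI)
    fix z assume "z \<in> (\<Union>x \<in> cl v. \<Union>y \<in> cl w. {x + y})"
    then obtain x y where "x - v \<in> K" "y - w \<in> K" "z = x + y" by (auto simp: class_iff)
    then have "(x - v) + (y - w) \<in> K" "z - (v + w) = (x - v) + (y - w)" by (simp_all add: K_add)
    then show "z \<in> cl (v + w)" by (simp only: class_iff)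
  next
    fix z assume "z \<in> cl (v + w)"
    then have "z - w \<in> cl v" by (simp add: class_iff algebra_simps)
    moreover have "z = (z - w) + w" by simp
    ultimately show "z \<in> (\<Union>x \<in> cl v. \<Union>y \<in> cl w. {x + y})" using class_self by blast
  qed
  finally show ?thesis .
qed

lemma smult_tensor: "b \<odot>\<^bsub>tensor_module R A M act\<^esub> Z = (\<Union>v \<in> Z. cl (frag_extend (act b) v))"
  by (simp add: tensor_module_def Let_def)

lemma tensor_cases:
  assumes "Z \<in> carrier (tensor_module R A M act)"
  obtains v where "Z = cl v" "Poly_Mapping.keys v \<subseteq> S"
  using assms unfolding carrier_tensor by auto

lemma tensor_ex: "Z \<in> carrier (tensor_module R A M act) \<Longrightarrow> \<exists>v. Z = cl v \<and> Poly_Mapping.keys v \<subseteq> S"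
  unfolding carrier_tensor by auto

lemma tensor_memI: "Poly_Mapping.keys v \<subseteq> S \<Longrightarrow> cl v \<in> carrier (tensor_module R A M act)"
  unfolding carrier_tensor by blast

lemma abelian_group_tensor: "abelian_group (tensor_module R A M act)"
proof (rule abelian_groupI)
  fix x y assume xy: "x \<in> carrier (tensor_module R A M act)" "y \<in> carrier (tensor_module R A M act)"
  obtain v w where vw: "x = cl v" "Poly_Mapping.keys v \<subseteq> S" "y = cl w" "Poly_Mapping.keys w \<subseteq> S"
    using tensor_ex[OF xy(1)] tensor_ex[OF xy(2)] by blast
  show "x \<oplus>\<^bsub>tensor_module R A M act\<^esub> y \<in> carrier (tensor_module R A M act)"
    unfolding vw(1,3) add_tensor using vw keys_add[of v w] by (intro tensor_memI) blast
  show "x \<oplus>\<^bsub>tensor_module R A M act\<^esub> y = y \<oplus>\<^bsub>tensor_module R A M act\<^esub> x"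
    unfolding vw(1,3) add_tensor by (simp add: add.commute)
next
  fix x y z
  assume xyz: "x \<in> carrier (tensor_module R A M act)" "y \<in> carrier (tensor_module R A M act)" "z \<in> carrier (tensor_module R A M act)"
  obtain u v w where "x = cl u" "y = cl v" "z = cl w"
    using tensor_ex[OF xyz(1)] tensor_ex[OF xyz(2)] tensor_ex[OF xyz(3)] by blast
  then show "x \<oplus>\<^bsub>tensor_module R A M act\<^esub> y \<oplus>\<^bsub>tensor_module R A M act\<^esub> z =
     x \<oplus>\<^bsub>tensor_module R A M act\<^esub> (y \<oplus>\<^bsub>tensor_module R A M act\<^esub> z)"
    by (simp add: add_tensor add.assoc)
next
  fix x assume "x \<in> carrier (tensor_module R A M act)"
  then obtain v where v: "x = cl v" "Poly_Mapping.keys v \<subseteq> S" by (rule tensor_cases)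
  show "\<zero>\<^bsub>tensor_module R A M act\<^esub> \<oplus>\<^bsub>tensor_module R A M act\<^esub> x = x" by (simp add: v zero_tensor add_tensor)
  show "\<exists>y \<in> carrier (tensor_module R A M act). y \<oplus>\<^bsub>tensor_module R A M act\<^esub> x = \<zero>\<^bsub>tensor_module R A M act\<^esub>"
    using v by (intro bexI[of _ "cl (- v)"] tensor_memI) (simp_all add: zero_tensor add_tensor)
qed (simp add: zero_tensor tensor_memI)

text \<open>An additive map sends the whole kernel into a subgroup as soon as it does so for the
  defining relations.\<close>

lemma K_map:
  assumes k: "k \<in> K" and rel: "\<And>\<rho>. \<rho> \<in> tensor_relations R A M \<Longrightarrow> frag_extend f \<rho> \<in> L"
    and L: "0 \<in> L" "\<And>x y. x \<in> L \<Longrightarrow> y \<in> L \<Longrightarrow> x + y \<in> L" "\<And>x. x \<in> L \<Longrightarrow> - x \<in> L"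
  shows "frag_extend f k \<in> L"
  using k unfolding tensor_kernel_def
proof (induction rule: generate.induct)
  case one
  then show ?case using L(1) by (simp add: tensor_free_def)
next
  case (incl \<rho>)
  then show ?case by (rule rel)
next
  case (inv \<rho>)
  then show ?case using rel[OF inv] relations_keys[OF inv] L(3) by (simp add: tensor_free_def frag_extend_minus)
next
  case (eng x y)
  then show ?case using L(2) by (simp add: tensor_free_def frag_extend_add)
qed

end

lemma frag_extend_mod:
  assumes "Poly_Mapping.keys v \<subseteq> S" "\<And>p. p \<in> S \<Longrightarrow> frag_extend f (frag_of p) - frag_extend g (frag_of p) \<in> L"
    and L: "0 \<in> L" "\<And>x y. x \<in> L \<Longrightarrow> y \<in> L \<Longrightarrow> x - y \<in> L"
  shows "frag_extend f v - frag_extend g v \<in> L"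
  using assms(1)
proof (induction v rule: frag_induction)
  case zero
  then show ?case using L(1) by simp
next
  case (one x)
  then show ?case using assms(2) by simp
next
  case (diff a b)
  have "frag_extend f (a - b) - frag_extend g (a - b) =
    (frag_extend f a - frag_extend g a) - (frag_extend f b - frag_extend g b)"
    by (simp add: frag_extend_diff)
  then show ?case using L(2) diff by simp
qed

text \<open>The values of \<open>f\<close> may be formal sums, as the action of a general tensor on
  a pure one requires, and relations are respected only modulo the kernel of the target.\<close>

locale tensor_morphism = src: tensor_data R A M + tgt: tensor_data R' A' M'
  for R :: "'r set" and A :: "('r, 'a) module" and M :: "('r, 'm) module"
    and R' :: "'s set" and A' :: "('s, 'b) module" and M' :: "('s, 'n) module" +
  fixes f :: "'a \<times> 'm \<Rightarrow> ('b \<times> 'n \<Rightarrow>\<^sub>0 int)"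
  assumes f_keys: "\<And>a x. a \<in> carrier A \<Longrightarrow> x \<in> carrier M \<Longrightarrow> Poly_Mapping.keys (f (a, x)) \<subseteq> tgt.S"
    and f_add_left: "\<And>a a' x. a \<in> carrier A \<Longrightarrow> a' \<in> carrier A \<Longrightarrow> x \<in> carrier M \<Longrightarrow>
      f (a \<oplus>\<^bsub>A\<^esub> a', x) - f (a, x) - f (a', x) \<in> tgt.K"
    and f_add_right: "\<And>a x x'. a \<in> carrier A \<Longrightarrow> x \<in> carrier M \<Longrightarrow> x' \<in> carrier M \<Longrightarrow>
      f (a, x \<oplus>\<^bsub>M\<^esub> x') - f (a, x) - f (a, x') \<in> tgt.K"
    and f_balanced: "\<And>a r x. a \<in> carrier A \<Longrightarrow> r \<in> R \<Longrightarrow> x \<in> carrier M \<Longrightarrow>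
      f (r \<odot>\<^bsub>A\<^esub> a, x) - f (a, r \<odot>\<^bsub>M\<^esub> x) \<in> tgt.K"
begin

text \<open>The union over representatives has the same form as the scalar action in
  \<open>tensor_module\<close>, so independence of the representative is proved once for maps and
  for actions.\<close>

definition map_class :: "('a \<times> 'm \<Rightarrow>\<^sub>0 int) set \<Rightarrow> ('b \<times> 'n \<Rightarrow>\<^sub>0 int) set" where
  "map_class Z = (\<Union>v \<in> Z. tgt.cl (frag_extend f v))"

lemma kernel_map: "k \<in> src.K \<Longrightarrow> frag_extend f k \<in> tgt.K"
  by (rule src.K_map)
    (auto simp: tensor_relations_def frag_extend_diff f_add_left f_add_right f_balanced
      intro: tgt.K_add tgt.K_minus)

lemma map_class [simp]: "map_class (src.cl v) = tgt.cl (frag_extend f v)"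
proof -
  have "tgt.cl (frag_extend f w) = tgt.cl (frag_extend f v)" if "w \<in> src.cl v" for w
    using that kernel_map[of "w - v"] by (intro tgt.class_eqI) (simp add: src.class_iff frag_extend_diff)
  then show ?thesis unfolding map_class_def using src.class_self by blast
qed

lemma map_keys: "Poly_Mapping.keys v \<subseteq> src.S \<Longrightarrow> Poly_Mapping.keys (frag_extend f v) \<subseteq> tgt.S"
  using keys_frag_extend[of f v] f_keys by fastforce

lemma map_class_closed:
  "Z \<in> carrier (tensor_module R A M act) \<Longrightarrow> map_class Z \<in> carrier (tensor_module R' A' M' act')"
  by (erule src.tensor_cases) (simp add: tgt.tensor_memI map_keys)

lemma map_class_add:
  assumes "Z \<in> carrier (tensor_module R A M act)" "Z' \<in> carrier (tensor_module R A M act)"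
  shows "map_class (Z \<oplus>\<^bsub>tensor_module R A M act\<^esub> Z') = map_class Z \<oplus>\<^bsub>tensor_module R' A' M' act'\<^esub> map_class Z'"
proof -
  obtain v w where "Z = src.cl v" "Z' = src.cl w"
    using src.tensor_ex[OF assms(1)] src.tensor_ex[OF assms(2)] by blast
  then show ?thesis by (simp add: src.add_tensor tgt.add_tensor frag_extend_add)
qed

end

section \<open>Modules over the tensor product of two affine Temperley--Lieb algebras\<close>

locale tl_module =
  fixes m :: complex and N :: nat and V :: "(tl, 'v) module"
  assumes N: "N > 0" and V: "left_module (TLa m N) V"
begin

lemma V_abelian: "abelian_group V"
  using V by (simp add: left_module_def)

lemma V_smult_closed: "Poly_Mapping.keys a \<subseteq> adiagrams N \<Longrightarrow> x \<in> carrier V \<Longrightarrow> a \<odot>\<^bsub>V\<^esub> x \<in> carrier V"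
  and V_smult_add: "Poly_Mapping.keys a \<subseteq> adiagrams N \<Longrightarrow> x \<in> carrier V \<Longrightarrow> y \<in> carrier V \<Longrightarrow>
    a \<odot>\<^bsub>V\<^esub> (x \<oplus>\<^bsub>V\<^esub> y) = a \<odot>\<^bsub>V\<^esub> x \<oplus>\<^bsub>V\<^esub> a \<odot>\<^bsub>V\<^esub> y"
  and V_smult_assoc: "Poly_Mapping.keys a \<subseteq> adiagrams N \<Longrightarrow> Poly_Mapping.keys b \<subseteq> adiagrams N \<Longrightarrow> x \<in> carrier V \<Longrightarrow>
    (a \<otimes>\<^bsub>TLa m N\<^esub> b) \<odot>\<^bsub>V\<^esub> x = a \<odot>\<^bsub>V\<^esub> (b \<odot>\<^bsub>V\<^esub> x)"
  using V by (simp_all add: left_module_def TLa_simps(2))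

lemma vspace_simps [simp]:
  "carrier (vspace V) = carrier V" "x \<oplus>\<^bsub>vspace V\<^esub> y = x \<oplus>\<^bsub>V\<^esub> y" "\<zero>\<^bsub>vspace V\<^esub> = \<zero>\<^bsub>V\<^esub>"
  "c \<odot>\<^bsub>vspace V\<^esub> x = Poly_Mapping.single (U 0) c \<odot>\<^bsub>V\<^esub> x"
  by (simp_all add: vspace_def restrict_scalars_def tl_one_def id_diagram_U)

lemma V_add: "x \<in> carrier V \<Longrightarrow> y \<in> carrier V \<Longrightarrow> x \<oplus>\<^bsub>V\<^esub> y \<in> carrier V"
  using abelian_monoid.a_closed[OF abelian_group.axioms(1)[OF V_abelian]] .

lemma scalar_left:
  assumes "d \<in> adiagrams N" "x \<in> carrier V"
  shows "c \<odot>\<^bsub>vspace V\<^esub> (Poly_Mapping.single d c' \<odot>\<^bsub>V\<^esub> x) = Poly_Mapping.single d (c * c') \<odot>\<^bsub>V\<^esub> x"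
  using V_smult_assoc[of "Poly_Mapping.single (U 0) c" "Poly_Mapping.single d c'" x] assms U_adiagrams[of 0 N]
    U_id[OF N adiagrams_pmatch[OF assms(1)]]
  by (simp add: TLa_simps)

lemma scalar_right:
  assumes "d \<in> adiagrams N" "x \<in> carrier V"
  shows "Poly_Mapping.single d c' \<odot>\<^bsub>V\<^esub> (c \<odot>\<^bsub>vspace V\<^esub> x) = Poly_Mapping.single d (c * c') \<odot>\<^bsub>V\<^esub> x"
  using V_smult_assoc[of "Poly_Mapping.single d c'" "Poly_Mapping.single (U 0) c" x] assms U_adiagrams[of 0 N]
    id_U[OF N adiagrams_pmatch[OF assms(1)]]
  by (simp add: TLa_simps mult.commute)

lemma single_closed: "d \<in> adiagrams N \<Longrightarrow> x \<in> carrier V \<Longrightarrow> Poly_Mapping.single d c \<odot>\<^bsub>V\<^esub> x \<in> carrier V"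
  by (rule V_smult_closed) auto

end

section \<open>The action on the tensor product over the complex numbers\<close>

definition outer_act ::
  "(tl, 'm1) module \<Rightarrow> (tl, 'm2) module \<Rightarrow> tl_tensor \<Rightarrow> 'm1 \<times> 'm2 \<Rightarrow> ('m1 \<times> 'm2 \<Rightarrow>\<^sub>0 int)" where
  "outer_act M1 M2 = (\<lambda>t (x, y). \<Sum>(d1, d2) \<in> Poly_Mapping.keys t.
        frag_of (Poly_Mapping.single d1 (Poly_Mapping.lookup t (d1, d2)) \<odot>\<^bsub>M1\<^esub> x,
                 Poly_Mapping.single d2 1 \<odot>\<^bsub>M2\<^esub> y))"

lemma outer_tensor_act: "outer_tensor M1 M2 = tensor_module UNIV (vspace M1) (vspace M2) (outer_act M1 M2)"
  by (simp add: outer_tensor_def outer_act_def)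

lemma keys_sum_subset:
  fixes g :: "'a \<Rightarrow> ('b \<Rightarrow>\<^sub>0 int)"
  shows "(\<And>p. p \<in> I \<Longrightarrow> Poly_Mapping.keys (g p) \<subseteq> S) \<Longrightarrow> Poly_Mapping.keys (sum g I) \<subseteq> S"
  using sum_closed_free_Abelian_group[of I g S] by simp

locale tl_module_pair = one: tl_module m N1 M1 + two: tl_module m N2 M2
  for m N1 N2 and M1 :: "(tl, 'm1) module" and M2 :: "(tl, 'm2) module"
begin

sublocale outer: tensor_data "UNIV :: complex set" "vspace M1" "vspace M2"
proof
  show "r \<odot>\<^bsub>vspace M1\<^esub> a \<in> carrier (vspace M1)" if "a \<in> carrier (vspace M1)" for r :: complex and a
    using one.single_closed[OF U_adiagrams] that by simp
  show "r \<odot>\<^bsub>vspace M2\<^esub> a \<in> carrier (vspace M2)" if "a \<in> carrier (vspace M2)" for r :: complex and a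
    using two.single_closed[OF U_adiagrams] that by simp
qed (simp_all add: one.V_add two.V_add)

text \<open>Shows that the action is well defined on classes: both module structures are additive,
  and diagrams commute with scalars, which may therefore pass from one factor to the other.\<close>

lemma act_morphism:
  assumes t: "t \<in> carrier (TLa_tensor m N1 N2)"
  shows "tensor_morphism (UNIV :: complex set) (vspace M1) (vspace M2) (UNIV :: complex set) (vspace M1) (vspace M2) (outer_act M1 M2 t)"
proof -
  have d: "d1 \<in> adiagrams N1" "d2 \<in> adiagrams N2" if "(d1, d2) \<in> Poly_Mapping.keys t" for d1 d2
    using t that by (auto simp: TLa_tensor_simps)
  let ?c = "\<lambda>d1 d2. Poly_Mapping.single d1 (Poly_Mapping.lookup t (d1, d2))" and ?e = "\<lambda>d2. Poly_Mapping.single d2 1"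
  show ?thesis
  proof
    fix a x assume ax: "a \<in> carrier (vspace M1)" "x \<in> carrier (vspace M2)"
    show "Poly_Mapping.keys (outer_act M1 M2 t (a, x)) \<subseteq> outer.S"
      unfolding outer_act_def prod.case
    proof (rule keys_sum_subset)
      fix p assume p: "p \<in> Poly_Mapping.keys t"
      obtain d1 d2 where "p = (d1, d2)" by (cases p)
      then show "Poly_Mapping.keys (case p of (d1, d2) \<Rightarrow> frag_of (?c d1 d2 \<odot>\<^bsub>M1\<^esub> a, ?e d2 \<odot>\<^bsub>M2\<^esub> x)) \<subseteq> outer.S"
        using p d[of d1 d2] ax one.single_closed two.single_closed by (simp add: keys_frag_of)
    qed
  next
    fix a a' x assume ax: "a \<in> carrier (vspace M1)" "a' \<in> carrier (vspace M1)" "x \<in> carrier (vspace M2)"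
    have "outer_act M1 M2 t (a \<oplus>\<^bsub>vspace M1\<^esub> a', x) - outer_act M1 M2 t (a, x) - outer_act M1 M2 t (a', x) =
      (\<Sum>(d1, d2) \<in> Poly_Mapping.keys t. frag_of (?c d1 d2 \<odot>\<^bsub>M1\<^esub> (a \<oplus>\<^bsub>M1\<^esub> a'), ?e d2 \<odot>\<^bsub>M2\<^esub> x) -
         frag_of (?c d1 d2 \<odot>\<^bsub>M1\<^esub> a, ?e d2 \<odot>\<^bsub>M2\<^esub> x) - frag_of (?c d1 d2 \<odot>\<^bsub>M1\<^esub> a', ?e d2 \<odot>\<^bsub>M2\<^esub> x))"
      by (simp add: outer_act_def case_prod_beta sum_subtractf)
    also have "\<dots> \<in> outer.K"
    proof (rule outer.K_sum, clarify)
      fix d1 d2 assume p: "(d1, d2) \<in> Poly_Mapping.keys t"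
      show "frag_of (?c d1 d2 \<odot>\<^bsub>M1\<^esub> (a \<oplus>\<^bsub>M1\<^esub> a'), ?e d2 \<odot>\<^bsub>M2\<^esub> x) -
         frag_of (?c d1 d2 \<odot>\<^bsub>M1\<^esub> a, ?e d2 \<odot>\<^bsub>M2\<^esub> x) - frag_of (?c d1 d2 \<odot>\<^bsub>M1\<^esub> a', ?e d2 \<odot>\<^bsub>M2\<^esub> x) \<in> outer.K"
        using outer.K_relations(1)[of "?c d1 d2 \<odot>\<^bsub>M1\<^esub> a" "?c d1 d2 \<odot>\<^bsub>M1\<^esub> a'" "?e d2 \<odot>\<^bsub>M2\<^esub> x"] ax d[OF p]
          one.single_closed two.single_closed one.V_smult_add[of "?c d1 d2" a a'] by simp
    qed
    finally show "outer_act M1 M2 t (a \<oplus>\<^bsub>vspace M1\<^esub> a', x) - outer_act M1 M2 t (a, x) - outer_act M1 M2 t (a', x) \<in> outer.K" .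
  next
    fix a x x' assume ax: "a \<in> carrier (vspace M1)" "x \<in> carrier (vspace M2)" "x' \<in> carrier (vspace M2)"
    have "outer_act M1 M2 t (a, x \<oplus>\<^bsub>vspace M2\<^esub> x') - outer_act M1 M2 t (a, x) - outer_act M1 M2 t (a, x') =
      (\<Sum>(d1, d2) \<in> Poly_Mapping.keys t. frag_of (?c d1 d2 \<odot>\<^bsub>M1\<^esub> a, ?e d2 \<odot>\<^bsub>M2\<^esub> (x \<oplus>\<^bsub>M2\<^esub> x')) -
         frag_of (?c d1 d2 \<odot>\<^bsub>M1\<^esub> a, ?e d2 \<odot>\<^bsub>M2\<^esub> x) - frag_of (?c d1 d2 \<odot>\<^bsub>M1\<^esub> a, ?e d2 \<odot>\<^bsub>M2\<^esub> x'))"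
      by (simp add: outer_act_def case_prod_beta sum_subtractf)
    also have "\<dots> \<in> outer.K"
    proof (rule outer.K_sum, clarify)
      fix d1 d2 assume p: "(d1, d2) \<in> Poly_Mapping.keys t"
      show "frag_of (?c d1 d2 \<odot>\<^bsub>M1\<^esub> a, ?e d2 \<odot>\<^bsub>M2\<^esub> (x \<oplus>\<^bsub>M2\<^esub> x')) -
         frag_of (?c d1 d2 \<odot>\<^bsub>M1\<^esub> a, ?e d2 \<odot>\<^bsub>M2\<^esub> x) - frag_of (?c d1 d2 \<odot>\<^bsub>M1\<^esub> a, ?e d2 \<odot>\<^bsub>M2\<^esub> x') \<in> outer.K"
        using outer.K_relations(2)[of "?c d1 d2 \<odot>\<^bsub>M1\<^esub> a" "?e d2 \<odot>\<^bsub>M2\<^esub> x" "?e d2 \<odot>\<^bsub>M2\<^esub> x'"] ax d[OF p]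
          one.single_closed two.single_closed two.V_smult_add[of "?e d2" x x'] by simp
    qed
    finally show "outer_act M1 M2 t (a, x \<oplus>\<^bsub>vspace M2\<^esub> x') - outer_act M1 M2 t (a, x) - outer_act M1 M2 t (a, x') \<in> outer.K" .
  next
    fix a r x assume ax: "a \<in> carrier (vspace M1)" "x \<in> carrier (vspace M2)"
    have "outer_act M1 M2 t (r \<odot>\<^bsub>vspace M1\<^esub> a, x) - outer_act M1 M2 t (a, r \<odot>\<^bsub>vspace M2\<^esub> x) =
      (\<Sum>(d1, d2) \<in> Poly_Mapping.keys t. frag_of (?c d1 d2 \<odot>\<^bsub>M1\<^esub> (r \<odot>\<^bsub>vspace M1\<^esub> a), ?e d2 \<odot>\<^bsub>M2\<^esub> x) -
         frag_of (?c d1 d2 \<odot>\<^bsub>M1\<^esub> a, ?e d2 \<odot>\<^bsub>M2\<^esub> (r \<odot>\<^bsub>vspace M2\<^esub> x)))"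
      by (simp only: outer_act_def case_prod_unfold sum_subtractf fst_conv snd_conv)
    also have "\<dots> \<in> outer.K"
    proof (rule outer.K_sum, clarify)
      fix d1 d2 assume p: "(d1, d2) \<in> Poly_Mapping.keys t"
      have "?c d1 d2 \<odot>\<^bsub>M1\<^esub> (r \<odot>\<^bsub>vspace M1\<^esub> a) = r \<odot>\<^bsub>vspace M1\<^esub> (?c d1 d2 \<odot>\<^bsub>M1\<^esub> a)"
        "?e d2 \<odot>\<^bsub>M2\<^esub> (r \<odot>\<^bsub>vspace M2\<^esub> x) = r \<odot>\<^bsub>vspace M2\<^esub> (?e d2 \<odot>\<^bsub>M2\<^esub> x)"
        using ax d[OF p] by (simp_all only: one.scalar_left one.scalar_right two.scalar_left two.scalar_right one.vspace_simps(1) two.vspace_simps(1))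
      then show "frag_of (?c d1 d2 \<odot>\<^bsub>M1\<^esub> (r \<odot>\<^bsub>vspace M1\<^esub> a), ?e d2 \<odot>\<^bsub>M2\<^esub> x) -
         frag_of (?c d1 d2 \<odot>\<^bsub>M1\<^esub> a, ?e d2 \<odot>\<^bsub>M2\<^esub> (r \<odot>\<^bsub>vspace M2\<^esub> x)) \<in> outer.K"
        using outer.K_relations(3)[of "?c d1 d2 \<odot>\<^bsub>M1\<^esub> a" r "?e d2 \<odot>\<^bsub>M2\<^esub> x"] ax d[OF p] one.single_closed two.single_closed
        by (simp only: one.vspace_simps(1) two.vspace_simps(1) UNIV_I)
    qed
    finally show "outer_act M1 M2 t (r \<odot>\<^bsub>vspace M1\<^esub> a, x) - outer_act M1 M2 t (a, r \<odot>\<^bsub>vspace M2\<^esub> x) \<in> outer.K" .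
  qed
qed

lemma outer_smult:
  assumes "t \<in> carrier (TLa_tensor m N1 N2)"
  shows "t \<odot>\<^bsub>outer_tensor M1 M2\<^esub> outer.cl v = outer.cl (frag_extend (outer_act M1 M2 t) v)"
proof -
  interpret tensor_morphism "UNIV :: complex set" "vspace M1" "vspace M2" "UNIV :: complex set" "vspace M1" "vspace M2" "outer_act M1 M2 t"
    by (rule act_morphism[OF assms])
  show ?thesis using map_class[of v] unfolding map_class_def outer_tensor_act outer.smult_tensor .
qed

lemma outer_smult_closed:
  assumes "t \<in> carrier (TLa_tensor m N1 N2)" "Z \<in> carrier (outer_tensor M1 M2)"
  shows "t \<odot>\<^bsub>outer_tensor M1 M2\<^esub> Z \<in> carrier (outer_tensor M1 M2)"
proof -
  interpret tensor_morphism "UNIV :: complex set" "vspace M1" "vspace M2" "UNIV :: complex set" "vspace M1" "vspace M2" "outer_act M1 M2 t"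
    by (rule act_morphism[OF assms(1)])
  obtain v where v: "Z = outer.cl v" "Poly_Mapping.keys v \<subseteq> outer.S"
    using assms(2) unfolding outer_tensor_act by (rule outer.tensor_cases)
  show ?thesis unfolding v(1) outer_smult[OF assms(1)] unfolding outer_tensor_act
    by (rule outer.tensor_memI[OF map_keys[OF v(2)]])
qed

end

section \<open>Exchange of the two tensor factors\<close>

definition swap_pure :: "'a \<times> 'b \<Rightarrow> ('b \<times> 'a \<Rightarrow>\<^sub>0 int)" where
  "swap_pure p = frag_of (prod.swap p)"

lemma frag_extend_frag_extend:
  "frag_extend f (frag_extend g v) = frag_extend (\<lambda>p. frag_extend f (g p)) v"
proof -
  have "Poly_Mapping.keys v \<subseteq> UNIV" by simp
  then show ?thesis by (induction v rule: frag_induction) (simp_all add: frag_extend_diff)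
qed

lemma frag_extend_fun_add:
  "frag_extend (\<lambda>p. f p + g p) v = frag_extend f v + frag_extend g v"
proof -
  have "Poly_Mapping.keys v \<subseteq> UNIV" by simp
  then show ?thesis by (induction v rule: frag_induction) (simp_all add: frag_extend_diff)
qed

lemma frag_extend_swap_swap: "frag_extend swap_pure (frag_extend swap_pure v) = v"
  unfolding frag_extend_frag_extend swap_pure_def by (simp flip: frag_expansion)

lemma lookup_swap_tensor_swap: "Poly_Mapping.lookup (swap_tensor t) (prod.swap p) = Poly_Mapping.lookup t p"
  by (cases p) simp

locale swap_pair = P: tl_module_pair m N1 N2 M1 M2 + Q: tl_module_pair m N2 N1 M2 M1
  for m N1 N2 and M1 :: "(tl, 'm1) module" and M2 :: "(tl, 'm2) module"
begin

sublocale SW: tensor_morphism "UNIV :: complex set" "vspace M1" "vspace M2"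
  "UNIV :: complex set" "vspace M2" "vspace M1" swap_pure
proof
  fix a r x assume "a \<in> carrier (vspace M1)" "x \<in> carrier (vspace M2)"
  then have "- (frag_of (r \<odot>\<^bsub>vspace M2\<^esub> x, a) - frag_of (x, r \<odot>\<^bsub>vspace M1\<^esub> a)) \<in> Q.outer.K"
    by (intro Q.outer.K_minus Q.outer.K_relations) auto
  then show "swap_pure (r \<odot>\<^bsub>vspace M1\<^esub> a, x) - swap_pure (a, r \<odot>\<^bsub>vspace M2\<^esub> x) \<in> Q.outer.K"
    by (simp add: swap_pure_def)
next
  show "swap_pure (a \<oplus>\<^bsub>vspace M1\<^esub> a', x) - swap_pure (a, x) - swap_pure (a', x) \<in> Q.outer.K"
    if "a \<in> carrier (vspace M1)" "a' \<in> carrier (vspace M1)" "x \<in> carrier (vspace M2)" for a a' x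
    using Q.outer.K_relations(2)[OF that(3,1,2)] by (simp add: swap_pure_def)
  show "swap_pure (a, x \<oplus>\<^bsub>vspace M2\<^esub> x') - swap_pure (a, x) - swap_pure (a, x') \<in> Q.outer.K"
    if "a \<in> carrier (vspace M1)" "x \<in> carrier (vspace M2)" "x' \<in> carrier (vspace M2)" for a x x'
    using Q.outer.K_relations(1)[OF that(2,3,1)] by (simp add: swap_pure_def)
qed (simp add: swap_pure_def keys_frag_of)

abbreviation "\<sigma> \<equiv> SW.map_class"

text \<open>\<open>outer_act\<close> puts the coefficient of a pair of diagrams into the left
  factor. After the exchange it therefore stands in the wrong factor, and the two sides agree only
  modulo the scalar relation.\<close>

lemma swap_act:
  assumes t: "t \<in> carrier (TLa_tensor m N1 N2)" and Z: "Z \<in> carrier (outer_tensor M1 M2)"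
  shows "\<sigma> (t \<odot>\<^bsub>outer_tensor M1 M2\<^esub> Z) = swap_tensor t \<odot>\<^bsub>outer_tensor M2 M1\<^esub> \<sigma> Z"
proof -
  obtain v where v: "Z = P.outer.cl v" "Poly_Mapping.keys v \<subseteq> P.outer.S"
    using Z unfolding outer_tensor_act by (rule P.outer.tensor_cases)
  have d: "d1 \<in> adiagrams N1" "d2 \<in> adiagrams N2" if "(d1, d2) \<in> Poly_Mapping.keys t" for d1 d2
    using t that by (auto simp: TLa_tensor_simps)
  have "frag_extend (\<lambda>p. frag_extend swap_pure (outer_act M1 M2 t p)) v -
      frag_extend (\<lambda>p. frag_extend (outer_act M2 M1 (swap_tensor t)) (swap_pure p)) v \<in> Q.outer.K"
  proof (rule frag_extend_mod[OF v(2)])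
    fix p assume p: "p \<in> P.outer.S"
    obtain x y where xy: "p = (x, y)" by (cases p)
    have "frag_extend swap_pure (outer_act M1 M2 t p) =
      (\<Sum>(d1, d2) \<in> Poly_Mapping.keys t. frag_of (Poly_Mapping.single d2 1 \<odot>\<^bsub>M2\<^esub> y,
         Poly_Mapping.single d1 (Poly_Mapping.lookup t (d1, d2)) \<odot>\<^bsub>M1\<^esub> x))"
      by (simp add: xy outer_act_def frag_extend_sum swap_pure_def case_prod_unfold)
    moreover have "frag_extend (outer_act M2 M1 (swap_tensor t)) (swap_pure p) =
      (\<Sum>(d1, d2) \<in> Poly_Mapping.keys t. frag_of (Poly_Mapping.single d2 (Poly_Mapping.lookup t (d1, d2)) \<odot>\<^bsub>M2\<^esub> y,
         Poly_Mapping.single d1 1 \<odot>\<^bsub>M1\<^esub> x))"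
      by (simp add: xy outer_act_def swap_pure_def case_prod_unfold keys_swap_tensor sum.reindex lookup_swap_tensor_swap)
    ultimately have "frag_extend swap_pure (outer_act M1 M2 t p) - frag_extend (outer_act M2 M1 (swap_tensor t)) (swap_pure p) =
      (\<Sum>(d1, d2) \<in> Poly_Mapping.keys t. frag_of (Poly_Mapping.single d2 1 \<odot>\<^bsub>M2\<^esub> y,
         Poly_Mapping.single d1 (Poly_Mapping.lookup t (d1, d2)) \<odot>\<^bsub>M1\<^esub> x) -
        frag_of (Poly_Mapping.single d2 (Poly_Mapping.lookup t (d1, d2)) \<odot>\<^bsub>M2\<^esub> y, Poly_Mapping.single d1 1 \<odot>\<^bsub>M1\<^esub> x))"
      by (simp add: case_prod_unfold sum_subtractf)
    also have "\<dots> \<in> Q.outer.K"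
    proof (rule Q.outer.K_sum, clarify)
      fix d1 d2 assume k: "(d1, d2) \<in> Poly_Mapping.keys t"
      let ?c = "Poly_Mapping.lookup t (d1, d2)"
      let ?x = "Poly_Mapping.single d1 1 \<odot>\<^bsub>M1\<^esub> x" and ?y = "Poly_Mapping.single d2 1 \<odot>\<^bsub>M2\<^esub> y"
      have x: "x \<in> carrier M1" "y \<in> carrier M2" using p xy by auto
      \<comment> \<open>Separates the coefficient from the diagram, so that it can cross the tensor
        sign as a scalar.\<close>
      have c: "Poly_Mapping.single d1 ?c \<odot>\<^bsub>M1\<^esub> x = ?c \<odot>\<^bsub>vspace M1\<^esub> ?x"
        "Poly_Mapping.single d2 ?c \<odot>\<^bsub>M2\<^esub> y = ?c \<odot>\<^bsub>vspace M2\<^esub> ?y"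
        using P.one.scalar_left[OF d(1)[OF k] x(1), of ?c 1] P.two.scalar_left[OF d(2)[OF k] x(2), of ?c 1]
        by (simp_all only: mult_1_right)
      have "- (frag_of (?c \<odot>\<^bsub>vspace M2\<^esub> ?y, ?x) - frag_of (?y, ?c \<odot>\<^bsub>vspace M1\<^esub> ?x)) \<in> Q.outer.K"
        using P.one.single_closed[OF d(1)[OF k] x(1)] P.two.single_closed[OF d(2)[OF k] x(2)]
        by (intro Q.outer.K_minus Q.outer.K_relations(3)) (simp_all only: P.one.vspace_simps(1) P.two.vspace_simps(1) UNIV_I)
      then show "frag_of (?y, Poly_Mapping.single d1 ?c \<odot>\<^bsub>M1\<^esub> x) - frag_of (Poly_Mapping.single d2 ?c \<odot>\<^bsub>M2\<^esub> y, ?x) \<in> Q.outer.K"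
        by (simp only: c minus_diff_eq)
    qed
    finally show "frag_extend (\<lambda>p. frag_extend swap_pure (outer_act M1 M2 t p)) (frag_of p) -
       frag_extend (\<lambda>p. frag_extend (outer_act M2 M1 (swap_tensor t)) (swap_pure p)) (frag_of p) \<in> Q.outer.K"
      by simp
  qed (auto intro: Q.outer.K_diff)
  then show ?thesis
    unfolding v(1) P.outer_smult[OF t] SW.map_class Q.outer_smult[OF swap_tensor_carrier[OF t]] frag_extend_frag_extend
    by (rule Q.outer.class_eqI)
qed

end

section \<open>The fusion product as a module\<close>

locale fusion_data = P: tl_module_pair m N1 N2 M1 M2 + T: ring T
  for m N1 N2 and M1 :: "(tl, 'm1) module" and M2 :: "(tl, 'm2) module" and T :: "tl ring" +
  fixes \<epsilon> :: "tl_tensor \<Rightarrow> tl"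
  assumes \<epsilon>: "\<epsilon> \<in> ring_hom (TLa_tensor m N1 N2) T"
begin

abbreviation "TT \<equiv> carrier (TLa_tensor m N1 N2)"
abbreviation "A \<equiv> right_regular T \<epsilon>"
abbreviation "OT \<equiv> outer_tensor M1 M2"
abbreviation "mult_act \<equiv> \<lambda>b (a, z). frag_of (b \<otimes>\<^bsub>T\<^esub> a, z)"
abbreviation "FM \<equiv> tensor_module TT A OT mult_act"

lemma A_simps [simp]: "carrier A = carrier T" "a \<oplus>\<^bsub>A\<^esub> b = a \<oplus>\<^bsub>T\<^esub> b" "t \<odot>\<^bsub>A\<^esub> a = a \<otimes>\<^bsub>T\<^esub> \<epsilon> t"
  by (simp_all add: right_regular_def)

lemma OT_abelian: "abelian_group OT"
  unfolding outer_tensor_act by (rule P.outer.abelian_group_tensor)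

sublocale D: tensor_data TT A OT
proof
  show "x \<oplus>\<^bsub>OT\<^esub> x' \<in> carrier OT" if "x \<in> carrier OT" "x' \<in> carrier OT" for x x'
    using abelian_monoid.a_closed[OF abelian_group.axioms(1)[OF OT_abelian]] that .
qed (simp_all add: P.outer_smult_closed ring_hom_closed[OF \<epsilon>])

lemma mult_morphism:
  assumes b: "b \<in> carrier T"
  shows "tensor_morphism TT A OT TT A OT (mult_act b)"
proof
  fix a t x assume a: "a \<in> carrier A" "t \<in> TT" "x \<in> carrier OT"
  have "b \<otimes>\<^bsub>T\<^esub> (a \<otimes>\<^bsub>T\<^esub> \<epsilon> t) = (b \<otimes>\<^bsub>T\<^esub> a) \<otimes>\<^bsub>T\<^esub> \<epsilon> t"
    using a b ring_hom_closed[OF \<epsilon>] by (simp add: T.m_assoc)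
  then show "mult_act b (t \<odot>\<^bsub>A\<^esub> a, x) - mult_act b (a, t \<odot>\<^bsub>OT\<^esub> x) \<in> D.K"
    using D.K_relations(3)[of "b \<otimes>\<^bsub>T\<^esub> a" t x] a b by simp
next
  show "mult_act b (a \<oplus>\<^bsub>A\<^esub> a', x) - mult_act b (a, x) - mult_act b (a', x) \<in> D.K"
    if "a \<in> carrier A" "a' \<in> carrier A" "x \<in> carrier OT" for a a' x
    using D.K_relations(1)[of "b \<otimes>\<^bsub>T\<^esub> a" "b \<otimes>\<^bsub>T\<^esub> a'" x] that b by (simp add: T.r_distr)
  show "mult_act b (a, x \<oplus>\<^bsub>OT\<^esub> x') - mult_act b (a, x) - mult_act b (a, x') \<in> D.K"
    if "a \<in> carrier A" "x \<in> carrier OT" "x' \<in> carrier OT" for a x x'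
    using D.K_relations(2)[of "b \<otimes>\<^bsub>T\<^esub> a" x x'] that b by simp
qed (use b in \<open>simp add: keys_frag_of\<close>)

lemma smult_class:
  assumes "b \<in> carrier T"
  shows "b \<odot>\<^bsub>FM\<^esub> D.cl v = D.cl (frag_extend (mult_act b) v)"
proof -
  interpret tensor_morphism TT A OT TT A OT "mult_act b" by (rule mult_morphism[OF assms])
  show ?thesis using map_class[of v] unfolding map_class_def D.smult_tensor .
qed

lemma smult_closed:
  assumes "b \<in> carrier T" "Z \<in> carrier FM"
  shows "b \<odot>\<^bsub>FM\<^esub> Z \<in> carrier FM"
proof -
  interpret tensor_morphism TT A OT TT A OT "mult_act b" by (rule mult_morphism[OF assms(1)])
  show ?thesis using map_class_closed[OF assms(2)] unfolding map_class_def D.smult_tensor .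
qed

lemma left_module_fusion: "left_module T FM"
  unfolding left_module_def
proof (intro conjI ballI)
  show "abelian_group FM" by (rule D.abelian_group_tensor)
  show "a \<odot>\<^bsub>FM\<^esub> x \<in> carrier FM" if "a \<in> carrier T" "x \<in> carrier FM" for a x
    using that by (rule smult_closed)
  fix x assume x: "x \<in> carrier FM"
  obtain v where v: "x = D.cl v" "Poly_Mapping.keys v \<subseteq> D.S" using x by (rule D.tensor_cases)
  have "frag_extend (mult_act \<one>\<^bsub>T\<^esub>) v = frag_extend frag_of v"
    by (rule frag_extend_eq) (use v(2) in auto)
  then show "\<one>\<^bsub>T\<^esub> \<odot>\<^bsub>FM\<^esub> x = x" by (simp add: v smult_class flip: frag_expansion)
  fix a assume a: "a \<in> carrier T"
  fix y assume y: "y \<in> carrier FM"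
  obtain w where w: "y = D.cl w" using D.tensor_ex[OF y] by blast
  show "a \<odot>\<^bsub>FM\<^esub> (x \<oplus>\<^bsub>FM\<^esub> y) = a \<odot>\<^bsub>FM\<^esub> x \<oplus>\<^bsub>FM\<^esub> a \<odot>\<^bsub>FM\<^esub> y"
    by (simp only: v w D.add_tensor smult_class[OF a] frag_extend_add)
next
  fix a b x assume a: "a \<in> carrier T" "b \<in> carrier T" and x: "x \<in> carrier FM"
  obtain v where v: "x = D.cl v" "Poly_Mapping.keys v \<subseteq> D.S" using x by (rule D.tensor_cases)
  \<comment> \<open>Additivity in the scalar holds only modulo the kernel, by its first relation,
    whereas the multiplicative law below holds for the representatives themselves.\<close>
  have "frag_extend (mult_act (a \<oplus>\<^bsub>T\<^esub> b)) v - frag_extend (\<lambda>p. mult_act a p + mult_act b p) v \<in> D.K"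
  proof (rule frag_extend_mod[OF v(2)])
    fix p assume p: "p \<in> D.S"
    obtain c z where cz: "p = (c, z)" by (cases p)
    show "frag_extend (mult_act (a \<oplus>\<^bsub>T\<^esub> b)) (frag_of p) - frag_extend (\<lambda>p. mult_act a p + mult_act b p) (frag_of p) \<in> D.K"
      using D.K_relations(1)[of "a \<otimes>\<^bsub>T\<^esub> c" "b \<otimes>\<^bsub>T\<^esub> c" z] p a by (simp add: cz T.l_distr diff_diff_eq)
  qed (auto intro: D.K_diff)
  then show "(a \<oplus>\<^bsub>T\<^esub> b) \<odot>\<^bsub>FM\<^esub> x = a \<odot>\<^bsub>FM\<^esub> x \<oplus>\<^bsub>FM\<^esub> b \<odot>\<^bsub>FM\<^esub> x"
    using a by (simp only: v D.add_tensor smult_class T.a_closed frag_extend_fun_add D.class_eqI)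
  have "frag_extend (mult_act (a \<otimes>\<^bsub>T\<^esub> b)) v = frag_extend (\<lambda>p. frag_extend (mult_act a) (mult_act b p)) v"
    by (rule frag_extend_eq) (use v(2) a in \<open>auto simp: T.m_assoc\<close>)
  then show "(a \<otimes>\<^bsub>T\<^esub> b) \<odot>\<^bsub>FM\<^esub> x = a \<odot>\<^bsub>FM\<^esub> (b \<odot>\<^bsub>FM\<^esub> x)"
    using a by (simp only: v smult_class T.m_closed frag_extend_frag_extend)
qed

text \<open>The pure tensors generate in two stages, because the second entry of a generator is
  itself a class of formal sums; each stage is an induction on the formal sum.\<close>

lemma pure_ext:
  assumes H: "abelian_group H" and f: "f \<in> hom (add_monoid FM) (add_monoid H)" and g: "g \<in> hom (add_monoid FM) (add_monoid H)"
    and pure: "\<And>a x y. a \<in> carrier T \<Longrightarrow> x \<in> carrier M1 \<Longrightarrow> y \<in> carrier M2 \<Longrightarrow>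
      f (D.cl (frag_of (a, P.outer.cl (frag_of (x, y))))) = g (D.cl (frag_of (a, P.outer.cl (frag_of (x, y)))))"
    and Z: "Z \<in> carrier FM"
  shows "f Z = g Z"
proof -
  interpret H: abelian_group H by (rule H)
  have cl: "f X \<in> carrier H" "g X \<in> carrier H" if "X \<in> carrier FM" for X
    using f g that by (auto simp: hom_def)
  have add: "f (X \<oplus>\<^bsub>FM\<^esub> Y) = f X \<oplus>\<^bsub>H\<^esub> f Y" "g (X \<oplus>\<^bsub>FM\<^esub> Y) = g X \<oplus>\<^bsub>H\<^esub> g Y"
    if "X \<in> carrier FM" "Y \<in> carrier FM" for X Y
    using f g that by (auto simp: hom_def)
  \<comment> \<open>\<open>frag_induction\<close> proceeds by differences: agreement at
    \<open>v - w\<close> is deduced from agreement at \<open>w\<close> and at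
    \<open>(v - w) + w\<close>.\<close>
  have cancel: "f (D.cl v) = g (D.cl v)" if "Poly_Mapping.keys v \<subseteq> D.S" "Poly_Mapping.keys w \<subseteq> D.S"
    "f (D.cl w) = g (D.cl w)" "f (D.cl (v + w)) = g (D.cl (v + w))" for v w
    using add[OF D.tensor_memI[OF that(1)] D.tensor_memI[OF that(2)]] cl[OF D.tensor_memI[OF that(1)]]
      cl[OF D.tensor_memI[OF that(2)]] that(3,4) unfolding D.add_tensor by (metis H.add.right_cancel)
  have zero: "f (D.cl 0) = g (D.cl 0)"
  proof -
    have "Poly_Mapping.keys (0 :: tl \<times> _ \<Rightarrow>\<^sub>0 int) \<subseteq> D.S" by simp
    note m = D.tensor_memI[OF this]
    have "f (D.cl 0) = f (D.cl 0) \<oplus>\<^bsub>H\<^esub> f (D.cl 0)" "g (D.cl 0) = g (D.cl 0) \<oplus>\<^bsub>H\<^esub> g (D.cl 0)"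
      using add[OF m m] unfolding D.add_tensor by simp_all
    then have "f (D.cl 0) = \<zero>\<^bsub>H\<^esub>" "g (D.cl 0) = \<zero>\<^bsub>H\<^esub>" using cl[OF m] by (metis H.add.l_cancel_one')+
    then show ?thesis by simp
  qed
  have one: "f (D.cl (frag_of (a, P.outer.cl w))) = g (D.cl (frag_of (a, P.outer.cl w)))"
    if a: "a \<in> carrier T" and w: "Poly_Mapping.keys w \<subseteq> P.outer.S" for a w
  proof -
    have mem: "P.outer.cl w \<in> carrier OT" if "Poly_Mapping.keys w \<subseteq> P.outer.S" for w
      unfolding outer_tensor_act using that by (rule P.outer.tensor_memI)
    have split: "D.cl (frag_of (a, P.outer.cl (v + w))) = D.cl (frag_of (a, P.outer.cl v) + frag_of (a, P.outer.cl w))"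
      if "Poly_Mapping.keys v \<subseteq> P.outer.S" "Poly_Mapping.keys w \<subseteq> P.outer.S" for v w
      using D.K_relations(2)[of a "P.outer.cl v" "P.outer.cl w"] a mem that
      by (intro D.class_eqI) (simp add: outer_tensor_act P.outer.add_tensor diff_diff_eq)
    have keys: "Poly_Mapping.keys (frag_of (a, P.outer.cl w)) \<subseteq> D.S" if "Poly_Mapping.keys w \<subseteq> P.outer.S" for w
      using a mem[OF that] by (simp add: keys_frag_of)
    have "Poly_Mapping.keys w \<subseteq> P.outer.S \<and> f (D.cl (frag_of (a, P.outer.cl w))) = g (D.cl (frag_of (a, P.outer.cl w)))"
      using w
    proof (induction w rule: frag_induction)
      case zero
      \<comment> \<open>Tensoring with the zero class gives zero: it equals its own double.\<close>
      have "D.cl (0 + frag_of (a, P.outer.cl 0)) = D.cl (frag_of (a, P.outer.cl 0) + frag_of (a, P.outer.cl 0))"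
        using split[of 0 0] by simp
      then have "0 + frag_of (a, P.outer.cl 0) - (frag_of (a, P.outer.cl 0) + frag_of (a, P.outer.cl 0)) \<in> D.K"
        unfolding D.class_eq_iff .
      then have "D.cl 0 = D.cl (frag_of (a, P.outer.cl 0))" by (intro D.class_eqI) simp
      then show ?case using \<open>f (D.cl 0) = g (D.cl 0)\<close> by simp
    next
      case (one p)
      then show ?case using pure[OF a] by (cases p) (auto simp: keys_frag_of)
    next
      case (diff v w)
      have k: "Poly_Mapping.keys (v - w) \<subseteq> P.outer.S" using diff keys_diff[of v w] by blast
      have "f (D.cl (frag_of (a, P.outer.cl (v - w)))) = g (D.cl (frag_of (a, P.outer.cl (v - w))))"
        by (rule cancel[of _ "frag_of (a, P.outer.cl w)"])
          (use diff k keys split[of "v - w" w, symmetric] in \<open>simp_all\<close>)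
      then show ?case using k by blast
    qed
    then show ?thesis ..
  qed
  obtain v where v: "Z = D.cl v" "Poly_Mapping.keys v \<subseteq> D.S" using Z by (rule D.tensor_cases)
  have "Poly_Mapping.keys v \<subseteq> D.S \<and> f (D.cl v) = g (D.cl v)"
    using v(2)
  proof (induction v rule: frag_induction)
    case zero
    show ?case using \<open>f (D.cl 0) = g (D.cl 0)\<close> by simp
  next
    case (one p)
    obtain a z where p: "p = (a, z)" "a \<in> carrier T" "z \<in> carrier OT" using one by (cases p) auto
    obtain w where "z = P.outer.cl w" "Poly_Mapping.keys w \<subseteq> P.outer.S"
      using p(3) unfolding outer_tensor_act by (rule P.outer.tensor_cases)
    then show ?case using \<open>\<And>w a. a \<in> carrier T \<Longrightarrow> Poly_Mapping.keys w \<subseteq> P.outer.S \<Longrightarrow>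
        f (D.cl (frag_of (a, P.outer.cl w))) = g (D.cl (frag_of (a, P.outer.cl w)))\<close> p one by (simp add: keys_frag_of)
  next
    case (diff v w)
    have k: "Poly_Mapping.keys (v - w) \<subseteq> D.S" using diff keys_diff[of v w] by blast
    have "f (D.cl (v - w)) = g (D.cl (v - w))" by (rule cancel[of _ w]) (use diff k in simp_all)
    then show ?case using k by blast
  qed
  then show ?thesis by (simp add: v(1))
qed

end

section \<open>The braiding\<close>

lemma left_module_restrict:
  assumes T: "left_module T V" and c: "c \<in> ring_hom T T"
  shows "left_module T (restrict_scalars c V)"
proof -
  have V: "abelian_group V" using T by (simp add: left_module_def)
  then interpret V: abelian_group V .
  have "abelian_group (restrict_scalars c V)"
  proof (rule abelian_groupI)
    fix x assume "x \<in> carrier (restrict_scalars c V)"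
    then have x: "x \<in> carrier V" by (simp add: restrict_scalars_def)
    then show "\<exists>y \<in> carrier (restrict_scalars c V). y \<oplus>\<^bsub>restrict_scalars c V\<^esub> x = \<zero>\<^bsub>restrict_scalars c V\<^esub>"
      by (intro bexI[of _ "\<ominus>\<^bsub>V\<^esub> x"]) (simp_all add: restrict_scalars_def V.l_neg)
  qed (simp_all add: restrict_scalars_def V.a_ac)
  then show ?thesis
    using T ring_hom_closed[OF c] ring_hom_add[OF c] ring_hom_mult[OF c] ring_hom_one[OF c]
    by (simp add: left_module_def restrict_scalars_def)
qed

locale braiding_data = fusion_pair q s m N1 N2 \<epsilon> \<epsilon>' + F: swap_pair m N1 N2 M1 M2 + B: swap_pair m N2 N1 M2 M1
  for q s m N1 N2 \<epsilon> \<epsilon>' and M1 :: "(tl, 'm1) module" and M2 :: "(tl, 'm2) module"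
begin

sublocale src: fusion_data m N1 N2 M1 M2 T \<epsilon>
  by unfold_locales (rule hom_\<epsilon>(1))

sublocale tgt: fusion_data m N2 N1 M2 M1 T \<epsilon>'
  by unfold_locales (rule hom_\<epsilon>(2))

lemma fusion_src: "fusion m N1 N2 \<epsilon> M1 M2 = src.FM"
  by (simp add: fusion_def Let_def)

lemma fusion_tgt: "fusion m N2 N1 \<epsilon>' M2 M1 = tgt.FM"
  by (simp add: fusion_def Let_def add.commute)

lemma fusion_pure_src: "fusion_pure m N1 N2 \<epsilon> M1 M2 a x y = src.D.cl (frag_of (a, F.P.outer.cl (frag_of (x, y))))"
  by (simp add: fusion_pure_def outer_pure_def pure_tensor_def)

lemma fusion_pure_tgt: "fusion_pure m N2 N1 \<epsilon>' M2 M1 a y x = tgt.D.cl (frag_of (a, F.Q.outer.cl (frag_of (y, x))))"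
  by (simp add: fusion_pure_def outer_pure_def pure_tensor_def add.commute)

abbreviation "k \<equiv> inv\<^bsub>T\<^esub> h"

lemma k: "k \<in> carrier T" "h \<otimes>\<^bsub>T\<^esub> k = \<one>\<^bsub>T\<^esub>" "k \<otimes>\<^bsub>T\<^esub> h = \<one>\<^bsub>T\<^esub>"
  using h_Units by (simp_all add: braid.Units_inv_closed)

lemma kh_cancel: "x \<in> carrier T \<Longrightarrow> h \<otimes>\<^bsub>T\<^esub> (k \<otimes>\<^bsub>T\<^esub> x) = x" "x \<in> carrier T \<Longrightarrow> k \<otimes>\<^bsub>T\<^esub> (h \<otimes>\<^bsub>T\<^esub> x) = x"
  using k h_carrier by (simp_all flip: braid.m_assoc)

abbreviation "cj \<equiv> g_conj m s N1 N2"

definition cj' :: "tl \<Rightarrow> tl" where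
  "cj' a = k \<otimes>\<^bsub>T\<^esub> a \<otimes>\<^bsub>T\<^esub> h"

lemma cj_def: "cj a = h \<otimes>\<^bsub>T\<^esub> a \<otimes>\<^bsub>T\<^esub> k"
  by (simp add: g_conj_def Let_def)

lemma cj_hom: "cj \<in> ring_hom T T"
proof (rule ring_hom_memI)
  fix x y assume x: "x \<in> carrier T" "y \<in> carrier T"
  show "cj (x \<otimes>\<^bsub>T\<^esub> y) = cj x \<otimes>\<^bsub>T\<^esub> cj y"
    using x h_carrier k(1) by (simp add: cj_def braid.m_assoc kh_cancel)
  show "cj (x \<oplus>\<^bsub>T\<^esub> y) = cj x \<oplus>\<^bsub>T\<^esub> cj y"
    using x h_carrier k(1) by (simp add: cj_def T.l_distr T.r_distr)
qed (use h_carrier k in \<open>simp_all add: cj_def\<close>)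

lemma cj'_closed: "a \<in> carrier T \<Longrightarrow> cj' a \<in> carrier T"
  using h_carrier k(1) by (simp add: cj'_def)

lemma cj'_add: "a \<in> carrier T \<Longrightarrow> b \<in> carrier T \<Longrightarrow> cj' (a \<oplus>\<^bsub>T\<^esub> b) = cj' a \<oplus>\<^bsub>T\<^esub> cj' b"
  using h_carrier k(1) by (simp add: cj'_def T.l_distr T.r_distr)

lemma cj_cj': "a \<in> carrier T \<Longrightarrow> cj (cj' a) = a" "a \<in> carrier T \<Longrightarrow> cj' (cj a) = a"
  using h_carrier k by (simp_all add: cj_def cj'_def braid.m_assoc kh_cancel)

text \<open>The relation \<open>intertwine\<close> in the form \<epsilon>(t) = \<open>k\<close>
  \<epsilon>'(t') \<open>h\<close>, where t' is the exchanged tensor; the outer \<open>k\<close>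
  then cancels \<open>h\<close>. It says that conjugation turns the right action through \<epsilon>
  into the one through \<epsilon>'.\<close>

lemma cj_balanced:
  assumes "a \<in> carrier T" "t \<in> carrier (TLa_tensor m N1 N2)"
  shows "cj (a \<otimes>\<^bsub>T\<^esub> \<epsilon> t) = cj a \<otimes>\<^bsub>T\<^esub> \<epsilon>' (swap_tensor t)"
proof -
  note c = h_carrier k(1) assms(1) \<epsilon>_closed[OF assms(2)] \<epsilon>'_closed[OF swap_tensor_carrier[OF assms(2)]]
  have "\<epsilon> t = k \<otimes>\<^bsub>T\<^esub> (\<epsilon>' (swap_tensor t) \<otimes>\<^bsub>T\<^esub> h)"
    using kh_cancel(2)[OF c(4)] by (simp add: intertwine[OF assms(2)])
  then show ?thesis using c k by (simp add: cj_def braid.m_assoc)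
qed

lemma cj'_balanced:
  assumes "a \<in> carrier T" "t \<in> carrier (TLa_tensor m N2 N1)"
  shows "cj' (a \<otimes>\<^bsub>T\<^esub> \<epsilon>' t) = cj' a \<otimes>\<^bsub>T\<^esub> \<epsilon> (swap_tensor t)"
proof -
  note t = swap_tensor_carrier[OF assms(2)]
  note c = h_carrier k(1) assms(1) \<epsilon>_closed[OF t] \<epsilon>'_closed[OF assms(2)]
  have "\<epsilon>' t \<otimes>\<^bsub>T\<^esub> h = h \<otimes>\<^bsub>T\<^esub> \<epsilon> (swap_tensor t)" using intertwine[OF t] by simp
  then show ?thesis using c by (simp add: cj'_def braid.m_assoc)
qed

text \<open>Well-definedness of the braiding. The balancing relation for \<open>t\<close> goes to
  the one for \<open>swap_tensor t\<close>, by \<open>cj_balanced\<close> in the first entry and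
  \<open>swap_act\<close> in the second.\<close>

sublocale C: tensor_morphism src.TT src.A src.OT tgt.TT tgt.A tgt.OT "\<lambda>(a, z). frag_of (cj a, F.\<sigma> z)"
proof
  have \<sigma>: "F.\<sigma> z \<in> carrier tgt.OT" if "z \<in> carrier src.OT" for z
    using F.SW.map_class_closed that unfolding outer_tensor_act .
  have \<sigma>_add: "F.\<sigma> (z \<oplus>\<^bsub>src.OT\<^esub> z') = F.\<sigma> z \<oplus>\<^bsub>tgt.OT\<^esub> F.\<sigma> z'" if "z \<in> carrier src.OT" "z' \<in> carrier src.OT" for z z'
    using F.SW.map_class_add that unfolding outer_tensor_act .
  note cc = ring_hom_closed[OF cj_hom]
  fix a z assume a: "a \<in> carrier src.A" and z: "z \<in> carrier src.OT"
  show "Poly_Mapping.keys ((\<lambda>(a, z). frag_of (cj a, F.\<sigma> z)) (a, z)) \<subseteq> tgt.D.S"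
    using a z cc \<sigma> by (simp add: keys_frag_of)
  show "(\<lambda>(a, z). frag_of (cj a, F.\<sigma> z)) (a \<oplus>\<^bsub>src.A\<^esub> a', z) - (\<lambda>(a, z). frag_of (cj a, F.\<sigma> z)) (a, z) -
      (\<lambda>(a, z). frag_of (cj a, F.\<sigma> z)) (a', z) \<in> tgt.D.K" if "a' \<in> carrier src.A" for a'
    using tgt.D.K_relations(1)[of "cj a" "cj a'" "F.\<sigma> z"] a z that cc \<sigma> ring_hom_add[OF cj_hom] by simp
  show "(\<lambda>(a, z). frag_of (cj a, F.\<sigma> z)) (a, z \<oplus>\<^bsub>src.OT\<^esub> z') - (\<lambda>(a, z). frag_of (cj a, F.\<sigma> z)) (a, z) -
      (\<lambda>(a, z). frag_of (cj a, F.\<sigma> z)) (a, z') \<in> tgt.D.K" if "z' \<in> carrier src.OT" for z'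
    using tgt.D.K_relations(2)[of "cj a" "F.\<sigma> z" "F.\<sigma> z'"] a z that cc \<sigma> \<sigma>_add by simp
  show "(\<lambda>(a, z). frag_of (cj a, F.\<sigma> z)) (t \<odot>\<^bsub>src.A\<^esub> a, z) - (\<lambda>(a, z). frag_of (cj a, F.\<sigma> z)) (a, t \<odot>\<^bsub>src.OT\<^esub> z) \<in> tgt.D.K"
    if "t \<in> src.TT" for t
    using tgt.D.K_relations(3)[of "cj a" "swap_tensor t" "F.\<sigma> z"] a z that cc \<sigma> swap_tensor_carrier[OF that]
    by (simp add: F.swap_act cj_balanced)
qed

text \<open>The candidate inverse, built in the same way from the inverse conjugation and the
  reverse exchange.\<close>

sublocale D: tensor_morphism tgt.TT tgt.A tgt.OT src.TT src.A src.OT "\<lambda>(a, z). frag_of (cj' a, B.\<sigma> z)"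
proof
  have \<sigma>: "B.\<sigma> z \<in> carrier src.OT" if "z \<in> carrier tgt.OT" for z
    using B.SW.map_class_closed that unfolding outer_tensor_act .
  have \<sigma>_add: "B.\<sigma> (z \<oplus>\<^bsub>tgt.OT\<^esub> z') = B.\<sigma> z \<oplus>\<^bsub>src.OT\<^esub> B.\<sigma> z'" if "z \<in> carrier tgt.OT" "z' \<in> carrier tgt.OT" for z z'
    using B.SW.map_class_add that unfolding outer_tensor_act .
  note cc = cj'_closed
  fix a z assume a: "a \<in> carrier tgt.A" and z: "z \<in> carrier tgt.OT"
  show "Poly_Mapping.keys ((\<lambda>(a, z). frag_of (cj' a, B.\<sigma> z)) (a, z)) \<subseteq> src.D.S"
    using a z cc \<sigma> by (simp add: keys_frag_of)
  show "(\<lambda>(a, z). frag_of (cj' a, B.\<sigma> z)) (a \<oplus>\<^bsub>tgt.A\<^esub> a', z) - (\<lambda>(a, z). frag_of (cj' a, B.\<sigma> z)) (a, z) -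
      (\<lambda>(a, z). frag_of (cj' a, B.\<sigma> z)) (a', z) \<in> src.D.K" if "a' \<in> carrier tgt.A" for a'
    using src.D.K_relations(1)[of "cj' a" "cj' a'" "B.\<sigma> z"] a z that cc \<sigma> by (simp add: cj'_add)
  show "(\<lambda>(a, z). frag_of (cj' a, B.\<sigma> z)) (a, z \<oplus>\<^bsub>tgt.OT\<^esub> z') - (\<lambda>(a, z). frag_of (cj' a, B.\<sigma> z)) (a, z) -
      (\<lambda>(a, z). frag_of (cj' a, B.\<sigma> z)) (a, z') \<in> src.D.K" if "z' \<in> carrier tgt.OT" for z'
    using src.D.K_relations(2)[of "cj' a" "B.\<sigma> z" "B.\<sigma> z'"] a z that cc \<sigma> \<sigma>_add by simp
  show "(\<lambda>(a, z). frag_of (cj' a, B.\<sigma> z)) (t \<odot>\<^bsub>tgt.A\<^esub> a, z) - (\<lambda>(a, z). frag_of (cj' a, B.\<sigma> z)) (a, t \<odot>\<^bsub>tgt.OT\<^esub> z) \<in> src.D.K"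
    if "t \<in> tgt.TT" for t
    using src.D.K_relations(3)[of "cj' a" "swap_tensor t" "B.\<sigma> z"] a z that cc \<sigma> swap_tensor_carrier[OF that]
    by (simp add: B.swap_act cj'_balanced)
qed

lemma \<sigma>_inverse: "z \<in> carrier src.OT \<Longrightarrow> B.\<sigma> (F.\<sigma> z) = z" "y \<in> carrier tgt.OT \<Longrightarrow> F.\<sigma> (B.\<sigma> y) = y"
  unfolding outer_tensor_act
  by (erule F.P.outer.tensor_cases F.Q.outer.tensor_cases, simp add: frag_extend_swap_swap)+

lemma D_C: assumes "Z \<in> carrier src.FM" shows "D.map_class (C.map_class Z) = Z"
proof -
  obtain v where v: "Z = src.D.cl v" "Poly_Mapping.keys v \<subseteq> src.D.S" using assms by (rule src.D.tensor_cases)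
  have "frag_extend (\<lambda>(a, z). frag_of (cj' a, B.\<sigma> z)) (frag_extend (\<lambda>(a, z). frag_of (cj a, F.\<sigma> z)) v) = frag_extend frag_of v"
    unfolding frag_extend_frag_extend
    by (rule frag_extend_eq) (use v(2) in \<open>auto simp: cj_cj' \<sigma>_inverse\<close>)
  then show ?thesis by (simp add: v(1) flip: frag_expansion)
qed

lemma C_D: assumes "Z \<in> carrier tgt.FM" shows "C.map_class (D.map_class Z) = Z"
proof -
  obtain v where v: "Z = tgt.D.cl v" "Poly_Mapping.keys v \<subseteq> tgt.D.S" using assms by (rule tgt.D.tensor_cases)
  have "frag_extend (\<lambda>(a, z). frag_of (cj a, F.\<sigma> z)) (frag_extend (\<lambda>(a, z). frag_of (cj' a, B.\<sigma> z)) v) = frag_extend frag_of v"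
    unfolding frag_extend_frag_extend
    by (rule frag_extend_eq) (use v(2) in \<open>auto simp: cj_cj' \<sigma>_inverse\<close>)
  then show ?thesis by (simp add: v(1) flip: frag_expansion)
qed

text \<open>Conjugation is multiplicative, so the map is linear up to conjugating the scalar; this
  is linearity for the target structure in the theorem.\<close>

lemma C_smult:
  assumes "b \<in> carrier T" "Z \<in> carrier src.FM"
  shows "C.map_class (b \<odot>\<^bsub>src.FM\<^esub> Z) = cj b \<odot>\<^bsub>tgt.FM\<^esub> C.map_class Z"
proof -
  obtain v where v: "Z = src.D.cl v" "Poly_Mapping.keys v \<subseteq> src.D.S" using assms(2) by (rule src.D.tensor_cases)
  have "frag_extend (\<lambda>(a, z). frag_of (cj a, F.\<sigma> z)) (frag_extend (src.mult_act b) v) =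
    frag_extend (tgt.mult_act (cj b)) (frag_extend (\<lambda>(a, z). frag_of (cj a, F.\<sigma> z)) v)"
    unfolding frag_extend_frag_extend
    by (rule frag_extend_eq) (use v(2) assms(1) ring_hom_mult[OF cj_hom] in auto)
  then show ?thesis
    unfolding v(1) src.smult_class[OF assms(1)] C.map_class tgt.smult_class[OF ring_hom_closed[OF cj_hom assms(1)]] by simp
qed

text \<open>\<open>is_braiding\<close> requires an extensional map, which makes uniqueness an
  equality of functions; the values outside the carrier are therefore fixed by restriction.\<close>

definition braid_map :: "('m1, 'm2) fused \<Rightarrow> ('m2, 'm1) fused" where
  "braid_map = restrict C.map_class (carrier src.FM)"

lemma braid_map_hom: "braid_map \<in> hom (add_monoid src.FM) (add_monoid tgt.FM)"
proof (rule homI)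
  interpret A: abelian_group src.FM by (rule src.D.abelian_group_tensor)
  fix x y assume "x \<in> carrier (add_monoid src.FM)" "y \<in> carrier (add_monoid src.FM)"
  then show "braid_map (x \<otimes>\<^bsub>add_monoid src.FM\<^esub> y) = braid_map x \<otimes>\<^bsub>add_monoid tgt.FM\<^esub> braid_map y"
    by (simp add: braid_map_def C.map_class_add[where act' = tgt.mult_act])
qed (simp add: braid_map_def C.map_class_closed)

lemma is_braiding_braid_map: "is_braiding m s N1 N2 \<epsilon> \<epsilon>' M1 M2 braid_map"
  unfolding is_braiding_def fusion_src fusion_tgt fusion_pure_src fusion_pure_tgt
proof (intro conjI ballI)
  show "braid_map \<in> extensional (carrier src.FM)" by (simp add: braid_map_def)
  show "braid_map \<in> hom (add_monoid src.FM) (add_monoid tgt.FM)" by (rule braid_map_hom)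
  fix a x y assume a: "a \<in> carrier T" "x \<in> carrier M1" "y \<in> carrier M2"
  have "F.P.outer.cl (frag_of (x, y)) \<in> carrier src.OT"
    unfolding outer_tensor_act by (rule F.P.outer.tensor_memI) (use a in \<open>simp add: keys_frag_of\<close>)
  then have "src.D.cl (frag_of (a, F.P.outer.cl (frag_of (x, y)))) \<in> carrier src.FM"
    using a by (intro src.D.tensor_memI) (simp add: keys_frag_of)
  then show "braid_map (src.D.cl (frag_of (a, F.P.outer.cl (frag_of (x, y))))) =
    tgt.D.cl (frag_of (cj a, F.Q.outer.cl (frag_of (y, x))))"
    by (simp add: braid_map_def swap_pure_def)
qed

lemma is_braiding_unique:
  assumes c: "is_braiding m s N1 N2 \<epsilon> \<epsilon>' M1 M2 c"
  shows "c = braid_map"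
proof (rule extensionalityI)
  note c = assms[unfolded is_braiding_def fusion_src fusion_tgt fusion_pure_src fusion_pure_tgt]
  note b = is_braiding_braid_map[unfolded is_braiding_def fusion_src fusion_tgt fusion_pure_src fusion_pure_tgt]
  show "c \<in> extensional (carrier src.FM)" "braid_map \<in> extensional (carrier src.FM)" using c b by blast+
  fix Z assume Z: "Z \<in> carrier src.FM"
  show "c Z = braid_map Z"
    by (rule src.pure_ext[OF tgt.D.abelian_group_tensor _ _ _ Z]) (use c b in auto)
qed

lemma braid_map_iso: "module_iso T src.FM (restrict_scalars cj tgt.FM) braid_map"
  unfolding module_iso_def
proof (intro conjI ballI)
  show "left_module T src.FM" by (rule src.left_module_fusion)
  show "left_module T (restrict_scalars cj tgt.FM)"
    by (rule left_module_restrict[OF tgt.left_module_fusion cj_hom])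
  have "bij_betw C.map_class (carrier src.FM) (carrier tgt.FM)"
    by (rule bij_betwI[of _ _ _ D.map_class]) (auto simp: D_C C_D C.map_class_closed D.map_class_closed)
  then have "bij_betw braid_map (carrier src.FM) (carrier tgt.FM)"
    unfolding braid_map_def by (subst bij_betw_restrict_eq)
  then have "braid_map \<in> iso (add_monoid src.FM) (add_monoid tgt.FM)" using braid_map_hom by (simp add: iso_def)
  then show "braid_map \<in> iso (add_monoid src.FM) (add_monoid (restrict_scalars cj tgt.FM))"
    by (simp add: iso_def hom_def restrict_scalars_def)
  fix a x assume "a \<in> carrier T" "x \<in> carrier src.FM"
  then show "braid_map (a \<odot>\<^bsub>src.FM\<^esub> x) = a \<odot>\<^bsub>restrict_scalars cj tgt.FM\<^esub> braid_map x"
    by (simp add: braid_map_def restrict_scalars_def src.smult_closed C_smult)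
qed

end

theorem mainTheorem9:
  fixes q s m :: complex and N1 N2 :: nat
    and M1 :: "(tl, 'm1) module" and M2 :: "(tl, 'm2) module"
    and \<epsilon> \<epsilon>' :: "tl_tensor \<Rightarrow> tl"
  assumes "q \<noteq> 0" and "s\<^sup>2 = q" and "m = q + inverse q"
    and "N1 \<ge> 1" and "N2 \<ge> 1"
    and "left_module (TLa m N1) M1" and "finite_dim M1"
    and "left_module (TLa m N2) M2" and "finite_dim M2"
    and "is_fusion_map m s N1 N2 \<epsilon>"
    and "is_fusion_map_minus m s N2 N1 \<epsilon>'"
  shows "(\<exists>!c. is_braiding m s N1 N2 \<epsilon> \<epsilon>' M1 M2 c) \<and>
    (\<forall>c. is_braiding m s N1 N2 \<epsilon> \<epsilon>' M1 M2 c \<longrightarrow>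
      module_iso (TLa m (N1 + N2))
        (fusion m N1 N2 \<epsilon> M1 M2)
        (restrict_scalars (g_conj m s N1 N2) (fusion m N2 N1 \<epsilon>' M2 M1))
        c)"
  proof -
  interpret braiding_data q s m N1 N2 \<epsilon> \<epsilon>' M1 M2
    by unfold_locales (use assms in auto)
  show ?thesis
    using is_braiding_braid_map is_braiding_unique braid_map_iso unfolding fusion_src fusion_tgt by metis
qed

end
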